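(* Let $\epsilon>0$ be arbitrary. For $Q>r$, $$\sum_{q\in[Q,2Q]}\ \sum_{0\neq f\in V(\mathbb Z)\cap rB}|\widehat{\Phi_q}(f)|\ \ll\ \left(\frac{r^2}{Q}+\frac{r^4}{Q^2}+\frac{r^5}{Q^{5/2}}\right)Q^{\epsilon},$$ where $q$ runs through all squarefree integers in the range $[Q,2Q]$.
   Context: For a ring $R$, $V(R)$ is the set of binary quartic forms $f=a_0x^4+a_1x^3y+a_2x^2y^2+a_3xy^3+a_4y^4$ with $a_i\in R$. With $I(f)=12a_0a_4-3a_1a_3+a_2^2$ and $J(f)=72a_0a_2a_4+9a_1a_2a_3-27(a_0a_3^2+a_1^2a_4)-2a_2^3$, the discriminant is $\mathrm{Disc}(f)=(4I(f)^3-J(f)^2)/27$, an integer polynomial in the $a_i$. $B\subset V(\mathbb R)$ is the box of side length $2$ centered at the origin, so $rB$ ($r>0$) is the set of forms all of whose coefficients have absolute value at most $r$. For squarefree $q\ge1$, $\Phi_q\colon V(\mathbb Z/q\mathbb Z)\to\{0,1\}$ is the indicator function of those $f$ with $\mathrm{Disc}(f)=0$ in $\mathbb Z/q\mathbb Z$. For $q$ squarefree and coprime to $6$, and $f\in V(\mathbb Z)$, $$\widehat{\Phi_q}(f)=q^{-5}\sum_{h\in V(\mathbb Z/q\mathbb Z)}\Phi_q(h)e^{2\pi i[h,f]/q},\qquad [h,f]=b_0a_0+\tfrac{b_1a_1}{4}+\tfrac{b_2a_2}{6}+\tfrac{b_3a_3}{4}+b_4a_4\in\mathbb Z/q\mathbb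 Z,$$ where $a_i$, $b_i$ are the coefficients of $f$, $h$. For general squarefree $q$ one defines $\widehat{\Phi_q}(f):=\widehat{\Phi_{q/\gcd(q,6)}}(f)$. The implied constant depends only on $\epsilon$. *)

theory Defs
  imports "HOL-Analysis.Analysis" "HOL-Number_Theory.Number_Theory"
    "HOL-Number_Theory.Modular_Inverse" "HOL-Computational_Algebra.Squarefree"
begin

text \<open>
  The binary quartic form \<open>a\<^sub>0 x^4 + a\<^sub>1 x^3 y + a\<^sub>2 x^2 y^2 + a\<^sub>3 x y^3 + a\<^sub>4 y^4\<close> is given by its
  coefficients. The type \<^typ>\<open>int\<close> of coefficients gives \<open>V(\<int>)\<close>, the type \<^typ>\<open>real\<close> gives \<open>V(\<real>)\<close>.
\<close>

datatype 'a quartic_form =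
  Quartic (qc0: 'a) (qc1: 'a) (qc2: 'a) (qc3: 'a) (qc4: 'a)

instantiation quartic_form :: (zero) zero
begin
definition "0 = Quartic 0 0 0 0 0"
instance ..
end

definition inv_I :: "'a::comm_ring_1 quartic_form \<Rightarrow> 'a" where
  "inv_I f = 12 * qc0 f * qc4 f - 3 * qc1 f * qc3 f + qc2 f ^ 2"

definition inv_J :: "'a::comm_ring_1 quartic_form \<Rightarrow> 'a" where
  "inv_J f = 72 * qc0 f * qc2 f * qc4 f + 9 * qc1 f * qc2 f * qc3 f
     - 27 * (qc0 f * qc3 f ^ 2 + qc1 f ^ 2 * qc4 f) - 2 * qc2 f ^ 3"

text \<open>The division by 27 is exact, see \<open>disc_times_27\<close> below.\<close>

definition disc :: "int quartic_form \<Rightarrow> int" where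
  "disc f = (4 * inv_I f ^ 3 - inv_J f ^ 2) div 27"

lemma disc_expand:
  "disc (Quartic a b c d e) =
     256*a^3*e^3 - 192*a^2*b*d*e^2 - 128*a^2*c^2*e^2 + 144*a^2*c*d^2*e - 27*a^2*d^4
     + 144*a*b^2*c*e^2 - 6*a*b^2*d^2*e - 80*a*b*c^2*d*e + 18*a*b*c*d^3 + 16*a*c^4*e
     - 4*a*c^3*d^2 - 27*b^4*e^2 + 18*b^3*c*d*e - 4*b^3*d^3 - 4*b^2*c^3*e + b^2*c^2*d^2"
  (is "_ = ?D")
proof -
  have "4 * inv_I (Quartic a b c d e) ^ 3 - inv_J (Quartic a b c d e) ^ 2 = 27 * ?D"
    unfolding inv_I_def inv_J_def quartic_form.sel
      by (simp add: eval_nat_numeral algebra_simps)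
  then show ?thesis
    unfolding disc_def by simp
qed

lemma disc_times_27: "27 * disc f = 4 * inv_I f ^ 3 - inv_J f ^ 2"
proof (cases f)
  case (Quartic a b c d e)
  show ?thesis
    unfolding Quartic disc_expand inv_I_def inv_J_def quartic_form.sel
      by (simp add: eval_nat_numeral algebra_simps)
qed

definition form_cong :: "int quartic_form \<Rightarrow> int quartic_form \<Rightarrow> int \<Rightarrow> bool" where
  "form_cong f g m \<longleftrightarrow> [qc0 f = qc0 g] (mod m) \<and> [qc1 f = qc1 g] (mod m) \<and>
     [qc2 f = qc2 g] (mod m) \<and> [qc3 f = qc3 g] (mod m) \<and> [qc4 f = qc4 g] (mod m)"

lemma disc_cong: "form_cong f g m \<Longrightarrow> [disc f = disc g] (mod m)"
  by (cases f; cases g)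
     (auto simp: form_cong_def disc_expand intro!: cong_add cong_diff cong_mult cong_pow)

definition quartic_box :: "real \<Rightarrow> real quartic_form set" where
  "quartic_box r = {f. \<forall>c\<in>set_quartic_form f. \<bar>c\<bar> \<le> r}"

text \<open>
  \<open>V(\<int>/q\<int>)\<close>, each residue class being represented by its element in \<open>{0..<q}\<close>.
\<close>

definition V_mod :: "nat \<Rightarrow> int quartic_form set" where
  "V_mod q = {h. set_quartic_form h \<subseteq> {0..<int q}}"

text \<open>
  By \<open>disc_cong\<close> this depends on the coefficients of the form modulo \<open>q\<close> only.
\<close>

definition Phi :: "nat \<Rightarrow> int quartic_form \<Rightarrow> nat" where
  "Phi q h = of_bool ([disc h = 0] (mod int q))"

text \<open>
  An integer representing \<open>[h, f] \<in> \<int>/q\<int>\<close>; used for \<open>q\<close> coprime to 6 only, so that 4 and 6 are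
  invertible modulo \<open>q\<close>. The value of \<open>e^(2\<pi>i[h,f]/q)\<close> does not depend on the representative.
\<close>

definition pairing :: "nat \<Rightarrow> int quartic_form \<Rightarrow> int quartic_form \<Rightarrow> int" where
  "pairing q h f = qc0 h * qc0 f
     + modular_inverse (int q) 4 * qc1 h * qc1 f
     + modular_inverse (int q) 6 * qc2 h * qc2 f
     + modular_inverse (int q) 4 * qc3 h * qc3 f
     + qc4 h * qc4 f"

definition Phi_hat_coprime :: "nat \<Rightarrow> int quartic_form \<Rightarrow> complex" where
  "Phi_hat_coprime q f = (1 / of_nat q ^ 5) *
     (\<Sum>h\<in>V_mod q. of_nat (Phi q h) * exp (2 * pi * \<i> * of_int (pairing q h f) / of_nat q))"

definition Phi_hat :: "nat \<Rightarrow> int quartic_form \<Rightarrow> complex" where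
  "Phi_hat q f = Phi_hat_coprime (q div gcd q 6) f"

lemma coprime_div_gcd_6:
  assumes "squarefree (q::nat)"
  shows "coprime (q div gcd q 6) 6"
proof -
  have "\<not> p dvd q div gcd q 6" if p: "prime p" "p dvd 6" for p
  proof
    assume "p dvd q div gcd q 6"
    moreover have "p dvd q"
      using calculation by (rule dvd_trans) (rule dvdI[of _ _ "gcd q 6"], simp)
    then have "p dvd gcd q 6"
      using p by simp
    ultimately have "p * p dvd (q div gcd q 6) * gcd q 6"
      by (rule mult_dvd_mono)
    then have "p ^ 2 dvd q"
      by (simp add: power2_eq_square)
    then have "p dvd 1"
      using assms squarefreeD by blast
    with p show False
      by simp
  qed
  then have "gcd (q div gcd q 6) 6 = 1"
    using prime_factor_nat[of "gcd (q div gcd q 6) 6"] dvd_trans[OF _ gcd_dvd1]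
      dvd_trans[OF _ gcd_dvd2] by blast
  then show ?thesis
    by (simp only: coprime_iff_gcd_eq_1)
qed

lemma finite_quartic_coeffs:
  assumes "finite A"
  shows "finite {f. set_quartic_form f \<subseteq> A}"
proof (rule finite_subset)
  show "{f. set_quartic_form f \<subseteq> A} \<subseteq>
    (\<lambda>(a, b, c, d, e). Quartic a b c d e) ` (A \<times> A \<times> A \<times> A \<times> A)"
  proof
    fix f assume "f \<in> {f. set_quartic_form f \<subseteq> A}"
    then show "f \<in> (\<lambda>(a, b, c, d, e). Quartic a b c d e) ` (A \<times> A \<times> A \<times> A \<times> A)"
      by (cases f) (auto simp: image_iff)
  qed
qed (use assms in auto)

lemma finite_V_mod: "finite (V_mod q)"
  unfolding V_mod_def by (rule finite_quartic_coeffs) simp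

lemma finite_integral_quartic_box:
  "finite {f. map_quartic_form real_of_int f \<in> quartic_box r}"
proof (rule finite_subset)
  show "{f. map_quartic_form real_of_int f \<in> quartic_box r} \<subseteq>
    {f. set_quartic_form f \<subseteq> {- \<lfloor>r\<rfloor>..\<lfloor>r\<rfloor>}}"
    by (auto simp: quartic_box_def quartic_form.set_map abs_le_iff le_floor_iff)
       (metis minus_le_iff le_floor_iff of_int_minus)
qed (rule finite_quartic_coeffs, simp)

lemma finite_dyadic_squarefree:
  "finite {q::nat. squarefree q \<and> Q \<le> real q \<and> real q \<le> 2 * Q}"
  by (rule finite_subset[of _ "{..nat \<lfloor>2 * Q\<rfloor>}"]) (auto simp: le_nat_floor)

end

theory Submission
  imports Defs
begin

text \<open>
  The Fourier transform is multiplicative in the modulus, so it is bounded prime by prime. Modulo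
  a prime \<open>p > 3\<close> a nonzero singular form either has exactly one double root on the
  projective line, or is a multiple \<open>k Q^2\<close> of a square, in which case it has
  \<open>1 + \<chi>(disc Q)\<close> double roots. Hence the indicator function of the singular
  forms is the number of double roots, corrected by a sum of \<open>\<chi>(disc Q)\<close> over
  the ways to write the form as \<open>k Q^2\<close>, and by a term at the zero form
  (\<open>singular_indicator_decomposition\<close>). The forms with a double root at a given point
  are a linear space of dimension three, whose Fourier transform is supported on its annihilator;
  summed over the points this contributes only if the dual form has a triple root, that is if
  \<open>p\<close> divides \<open>I(f)\<close> and \<open>J(f)\<close>. The correction becomes a
  sum of \<open>\<chi>(disc Q)\<close> over the quadratic forms \<open>Q\<close> on the conic
  \<open>[Q^2, f] = 0\<close>. Detecting the conic by a pencil of quadratic forms turns this into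
  a character sum over the resolvent cubic of \<open>f\<close>
  (\<open>conic_sum_eq_resolvent_sum\<close>), and the square-root bound for cubic character sums
  is proved by Stepanov's method (\<open>cubic_Legendre_sum_bound\<close>). The outcome is the
  bound \<open>norm_Phi_hat_prime_le\<close>: up to a constant, the transform at \<open>p\<close>
  is at most \<open>p^(-1)\<close> if \<open>p\<close> divides \<open>f\<close>, otherwise
  \<open>p^(-2)\<close> if \<open>f\<close> has a triple root modulo \<open>p\<close>, otherwise
  \<open>p^(-3)\<close> if \<open>p\<close> divides a certain nonzero polynomial
  \<open>generic_cov f\<close> in the coefficients, and \<open>p^(-7/2)\<close> in all other
  cases.

  The product of these local weights over the primes dividing \<open>q\<close> is a function of
  the three divisors of \<open>q\<close> made of the primes of the first three kinds. Fixing these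
  divisors leaves few \<open>q\<close>, because \<open>q\<close> is a multiple of their product,
  and the divisors of the third kind, as well as those of the second kind when only
  \<open>generic_cov f\<close> vanishes, divide nonzero integers of polynomial size, so that the
  divisor bound leaves \<open>Q^\<epsilon>\<close> of them. The forms fall into three classes.
  Those with \<open>I = J = 0\<close> number about \<open>r^2\<close>
  (\<open>triple_root_count\<close>) and give the term \<open>r^2/Q\<close>. Those with
  \<open>generic_cov f = 0\<close> number at most \<open>O(r^4)\<close> and give
  \<open>r^4/Q^2\<close>. For the others one has to sum the square roots of the moduli
  \<open>m\<close> modulo which \<open>f\<close> has a triple root at every prime: such an
  \<open>m\<close> divides a polynomial in the first four coefficients, and \<open>I(f) \<equiv>
  0\<close> modulo \<open>m\<close> then confines the last coefficient to a residue class,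
  provided the leading coefficient shares no large factor with \<open>m\<close>. That proviso is
  met after replacing \<open>y\<close> by \<open>y + k x\<close> for some \<open>k \<in>
  {0..3}\<close> (\<open>exists_transversal_translate\<close>), as a form has at most two roots
  modulo a prime where it has a triple root. This gives \<open>r^5/Q^(5/2)\<close> and a further
  \<open>r^4/Q^2\<close>.
\<close>

hide_const (open) Module.smult UnivPoly.monom UnivPoly.coeff

section \<open>The divisor bound\<close>

lemma card_divisors_prime_power_mult:
  fixes p m e :: nat
  assumes "prime p" "m > 0" "\<not> p dvd m"
  shows "card {d. d dvd p ^ e * m} \<le> Suc e * card {d. d dvd m}"
proof -
  have "{d. d dvd p ^ e * m} \<subseteq> (\<lambda>(i, d). p ^ i * d) ` ({..e} \<times> {d. d dvd m})"
  proof
    fix d assume "d \<in> {d. d dvd p ^ e * m}"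
    then obtain x y where "d = x * y" "x dvd p ^ e" "y dvd m"
      using division_decomp by blast
    moreover from \<open>x dvd p ^ e\<close> obtain i where "i \<le> e" "x = p ^ i"
      using assms(1) divides_primepow_nat by blast
    ultimately show "d \<in> (\<lambda>(i, d). p ^ i * d) ` ({..e} \<times> {d. d dvd m})"
      by (auto intro!: image_eqI[where x = "(i, y)"])
  qed
  moreover have fin: "finite ({..e} \<times> {d. d dvd m})"
    using assms(2) by auto
  ultimately have "card {d. d dvd p ^ e * m} \<le> card ({..e} \<times> {d. d dvd m})"
    by (meson surj_card_le)
  also have "\<dots> = Suc e * card {d. d dvd m}"
    by (simp add: card_cartesian_product)
  finally show ?thesis .
qed

text \<open>
  This is the factor at one prime of the divisor bound: for large primes the constant 1 suffices,
  and the finitely many small primes are absorbed into the constant.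
\<close>

lemma Suc_le_powr:
  fixes \<delta> :: real
  assumes "\<delta> > 0" "x \<ge> 2"
  shows "real (Suc e) \<le> max 1 (1 / (\<delta> * ln 2)) * (x ^ e) powr \<delta>"
proof -
  define K where "K = max 1 (1 / (\<delta> * ln 2))"
  have dl: "\<delta> * ln 2 > 0" using assms by simp
  have K: "K \<ge> 1" "K * (\<delta> * ln 2) \<ge> 1"
    using dl by (auto simp: K_def max_def field_simps)
  have "real (Suc e) = 1 + real e" by simp
  also have "\<dots> \<le> K + K * (\<delta> * ln 2) * real e"
    using K(1) mult_right_mono[OF K(2), of "real e"] by simp
  also have "\<dots> = K * (1 + real e * ln 2 * \<delta>)" by (simp add: algebra_simps)
  also have "\<dots> \<le> K * exp (real e * ln 2 * \<delta>)"
    using K by (intro mult_left_mono) auto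
  also have "exp (real e * ln 2 * \<delta>) = (2 ^ e) powr \<delta>"
    by (simp add: powr_def ln_realpow mult.commute)
  also have "K * (2 ^ e) powr \<delta> \<le> K * (x ^ e) powr \<delta>"
    using K assms by (intro mult_left_mono powr_mono2 power_mono) auto
  finally show ?thesis unfolding K_def .
qed

lemma divisor_bound_small_primes:
  fixes \<delta> K :: real and B n :: nat
  assumes "\<delta> > 0" "K \<ge> 1" "n > 0"
    and K: "\<And>e x. x \<ge> 2 \<Longrightarrow> real (Suc e) \<le> K * (x ^ e) powr \<delta>"
    and B: "\<And>p. p \<ge> B \<Longrightarrow> 2 \<le> real p powr \<delta>"
  shows "real (card {d. d dvd n}) \<le> K ^ card {p \<in> prime_factors n. p < B} * real n powr \<delta>"
  using \<open>n > 0\<close>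
proof (induction n rule: less_induct)
  case (less n)
  show ?case
  proof (cases "n = 1")
    case True
    then show ?thesis by simp
  next
    case False
    then obtain p where p: "prime p" "p dvd n"
      using prime_factor_nat by blast
    then obtain m where m: "n = p ^ multiplicity p n * m" "\<not> p dvd m"
      using multiplicity_decompose'[of n p] less.prems by (metis not_prime_unit not_gr_zero)
    define e where "e = multiplicity p n"
    have n: "n = p ^ e * m" using m e_def by simp
    have e: "e > 0" using p less.prems unfolding e_def
      by (metis gr0I multiplicity_eq_zero_iff not_prime_unit gr_implies_not0)
    have m0: "m > 0" using less.prems n by (cases m) auto
    have mn: "m < n"
    proof -
      have "1 < p ^ e" using p e prime_gt_1_nat one_less_power by blast
      then show ?thesis using m0 n by simp
    qed
    have pf: "prime_factors n = insert p (prime_factors m)"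
      using p e m0 unfolding n
      by (subst prime_factors_product) (auto simp: prime_factors_power prime_prime_factors)
    have pm: "p \<notin> prime_factors m" using m(2) by (auto dest: in_prime_factors_imp_dvd)
    have p2: "real p \<ge> 2" using p(1) prime_ge_2_nat by fastforce
    define c where "c = (if p < B then K else 1)"
    have step: "real (Suc e) \<le> c * (real p ^ e) powr \<delta>"
    proof (cases "p < B")
      case True
      then show ?thesis using K[OF p2] by (simp add: c_def)
    next
      case False
      then have "2 \<le> real p powr \<delta>" using B by simp
      then have "2 ^ e \<le> (real p powr \<delta>) ^ e" by (intro power_mono) auto
      also have "(real p powr \<delta>) ^ e = (real p ^ e) powr \<delta>"
        using p2 by (simp add: powr_power powr_powr mult.commute flip: powr_realpow)
      finally have a: "2 ^ e \<le> (real p ^ e) powr \<delta>" .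
      have "real (Suc e) \<le> 2 ^ e"
        using less_exp[of e] by (metis Suc_leI of_nat_le_iff of_nat_numeral of_nat_power)
      with a show ?thesis using False by (simp add: c_def)
    qed
    have c1: "c \<ge> 1" using assms by (simp add: c_def)
    have cK: "K ^ card {q \<in> prime_factors n. q < B} = c * K ^ card {q \<in> prime_factors m. q < B}"
    proof (cases "p < B")
      case True
      then have "{q \<in> prime_factors n. q < B} = insert p {q \<in> prime_factors m. q < B}"
        unfolding pf by auto
      then show ?thesis using pm True by (simp add: c_def)
    next
      case False
      then have "{q \<in> prime_factors n. q < B} = {q \<in> prime_factors m. q < B}"
        unfolding pf by auto
      then show ?thesis using False by (simp add: c_def)
    qed
    have "real (card {d. d dvd n}) \<le> real (Suc e) * real (card {d. d dvd m})"
      using card_divisors_prime_power_mult[OF p(1) m0 m(2), of e] n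
      by (metis of_nat_le_iff of_nat_mult)
    also have "\<dots> \<le> (c * (real p ^ e) powr \<delta>) *
        (K ^ card {q \<in> prime_factors m. q < B} * real m powr \<delta>)"
      using less.IH[OF mn m0] step assms c1 by (intro mult_mono) auto
    also have "\<dots> = K ^ card {q \<in> prime_factors n. q < B} * real n powr \<delta>"
    proof -
      have "real n powr \<delta> = (real p ^ e) powr \<delta> * real m powr \<delta>"
        unfolding n by (simp add: powr_mult)
      then show ?thesis by (simp only: cK mult_ac)
    qed
    finally show ?thesis .
  qed
qed

text \<open>
  Only the primes below \<open>2 powr (1/\<delta>)\<close> cost a constant factor each, and their
  number does not depend on \<open>n\<close>.
\<close>

lemma divisor_bound:
  fixes \<delta> :: real
  assumes "\<delta> > 0"
  obtains C where "C \<ge> 1" "\<And>n::nat. n > 0 \<Longrightarrow> real (card {d. d dvd n}) \<le> C * real n powr \<delta>"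
proof -
  define K where "K = max 1 (1 / (\<delta> * ln 2))"
  define B where "B = nat \<lceil>2 powr (1 / \<delta>)\<rceil>"
  have K1: "K \<ge> 1" by (simp add: K_def)
  have B: "2 \<le> real p powr \<delta>" if "p \<ge> B" for p
  proof -
    have "2 powr (1 / \<delta>) \<le> real p" using that unfolding B_def by linarith
    then have "(2 powr (1 / \<delta>)) powr \<delta> \<le> real p powr \<delta>"
      using assms by (intro powr_mono2) auto
    then show ?thesis using assms by (simp add: powr_powr)
  qed
  have "real (card {d. d dvd n}) \<le> K ^ B * real n powr \<delta>" if "n > 0" for n
  proof -
    have "card {p \<in> prime_factors n. p < B} \<le> card {..<B}"
      by (intro card_mono) auto
    then have "K ^ card {p \<in> prime_factors n. p < B} \<le> K ^ B"
      using K1 by (intro power_increasing) auto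
    then have "K ^ card {p \<in> prime_factors n. p < B} * real n powr \<delta> \<le> K ^ B * real n powr \<delta>"
      by (intro mult_right_mono) auto
    with divisor_bound_small_primes[OF assms K1 that _ B, of B] Suc_le_powr[OF assms]
    show ?thesis unfolding K_def by fastforce
  qed
  moreover have "K ^ B \<ge> 1" using K1 by simp
  ultimately show ?thesis using that by blast
qed

text \<open>
  Distinct sets of prime factors have distinct products.
\<close>

lemma two_power_card_prime_factors_le:
  fixes n :: nat
  assumes "n > 0"
  shows "2 ^ card (prime_factors n) \<le> card {d. d dvd n}"
proof -
  have "inj_on (\<lambda>S. \<Prod>S) (Pow (prime_factors n))"
  proof (rule inj_onI)
    fix S T assume S: "S \<in> Pow (prime_factors n)" and T: "T \<in> Pow (prime_factors n)"
      and eq: "\<Prod>S = \<Prod>T"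
    have pf: "prime_factors (\<Prod>U) = U" if "U \<in> Pow (prime_factors n)" for U
    proof -
      have fin: "finite U" using that finite_subset by auto
      have "prime_factors (\<Prod>U) = \<Union> (prime_factors ` U)"
        using that fin by (subst prime_factors_prod) auto
      also have "\<dots> = (\<Union>p\<in>U. {p})"
      proof (rule SUP_cong[OF refl])
        fix p assume "p \<in> U"
        with that have "p \<in> prime_factors n" by auto
        then have "prime p" by (rule in_prime_factors_imp_prime)
        then show "prime_factors p = {p}" by (rule prime_prime_factors)
      qed
      also have "\<dots> = U" by simp
      finally show ?thesis .
    qed
    show "S = T" using pf[OF S] pf[OF T] unfolding eq by (rule trans[OF sym])
  qed
  moreover have "(\<lambda>S. \<Prod>S) ` Pow (prime_factors n) \<subseteq> {d. d dvd n}"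
  proof clarsimp
    fix S assume S: "S \<subseteq> prime_factors n"
    have "\<Prod>S dvd \<Prod>(prime_factors n)"
      using S by (intro prod_dvd_prod_subset) auto
    also have "\<dots> dvd (\<Prod>p\<in>prime_factors n. p ^ multiplicity p n)"
    proof (rule prod_dvd_prod)
      fix p assume p: "p \<in> prime_factors n"
      then have "multiplicity p n > 0"
        by (simp add: prime_factors_multiplicity)
      then show "p dvd p ^ multiplicity p n" by (rule dvd_power[OF disjI1])
    qed
    also have "\<dots> = n"
      using prod_prime_factors[of n] assms by simp
    finally show "\<Prod>S dvd n" .
  qed
  ultimately have "card (Pow (prime_factors n)) \<le> card {d. d dvd n}"
    using assms by (intro card_inj_on_le) auto
  then show ?thesis by (simp add: card_Pow)
qed

section \<open>Polynomials vanishing to high order modulo a prime\<close>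

text \<open>
  Induction step for splitting off linear factors: it relates the derivatives of a polynomial to
  those of its quotient by \<open>X - x\<close>.
\<close>

lemma higher_pderiv_linear_mult:
  fixes R :: "int poly"
  shows "(pderiv ^^ i) ([:- x, 1:] * R + [:c:]) =
    [:- x, 1:] * (pderiv ^^ i) R + (if i = 0 then [:c:] else smult (int i) ((pderiv ^^ (i - 1)) R))"
proof (induction i)
  case 0
  then show ?case by simp
next
  case (Suc i)
  show ?case
  proof (cases i)
    case 0
    then show ?thesis
      by (simp add: pderiv_add pderiv_diff pderiv_smult pderiv_mult pderiv_pCons algebra_simps)
  next
    case i: (Suc k)
    have "(pderiv ^^ Suc i) ([:- x, 1:] * R + [:c:]) =
      pderiv ([:- x, 1:] * (pderiv ^^ i) R + smult (int i) ((pderiv ^^ k) R))"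
      using Suc i by simp
    also have "\<dots> = [:- x, 1:] * (pderiv ^^ Suc i) R + ((pderiv ^^ i) R + smult (int i) ((pderiv ^^ i) R))"
      by (simp add: i pderiv_add pderiv_diff pderiv_mult pderiv_pCons pderiv_smult algebra_simps)
    also have "(pderiv ^^ i) R + smult (int i) ((pderiv ^^ i) R) = smult (int (Suc i)) ((pderiv ^^ i) R)"
      using smult_add_left[of 1 "int i" "(pderiv ^^ i) R"] by simp
    finally show ?thesis by simp
  qed
qed

text \<open>
  Modulo \<open>p\<close>, the vanishing of all derivatives of order below \<open>m \<le>
  p\<close> at \<open>x\<close> amounts to divisibility by \<open>(X - x)^m\<close>, since the
  factorials that occur are units. A polynomial that is nonzero modulo \<open>p\<close> therefore
  cannot have more roots than its degree, counted with these multiplicities.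
\<close>

lemma sum_root_orders_mod_prime_le_degree:
  fixes p :: int and R :: "int poly" and m :: "int \<Rightarrow> nat"
  assumes "prime p" "finite S"
    and "\<And>x y. x \<in> S \<Longrightarrow> y \<in> S \<Longrightarrow> x \<noteq> y \<Longrightarrow> \<not> p dvd x - y"
    and "\<And>x. x \<in> S \<Longrightarrow> int (m x) \<le> p"
    and "\<And>x i. x \<in> S \<Longrightarrow> i < m x \<Longrightarrow> p dvd poly ((pderiv ^^ i) R) x"
    and "\<not> [:p:] dvd R"
  shows "(\<Sum>x\<in>S. m x) \<le> degree R"
  using assms(4,5,6)
proof (induction "\<Sum>x\<in>S. m x" arbitrary: R m)
  case 0
  then show ?case by simp
next
  case (Suc N)
  have "\<exists>x\<in>S. m x > 0"
  proof (rule ccontr)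
    assume "\<not> ?thesis"
    then have "(\<Sum>x\<in>S. m x) = 0" by simp
    with Suc.hyps(2) show False by simp
  qed
  then obtain x where x: "x \<in> S" "m x > 0" by blast
  define R1 where "R1 = synthetic_div R x"
  have R: "R = [:- x, 1:] * R1 + [:poly R x:]"
    unfolding R1_def by (rule synthetic_div_correct'[symmetric])
  have px: "p dvd poly R x"
    using Suc.prems(2)[OF x] by simp
  have pR1: "\<not> [:p:] dvd R1"
  proof
    assume a: "[:p:] dvd R1"
    have "[:p:] dvd [:poly R x:]" using px by (simp add: const_poly_dvd_const_poly_iff)
    with a have "[:p:] dvd [:- x, 1:] * R1 + [:poly R x:]"
      by (intro dvd_add dvd_mult)
    with R Suc.prems(3) show False by metis
  qed
  have deg: "degree R \<noteq> 0"
  proof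
    assume "degree R = 0"
    then obtain c where "R = [:c:]" by (rule degree_eq_zeroE)
    with px Suc.prems(3) show False
      by (simp add: is_unit_const_poly_iff const_poly_dvd_const_poly_iff)
  qed
  define m' where "m' = m(x := m x - 1)"
  have summ': "(\<Sum>y\<in>S. m' y) = N"
  proof -
    have "(\<Sum>y\<in>S. m y) = m x + (\<Sum>y\<in>S - {x}. m y)"
      using x assms(2) by (simp add: sum.remove)
    moreover have "(\<Sum>y\<in>S. m' y) = m' x + (\<Sum>y\<in>S - {x}. m' y)"
      using x assms(2) by (simp add: sum.remove)
    moreover have "(\<Sum>y\<in>S - {x}. m' y) = (\<Sum>y\<in>S - {x}. m y)"
      by (intro sum.cong) (auto simp: m'_def)
    ultimately show ?thesis using Suc.hyps(2) x by (simp add: m'_def)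
  qed
  have der: "poly ((pderiv ^^ i) R) y = (y - x) * poly ((pderiv ^^ i) R1) y +
      (if i = 0 then poly R x else int i * poly ((pderiv ^^ (i - 1)) R1) y)" for i y
  proof -
    have "(pderiv ^^ i) R = (pderiv ^^ i) ([:- x, 1:] * R1 + [:poly R x:])"
      using R by simp
    also have "\<dots> = [:- x, 1:] * (pderiv ^^ i) R1 +
        (if i = 0 then [:poly R x:] else smult (int i) ((pderiv ^^ (i - 1)) R1))"
      by (rule higher_pderiv_linear_mult)
    finally have E: "(pderiv ^^ i) R = [:- x, 1:] * (pderiv ^^ i) R1 +
        (if i = 0 then [:poly R x:] else smult (int i) ((pderiv ^^ (i - 1)) R1))" .
    show ?thesis by (subst E) (simp add: algebra_simps)
  qed
  have "N \<le> degree R1"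
    unfolding summ'[symmetric]
  proof (rule Suc.hyps(1))
    show "N = (\<Sum>y\<in>S. m' y)" by (simp add: summ')
    show "int (m' y) \<le> p" if "y \<in> S" for y
      using Suc.prems(1)[OF that] x by (auto simp: m'_def)
    show "\<not> [:p:] dvd R1" by (rule pR1)
    fix y i assume y: "y \<in> S" and i: "i < m' y"
    show "p dvd poly ((pderiv ^^ i) R1) y"
    proof (cases "y = x")
      case True
      then have "Suc i < m x" using i by (simp add: m'_def)
      then have "p dvd poly ((pderiv ^^ Suc i) R) x" using Suc.prems(2) x by blast
      then have "p dvd int (Suc i) * poly ((pderiv ^^ i) R1) x"
        using der[of "Suc i" x] by simp
      moreover have "\<not> p dvd int (Suc i)"
        using \<open>Suc i < m x\<close> Suc.prems(1)[OF x(1)] by (auto dest: zdvd_imp_le)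
      ultimately show ?thesis
        using True assms(1) prime_dvd_mult_iff by blast
    next
      case False
      then have my: "m' y = m y" by (simp add: m'_def)
      from False y x have nd: "\<not> p dvd y - x" using assms(3) by blast
      from i show ?thesis
      proof (induction i)
        case 0
        then have "p dvd poly R y" using Suc.prems(2)[OF y, of 0] my by simp
        then have "p dvd (y - x) * poly R1 y"
          using der[of 0 y] px by (simp add: dvd_add_left_iff)
        then show ?case using nd assms(1) prime_dvd_mult_iff by (metis funpow_0)
      next
        case (Suc i)
        then have "p dvd poly ((pderiv ^^ i) R1) y" by simp
        moreover have "p dvd poly ((pderiv ^^ Suc i) R) y"
          using \<open>\<And>x i. x \<in> S \<Longrightarrow> i < m x \<Longrightarrow> p dvd poly ((pderiv ^^ i) R) x\<close>[OF y, of "Suc i"] Suc.prems my by simp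
        ultimately have "p dvd (y - x) * poly ((pderiv ^^ Suc i) R1) y"
          using der[of "Suc i" y] by (simp add: dvd_add_left_iff del: funpow.simps)
        then show ?case using nd assms(1) prime_dvd_mult_iff by blast
      qed
    qed
  qed
  moreover have "degree R1 = degree R - 1" by (simp add: R1_def degree_synthetic_div)
  ultimately show ?case using Suc.hyps(2) deg by linarith
qed

lemma homogeneous_congruences_solvable:
  fixes A :: "'e \<Rightarrow> 'u \<Rightarrow> int" and p :: nat
  assumes "p > 1" "finite U" "finite E" "card E < card U"
  obtains c where "\<exists>u\<in>U. \<not> int p dvd c u" "\<And>e. e \<in> E \<Longrightarrow> int p dvd (\<Sum>u\<in>U. c u * A e u)"
proof -
  define F where "F = (\<lambda>c. restrict (\<lambda>e. (\<Sum>u\<in>U. c u * A e u) mod int p) E)"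
  have "F ` (PiE U (\<lambda>_. {0..<int p})) \<subseteq> PiE E (\<lambda>_. {0..<int p})"
    using assms(1) by (auto simp: F_def)
  moreover have "finite (PiE E (\<lambda>_. {0..<int p}))"
    using assms by (intro finite_PiE) auto
  moreover have "card (PiE E (\<lambda>_. {0..<int p})) < card (PiE U (\<lambda>_. {0..<int p}))"
    using assms by (simp add: card_PiE)
  ultimately have "\<not> inj_on F (PiE U (\<lambda>_. {0..<int p}))"
    by (metis card_inj_on_le leD)
  then obtain c d where cd: "c \<in> PiE U (\<lambda>_. {0..<int p})" "d \<in> PiE U (\<lambda>_. {0..<int p})"
    "c \<noteq> d" "F c = F d" unfolding inj_on_def by blast
  from cd(1-3) obtain u where u: "u \<in> U" "c u \<noteq> d u" by (metis PiE_ext)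
  have "\<not> int p dvd c u - d u"
  proof
    assume "int p dvd c u - d u"
    then have "c u mod int p = d u mod int p" by (simp add: mod_eq_dvd_iff)
    moreover have "c u \<in> {0..<int p}" "d u \<in> {0..<int p}" using cd u by auto
    ultimately show False using u by simp
  qed
  moreover have "int p dvd (\<Sum>u\<in>U. (c u - d u) * A e u)" if "e \<in> E" for e
  proof -
    have "F c e = F d e" using cd(4) by simp
    then have "(\<Sum>u\<in>U. c u * A e u) mod int p = (\<Sum>u\<in>U. d u * A e u) mod int p"
      using that by (simp add: F_def)
    then show ?thesis by (simp add: mod_eq_dvd_iff left_diff_distrib sum_subtractf)
  qed
  ultimately show ?thesis using that[of "\<lambda>u. c u - d u"] u by blast
qed

text \<open>
  The cofactor of \<open>g^(\<kappa> - i)\<close> in the \<open>i\<close>-th derivative of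
  \<open>g^\<kappa> h\<close>. The exponent is an integer so that the recursion involves no
  truncated subtraction.
\<close>

primrec pow_deriv_cofactor :: "int poly \<Rightarrow> int \<Rightarrow> nat \<Rightarrow> int poly \<Rightarrow> int poly" where
  "pow_deriv_cofactor g \<kappa> 0 h = h"
| "pow_deriv_cofactor g \<kappa> (Suc i) h =
     smult (\<kappa> - int i) (pderiv g * pow_deriv_cofactor g \<kappa> i h) + g * pderiv (pow_deriv_cofactor g \<kappa> i h)"

lemma const_dvd_pderiv: "[:c:] dvd P \<Longrightarrow> [:c:] dvd pderiv P" for c :: int
  by (auto simp: const_poly_dvd_iff coeff_pderiv)

lemma const_dvd_poly: "[:c:] dvd P \<Longrightarrow> c dvd poly P x" for c :: int
  by (auto elim!: dvdE)

text \<open>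
  The derivative of \<open>X^(j p)\<close> is divisible by \<open>p\<close>, so this factor
  behaves like a constant.
\<close>

lemma higher_pderiv_pow_mult_cong:
  fixes g h :: "int poly" and p j k i :: nat
  assumes "i \<le> k"
  shows "[:int p:] dvd (pderiv ^^ i) (g ^ k * h * monom 1 (j * p)) -
    g ^ (k - i) * pow_deriv_cofactor g (int k) i h * monom 1 (j * p)"
  using assms
proof (induction i)
  case 0
  then show ?case by simp
next
  case (Suc i)
  define u where "u = pow_deriv_cofactor g (int k) i h"
  define M :: "int poly" where "M = monom 1 (j * p)"
  obtain m where m: "k - i = Suc m" using Suc.prems by (metis Suc_diff_Suc Suc_le_lessD)
  then have km: "k - Suc i = m" "int k - int i = int (Suc m)" using Suc.prems by auto
  have dM: "[:int p:] dvd pderiv M"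
    by (simp add: M_def pderiv_monom const_poly_dvd_iff)
  have "[:int p:] dvd pderiv ((pderiv ^^ i) (g ^ k * h * M) - g ^ (k - i) * u * M)"
    using Suc unfolding u_def M_def by (intro const_dvd_pderiv) simp
  then have 1: "[:int p:] dvd (pderiv ^^ Suc i) (g ^ k * h * M) - pderiv (g ^ Suc m * u * M)"
    by (simp add: pderiv_diff m)
  have "pderiv (g ^ Suc m * u * M) =
      g ^ m * (smult (int (Suc m)) (pderiv g * u) + g * pderiv u) * M + g ^ Suc m * u * pderiv M"
    by (simp add: pderiv_mult pderiv_power_Suc algebra_simps del: power_Suc of_nat_Suc)
       (simp add: algebra_simps)
  then have "pderiv (g ^ Suc m * u * M) - g ^ m * pow_deriv_cofactor g (int k) (Suc i) h * M
      = g ^ Suc m * u * pderiv M"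
    by (simp add: u_def km)
  then have 2: "[:int p:] dvd pderiv (g ^ Suc m * u * M) - g ^ m * pow_deriv_cofactor g (int k) (Suc i) h * M"
    using dM by simp
  from dvd_add[OF 1 2] show ?case unfolding M_def km by simp
qed

lemma degree_pow_deriv_cofactor_le:
  assumes "degree g \<le> 3"
  shows "degree (pow_deriv_cofactor g \<kappa> i h) \<le> degree h + 2 * i"
proof (induction i)
  case 0
  then show ?case by simp
next
  case (Suc i)
  define u where "u = pow_deriv_cofactor g \<kappa> i h"
  have "degree (pderiv g) \<le> 2" using assms by (simp add: degree_pderiv)
  then have "degree (pderiv g * u) \<le> degree u + 2"
    using degree_mult_le[of "pderiv g" u] by linarith
  moreover have "degree (g * pderiv u) \<le> degree u + 2"
  proof (cases "degree u = 0")
    case True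
    then have "pderiv u = 0" by (simp add: pderiv_eq_0_iff)
    then show ?thesis by simp
  next
    case False
    then show ?thesis
      using degree_mult_le[of g "pderiv u"] assms degree_pderiv[of u] by linarith
  qed
  ultimately have "degree (smult (\<kappa> - int i) (pderiv g * u) + g * pderiv u) \<le> degree u + 2"
    by (intro degree_add_le) (auto intro: order_trans[OF degree_smult_le])
  then show ?case using Suc by (simp add: u_def)
qed

text \<open>
  Among the terms whose coefficient is not divisible by \<open>p\<close>, the one of largest
  degree cannot be cancelled.
\<close>

lemma distinct_degrees_not_dvd:
  fixes p :: int and B :: "'u \<Rightarrow> int poly"
  assumes "prime p" "finite U" "inj_on (\<lambda>u. degree (B u)) U"
    and "\<And>u. u \<in> U \<Longrightarrow> \<not> p dvd lead_coeff (B u)"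
    and "\<exists>u\<in>U. \<not> p dvd c u"
  shows "\<not> [:p:] dvd (\<Sum>u\<in>U. smult (c u) (B u))"
proof
  assume dvd: "[:p:] dvd (\<Sum>u\<in>U. smult (c u) (B u))"
  define V where "V = {u \<in> U. \<not> p dvd c u}"
  have V: "finite V" "V \<noteq> {}" using assms(2,5) by (auto simp: V_def)
  define D where "D = Max ((\<lambda>u. degree (B u)) ` V)"
  have "D \<in> (\<lambda>u. degree (B u)) ` V" unfolding D_def using V by (intro Max_in) auto
  then obtain w where w: "w \<in> V" "degree (B w) = D" by auto
  have wU: "w \<in> U" using w by (simp add: V_def)
  have "p dvd (\<Sum>u\<in>U. c u * coeff (B u) D)"
    using dvd by (simp add: const_poly_dvd_iff coeff_sum)
  also have "(\<Sum>u\<in>U. c u * coeff (B u) D) = c w * coeff (B w) D + (\<Sum>u\<in>U - {w}. c u * coeff (B u) D)"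
    using assms(2) wU by (simp add: sum.remove)
  finally have "p dvd c w * coeff (B w) D + (\<Sum>u\<in>U - {w}. c u * coeff (B u) D)" .
  moreover have "p dvd (\<Sum>u\<in>U - {w}. c u * coeff (B u) D)"
  proof (rule dvd_sum)
    fix u assume u: "u \<in> U - {w}"
    show "p dvd c u * coeff (B u) D"
    proof (cases "p dvd c u")
      case False
      then have "u \<in> V" using u by (simp add: V_def)
      then have "degree (B u) \<le> D" unfolding D_def using V by (intro Max_ge) auto
      moreover have "degree (B u) \<noteq> D"
        using assms(3) u wU w(2) by (auto dest: inj_onD)
      ultimately show ?thesis by (simp add: coeff_eq_0)
    qed simp
  qed
  ultimately have "p dvd c w * coeff (B w) D" by (simp add: dvd_add_left_iff)
  moreover have "\<not> p dvd c w" using w by (simp add: V_def)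
  moreover have "\<not> p dvd coeff (B w) D" using assms(4)[OF wU] w by simp
  ultimately show False using assms(1) prime_dvd_mult_iff by blast
qed

section \<open>Stepanov's bound for cubic character sums\<close>

lemma higher_pderiv_sum_smult:
  "(pderiv ^^ i) (\<Sum>u\<in>U. smult (c u) (B u)) = (\<Sum>u\<in>U. smult (c u) ((pderiv ^^ i) (B u)))"
  for B :: "'u \<Rightarrow> int poly"
proof (induction U rule: infinite_finite_induct)
  case (insert u U)
  then show ?case by (simp add: higher_pderiv_add higher_pderiv_smult)
qed simp_all

lemma power_prime_cong_self:
  fixes x :: int
  assumes "prime p"
  shows "[x ^ p = x] (mod int p)"
proof -
  define y where "y = nat (x mod int p)"
  have p0: "p > 0" using assms prime_gt_0_nat by blast
  have y: "int y = x mod int p" using p0 by (simp add: y_def)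
  have "[y ^ p = y] (mod p)"
  proof (cases "p dvd y")
    case True
    then have "p dvd y ^ p" using p0 by (simp add: dvd_power_le[of p y 1 p, simplified])
    with True show ?thesis by (simp add: cong_def dvd_eq_mod_eq_0)
  next
    case False
    then have "[y ^ (p - 1) * y = 1 * y] (mod p)"
      using assms by (intro cong_scalar_right fermat_theorem)
    moreover have "y ^ (p - 1) * y = y ^ p" using p0 by (cases p) auto
    ultimately show ?thesis by simp
  qed
  then have "[int y ^ p = int y] (mod int p)"
    by (metis cong_int_iff of_nat_power)
  moreover have "[x = int y] (mod int p)" by (simp add: y cong_def)
  ultimately show ?thesis
    by (meson cong_pow cong_sym cong_trans)
qed

text \<open>
  Stepanov's construction. Consider \<open>R = g^l \<Sum> c(b,j,k) g^(b n) X^k X^(j p)\<close>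
  with \<open>b \<in> {0,1}\<close>, \<open>j < J\<close>, \<open>k < M\<close>. At a point where
  \<open>g^n\<close> is \<open>a\<close>, and where \<open>x^p\<close> is \<open>x\<close>, each
  derivative of order \<open>i < l\<close> agrees modulo \<open>p\<close> with a multiple of a
  polynomial of degree below \<open>M + J + 2 l\<close>, linear in the unknowns \<open>c\<close>.
  Requiring all these polynomials to vanish gives fewer equations than unknowns, so some nonzero
  \<open>R\<close> vanishes to order \<open>l\<close> at every such point, and the degree of
  \<open>R\<close> bounds their number.
\<close>

lemma stepanov_point_count:
  fixes p J l :: nat and g :: "int poly" and a :: int
  defines "n \<equiv> (p - 1) div 2" and "M \<equiv> (p - 3) div 2"
  assumes p: "prime p" "p \<ge> 5" and g: "degree g = 3" "\<not> int p dvd lead_coeff g"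
    and l: "l * (M + J + 2 * l) < 2 * M * J" "l \<le> p"
  shows "l * card {x \<in> {0..<int p}. [poly g x ^ n = a] (mod int p)} \<le> 3 * l + (J + 1) * p"
proof -
  define S where "S = {x \<in> {0..<int p}. [poly g x ^ n = a] (mod int p)}"
  have ip: "prime (int p)" using p by simp
  have "odd p" using p prime_odd_nat[of p] by auto
  then have pM: "p = 2 * M + 3" using p(2) by (auto simp: M_def elim!: oddE)
  have nM: "n = M + 1" unfolding n_def using pM by simp
  define ex where "ex = (\<lambda>b. if b then n else 0)"
  define B :: "bool \<times> nat \<times> nat \<Rightarrow> int poly" where
    "B = (\<lambda>(b, j, k). g ^ ex b * monom 1 k * monom 1 (j * p))"
  define C :: "nat \<Rightarrow> bool \<times> nat \<times> nat \<Rightarrow> int poly" where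
    "C = (\<lambda>i (b, j, k). smult (if b then a else 1)
       (monom 1 j * pow_deriv_cofactor g (int (l + ex b)) i (monom 1 k)))"
  define U where "U = (UNIV :: bool set) \<times> {..<J} \<times> {..<M}"
  define E where "E = {..<l} \<times> {..<M + J + 2 * l}"
  have g0: "g \<noteq> 0" using g by auto
  have fin: "finite U" "finite E" by (auto simp: U_def E_def)
  have "card E < card U" using l(1) by (simp add: U_def E_def card_cartesian_product mult.commute)
  then obtain c where c: "\<exists>u\<in>U. \<not> int p dvd c u"
    and cE: "\<And>e. e \<in> E \<Longrightarrow> int p dvd (\<Sum>u\<in>U. c u * coeff (C (fst e) u) (snd e))"
    using homogeneous_congruences_solvable[of p U E "\<lambda>e u. coeff (C (fst e) u) (snd e)"] fin p(2)
    by auto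
  have degB: "degree (B (b, j, k)) = 3 * ex b + k + j * p" for b j k
    using g0 g(1) by (simp add: B_def degree_mult_eq degree_power_eq degree_monom_eq)
  have lcB: "\<not> int p dvd lead_coeff (B u)" for u
  proof -
    obtain b j k where u: "u = (b, j, k)" by (cases u)
    have "lead_coeff (B u) = lead_coeff g ^ ex b * lead_coeff (monom 1 k) * lead_coeff (monom 1 (j * p))"
      by (simp only: u B_def lead_coeff_mult lead_coeff_power prod.case)
    then have "lead_coeff (B u) = lead_coeff g ^ ex b" by (simp add: degree_monom_eq)
    then show ?thesis using g(2) prime_dvd_power[OF ip] by auto
  qed
  have inj: "inj_on (\<lambda>u. degree (B u)) U"
  proof (rule inj_onI)
    fix u v assume u: "u \<in> U" "v \<in> U" and eq: "degree (B u) = degree (B v)"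
    obtain b j k where ubjk: "u = (b, j, k)" by (cases u)
    obtain b' j' k' where v: "v = (b', j', k')" by (cases v)
    define r where "r = (\<lambda>b k. (if b then M else 0) + k)"
    define t where "t = (\<lambda>b j. j + (if b then 1 else 0 :: nat))"
    (* Here 3 n = M + p, so the degrees 3 n b + k + j p are written with remainder M b + k and
       quotient j + b modulo p; this separates the two values of b. *)
    have d: "degree (B (b, j, k)) = r b k + p * t b j" for b j k
      unfolding degB r_def t_def ex_def using nM pM by (simp add: algebra_simps)
    have kk: "k < M" "k' < M" using u by (auto simp: U_def ubjk v)
    then have rp: "r b k < p" "r b' k' < p" using pM by (auto simp: r_def)
    have eq': "r b k + p * t b j = r b' k' + p * t b' j'" using eq by (simp add: d ubjk v)
    then have "(r b k + p * t b j) mod p = (r b' k' + p * t b' j') mod p" by simp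
    then have r: "r b k = r b' k'" using rp by simp
    then have "t b j = t b' j'" using eq' p(2) by simp
    moreover from r kk have "b = b' \<and> k = k'" by (auto simp: r_def split: if_splits)
    ultimately show "u = v" by (auto simp: ubjk v t_def)
  qed
  define R where "R = g ^ l * (\<Sum>u\<in>U. smult (c u) (B u))"
  have "\<not> [:int p:] dvd R"
  proof
    assume "[:int p:] dvd R"
    moreover have pe: "prime_elem [:int p:]"
      using ip by (simp add: prime_elem_const_poly_iff)
    ultimately have "[:int p:] dvd g ^ l \<or> [:int p:] dvd (\<Sum>u\<in>U. smult (c u) (B u))"
      unfolding R_def using prime_elem_dvd_mult_iff by blast
    moreover have "\<not> [:int p:] dvd g" using g(2) by (auto simp: const_poly_dvd_iff)
    then have "\<not> [:int p:] dvd g ^ l" using pe prime_elem_dvd_power by blast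
    moreover have "\<not> [:int p:] dvd (\<Sum>u\<in>U. smult (c u) (B u))"
      by (rule distinct_degrees_not_dvd[OF ip fin(1) inj lcB c])
    ultimately show False by blast
  qed
  moreover have "int p dvd poly ((pderiv ^^ i) R) x" if x: "x \<in> S" and i: "i < l" for x i
  proof -
    define G where "G = poly g x"
    have R: "R = (\<Sum>u\<in>U. smult (c u) (g ^ l * B u))"
      by (simp add: R_def sum_distrib_left)
    have each: "[poly ((pderiv ^^ i) (g ^ l * B u)) x = G ^ (l - i) * poly (C i u) x] (mod int p)" for u
    proof -
      obtain b j k where u: "u = (b, j, k)" by (cases u)
      define w where "w = poly (pow_deriv_cofactor g (int (l + ex b)) i (monom 1 k)) x"
      have "g ^ l * B u = g ^ (l + ex b) * monom 1 k * monom 1 (j * p)"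
        by (simp add: u B_def power_add mult_ac)
      then have "int p dvd poly ((pderiv ^^ i) (g ^ l * B u) -
          g ^ (l + ex b - i) * pow_deriv_cofactor g (int (l + ex b)) i (monom 1 k) * monom 1 (j * p)) x"
        using i by (intro const_dvd_poly) (simp only:, rule higher_pderiv_pow_mult_cong, simp)
      then have "[poly ((pderiv ^^ i) (g ^ l * B u)) x = G ^ (l + ex b - i) * w * x ^ (j * p)] (mod int p)"
        by (simp add: cong_iff_dvd_diff G_def w_def poly_monom)
      also have "l + ex b - i = (l - i) + ex b" using i by simp
      also have "[G ^ (l - i + ex b) * w * x ^ (j * p) =
          G ^ (l - i) * (if b then a else 1) * w * x ^ j] (mod int p)"
        unfolding power_add
      proof (intro cong_mult cong_refl)
        show "[G ^ ex b = (if b then a else 1)] (mod int p)"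
          using x by (auto simp: ex_def S_def G_def)
        have "[(x ^ p) ^ j = x ^ j] (mod int p)" by (intro cong_pow power_prime_cong_self p)
        then show "[x ^ (j * p) = x ^ j] (mod int p)" by (simp only: mult.commute[of j p] power_mult)
      qed
      also have "G ^ (l - i) * (if b then a else 1) * w * x ^ j = G ^ (l - i) * poly (C i u) x"
        by (simp add: C_def u w_def poly_monom)
      finally show ?thesis .
    qed
    have "[poly ((pderiv ^^ i) R) x = (\<Sum>u\<in>U. c u * (G ^ (l - i) * poly (C i u) x))] (mod int p)"
      unfolding R higher_pderiv_sum_smult poly_sum poly_smult
      by (intro cong_sum cong_mult cong_refl each)
    also have "(\<Sum>u\<in>U. c u * (G ^ (l - i) * poly (C i u) x)) =
        G ^ (l - i) * poly (\<Sum>u\<in>U. smult (c u) (C i u)) x"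
      by (simp add: poly_sum sum_distrib_left mult_ac)
    also have "[\<dots> = 0] (mod int p)"
    proof -
      have "int p dvd coeff (\<Sum>u\<in>U. smult (c u) (C i u)) v" for v
      proof (cases "v < M + J + 2 * l")
        case True
        then show ?thesis using cE[of "(i, v)"] i by (simp add: E_def coeff_sum)
      next
        case False
        have "coeff (C i u) v = 0" if u: "u \<in> U" for u
        proof -
          obtain b j k where ub: "u = (b, j, k)" by (cases u)
          have "degree (pow_deriv_cofactor g (int (l + ex b)) i (monom 1 k)) \<le> k + 2 * i"
            using degree_pow_deriv_cofactor_le[of g "int (l + ex b)" i "monom 1 k"] g(1)
            by (simp add: degree_monom_eq)
          then have "degree (C i u) \<le> j + (k + 2 * i)"
            unfolding C_def ub
            using degree_mult_le[of "monom 1 j" "pow_deriv_cofactor g (int (l + ex b)) i (monom 1 k)"]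
            by (auto simp: degree_monom_eq intro!: order_trans[OF degree_smult_le])
          also have "\<dots> < v" using u False i by (simp add: U_def ub)
          finally show ?thesis by (rule coeff_eq_0)
        qed
        then show ?thesis by (simp add: coeff_sum)
      qed
      then have "[:int p:] dvd (\<Sum>u\<in>U. smult (c u) (C i u))" by (simp add: const_poly_dvd_iff)
      then have "int p dvd poly (\<Sum>u\<in>U. smult (c u) (C i u)) x" by (rule const_dvd_poly)
      then show ?thesis by (simp add: cong_0_iff)
    qed
    finally show ?thesis by (simp add: cong_0_iff)
  qed
  moreover have "finite S"
    by (rule rev_finite_subset[of "{0..<int p}"]) (auto simp: S_def)
  moreover have "\<not> int p dvd x - y" if "x \<in> S" "y \<in> S" "x \<noteq> y" for x y
  proof
    assume "int p dvd x - y"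
    then have "x mod int p = y mod int p" by (simp add: mod_eq_dvd_iff)
    with that show False by (simp add: S_def)
  qed
  ultimately have "(\<Sum>x\<in>S. l) \<le> degree R"
    using l(2) by (intro sum_root_orders_mod_prime_le_degree[OF ip]) simp_all
  moreover have "degree R \<le> 3 * l + (J + 1) * p"
  proof -
    have "degree (\<Sum>u\<in>U. smult (c u) (B u)) \<le> (J + 1) * p"
    proof (rule degree_sum_le[OF fin(1)])
      fix u assume u: "u \<in> U"
      obtain b j k where ub: "u = (b, j, k)" by (cases u)
      have jk: "j < J" "k < M" using u by (auto simp: U_def ub)
      then have "(j + 1) * p \<le> J * p" by (intro mult_right_mono) auto
      moreover have "3 * ex b + k \<le> 2 * p" using jk nM pM by (auto simp: ex_def)
      ultimately have "degree (B u) \<le> (J + 1) * p"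
        unfolding ub degB by (simp add: algebra_simps)
      then show "degree (smult (c u) (B u)) \<le> (J + 1) * p"
        using degree_smult_le order_trans by blast
    qed
    moreover have "degree (g ^ l) = 3 * l" using g0 g(1) by (simp add: degree_power_eq)
    ultimately show ?thesis
      using degree_mult_le[of "g ^ l" "\<Sum>u\<in>U. smult (c u) (B u)"] unfolding R_def by linarith
  qed
  ultimately show ?thesis by (simp add: S_def mult.commute)
qed

text \<open>
  With \<open>l\<close> about \<open>sqrt p\<close>, the smallest admissible \<open>J\<close> is
  about \<open>l/2\<close>, and the bound \<open>(J + 1) p / l\<close> is \<open>p/2\<close> up to
  \<open>O(sqrt p)\<close>.
\<close>

lemma stepanov_half:
  fixes p :: nat and g :: "int poly" and a :: int
  assumes p: "prime p" "p \<ge> 37" and g: "degree g = 3" "\<not> int p dvd lead_coeff g"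
  shows "real (card {x \<in> {0..<int p}. [poly g x ^ ((p - 1) div 2) = a] (mod int p)})
    \<le> real p / 2 + 7 * sqrt (real p)"
proof -
  define M where "M = (p - 3) div 2"
  define l where "l = nat \<lfloor>sqrt (real p)\<rfloor>"
  define J where "J = l div 2 + 4"
  define N where "N = card {x \<in> {0..<int p}. [poly g x ^ ((p - 1) div 2) = a] (mod int p)}"
  have s6: "sqrt (real p) \<ge> 6" using p(2) by (intro real_le_rsqrt) auto
  have ls: "real l \<le> sqrt (real p)" "sqrt (real p) < real l + 1"
    using s6 by (auto simp: l_def)
  have l6: "l \<ge> 6" using s6 by (simp add: l_def le_nat_floor)
  have "real (l * l) \<le> sqrt (real p) * sqrt (real p)"
    unfolding of_nat_mult using ls by (intro mult_mono) auto
  then have "real (l * l) \<le> real p" by simp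
  then have llp: "l * l \<le> p" by (simp only: of_nat_le_iff)
  have "odd p" using p prime_odd_nat[of p] by auto
  then have pM: "p = 2 * M + 3" using p(2) by (auto simp: M_def elim!: oddE)
  have l8: "8 * l + 22 \<le> 2 * (l * l)"
  proof -
    obtain k where "l = 6 + k" using l6 le_Suc_ex by blast
    then show ?thesis by (simp add: algebra_simps)
  qed
  have "2 * (l * (M + J + 2 * l)) < 2 * (2 * M * J)"
  proof -
    have J2: "2 * J \<le> l + 8" "l + 7 \<le> 2 * J" by (auto simp: J_def)
    have "2 * (l * (M + J + 2 * l)) = 2 * M * l + l * (2 * J) + 4 * (l * l)"
      by (simp add: algebra_simps)
    also have "\<dots> \<le> 2 * M * l + l * (l + 8) + 4 * (l * l)"
      using J2(1) by (intro add_mono mult_left_mono) auto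
    also have "\<dots> = 2 * M * l + (5 * (l * l) + 8 * l)" by (simp add: algebra_simps)
    also have "\<dots> < 2 * M * l + 14 * M" using llp l8 pM by linarith
    also have "\<dots> = 2 * M * (l + 7)" by (simp add: algebra_simps)
    also have "\<dots> \<le> 2 * M * (2 * J)" using J2(2) by (intro mult_left_mono) auto
    finally show ?thesis by (simp only: mult_ac)
  qed
  then have "l * (M + J + 2 * l) < 2 * M * J"
    by (rule nat_mult_less_cancel1[OF zero_less_numeral, THEN iffD1])
  moreover have "l \<le> p" using llp l6 by (metis le_square order_trans)
  ultimately have "l * N \<le> 3 * l + (J + 1) * p"
    using stepanov_point_count[OF p(1) _ g, of l J a] p(2) unfolding N_def M_def by simp
  then have "real l * real N \<le> 3 * real l + (real J + 1) * real p"
    using of_nat_mono[where 'a = real, OF \<open>l * N \<le> 3 * l + (J + 1) * p\<close>]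
    by (simp add: algebra_simps)
  also have "\<dots> \<le> 3 * real l + (real l / 2 + 5) * real p"
  proof -
    have "2 * J \<le> l + 8" by (simp add: J_def)
    then have "real J + 1 \<le> real l / 2 + 5" by linarith
    then have "(real J + 1) * real p \<le> (real l / 2 + 5) * real p" by (rule mult_right_mono) simp
    then show ?thesis by simp
  qed
  finally have "real l * real N \<le> 3 * real l + (real l / 2 + 5) * real p" .
  then have 1: "real N \<le> 3 + real p / 2 + 5 * (real p / real l)"
    using l6 by (simp add: field_simps)
  have "5 * sqrt (real p) \<le> 6 * real l" using ls s6 by linarith
  then have le: "sqrt (real p) * (5 * sqrt (real p)) \<le> sqrt (real p) * (6 * real l)"
    by (intro mult_left_mono) auto
  have "5 * real p = 5 * (sqrt (real p) * sqrt (real p))" by simp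
  also have "\<dots> = sqrt (real p) * (5 * sqrt (real p))" by (simp only: mult_ac)
  also note le
  also have "sqrt (real p) * (6 * real l) = 6 * sqrt (real p) * real l" by (simp only: mult_ac)
  finally have "5 * real p \<le> 6 * sqrt (real p) * real l" .
  then have "5 * (real p / real l) \<le> 6 * sqrt (real p)" using l6 by (simp add: field_simps)
  with 1 s6 show ?thesis unfolding N_def by linarith
qed

text \<open>
  By Euler's criterion the Legendre symbol is the power with exponent \<open>(p-1)/2\<close>. The
  upper bounds for the values \<open>1\<close> and \<open>-1\<close>, together with the at most
  three roots, also bound the two classes from below; small primes are covered by the trivial
  bound.
\<close>

theorem cubic_Legendre_sum_bound:
  fixes p :: nat and g :: "int poly"
  assumes p: "prime p" "p > 2" and g: "degree g = 3" "\<not> int p dvd lead_coeff g"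
  shows "\<bar>\<Sum>x\<in>{0..<int p}. real_of_int (Legendre (poly g x) (int p))\<bar> \<le> 15 * sqrt (real p)"
proof -
  define I where "I = {0..<int p}"
  define L where "L = (\<lambda>x. Legendre (poly g x) (int p))"
  have L3: "L x \<in> {-1, 0, 1}" for x by (auto simp: L_def Legendre_def)
  define N where "N = (\<lambda>v. {x \<in> I. L x = v})"
  have fin: "finite I" "finite (N v)" for v
  proof -
    show "finite I" by (simp add: I_def)
    then show "finite (N v)" by (rule rev_finite_subset) (auto simp: N_def)
  qed
  have Iun: "I = N (-1) \<union> N 0 \<union> N 1" using L3 by (auto simp: N_def)
  have "card I = card (N (-1) \<union> N 0) + card (N 1)"
    unfolding Iun by (intro card_Un_disjoint) (auto simp: fin, auto simp: N_def)
  also have "card (N (-1) \<union> N 0) = card (N (-1)) + card (N 0)"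
    by (intro card_Un_disjoint) (auto simp: fin, auto simp: N_def)
  finally have cards: "real p = real (card (N (-1))) + real (card (N 0)) + real (card (N 1))"
    by (simp add: I_def)
  have "(\<Sum>x\<in>I. real_of_int (L x)) = (\<Sum>x\<in>I. of_bool (L x = 1) - of_bool (L x = -1))"
    using L3 by (intro sum.cong refl) force
  also have "\<dots> = real (card (N 1)) - real (card (N (-1)))"
    by (simp add: sum_subtractf N_def fin(1) flip: sum.inter_filter)
       (simp add: of_bool_def sum.If_cases fin Int_def)
  finally have S: "(\<Sum>x\<in>I. real_of_int (L x)) = real (card (N 1)) - real (card (N (-1)))" .
  show ?thesis
  proof (cases "p \<ge> 37")
    case True
    have s6: "sqrt (real p) \<ge> 6" using True by (intro real_le_rsqrt) auto
    have "card (N v) \<le> card {x \<in> I. [poly g x ^ ((p - 1) div 2) = v] (mod int p)}" for v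
    proof (intro card_mono subsetI)
      fix x assume "x \<in> N v"
      then have x: "x \<in> I" "L x = v" by (auto simp: N_def)
      have "[L x = poly g x ^ ((p - 1) div 2)] (mod int p)"
        unfolding L_def by (rule euler_criterion[OF p(1)]) (use p(2) in simp)
      with x show "x \<in> {x \<in> I. [poly g x ^ ((p - 1) div 2) = v] (mod int p)}"
        by (auto intro: cong_sym)
    qed (simp add: fin)
    then have N: "real (card (N v)) \<le> real p / 2 + 7 * sqrt (real p)" for v
      using stepanov_half[OF p(1) True g, of v] unfolding I_def
      by (meson of_nat_le_iff order_trans)
    have N0: "card (N 0) \<le> 3"
    proof -
      have "(\<Sum>x\<in>N 0. 1) \<le> degree g"
      proof (rule sum_root_orders_mod_prime_le_degree[of "int p"])
        show "\<not> int p dvd x - y" if "x \<in> N 0" "y \<in> N 0" "x \<noteq> y" for x y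
        proof
          assume "int p dvd x - y"
          then have "x mod int p = y mod int p" by (simp add: mod_eq_dvd_iff)
          with that show False by (simp add: N_def I_def)
        qed
        show "\<not> [:int p:] dvd g" using g(2) by (auto simp: const_poly_dvd_iff)
        show "int p dvd poly ((pderiv ^^ i) g) x" if "x \<in> N 0" "i < 1" for x i
          using that by (auto simp: N_def L_def Legendre_def cong_0_iff split: if_splits)
      qed (use p fin in auto)
      then show ?thesis using g(1) by simp
    qed
    have "real (card (N 0)) \<le> 3" using N0 by simp
    then have "\<bar>real (card (N 1)) - real (card (N (-1)))\<bar> \<le> 15 * sqrt (real p)"
      using N[of 1] N[of "-1"] cards s6 by linarith
    then show ?thesis using S unfolding I_def L_def by simp
  next
    case False
    have "\<bar>real (card (N 1)) - real (card (N (-1)))\<bar> \<le> real p" using cards by linarith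
    also have "\<dots> = sqrt (real p) * sqrt (real p)" by simp
    also have "\<dots> \<le> 15 * sqrt (real p)"
      using False by (intro mult_right_mono real_le_lsqrt) auto
    finally show ?thesis using S unfolding I_def L_def by simp
  qed
qed

section \<open>Additive characters and the quadratic character\<close>

definition add_char :: "nat \<Rightarrow> int \<Rightarrow> complex" where
  "add_char q x = exp (2 * pi * \<i> * of_int x / of_nat q)"

lemma add_char_add: "add_char q (x + y) = add_char q x * add_char q y"
  by (simp add: add_char_def exp_add[symmetric] add_divide_distrib algebra_simps)

lemma add_char_0 [simp]: "add_char q 0 = 1"
  by (simp add: add_char_def)

lemma add_char_eq_1_iff:
  assumes "q > 0"
  shows "add_char q x = 1 \<longleftrightarrow> int q dvd x"
proof -
  have eq: "add_char q x = exp (\<i> * of_real (2 * pi * of_int x / of_nat q))"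
    by (simp add: add_char_def mult_ac)
  have "add_char q x = 1 \<longleftrightarrow> (\<exists>n::int. 2 * pi * of_int x / of_nat q = of_int (2 * n) * pi)"
    unfolding eq exp_eq_1 by simp
  also have "\<dots> \<longleftrightarrow> (\<exists>n::int. real_of_int x = real_of_int (n * int q))"
    using assms by (intro ex_cong1) (auto simp: field_simps)
  also have "\<dots> \<longleftrightarrow> int q dvd x"
    unfolding of_int_eq_iff by (auto simp: dvd_def mult.commute)
  finally show ?thesis .
qed

lemma add_char_cong:
  assumes "q > 0" "[x = y] (mod int q)"
  shows "add_char q x = add_char q y"
proof -
  have "int q dvd x - y" using assms(2) by (simp add: cong_iff_dvd_diff)
  then have "add_char q (x - y) = 1" using add_char_eq_1_iff[OF assms(1)] by blast
  then show ?thesis using add_char_add[of q "x - y" y] by simp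
qed

lemma of_bool_dvd_cong: "[a = b] (mod m) \<Longrightarrow> of_bool (m dvd a) = of_bool (m dvd b)"
  for m :: int
  using cong_dvd_iff by auto

lemma sum_residues_affine:
  fixes F :: "int \<Rightarrow> 'a::comm_monoid_add" and m :: nat
  assumes "m > 0" "coprime u (int m)"
    and F: "\<And>x y. [x = y] (mod int m) \<Longrightarrow> F x = F y"
  shows "(\<Sum>x\<in>{0..<int m}. F (u * x + v)) = (\<Sum>x\<in>{0..<int m}. F x)"
proof -
  have "(\<Sum>x\<in>{0..<int m}. F (u * x + v)) = (\<Sum>x\<in>{0..<int m}. F ((u * x + v) mod int m))"
    by (intro sum.cong refl F) (simp add: cong_def)
  also have "\<dots> = (\<Sum>x\<in>(\<lambda>x. (u * x + v) mod int m) ` {0..<int m}. F x)"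
  proof (subst sum.reindex)
    show "inj_on (\<lambda>x. (u * x + v) mod int m) {0..<int m}"
    proof (rule inj_onI)
      fix x y assume xy: "x \<in> {0..<int m}" "y \<in> {0..<int m}"
        and eq: "(u * x + v) mod int m = (u * y + v) mod int m"
      then have "[u * x + v = u * y + v] (mod int m)" by (simp add: cong_def)
      then have "[u * x = u * y] (mod int m)" by (simp add: cong_add_rcancel)
      then have "[x = y] (mod int m)" using assms(2) by (simp add: cong_mult_lcancel)
      with xy show "x = y" by (simp add: cong_def)
    qed
  qed simp
  also have "(\<lambda>x. (u * x + v) mod int m) ` {0..<int m} = {0..<int m}"
  proof (rule endo_inj_surj)
    show "(\<lambda>x. (u * x + v) mod int m) ` {0..<int m} \<subseteq> {0..<int m}"
      using assms(1) by auto
    show "inj_on (\<lambda>x. (u * x + v) mod int m) {0..<int m}"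
    proof (rule inj_onI)
      fix x y assume xy: "x \<in> {0..<int m}" "y \<in> {0..<int m}"
        and eq: "(u * x + v) mod int m = (u * y + v) mod int m"
      then have "[u * x + v = u * y + v] (mod int m)" by (simp add: cong_def)
      then have "[u * x = u * y] (mod int m)" by (simp add: cong_add_rcancel)
      then have "[x = y] (mod int m)" using assms(2) by (simp add: cong_mult_lcancel)
      with xy show "x = y" by (simp add: cong_def)
    qed
  qed simp
  finally show ?thesis .
qed

lemma sum_residues_delta:
  fixes F :: "int \<Rightarrow> 'a::comm_monoid_add" and m :: nat
  assumes "m > 0" and F: "\<And>x y. [x = y] (mod int m) \<Longrightarrow> F x = F y"
  shows "(\<Sum>x\<in>{0..<int m}. if [x = a] (mod int m) then F x else 0) = F a"
proof -
  have "(\<Sum>x\<in>{0..<int m}. if [x = a] (mod int m) then F x else 0) =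
      (\<Sum>x\<in>{0..<int m}. if x = a mod int m then F a else 0)"
    by (intro sum.cong refl) (auto simp: cong_def intro: F)
  also have "\<dots> = F a" using assms(1) by simp
  finally show ?thesis .
qed

lemma sum_add_char:
  assumes "q > 0"
  shows "(\<Sum>x\<in>{0..<int q}. add_char q (x * a)) = (if int q dvd a then of_nat q else 0)"
proof (cases "int q dvd a")
  case True
  then have "add_char q (x * a) = 1" for x
    using add_char_eq_1_iff[OF assms] by simp
  then show ?thesis using True by simp
next
  case False
  define S where "S = (\<Sum>x\<in>{0..<int q}. add_char q (x * a))"
  have "add_char q a * S = (\<Sum>x\<in>{0..<int q}. add_char q ((1 * x + 1) * a))"
    unfolding S_def sum_distrib_left
  proof (intro sum.cong refl)
    fix x
    have "(1 * x + 1) * a = a + x * a" by (simp add: algebra_simps)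
    then show "add_char q a * add_char q (x * a) = add_char q ((1 * x + 1) * a)"
      by (simp only: add_char_add)
  qed
  also have "\<dots> = S"
    unfolding S_def using assms
    by (intro sum_residues_affine[where F = "\<lambda>x. add_char q (x * a)"])
       (auto intro: add_char_cong cong_scalar_right)
  finally have "(add_char q a - 1) * S = 0" by (simp add: algebra_simps)
  moreover have "add_char q a \<noteq> 1" using False add_char_eq_1_iff[OF assms] by blast
  ultimately show ?thesis using False by (simp add: S_def)
qed

text \<open>
  Characteristics 2 and 3 are excluded because the roots of a quartic form are analysed by
  completing fourth powers and cubes, and because the pairing has denominators 4 and 6.
\<close>

locale prime_gt_3 =
  fixes p :: nat
  assumes prime_p: "prime p" and p_gt_3: "p > 3"
begin

abbreviation "Fp \<equiv> {0..<int p}"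

definition chi :: "int \<Rightarrow> int" where "chi x = Legendre x (int p)"

lemma p_pos: "p > 0" using p_gt_3 by simp

lemma p_ge_5: "p \<ge> 5"
proof (rule ccontr)
  assume "\<not> ?thesis"
  with p_gt_3 have "p = 2 * 2" by simp
  with prime_p show False using prime_product[of 2 2] by simp
qed

lemma prime_int_p: "prime (int p)" using prime_p by simp

lemma dvd_mult_p: "int p dvd a * b \<longleftrightarrow> int p dvd a \<or> int p dvd b"
  using prime_int_p prime_dvd_mult_iff by blast

lemma dvd_power_p: "n > 0 \<Longrightarrow> int p dvd a ^ n \<longleftrightarrow> int p dvd a"
  using prime_int_p prime_dvd_power_iff by blast

lemma not_dvd_2: "\<not> int p dvd 2" and not_dvd_3: "\<not> int p dvd 3" and not_dvd_1: "\<not> int p dvd 1"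
  using p_gt_3 by (auto dest: zdvd_imp_le)

lemma not_dvd_4: "\<not> int p dvd 4" and not_dvd_16: "\<not> int p dvd 16" and not_dvd_8: "\<not> int p dvd 8"
  and not_dvd_9: "\<not> int p dvd 9" and not_dvd_6: "\<not> int p dvd 6" and not_dvd_12: "\<not> int p dvd 12"
  and not_dvd_27: "\<not> int p dvd 27" and not_dvd_432: "\<not> int p dvd 432" and not_dvd_32: "\<not> int p dvd 32"
  using dvd_power_p[of 2 2] dvd_power_p[of 4 2] dvd_power_p[of 3 2] dvd_power_p[of 2 3] dvd_power_p[of 3 3]
    dvd_power_p[of 5 2] dvd_mult_p[of 16 27] dvd_mult_p[of 2 3] dvd_mult_p[of 4 3] not_dvd_2 not_dvd_3
  by simp_all

lemma coprime_p: "\<not> int p dvd u \<Longrightarrow> coprime u (int p)"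
  using prime_int_p prime_imp_coprime coprime_commute by blast

lemma ex_inverse:
  assumes "\<not> int p dvd u"
  obtains t where "int p dvd u * t - v"
proof -
  obtain w where "[u * w = 1] (mod int p)"
    using cong_solve_coprime_int[OF coprime_p[OF assms]] by blast
  then have "[u * w * v = 1 * v] (mod int p)" by (rule cong_scalar_right)
  then show ?thesis using that[of "w * v"] by (simp add: cong_iff_dvd_diff mult_ac)
qed

lemma chi_cong: "[x = y] (mod int p) \<Longrightarrow> chi x = chi y"
  unfolding chi_def Legendre_def QuadRes_def by (auto dest: cong_trans cong_sym)

lemma chi_range: "chi x \<in> {-1, 0, 1}"
  by (auto simp: chi_def Legendre_def)

lemma abs_chi_le: "\<bar>chi x\<bar> \<le> 1"
  using chi_range[of x] by auto

lemma chi_eq_0_iff: "chi x = 0 \<longleftrightarrow> int p dvd x"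
  by (simp add: chi_def Legendre_def cong_0_iff)

lemma chi_mult: "chi (x * y) = chi x * chi y"
proof -
  have eu: "[chi z = z ^ ((p - 1) div 2)] (mod int p)" for z
    unfolding chi_def using prime_p p_gt_3 by (intro euler_criterion) auto
  have "[chi (x * y) = chi x * chi y] (mod int p)"
    using eu[of "x * y"] cong_mult[OF eu[of x] eu[of y]]
    by (metis cong_sym cong_trans power_mult_distrib)
  then have d: "int p dvd chi (x * y) - chi x * chi y" by (simp add: cong_iff_dvd_diff)
  have "\<bar>chi (x * y) - chi x * chi y\<bar> \<le> 2"
    using chi_range[of x] chi_range[of y] chi_range[of "x * y"] by auto
  moreover have "\<bar>chi (x * y) - chi x * chi y\<bar> \<ge> int p" if "chi (x * y) - chi x * chi y \<noteq> 0"
    using zdvd_imp_le[of "int p" "\<bar>chi (x * y) - chi x * chi y\<bar>"] d that by simp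
  ultimately show ?thesis using p_gt_3 by force
qed

lemma chi_square: "chi (x ^ 2) = of_bool (\<not> int p dvd x)"
  using chi_mult[of x x] chi_range[of x] chi_eq_0_iff[of x] by (auto simp: power2_eq_square)

lemma chi_4: "chi 4 = 1"
  using chi_square[of 2] not_dvd_2 by simp

lemma sum_linear_indicator:
  assumes "\<not> int p dvd u"
  shows "(\<Sum>x\<in>Fp. of_bool (int p dvd u * x + v) :: int) = 1"
proof -
  have "(\<Sum>x\<in>Fp. of_bool (int p dvd u * x + v) :: int) = (\<Sum>x\<in>Fp. of_bool (int p dvd x))"
    using assms p_pos
    by (intro sum_residues_affine[where F = "\<lambda>x. of_bool (int p dvd x)"] coprime_p)
       (auto simp: cong_dvd_iff)
  also have "\<dots> = (\<Sum>x\<in>Fp. if [x = 0] (mod int p) then 1 else 0)"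
    by (intro sum.cong refl) (simp add: cong_0_iff)
  also have "\<dots> = 1" using sum_residues_delta[OF p_pos, of "\<lambda>_. 1 :: int" 0] by simp
  finally show ?thesis .
qed

lemma sum_square_indicator:
  "(\<Sum>y\<in>Fp. of_bool (int p dvd y ^ 2 - a)) = 1 + chi a"
proof (cases "int p dvd a")
  case True
  have "int p dvd y ^ 2 - a \<longleftrightarrow> int p dvd 1 * y + 0" for y
    using True dvd_power_p[of 2 y] by (simp add: dvd_diff_left_iff)
  then have "(\<Sum>y\<in>Fp. of_bool (int p dvd y ^ 2 - a)) = (\<Sum>y\<in>Fp. of_bool (int p dvd 1 * y + 0) :: int)"
    by (simp only:)
  also have "\<dots> = 1" by (rule sum_linear_indicator) (rule not_dvd_1)
  finally show ?thesis using True chi_eq_0_iff by simp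
next
  case nz: False
  show ?thesis
  proof (cases "\<exists>z. int p dvd z ^ 2 - a")
    case True
    then obtain z where z: "int p dvd z ^ 2 - a" by blast
    have "\<not> int p dvd z"
      using z nz dvd_power_p[of 2 z] by (metis dvd_diff_commute dvd_diff_left_iff zero_less_numeral dvd_diffD)
    then have z2: "\<not> int p dvd 2 * z" using dvd_mult_p not_dvd_2 by blast
    have "of_bool (int p dvd y ^ 2 - a) = of_bool (int p dvd 1 * y + z) + (of_bool (int p dvd 1 * y + (- z)) :: int)" for y
    proof -
      have "y ^ 2 - a = (y + z) * (y - z) + (z ^ 2 - a)" by (simp add: algebra_simps power2_eq_square)
      then have "int p dvd y ^ 2 - a \<longleftrightarrow> int p dvd y + z \<or> int p dvd y - z"
        using z dvd_mult_p by (metis dvd_add_left_iff)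
      moreover have "\<not> (int p dvd y + z \<and> int p dvd y - z)"
        using z2 dvd_diff[of "int p" "y + z" "y - z"] by auto
      ultimately show ?thesis by auto
    qed
    then have "(\<Sum>y\<in>Fp. of_bool (int p dvd y ^ 2 - a)) = (2 :: int)"
      using sum_linear_indicator[OF not_dvd_1, of z] sum_linear_indicator[OF not_dvd_1, of "- z"]
      by (simp only: sum.distrib)
    moreover have "chi a = 1"
    proof -
      have "chi a = chi (z ^ 2)" using z by (intro chi_cong) (simp add: cong_iff_dvd_diff dvd_diff_commute)
      then show ?thesis using \<open>\<not> int p dvd z\<close> by (simp add: chi_square)
    qed
    ultimately show ?thesis by simp
  next
    case False
    then have "chi a = -1"
      using nz by (simp add: chi_def Legendre_def QuadRes_def cong_0_iff cong_iff_dvd_diff)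
    with False show ?thesis by simp
  qed
qed

lemma sum_chi: "(\<Sum>x\<in>Fp. chi x) = 0"
proof -
  have "(\<Sum>a\<in>Fp. 1 + chi a) = (\<Sum>a\<in>Fp. \<Sum>y\<in>Fp. of_bool (int p dvd y ^ 2 - a))"
    by (simp only: sum_square_indicator)
  also have "\<dots> = (\<Sum>y\<in>Fp. \<Sum>a\<in>Fp. of_bool (int p dvd - 1 * a + y ^ 2))"
    by (subst sum.swap) simp
  also have "\<dots> = int p"
    by (subst sum_linear_indicator) (use not_dvd_1 in auto)
  finally show ?thesis by (simp add: sum.distrib)
qed

lemma sum_chi_linear:
  assumes "\<not> int p dvd u"
  shows "(\<Sum>x\<in>Fp. chi (u * x + v)) = 0"
  using sum_residues_affine[OF p_pos coprime_p[OF assms], of chi v] chi_cong sum_chi by simp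

lemma quadratic_root_count:
  assumes "\<not> int p dvd u"
  shows "(\<Sum>x\<in>Fp. of_bool (int p dvd u * x ^ 2 + v * x + w)) = 1 + chi (v ^ 2 - 4 * u * w)"
proof -
  have u2: "\<not> int p dvd 2 * u" "\<not> int p dvd 4 * u"
    using assms dvd_mult_p not_dvd_2 not_dvd_4 by blast+
  have "int p dvd u * x ^ 2 + v * x + w \<longleftrightarrow> int p dvd (2 * u * x + v) ^ 2 - (v ^ 2 - 4 * u * w)" for x
  proof -
    have "(2 * u * x + v) ^ 2 - (v ^ 2 - 4 * u * w) = (4 * u) * (u * x ^ 2 + v * x + w)"
      by (simp add: algebra_simps power2_eq_square)
    then show ?thesis using u2 dvd_mult_p by metis
  qed
  then have "(\<Sum>x\<in>Fp. of_bool (int p dvd u * x ^ 2 + v * x + w)) =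
      (\<Sum>x\<in>Fp. of_bool (int p dvd (2 * u * x + v) ^ 2 - (v ^ 2 - 4 * u * w)) :: int)"
    by (simp only:)
  also have "\<dots> = (\<Sum>y\<in>Fp. of_bool (int p dvd y ^ 2 - (v ^ 2 - 4 * u * w)))"
    by (intro sum_residues_affine[where F = "\<lambda>y. of_bool (int p dvd y ^ 2 - (v ^ 2 - 4 * u * w))"]
          p_pos coprime_p u2(1) of_bool_dvd_cong cong_diff cong_pow cong_refl)
  also have "\<dots> = 1 + chi (v ^ 2 - 4 * u * w)" by (rule sum_square_indicator)
  finally show ?thesis .
qed

lemma sum_chi_square_minus: "(\<Sum>y\<in>Fp. chi (y ^ 2 - D)) = int p * of_bool (int p dvd D) - 1"
proof (cases "int p dvd D")
  case True
  have "chi (y ^ 2 - D) = 1 - of_bool (int p dvd 1 * y + 0)" for y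
  proof -
    have "chi (y ^ 2 - D) = chi (y ^ 2)"
      using True by (intro chi_cong) (simp add: cong_iff_dvd_diff)
    then show ?thesis by (simp add: chi_square)
  qed
  then have "(\<Sum>y\<in>Fp. chi (y ^ 2 - D)) = int p - (\<Sum>y\<in>Fp. of_bool (int p dvd 1 * y + 0))"
    by (simp only: sum_subtractf) simp
  also have "\<dots> = int p - 1" using sum_linear_indicator[OF not_dvd_1, of 0] by (simp only:)
  finally show ?thesis using True by simp
next
  case False
  have "(\<Sum>y\<in>Fp. 1 + chi (y ^ 2 - D)) = (\<Sum>y\<in>Fp. \<Sum>z\<in>Fp. of_bool (int p dvd z ^ 2 - (y ^ 2 - D)))"
    by (simp only: sum_square_indicator)
  also have "\<dots> = (\<Sum>z\<in>Fp. \<Sum>y\<in>Fp. of_bool (int p dvd z ^ 2 - (y ^ 2 - D)))" by (rule sum.swap)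
  also have "\<dots> = (\<Sum>z\<in>Fp. \<Sum>s\<in>Fp. of_bool (int p dvd z ^ 2 - ((1 * s + z) ^ 2 - D)))"
  proof (rule sum.cong[OF refl])
    fix z
    show "(\<Sum>y\<in>Fp. of_bool (int p dvd z ^ 2 - (y ^ 2 - D))) =
        (\<Sum>s\<in>Fp. of_bool (int p dvd z ^ 2 - ((1 * s + z) ^ 2 - D)) :: int)"
      by (rule sum_residues_affine[symmetric, where F = "\<lambda>y. of_bool (int p dvd z ^ 2 - (y ^ 2 - D))"])
         (rule p_pos, simp, intro of_bool_dvd_cong cong_diff cong_pow cong_refl)
  qed
  also have "\<dots> = (\<Sum>s\<in>Fp. \<Sum>z\<in>Fp. of_bool (int p dvd (- 2 * s) * z + (D - s ^ 2)))"
    by (subst sum.swap) (simp add: algebra_simps power2_eq_square)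
  also have "\<dots> = (\<Sum>s\<in>Fp. 1 - of_bool (int p dvd 1 * s + 0))"
  proof (intro sum.cong refl)
    fix s
    show "(\<Sum>z\<in>Fp. of_bool (int p dvd (- 2 * s) * z + (D - s ^ 2))) = (1 :: int) - of_bool (int p dvd 1 * s + 0)"
    proof (cases "int p dvd s")
      case True
      then have "\<not> int p dvd (- 2 * s) * z + (D - s ^ 2)" for z
        using False by (simp add: dvd_diff_left_iff dvd_add_right_iff power2_eq_square)
      then show ?thesis using True by simp
    next
      case s: False
      then have "\<not> int p dvd - 2 * s" using dvd_mult_p[of 2 s] not_dvd_2 by simp
      then show ?thesis using s by (subst sum_linear_indicator) auto
    qed
  qed
  also have "\<dots> = int p - 1"
    using sum_linear_indicator[OF not_dvd_1, of 0] by (simp only: sum_subtractf) simp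
  finally show ?thesis using False by (simp add: sum.distrib)
qed

lemma sum_chi_quadratic:
  assumes "\<not> int p dvd u"
  shows "(\<Sum>x\<in>Fp. chi (u * x ^ 2 + v * x + w)) =
    chi u * (int p * of_bool (int p dvd v ^ 2 - 4 * u * w) - 1)"
proof -
  have u2: "\<not> int p dvd 2 * u" using assms dvd_mult_p not_dvd_2 by blast
  have uu: "chi u * chi u = 1" using chi_range[of u] chi_eq_0_iff[of u] assms by auto
  have "chi (u * x ^ 2 + v * x + w) = chi u * chi ((2 * u * x + v) ^ 2 - (v ^ 2 - 4 * u * w))" for x
  proof -
    have "(2 * u * x + v) ^ 2 - (v ^ 2 - 4 * u * w) = 4 * (u * (u * x ^ 2 + v * x + w))"
      by (simp add: algebra_simps power2_eq_square)
    then have "chi ((2 * u * x + v) ^ 2 - (v ^ 2 - 4 * u * w)) = chi u * chi (u * x ^ 2 + v * x + w)"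
      by (simp only: chi_mult chi_4 mult_1)
    then show ?thesis using uu by (simp flip: mult.assoc)
  qed
  then have "(\<Sum>x\<in>Fp. chi (u * x ^ 2 + v * x + w)) =
      chi u * (\<Sum>x\<in>Fp. chi ((2 * u * x + v) ^ 2 - (v ^ 2 - 4 * u * w)))"
    by (simp only: sum_distrib_left)
  also have "(\<Sum>x\<in>Fp. chi ((2 * u * x + v) ^ 2 - (v ^ 2 - 4 * u * w))) = (\<Sum>y\<in>Fp. chi (y ^ 2 - (v ^ 2 - 4 * u * w)))"
    by (intro sum_residues_affine[where F = "\<lambda>y. chi (y ^ 2 - (v ^ 2 - 4 * u * w))"] p_pos coprime_p u2)
       (auto intro!: chi_cong cong_diff cong_pow)
  finally show ?thesis by (simp only: sum_chi_square_minus)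
qed

end

section \<open>Character sums over the dual conic\<close>

text \<open>
  The value of the linear form \<open>F\<close> at the square of \<open>\<alpha> x^2 + \<beta> x y
  + \<gamma> y^2\<close>. As a quadratic form in \<open>(\<alpha>, \<beta>, \<gamma>)\<close> its
  matrix is the Hankel matrix of \<open>F\<close>.
\<close>

definition dual_conic :: "int quartic_form \<Rightarrow> int \<Rightarrow> int \<Rightarrow> int \<Rightarrow> int" where
  "dual_conic F \<alpha> \<beta> \<gamma> = qc0 F * \<alpha> ^ 2 + 2 * qc1 F * \<alpha> * \<beta> + qc2 F * (\<beta> ^ 2 + 2 * \<alpha> * \<gamma>)
     + 2 * qc3 F * \<beta> * \<gamma> + qc4 F * \<gamma> ^ 2"

text \<open>
  The invariants \<open>I\<close> and \<open>J\<close>, and the leading coefficient of the sextic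
  covariant, of the quartic with coefficients \<open>F0, 4 F1, 6 F2, 4 F3, F4\<close>, up to
  constant factors supported at 2 and 3.
\<close>

definition apolar_I :: "int quartic_form \<Rightarrow> int" where
  "apolar_I F = qc0 F * qc4 F - 4 * qc1 F * qc3 F + 3 * qc2 F ^ 2"

definition apolar_J :: "int quartic_form \<Rightarrow> int" where
  "apolar_J F = qc0 F * qc2 F * qc4 F + 2 * qc1 F * qc2 F * qc3 F - qc0 F * qc3 F ^ 2
     - qc1 F ^ 2 * qc4 F - qc2 F ^ 3"

definition apolar_R :: "int quartic_form \<Rightarrow> int" where
  "apolar_R F = 2 * qc1 F ^ 3 + qc0 F ^ 2 * qc3 F - 3 * qc0 F * qc1 F * qc2 F"

text \<open>
  Up to a constant factor, the determinant of the ternary quadratic form \<open>disc Q + t [Q^2,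
  F]\<close> in the coefficients of \<open>Q\<close>.
\<close>

definition resolvent_cubic :: "int quartic_form \<Rightarrow> int poly" where
  "resolvent_cubic F = [:4, 0, - apolar_I F, - apolar_J F:]"

context prime_gt_3
begin

lemma sum_dvd_indicator: "(\<Sum>x\<in>Fp. of_bool (int p dvd x)) = (1 :: int)"
  using sum_linear_indicator[OF not_dvd_1, of 0] by (simp only: mult_1 add_0_right)

lemma sum_not_dvd_indicator: "(\<Sum>x\<in>Fp. of_bool (\<not> int p dvd x)) = int p - 1"
proof -
  have "of_bool (\<not> int p dvd x) = (1 :: int) - of_bool (int p dvd x)" for x by simp
  then have "(\<Sum>x\<in>Fp. of_bool (\<not> int p dvd x)) = (\<Sum>x\<in>Fp. 1 - of_bool (int p dvd x) :: int)"
    by (simp only:)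
  then show ?thesis by (simp only: sum_subtractf sum_dvd_indicator) simp
qed

text \<open>
  A nonzero binary quadratic form has as many zeros on the projective line as its discriminant has
  square roots.
\<close>

lemma binary_form_zero_count:
  assumes "\<not> (int p dvd B0 \<and> int p dvd B1 \<and> int p dvd B2)"
  shows "(\<Sum>x\<in>Fp. \<Sum>y\<in>Fp. of_bool (int p dvd B0 * x ^ 2 + 2 * B1 * x * y + B2 * y ^ 2)) =
    int p + (int p - 1) * chi (B1 ^ 2 - B0 * B2)"
proof (cases "int p dvd B0")
  case False
  have "(\<Sum>x\<in>Fp. of_bool (int p dvd B0 * x ^ 2 + 2 * B1 * x * y + B2 * y ^ 2)) =
      1 + of_bool (\<not> int p dvd y) * chi (B1 ^ 2 - B0 * B2)" for y
  proof -
    have "B0 * x ^ 2 + 2 * B1 * x * y + B2 * y ^ 2 = B0 * x ^ 2 + (2 * B1 * y) * x + B2 * y ^ 2" for x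
      by simp
    then have "(\<Sum>x\<in>Fp. of_bool (int p dvd B0 * x ^ 2 + 2 * B1 * x * y + B2 * y ^ 2)) =
        1 + chi ((2 * B1 * y) ^ 2 - 4 * B0 * (B2 * y ^ 2))"
      using quadratic_root_count[OF False] by (simp only:)
    moreover have "(2 * B1 * y) ^ 2 - 4 * B0 * (B2 * y ^ 2) = 4 * (y ^ 2 * (B1 ^ 2 - B0 * B2))"
      by (simp add: algebra_simps power2_eq_square)
    ultimately show ?thesis by (simp only: chi_mult chi_4 chi_square mult_1)
  qed
  then show ?thesis
    by (subst sum.swap) (simp only: sum.distrib sum_distrib_right[symmetric] sum_not_dvd_indicator, simp)
next
  case B0: True
  define e where "e = (of_bool (\<not> int p dvd B1) :: int)"
  have "(\<Sum>x\<in>Fp. of_bool (int p dvd B0 * x ^ 2 + 2 * B1 * x * y + B2 * y ^ 2)) =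
      int p * of_bool (int p dvd y) + e * of_bool (\<not> int p dvd y)" for y
  proof -
    have iff: "int p dvd B0 * x ^ 2 + 2 * B1 * x * y + B2 * y ^ 2 \<longleftrightarrow>
        int p dvd y \<or> int p dvd (2 * B1) * x + B2 * y" for x
    proof -
      have eq: "B0 * x ^ 2 + 2 * B1 * x * y + B2 * y ^ 2 = B0 * x ^ 2 + y * ((2 * B1) * x + B2 * y)"
        by (simp add: algebra_simps power2_eq_square)
      have d: "int p dvd B0 * x ^ 2" using B0 by simp
      show ?thesis by (simp only: eq dvd_add_right_iff[OF d] dvd_mult_p)
    qed
    show ?thesis
    proof (cases "int p dvd y")
      case True
      then show ?thesis by (simp add: iff)
    next
      case y: False
      have "(\<Sum>x\<in>Fp. of_bool (int p dvd (2 * B1) * x + B2 * y)) = e"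
      proof (cases "int p dvd B1")
        case True
        then have "\<not> int p dvd B2 * y" using assms B0 y dvd_mult_p by blast
        then have "\<not> int p dvd (2 * B1) * x + B2 * y" for x
          using True by (simp add: dvd_add_right_iff)
        then show ?thesis using True by (simp add: e_def)
      next
        case False
        then have "\<not> int p dvd 2 * B1" using dvd_mult_p not_dvd_2 by blast
        then show ?thesis using False by (subst sum_linear_indicator) (auto simp: e_def)
      qed
      then show ?thesis using y by (simp add: iff)
    qed
  qed
  then have "(\<Sum>x\<in>Fp. \<Sum>y\<in>Fp. of_bool (int p dvd B0 * x ^ 2 + 2 * B1 * x * y + B2 * y ^ 2)) =
      int p + e * (int p - 1)"
    by (subst sum.swap)
       (simp only: sum.distrib sum_distrib_left[symmetric] sum_not_dvd_indicator sum_dvd_indicator mult_1_right)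
  moreover have "chi (B1 ^ 2 - B0 * B2) = chi (B1 ^ 2)"
    using B0 by (intro chi_cong) (simp add: cong_iff_dvd_diff)
  ultimately show ?thesis by (simp add: chi_square e_def)
qed

lemma sum_chi_discriminant:
  "(\<Sum>\<alpha>\<in>Fp. \<Sum>\<beta>\<in>Fp. \<Sum>\<gamma>\<in>Fp. chi (\<beta> ^ 2 - 4 * \<alpha> * \<gamma>)) = int p * (int p - 1)"
proof -
  have inner: "(\<Sum>\<beta>\<in>Fp. chi (\<beta> ^ 2 - 4 * \<alpha> * \<gamma>)) =
      int p * of_bool (int p dvd \<alpha> * \<gamma>) - 1" for \<alpha> \<gamma>
    using sum_chi_square_minus[of "4 * \<alpha> * \<gamma>"] dvd_mult_p not_dvd_4 by (simp add: mult.assoc)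
  have two: "(\<Sum>\<gamma>\<in>Fp. of_bool (int p dvd \<alpha> * \<gamma>)) =
      (int p - 1) * of_bool (int p dvd \<alpha>) + 1" for \<alpha>
  proof (cases "int p dvd \<alpha>")
    case True
    then show ?thesis by simp
  next
    case False
    then have "int p dvd \<alpha> * \<gamma> \<longleftrightarrow> int p dvd \<gamma>" for \<gamma> using dvd_mult_p by blast
    then have "(\<Sum>\<gamma>\<in>Fp. of_bool (int p dvd \<alpha> * \<gamma>)) = (\<Sum>\<gamma>\<in>Fp. of_bool (int p dvd \<gamma>) :: int)"
      by (simp only:)
    then show ?thesis using False sum_dvd_indicator by simp
  qed
  have "(\<Sum>\<alpha>\<in>Fp. \<Sum>\<beta>\<in>Fp. \<Sum>\<gamma>\<in>Fp. chi (\<beta> ^ 2 - 4 * \<alpha> * \<gamma>)) =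
      (\<Sum>\<alpha>\<in>Fp. \<Sum>\<gamma>\<in>Fp. \<Sum>\<beta>\<in>Fp. chi (\<beta> ^ 2 - 4 * \<alpha> * \<gamma>))"
    by (rule sum.cong[OF refl], rule sum.swap)
  also have "\<dots> = (\<Sum>\<alpha>\<in>Fp. int p * ((int p - 1) * of_bool (int p dvd \<alpha>) + 1) - int p)"
    by (simp only: inner sum_subtractf sum_distrib_left[symmetric] two) simp
  also have "\<dots> = int p * (int p - 1)"
    by (simp only: sum_subtractf sum_distrib_left[symmetric] sum.distrib sum_dvd_indicator)
       (simp add: algebra_simps)
  finally show ?thesis .
qed

text \<open>
  For fixed \<open>\<beta>\<close> and \<open>\<gamma>\<close> the sum over
  \<open>\<alpha>\<close> is a quadratic character sum, which depends only on whether its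
  discriminant vanishes. That discriminant is a binary quadratic form in \<open>(\<beta>,
  \<gamma>)\<close>, whose own discriminant is the product of the resolvent cubic at
  \<open>t\<close> with the coefficient \<open>t F0\<close> of \<open>\<alpha>^2\<close>. The
  hypothesis on \<open>apolar_R F\<close> keeps this binary form from vanishing identically.
\<close>

lemma sum_chi_pencil_member:
  assumes t: "\<not> int p dvd t" and F0: "\<not> int p dvd qc0 F" and R: "\<not> int p dvd apolar_R F"
  shows "(\<Sum>\<alpha>\<in>Fp. \<Sum>\<beta>\<in>Fp. \<Sum>\<gamma>\<in>Fp. chi (\<beta> ^ 2 - 4 * \<alpha> * \<gamma> + t * dual_conic F \<alpha> \<beta> \<gamma>)) =
    int p * (int p - 1) * chi (poly (resolvent_cubic F) t)"
proof -
  obtain a b c d e where F: "F = Quartic a b c d e" by (cases F)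
  (* u is the coefficient of alpha^2, and B0, B1, B2 are the coefficients of a quarter of the
     discriminant in alpha. *)
  define u where "u = t * a"
  define B0 where "B0 = t ^ 2 * b ^ 2 - t * a * (1 + t * c)"
  define B1 where "B1 = t * b * (t * c - 2) - t ^ 2 * a * d"
  define B2 where "B2 = (t * c - 2) ^ 2 - t ^ 2 * a * e"
  have u: "\<not> int p dvd u" using t F0 dvd_mult_p by (auto simp: F u_def)
  have nz: "\<not> (int p dvd B0 \<and> int p dvd B1 \<and> int p dvd B2)"
  proof
    assume "int p dvd B0 \<and> int p dvd B1 \<and> int p dvd B2"
    then have d: "int p dvd B0" "int p dvd B1" by auto
    have "t ^ 2 * apolar_R F = 2 * b * B0 - a * B1"
      by (simp add: F apolar_R_def B0_def B1_def algebra_simps power2_eq_square power3_eq_cube)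
    then have "int p dvd t ^ 2 * apolar_R F" using d by simp
    then show False using t R dvd_mult_p dvd_power_p[of 2 t] by auto
  qed
  have poly: "poly (resolvent_cubic F) t * (t * a) = B1 ^ 2 - B0 * B2"
    by (simp add: resolvent_cubic_def apolar_I_def apolar_J_def F B0_def B1_def B2_def
          algebra_simps power2_eq_square power3_eq_cube)
  have inner: "(\<Sum>\<alpha>\<in>Fp. chi (\<beta> ^ 2 - 4 * \<alpha> * \<gamma> + t * dual_conic F \<alpha> \<beta> \<gamma>)) =
      chi u * (int p * of_bool (int p dvd B0 * \<beta> ^ 2 + 2 * B1 * \<beta> * \<gamma> + B2 * \<gamma> ^ 2) - 1)" for \<beta> \<gamma>
  proof -
    define v where "v = 2 * t * b * \<beta> + (2 * t * c - 4) * \<gamma>"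
    define w where "w = (1 + t * c) * \<beta> ^ 2 + 2 * t * d * \<beta> * \<gamma> + t * e * \<gamma> ^ 2"
    have "\<beta> ^ 2 - 4 * \<alpha> * \<gamma> + t * dual_conic F \<alpha> \<beta> \<gamma> = u * \<alpha> ^ 2 + v * \<alpha> + w" for \<alpha>
      by (simp add: F dual_conic_def u_def v_def w_def algebra_simps power2_eq_square)
    then have "(\<Sum>\<alpha>\<in>Fp. chi (\<beta> ^ 2 - 4 * \<alpha> * \<gamma> + t * dual_conic F \<alpha> \<beta> \<gamma>)) =
        chi u * (int p * of_bool (int p dvd v ^ 2 - 4 * u * w) - 1)"
      using sum_chi_quadratic[OF u] by (simp only:)
    moreover have "v ^ 2 - 4 * u * w = 4 * (B0 * \<beta> ^ 2 + 2 * B1 * \<beta> * \<gamma> + B2 * \<gamma> ^ 2)"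
      by (simp add: u_def v_def w_def B0_def B1_def B2_def algebra_simps power2_eq_square)
    ultimately show ?thesis by (simp only: dvd_mult_p not_dvd_4 simp_thms)
  qed
  have "(\<Sum>\<alpha>\<in>Fp. \<Sum>\<beta>\<in>Fp. \<Sum>\<gamma>\<in>Fp. chi (\<beta> ^ 2 - 4 * \<alpha> * \<gamma> + t * dual_conic F \<alpha> \<beta> \<gamma>)) =
      (\<Sum>\<beta>\<in>Fp. \<Sum>\<gamma>\<in>Fp. \<Sum>\<alpha>\<in>Fp. chi (\<beta> ^ 2 - 4 * \<alpha> * \<gamma> + t * dual_conic F \<alpha> \<beta> \<gamma>))"
    by (subst sum.swap, rule sum.cong[OF refl], rule sum.swap)
  also have "\<dots> = chi u * (int p * (int p + (int p - 1) * chi (B1 ^ 2 - B0 * B2)) - int p * int p)"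
    by (simp only: inner sum_distrib_left[symmetric] sum_subtractf binary_form_zero_count[OF nz]) simp
  also have "\<dots> = int p * (int p - 1) * (chi u * chi (B1 ^ 2 - B0 * B2))"
    by (simp add: algebra_simps)
  also have "chi u * chi (B1 ^ 2 - B0 * B2) = chi (poly (resolvent_cubic F) t) * chi (u ^ 2)"
    by (simp only: poly[symmetric], simp only: chi_mult u_def power2_eq_square mult_ac)
  also have "chi (u ^ 2) = 1" using u by (simp add: chi_square)
  finally show ?thesis by simp
qed

definition conic_sum :: "int quartic_form \<Rightarrow> int" where
  "conic_sum F = (\<Sum>\<alpha>\<in>Fp. \<Sum>\<beta>\<in>Fp. \<Sum>\<gamma>\<in>Fp.
     if int p dvd dual_conic F \<alpha> \<beta> \<gamma> then chi (\<beta> ^ 2 - 4 * \<alpha> * \<gamma>) else 0)"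

text \<open>
  The inner sum of \<open>\<chi>(D + t A)\<close> over \<open>t\<close> vanishes unless \<open>A =
  0\<close>, so summing \<open>\<chi>\<close> over all members of the pencil detects the conic.
\<close>

lemma conic_sum_eq_resolvent_sum:
  assumes F0: "\<not> int p dvd qc0 F" and R: "\<not> int p dvd apolar_R F"
  shows "conic_sum F = (int p - 1) * (\<Sum>t\<in>Fp. chi (poly (resolvent_cubic F) t))"
proof -
  have pencil: "(\<Sum>t\<in>Fp. chi (D + t * A)) = int p * (if int p dvd A then chi D else 0)" for D A
  proof (cases "int p dvd A")
    case True
    then have "chi (D + t * A) = chi D" for t
      by (intro chi_cong) (simp add: cong_iff_dvd_diff)
    then show ?thesis using True by simp
  next
    case False
    then show ?thesis using sum_chi_linear[OF False, of D] by (simp add: add.commute mult.commute)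
  qed
  define G where "G = (\<lambda>\<alpha> \<beta> \<gamma> t. chi (\<beta> ^ 2 - 4 * \<alpha> * \<gamma> + t * dual_conic F \<alpha> \<beta> \<gamma>))"
  have all_t: "(\<Sum>\<alpha>\<in>Fp. \<Sum>\<beta>\<in>Fp. \<Sum>\<gamma>\<in>Fp. G \<alpha> \<beta> \<gamma> t) =
      int p * (int p - 1) * chi (poly (resolvent_cubic F) t)" for t
  proof (cases "int p dvd t")
    case True
    have "G \<alpha> \<beta> \<gamma> t = chi (\<beta> ^ 2 - 4 * \<alpha> * \<gamma>)" for \<alpha> \<beta> \<gamma>
      unfolding G_def using True by (intro chi_cong) (simp add: cong_iff_dvd_diff)
    moreover have "chi (poly (resolvent_cubic F) t) = 1"
    proof -
      have "chi (poly (resolvent_cubic F) t) = chi 4"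
        using True by (intro chi_cong) (simp add: cong_iff_dvd_diff resolvent_cubic_def)
      then show ?thesis by (simp add: chi_4)
    qed
    ultimately show ?thesis using sum_chi_discriminant by simp
  next
    case False
    then show ?thesis unfolding G_def by (rule sum_chi_pencil_member[OF _ F0 R])
  qed
  have "int p * conic_sum F = (\<Sum>\<alpha>\<in>Fp. \<Sum>\<beta>\<in>Fp. \<Sum>\<gamma>\<in>Fp. \<Sum>t\<in>Fp. G \<alpha> \<beta> \<gamma> t)"
    unfolding conic_sum_def sum_distrib_left G_def pencil ..
  also have "\<dots> = (\<Sum>\<alpha>\<in>Fp. \<Sum>\<beta>\<in>Fp. \<Sum>t\<in>Fp. \<Sum>\<gamma>\<in>Fp. G \<alpha> \<beta> \<gamma> t)"
    by (rule sum.cong[OF refl], rule sum.cong[OF refl], rule sum.swap)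
  also have "\<dots> = (\<Sum>\<alpha>\<in>Fp. \<Sum>t\<in>Fp. \<Sum>\<beta>\<in>Fp. \<Sum>\<gamma>\<in>Fp. G \<alpha> \<beta> \<gamma> t)"
    by (rule sum.cong[OF refl], rule sum.swap)
  also have "\<dots> = (\<Sum>t\<in>Fp. \<Sum>\<alpha>\<in>Fp. \<Sum>\<beta>\<in>Fp. \<Sum>\<gamma>\<in>Fp. G \<alpha> \<beta> \<gamma> t)"
    by (rule sum.swap)
  also have "\<dots> = int p * ((int p - 1) * (\<Sum>t\<in>Fp. chi (poly (resolvent_cubic F) t)))"
    by (simp only: all_t sum_distrib_left mult.assoc)
  finally show ?thesis using p_pos by simp
qed

text \<open>
  If \<open>p\<close> does not divide \<open>apolar_J F\<close>, the resolvent is a genuine cubic,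
  and the square-root bound applies.
\<close>

lemma conic_sum_generic_bound:
  assumes "\<not> int p dvd qc0 F" "\<not> int p dvd apolar_R F" "\<not> int p dvd apolar_J F"
  shows "\<bar>real_of_int (conic_sum F)\<bar> \<le> 15 * (real p - 1) * sqrt (real p)"
proof -
  have J: "apolar_J F \<noteq> 0" using assms(3) by auto
  have "degree (resolvent_cubic F) = 3" "lead_coeff (resolvent_cubic F) = - apolar_J F"
    using J by (simp_all add: resolvent_cubic_def)
  then have "\<bar>\<Sum>t\<in>Fp. real_of_int (chi (poly (resolvent_cubic F) t))\<bar> \<le> 15 * sqrt (real p)"
    unfolding chi_def using prime_p p_gt_3 assms(3) by (intro cubic_Legendre_sum_bound) auto
  then have "(real p - 1) * \<bar>\<Sum>t\<in>Fp. real_of_int (chi (poly (resolvent_cubic F) t))\<bar> \<le>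
      (real p - 1) * (15 * sqrt (real p))"
    using p_gt_3 by (intro mult_left_mono) auto
  then show ?thesis
    using p_gt_3 by (simp add: conic_sum_eq_resolvent_sum[OF assms(1,2)] abs_mult mult_ac)
qed

lemma abs_conic_sum_le: "\<bar>conic_sum F\<bar> \<le>
    (\<Sum>\<alpha>\<in>Fp. \<Sum>\<beta>\<in>Fp. \<Sum>\<gamma>\<in>Fp. of_bool (int p dvd dual_conic F \<alpha> \<beta> \<gamma>))"
  unfolding conic_sum_def
  by (intro order_trans[OF sum_abs] sum_mono) (auto intro: abs_chi_le)

lemma conic_sum_trivial_bound: "\<bar>conic_sum F\<bar> \<le> int p ^ 3"
proof -
  have "\<bar>conic_sum F\<bar> \<le> (\<Sum>\<alpha>\<in>Fp. \<Sum>\<beta>\<in>Fp. \<Sum>\<gamma>\<in>Fp. 1)"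
    by (intro order_trans[OF abs_conic_sum_le] sum_mono) auto
  then show ?thesis by (simp add: power3_eq_cube mult.assoc)
qed

lemma quadratic_root_count_le:
  assumes "\<not> (int p dvd u \<and> int p dvd v \<and> int p dvd w)"
  shows "(\<Sum>x\<in>Fp. of_bool (int p dvd u * x ^ 2 + v * x + w)) \<le> (2 :: int)"
proof (cases "int p dvd u")
  case False
  then show ?thesis using quadratic_root_count[OF False, of v w] chi_range[of "v ^ 2 - 4 * u * w"] by auto
next
  case True
  then have "int p dvd u * x ^ 2 + v * x + w \<longleftrightarrow> int p dvd v * x + w" for x
    by (simp add: dvd_add_right_iff add.assoc)
  then have eq: "(\<Sum>x\<in>Fp. of_bool (int p dvd u * x ^ 2 + v * x + w)) = (\<Sum>x\<in>Fp. of_bool (int p dvd v * x + w) :: int)"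
    by (simp only:)
  show ?thesis
  proof (cases "int p dvd v")
    case False
    then show ?thesis using eq sum_linear_indicator[OF False, of w] by simp
  next
    case v: True
    then have "\<not> int p dvd v * x + w" for x using True assms by (simp add: dvd_add_right_iff)
    then show ?thesis using eq by simp
  qed
qed

lemma dual_conic_point_count:
  assumes "\<not> (int p dvd qc0 F \<and> int p dvd qc1 F \<and> int p dvd qc2 F \<and> int p dvd qc3 F \<and> int p dvd qc4 F)"
  shows "(\<Sum>\<alpha>\<in>Fp. \<Sum>\<beta>\<in>Fp. \<Sum>\<gamma>\<in>Fp. of_bool (int p dvd dual_conic F \<alpha> \<beta> \<gamma>)) \<le> 2 * int p ^ 2"
proof -
  obtain a b c d e where F: "F = Quartic a b c d e" by (cases F)
  define Z where "Z = (\<lambda>\<alpha> \<beta> \<gamma>. of_bool (int p dvd dual_conic F \<alpha> \<beta> \<gamma>) :: int)"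
  have two: "(\<Sum>x\<in>Fp. \<Sum>y\<in>Fp. H x y) \<le> 2 * int p ^ 2" if "\<And>x y. H x y \<le> 2" for H :: "int \<Rightarrow> int \<Rightarrow> int"
  proof -
    have "(\<Sum>x\<in>Fp. \<Sum>y\<in>Fp. H x y) \<le> (\<Sum>x\<in>Fp. \<Sum>y\<in>Fp. 2)" by (intro sum_mono that)
    then show ?thesis by (simp add: power2_eq_square)
  qed
  have "(\<Sum>\<alpha>\<in>Fp. \<Sum>\<beta>\<in>Fp. \<Sum>\<gamma>\<in>Fp. Z \<alpha> \<beta> \<gamma>) \<le> 2 * int p ^ 2"
  proof (cases "int p dvd a")
    case False
    have "(\<Sum>\<alpha>\<in>Fp. Z \<alpha> \<beta> \<gamma>) \<le> 2" for \<beta> \<gamma>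
    proof -
      have form: "dual_conic F \<alpha> \<beta> \<gamma> = a * \<alpha> ^ 2 + (2 * b * \<beta> + 2 * c * \<gamma>) * \<alpha>
          + (c * \<beta> ^ 2 + 2 * d * \<beta> * \<gamma> + e * \<gamma> ^ 2)" for \<alpha>
        by (simp add: F dual_conic_def algebra_simps)
      show ?thesis unfolding Z_def form by (rule quadratic_root_count_le) (use False in blast)
    qed
    then have "(\<Sum>\<beta>\<in>Fp. \<Sum>\<gamma>\<in>Fp. \<Sum>\<alpha>\<in>Fp. Z \<alpha> \<beta> \<gamma>) \<le> 2 * int p ^ 2" by (rule two)
    also have "(\<Sum>\<beta>\<in>Fp. \<Sum>\<gamma>\<in>Fp. \<Sum>\<alpha>\<in>Fp. Z \<alpha> \<beta> \<gamma>) = (\<Sum>\<alpha>\<in>Fp. \<Sum>\<beta>\<in>Fp. \<Sum>\<gamma>\<in>Fp. Z \<alpha> \<beta> \<gamma>)"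
      by (subst (2) sum.swap, rule sum.cong[OF refl], rule sum.swap)
    finally show ?thesis .
  next
    case a: True
    show ?thesis
    proof (cases "int p dvd e")
      case False
      have "(\<Sum>\<gamma>\<in>Fp. Z \<alpha> \<beta> \<gamma>) \<le> 2" for \<alpha> \<beta>
      proof -
        have form: "dual_conic F \<alpha> \<beta> \<gamma> = e * \<gamma> ^ 2 + (2 * c * \<alpha> + 2 * d * \<beta>) * \<gamma>
            + (a * \<alpha> ^ 2 + 2 * b * \<alpha> * \<beta> + c * \<beta> ^ 2)" for \<gamma>
          by (simp add: F dual_conic_def algebra_simps)
        show ?thesis unfolding Z_def form by (rule quadratic_root_count_le) (use False in blast)
      qed
      then show ?thesis by (rule two)
    next
      case e: True
      have swap: "(\<Sum>\<alpha>\<in>Fp. \<Sum>\<beta>\<in>Fp. \<Sum>\<gamma>\<in>Fp. Z \<alpha> \<beta> \<gamma>) = (\<Sum>\<alpha>\<in>Fp. \<Sum>\<gamma>\<in>Fp. \<Sum>\<beta>\<in>Fp. Z \<alpha> \<beta> \<gamma>)"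
        by (rule sum.cong[OF refl], rule sum.swap)
      have form: "dual_conic F \<alpha> \<beta> \<gamma> = c * \<beta> ^ 2 + (2 * b * \<alpha> + 2 * d * \<gamma>) * \<beta>
            + (a * \<alpha> ^ 2 + 2 * c * \<alpha> * \<gamma> + e * \<gamma> ^ 2)" for \<alpha> \<beta> \<gamma>
        by (simp add: F dual_conic_def algebra_simps)
      show ?thesis
      proof (cases "int p dvd c")
        case False
        then have "(\<Sum>\<beta>\<in>Fp. Z \<alpha> \<beta> \<gamma>) \<le> 2" for \<alpha> \<gamma>
          unfolding Z_def form by (intro quadratic_root_count_le) blast
        then show ?thesis unfolding swap by (rule two)
      next
        case c: True
        then have bd: "\<not> (int p dvd b \<and> int p dvd d)" using assms a e by (auto simp: F)
        have Zle: "(\<Sum>\<beta>\<in>Fp. Z \<alpha> \<beta> \<gamma>) \<le> 1 + int p * of_bool (int p dvd b * \<alpha> + d * \<gamma>)" for \<alpha> \<gamma>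
        proof (cases "int p dvd b * \<alpha> + d * \<gamma>")
          case True
          have "(\<Sum>\<beta>\<in>Fp. Z \<alpha> \<beta> \<gamma>) \<le> (\<Sum>\<beta>\<in>Fp. 1)" unfolding Z_def by (intro sum_mono) auto
          then show ?thesis using True by simp
        next
          case False
          define v where "v = 2 * b * \<alpha> + 2 * d * \<gamma>"
          have v: "\<not> int p dvd v"
            using False dvd_mult_p[of 2 "b * \<alpha> + d * \<gamma>"] not_dvd_2 by (simp add: v_def algebra_simps)
          have "int p dvd dual_conic F \<alpha> \<beta> \<gamma> \<longleftrightarrow> int p dvd v * \<beta> + 0" for \<beta>
            unfolding form v_def[symmetric] using a c e
            by (simp add: dvd_add_left_iff dvd_add_right_iff)
          then have "(\<Sum>\<beta>\<in>Fp. Z \<alpha> \<beta> \<gamma>) = 1"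
            unfolding Z_def using sum_linear_indicator[OF v, of 0] by (simp only:)
          then show ?thesis by simp
        qed
        have lin: "(\<Sum>\<alpha>\<in>Fp. \<Sum>\<gamma>\<in>Fp. of_bool (int p dvd b * \<alpha> + d * \<gamma>)) = int p"
        proof (cases "int p dvd b")
          case False
          have "(\<Sum>\<alpha>\<in>Fp. \<Sum>\<gamma>\<in>Fp. of_bool (int p dvd b * \<alpha> + d * \<gamma>)) =
              (\<Sum>\<gamma>\<in>Fp. \<Sum>\<alpha>\<in>Fp. of_bool (int p dvd b * \<alpha> + d * \<gamma>) :: int)" by (rule sum.swap)
          then show ?thesis by (simp only: sum_linear_indicator[OF False]) simp
        next
          case True
          then have d: "\<not> int p dvd d" using bd by blast
          have "(\<Sum>\<alpha>\<in>Fp. \<Sum>\<gamma>\<in>Fp. of_bool (int p dvd d * \<gamma> + b * \<alpha>)) = int p"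
            by (simp only: sum_linear_indicator[OF d]) simp
          then show ?thesis by (simp only: add.commute)
        qed
        have "(\<Sum>\<alpha>\<in>Fp. \<Sum>\<gamma>\<in>Fp. \<Sum>\<beta>\<in>Fp. Z \<alpha> \<beta> \<gamma>) \<le>
            (\<Sum>\<alpha>\<in>Fp. \<Sum>\<gamma>\<in>Fp. 1 + int p * of_bool (int p dvd b * \<alpha> + d * \<gamma>))"
          by (intro sum_mono Zle)
        also have "\<dots> = 2 * int p ^ 2"
          by (simp only: sum.distrib sum_distrib_left[symmetric] lin) (simp add: power2_eq_square)
        finally show ?thesis unfolding swap .
      qed
    qed
  qed
  then show ?thesis unfolding Z_def .
qed

end

section \<open>Singular binary quartic forms modulo a prime\<close>

text \<open>
  The form \<open>f(x, y + s x)\<close>: its first coefficient is the value \<open>f(1,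
  s)\<close>, its second the derivative at \<open>s\<close>.
\<close>

fun translate :: "int \<Rightarrow> int quartic_form \<Rightarrow> int quartic_form" where
  "translate s (Quartic a b c d e) =
     Quartic (a + b * s + c * s ^ 2 + d * s ^ 3 + e * s ^ 4)
       (b + 2 * c * s + 3 * d * s ^ 2 + 4 * e * s ^ 3) (c + 3 * d * s + 6 * e * s ^ 2) (d + 4 * e * s) e"

lemma inv_I_translate: "inv_I (translate s f) = inv_I f"
  by (cases f) (simp add: inv_I_def eval_nat_numeral algebra_simps)

lemma inv_J_translate: "inv_J (translate s f) = inv_J f"
  by (cases f) (simp add: inv_J_def eval_nat_numeral algebra_simps)

lemma disc_translate: "disc (translate s f) = disc f"
  by (simp add: disc_def inv_I_translate inv_J_translate)

lemma translate_translate: "translate t (translate s f) = translate (s + t) f"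
  by (cases f) (simp add: eval_nat_numeral algebra_simps)

lemma translate_0: "translate 0 f = f"
  by (cases f) simp

lemma form_cong_refl: "form_cong f f m"
  by (simp add: form_cong_def)

lemma form_cong_sym: "form_cong f g m \<Longrightarrow> form_cong g f m"
  by (auto simp: form_cong_def intro: cong_sym)

lemma form_cong_trans: "form_cong f g m \<Longrightarrow> form_cong g h m \<Longrightarrow> form_cong f h m"
  by (auto simp: form_cong_def intro: cong_trans)

lemma form_cong_translate:
  assumes "form_cong f g m" "[s = t] (mod m)"
  shows "form_cong (translate s f) (translate t g) m"
  using assms
  by (cases f; cases g) (auto simp: form_cong_def intro!: cong_add cong_mult cong_pow)

text \<open>
  The form \<open>k Q^2\<close> for the quadratic form \<open>Q\<close> with coefficients
  \<open>\<alpha>, \<beta>, \<gamma>\<close>.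
\<close>

definition scaled_square :: "int \<Rightarrow> int \<Rightarrow> int \<Rightarrow> int \<Rightarrow> int quartic_form" where
  "scaled_square k \<alpha> \<beta> \<gamma> =
     Quartic (k * \<alpha> ^ 2) (k * (2 * \<alpha> * \<beta>)) (k * (\<beta> ^ 2 + 2 * \<alpha> * \<gamma>)) (k * (2 * \<beta> * \<gamma>)) (k * \<gamma> ^ 2)"

lemma translate_scaled_square:
  "translate s (scaled_square k \<alpha> \<beta> \<gamma>) = scaled_square k (\<alpha> + \<beta> * s + \<gamma> * s ^ 2) (\<beta> + 2 * \<gamma> * s) \<gamma>"
  by (simp add: scaled_square_def eval_nat_numeral algebra_simps)

lemma scaled_square_cong:
  assumes "[k = k'] (mod m)" "[\<alpha> = \<alpha>'] (mod m)" "[\<beta> = \<beta>'] (mod m)" "[\<gamma> = \<gamma>'] (mod m)"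
  shows "form_cong (scaled_square k \<alpha> \<beta> \<gamma>) (scaled_square k' \<alpha>' \<beta>' \<gamma>') m"
  using assms by (auto simp: form_cong_def scaled_square_def intro!: cong_add cong_mult cong_pow)

lemma scaled_square_rescale:
  "scaled_square k (l * \<alpha>) (l * \<beta>) (l * \<gamma>) = scaled_square (k * l ^ 2) \<alpha> \<beta> \<gamma>"
  by (simp add: scaled_square_def power2_eq_square algebra_simps)

lemma disc_scaled_square: "disc (scaled_square k \<alpha> \<beta> \<gamma>) = 0"
  unfolding scaled_square_def disc_expand by (simp add: eval_nat_numeral algebra_simps)

definition form_dvd :: "int \<Rightarrow> int quartic_form \<Rightarrow> bool" where
  "form_dvd m f \<longleftrightarrow> m dvd qc0 f \<and> m dvd qc1 f \<and> m dvd qc2 f \<and> m dvd qc3 f \<and> m dvd qc4 f"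

lemma form_dvd_cong: "form_cong f g m \<Longrightarrow> form_dvd m f \<longleftrightarrow> form_dvd m g"
  by (auto simp: form_cong_def form_dvd_def cong_dvd_iff)

lemma form_dvd_translate: "form_dvd m f \<Longrightarrow> form_dvd m (translate s f)"
  by (cases f) (auto simp: form_dvd_def)

lemma form_dvd_translate_iff: "form_dvd m (translate s f) \<longleftrightarrow> form_dvd m f"
  using form_dvd_translate[of m "translate s f" "- s"] form_dvd_translate[of m f s]
  by (auto simp: translate_translate translate_0)

context prime_gt_3
begin

text \<open>
  After moving \<open>t\<close> to the origin, a double root means that the two lowest
  coefficients vanish; the point at infinity is treated separately.
\<close>

definition double_root :: "int \<Rightarrow> int quartic_form \<Rightarrow> bool" where
  "double_root t h \<longleftrightarrow> int p dvd qc0 (translate t h) \<and> int p dvd qc1 (translate t h)"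

definition double_root_inf :: "int quartic_form \<Rightarrow> bool" where
  "double_root_inf h \<longleftrightarrow> int p dvd qc4 h \<and> int p dvd qc3 h"

definition square_like :: "int quartic_form \<Rightarrow> bool" where
  "square_like h \<longleftrightarrow> (\<exists>k \<alpha> \<beta> \<gamma>. \<not> int p dvd k \<and> form_cong h (scaled_square k \<alpha> \<beta> \<gamma>) (int p))"

lemma double_root_cong:
  assumes "form_cong h h' (int p)" "[s = t] (mod int p)"
  shows "double_root s h \<longleftrightarrow> double_root t h'"
  using form_cong_translate[OF assms] by (auto simp: double_root_def form_cong_def cong_dvd_iff)

lemma double_root_translate: "double_root t (translate s h) \<longleftrightarrow> double_root (s + t) h"
  by (simp add: double_root_def translate_translate)

lemma double_root_inf_cong: "form_cong h h' (int p) \<Longrightarrow> double_root_inf h \<longleftrightarrow> double_root_inf h'"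
  by (auto simp: double_root_inf_def form_cong_def cong_dvd_iff)

lemma double_root_inf_translate: "double_root_inf (translate s h) \<longleftrightarrow> double_root_inf h"
  by (cases h) (auto simp: double_root_inf_def dvd_add_left_iff)

lemma square_like_cong: "form_cong h h' (int p) \<Longrightarrow> square_like h' \<Longrightarrow> square_like h"
  unfolding square_like_def by (meson form_cong_trans)

lemma square_like_translateD:
  assumes "square_like (translate s h)"
  shows "square_like h"
proof -
  obtain k \<alpha> \<beta> \<gamma> where k: "\<not> int p dvd k" and c: "form_cong (translate s h) (scaled_square k \<alpha> \<beta> \<gamma>) (int p)"
    using assms unfolding square_like_def by blast
  from form_cong_translate[OF c cong_refl[of "- s"]]
  show ?thesis using k unfolding square_like_def
    by (auto simp: translate_translate translate_0 translate_scaled_square)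
qed

lemma dvd_cancel: "\<not> int p dvd u \<Longrightarrow> int p dvd u * v \<Longrightarrow> int p dvd v"
  using dvd_mult_p by blast

text \<open>
  The double root of a cubic is a rational function of its coefficients, read off from the
  remainder of the cubic on division by its derivative. A triple root is \<open>-c/(3 d)\<close>.
\<close>

lemma singular_cubic_has_double_root:
  assumes d: "\<not> int p dvd d" and disc: "int p dvd disc (Quartic a b c d 0)"
  shows "\<exists>t. double_root t (Quartic a b c d 0)"
proof -
  define D where "D = - 27 * a ^ 2 * d ^ 2 + 18 * a * b * c * d - 4 * a * c ^ 3 - 4 * b ^ 3 * d + b ^ 2 * c ^ 2"
  have "disc (Quartic a b c d 0) = d ^ 2 * D"
    unfolding disc_expand D_def by (simp add: eval_nat_numeral algebra_simps)
  then have D: "int p dvd D" using disc d dvd_mult_p dvd_power_p[of 2 d] by auto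
  (* Up to a factor, m - 2 w t is the remainder of the cubic on division by its derivative. *)
  define w where "w = c ^ 2 - 3 * b * d"
  define m where "m = 9 * a * d - b * c"
  have d9: "\<not> int p dvd 9 * d" "\<not> int p dvd 3 * d" using d dvd_mult_p not_dvd_9 not_dvd_3 by blast+
  have H: "9 * d * (a + b * t + c * t ^ 2 + d * t ^ 3) =
      (3 * d * t + c) * (b + 2 * c * t + 3 * d * t ^ 2) + (m - 2 * w * t)" for t
    by (simp add: w_def m_def eval_nat_numeral algebra_simps)
  have "\<exists>t. int p dvd b + 2 * c * t + 3 * d * t ^ 2 \<and> int p dvd m - 2 * w * t"
  proof (cases "int p dvd w")
    case False
    then have w2: "\<not> int p dvd 2 * w" "\<not> int p dvd 4 * w ^ 2"
      using dvd_mult_p not_dvd_2 not_dvd_4 dvd_power_p[of 2 w] by auto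
    obtain t where t: "int p dvd (2 * w) * t - m" using ex_inverse[OF w2(1)] by blast
    have "(4 * w ^ 2) * (b + 2 * c * t + 3 * d * t ^ 2) =
        - 9 * d * D + ((2 * w) * t - m) * (4 * w * c + 3 * d * (2 * w * t + m))"
      by (simp add: w_def m_def D_def eval_nat_numeral algebra_simps)
    then have "int p dvd (4 * w ^ 2) * (b + 2 * c * t + 3 * d * t ^ 2)" using D t by simp
    then have "int p dvd b + 2 * c * t + 3 * d * t ^ 2" by (rule dvd_cancel[OF w2(2)])
    moreover have "int p dvd m - 2 * w * t" using t by (simp add: dvd_diff_commute)
    ultimately show ?thesis by blast
  next
    case True
    obtain t where t: "int p dvd (3 * d) * t - (- c)" using ex_inverse[OF d9(2)] by blast
    have "(3 * d) * (b + 2 * c * t + 3 * d * t ^ 2) = ((3 * d) * t - (- c)) * (3 * d * t + c) - w"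
      by (simp add: w_def eval_nat_numeral algebra_simps)
    then have "int p dvd (3 * d) * (b + 2 * c * t + 3 * d * t ^ 2)" using t True by simp
    then have 1: "int p dvd b + 2 * c * t + 3 * d * t ^ 2" by (rule dvd_cancel[OF d9(2)])
    have "m ^ 2 = - 3 * D + w * (b ^ 2 * 4 - 12 * a * c)"
      by (simp add: w_def m_def D_def eval_nat_numeral algebra_simps)
    then have "int p dvd m ^ 2" using D True by simp
    then have "int p dvd m" using dvd_power_p by simp
    then have "int p dvd m - 2 * w * t" using True by simp
    with 1 show ?thesis by blast
  qed
  then obtain t where t: "int p dvd b + 2 * c * t + 3 * d * t ^ 2" "int p dvd m - 2 * w * t" by blast
  then have "int p dvd 9 * d * (a + b * t + c * t ^ 2 + d * t ^ 3)" unfolding H by simp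
  then have "int p dvd a + b * t + c * t ^ 2 + d * t ^ 3" by (rule dvd_cancel[OF d9(1)])
  with t show ?thesis by (auto simp: double_root_def)
qed

text \<open>
  A double root that is unique is rational in the coefficients: it is \<open>m/A\<close> with
  \<open>A\<close> and \<open>m\<close> the coefficients of the linear subresultant of the quartic
  and its derivative. If \<open>A\<close> vanishes, the form has a triple root or is a multiple of
  a square.
\<close>

lemma singular_depressed_quartic:
  assumes e: "\<not> int p dvd e" and disc: "int p dvd disc (Quartic r q c 0 e)"
  shows "(\<exists>t. double_root t (Quartic r q c 0 e)) \<or> square_like (Quartic r q c 0 e)"
proof -
  define D where "D = 256 * r ^ 3 * e ^ 2 - 128 * r ^ 2 * c ^ 2 * e + 144 * r * q ^ 2 * c * e + 16 * r * c ^ 4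
      - 27 * q ^ 4 * e - 4 * q ^ 2 * c ^ 3"
  have "disc (Quartic r q c 0 e) = e * D"
    unfolding disc_expand D_def by (simp add: eval_nat_numeral algebra_simps)
  then have D: "int p dvd D" using disc e dvd_mult_p by auto
  define A where "A = 2 * c ^ 3 - 8 * c * r * e + 9 * q ^ 2 * e"
  define m where "m = - q * (c ^ 2 + 12 * r * e)"
  have root: "double_root t (Quartic r q c 0 e)"
    if "int p dvd q + 2 * c * t + 4 * e * t ^ 3" "int p dvd 2 * c * t ^ 2 + 3 * q * t + 4 * r" for t
  proof -
    have eq: "4 * (r + q * t + c * t ^ 2 + e * t ^ 4) =
        t * (q + 2 * c * t + 4 * e * t ^ 3) + (2 * c * t ^ 2 + 3 * q * t + 4 * r)"
      by (simp add: eval_nat_numeral algebra_simps)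
    have "int p dvd 4 * (r + q * t + c * t ^ 2 + e * t ^ 4)"
      unfolding eq by (rule dvd_add[OF dvd_mult[OF that(1)] that(2)])
    then have "int p dvd r + q * t + c * t ^ 2 + e * t ^ 4" by (rule dvd_cancel[OF not_dvd_4])
    with that(1) show ?thesis by (simp add: double_root_def)
  qed
  show ?thesis
  proof (cases "int p dvd A")
    case False
    then have A2: "\<not> int p dvd A ^ 2" "\<not> int p dvd A ^ 3" using dvd_power_p by auto
    obtain t where t: "int p dvd A * t - m" using ex_inverse[OF False] by blast
    have "A ^ 3 * (q + 2 * c * t + 4 * e * t ^ 3) = (A ^ 3 * q + 2 * c * A ^ 2 * m + 4 * e * m ^ 3)
        + (A * t - m) * (2 * c * A ^ 2 + 4 * e * ((A * t) ^ 2 + A * t * m + m ^ 2))"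
      by (simp add: eval_nat_numeral algebra_simps)
    moreover have "A ^ 3 * q + 2 * c * A ^ 2 * m + 4 * e * m ^ 3 = - q * e * (27 * q ^ 2 * e + 8 * c ^ 3) * D"
      unfolding A_def m_def D_def by (simp add: eval_nat_numeral algebra_simps)
    ultimately have "int p dvd A ^ 3 * (q + 2 * c * t + 4 * e * t ^ 3)" using t D by simp
    then have 1: "int p dvd q + 2 * c * t + 4 * e * t ^ 3" by (rule dvd_cancel[OF A2(2)])
    have "A ^ 2 * (2 * c * t ^ 2 + 3 * q * t + 4 * r) = (2 * c * m ^ 2 + 3 * q * A * m + 4 * r * A ^ 2)
        + (A * t - m) * (2 * c * (A * t + m) + 3 * q * A)"
      by (simp add: eval_nat_numeral algebra_simps)
    moreover have "2 * c * m ^ 2 + 3 * q * A * m + 4 * r * A ^ 2 = c ^ 2 * D"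
      unfolding A_def m_def D_def by (simp add: eval_nat_numeral algebra_simps)
    ultimately have "int p dvd A ^ 2 * (2 * c * t ^ 2 + 3 * q * t + 4 * r)" using t D by simp
    then have "int p dvd 2 * c * t ^ 2 + 3 * q * t + 4 * r" by (rule dvd_cancel[OF A2(1)])
    with 1 root show ?thesis by blast
  next
    case A: True
    show ?thesis
    proof (cases "int p dvd q")
      case q: True
      have cr: "int p dvd c ^ 2 - 4 * r * e"
      proof (cases "int p dvd c")
        case True
        have "16 * r * (4 * r * e - c ^ 2) ^ 2 = D - q * (144 * r * q * c * e - 27 * q ^ 3 * e - 4 * q * c ^ 3)"
          by (simp add: D_def eval_nat_numeral algebra_simps)
        then have "int p dvd 16 * r * (4 * r * e - c ^ 2) ^ 2" using D q by simp
        then have "int p dvd r \<or> int p dvd 4 * r * e - c ^ 2"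
          using dvd_mult_p not_dvd_16 dvd_power_p[of 2] by auto
        then show ?thesis using True by (auto simp: dvd_diff_commute power2_eq_square)
      next
        case False
        have "(2 * c) * (c ^ 2 - 4 * r * e) = A - q * (9 * q * e)"
          by (simp add: A_def eval_nat_numeral algebra_simps)
        then have "int p dvd (2 * c) * (c ^ 2 - 4 * r * e)" using A q by simp
        then show ?thesis using False dvd_mult_p not_dvd_2 by blast
      qed
      have e4: "\<not> int p dvd 4 * e" using e dvd_mult_p not_dvd_4 by blast
      obtain k where k: "int p dvd (4 * e) * k - 1" using ex_inverse[OF e4] by blast
      have "\<not> int p dvd k"
      proof
        assume "int p dvd k"
        then have "int p dvd (4 * e) * k" by simp
        from dvd_diff[OF this k] show False using not_dvd_1 by simp
      qed
      moreover have "form_cong (Quartic r q c 0 e) (scaled_square k c 0 (2 * e)) (int p)"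
      proof -
        have "int p dvd r - k * c ^ 2"
        proof -
          have "r - k * c ^ 2 = - r * ((4 * e) * k - 1) - k * (c ^ 2 - 4 * r * e)"
            by (simp add: algebra_simps)
          then show ?thesis using k cr by simp
        qed
        moreover have "int p dvd c - k * (0 ^ 2 + 2 * c * (2 * e))"
        proof -
          have "c - k * (0 ^ 2 + 2 * c * (2 * e)) = - c * ((4 * e) * k - 1)" by (simp add: algebra_simps)
          then show ?thesis using k by simp
        qed
        moreover have "int p dvd e - k * (2 * e) ^ 2"
        proof -
          have "e - k * (2 * e) ^ 2 = - e * ((4 * e) * k - 1)" by (simp add: algebra_simps power2_eq_square)
          then show ?thesis using k by simp
        qed
        ultimately show ?thesis
          using q by (simp add: form_cong_def scaled_square_def cong_iff_dvd_diff)
      qed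
      ultimately show ?thesis unfolding square_like_def by blast
    next
      case q: False
      have c: "\<not> int p dvd c"
      proof
        assume "int p dvd c"
        then have "int p dvd A - c * (2 * c ^ 2 - 8 * r * e)" using A by simp
        also have "A - c * (2 * c ^ 2 - 8 * r * e) = 9 * (q ^ 2 * e)"
          by (simp add: A_def eval_nat_numeral algebra_simps)
        finally show False using q e dvd_mult_p not_dvd_9 dvd_power_p[of 2 q] by auto
      qed
      define s where "s = 8 * c * r * e"
      define s0 where "s0 = 2 * c ^ 3 + 9 * q ^ 2 * e"
      define W where "W = 8 * c ^ 3 + 27 * q ^ 2 * e"
      have "(q ^ 2 * e) * W ^ 2 = 2 * c ^ 3 * e * D + A * ((s0 ^ 2 + s0 * s + s ^ 2) - 4 * c ^ 3 * (s0 + s)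
          + 36 * c ^ 3 * (q ^ 2 * e) + 4 * c ^ 6)"
        unfolding W_def s0_def s_def A_def D_def by (simp add: eval_nat_numeral algebra_simps)
      then have "int p dvd (q ^ 2 * e) * W ^ 2" using A D by simp
      then have W: "int p dvd W" using q e dvd_mult_p dvd_power_p by auto
      have c4: "\<not> int p dvd 4 * c" "\<not> int p dvd 16 * c ^ 3" "\<not> int p dvd 8 * c * e"
        using c e dvd_mult_p not_dvd_4 not_dvd_16 not_dvd_8 dvd_power_p[of 3 c] by auto
      obtain t where t: "int p dvd (4 * c) * t - (- 3 * q)" using ex_inverse[OF c4(1)] by blast
      have "(16 * c ^ 3) * (q + 2 * c * t + 4 * e * t ^ 3) = - q * W +
          ((4 * c) * t - (- 3 * q)) * (8 * c ^ 3 + e * ((4 * c * t) ^ 2 - (4 * c * t) * (3 * q) + 9 * q ^ 2))"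
        by (simp add: W_def eval_nat_numeral algebra_simps)
      then have "int p dvd (16 * c ^ 3) * (q + 2 * c * t + 4 * e * t ^ 3)" using W t by simp
      then have 1: "int p dvd q + 2 * c * t + 4 * e * t ^ 3" by (rule dvd_cancel[OF c4(2)])
      have "(8 * c * e) * (2 * c * t ^ 2 + 3 * q * t + 4 * r) = W - 4 * A +
          ((4 * c) * t - (- 3 * q)) * (e * ((4 * c * t) - 3 * q) + 6 * q * e)"
        by (simp add: W_def A_def eval_nat_numeral algebra_simps)
      then have "int p dvd (8 * c * e) * (2 * c * t ^ 2 + 3 * q * t + 4 * r)" using W A t by simp
      then have "int p dvd 2 * c * t ^ 2 + 3 * q * t + 4 * r" by (rule dvd_cancel[OF c4(3)])
      with 1 root show ?thesis by blast
    qed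
  qed
qed

text \<open>
  Completing the fourth power reduces to the case without a term in \<open>x y^3\<close>. The
  square case is unavoidable: the roots of \<open>Q\<close> need not be rational over the field
  with \<open>p\<close> elements.
\<close>

lemma singular_form_classification:
  assumes disc: "int p dvd disc h"
  shows "double_root_inf h \<or> (\<exists>t. double_root t h) \<or> square_like h"
proof -
  obtain a b c d e where h: "h = Quartic a b c d e" by (cases h)
  show ?thesis
  proof (cases "int p dvd e")
    case e: True
    define h' where "h' = Quartic a b c d 0"
    have hh': "form_cong h h' (int p)" using e by (simp add: form_cong_def h h'_def cong_0_iff)
    show ?thesis
    proof (cases "int p dvd d")
      case True
      then show ?thesis using e by (simp add: double_root_inf_def h)
    next
      case False
      have "int p dvd disc h'" using disc_cong[OF hh'] disc by (simp add: cong_dvd_iff)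
      then obtain t where "double_root t h'" using singular_cubic_has_double_root[OF False] h'_def by blast
      then show ?thesis using double_root_cong[OF hh' cong_refl] by blast
    qed
  next
    case e: False
    then have "\<not> int p dvd 4 * e" using dvd_mult_p not_dvd_4 by blast
    then obtain s where s: "int p dvd (4 * e) * s - (- d)" using ex_inverse by blast
    obtain r q c' d' where T: "translate s h = Quartic r q c' d' e" "d' = d + 4 * e * s"
      by (simp add: h)
    define h' where "h' = Quartic r q c' 0 e"
    have hh': "form_cong (translate s h) h' (int p)"
      using s by (simp add: form_cong_def T h'_def cong_0_iff add.commute)
    have "int p dvd disc h'" using disc_cong[OF hh'] disc by (simp add: cong_dvd_iff disc_translate)
    then have "(\<exists>t. double_root t h') \<or> square_like h'"
      using singular_depressed_quartic[OF e] h'_def by blast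
    then show ?thesis
    proof
      assume "\<exists>t. double_root t h'"
      then obtain t where "double_root t (translate s h)" using double_root_cong[OF hh' cong_refl] by blast
      then show ?thesis unfolding double_root_translate by blast
    next
      assume "square_like h'"
      then show ?thesis using square_like_cong[OF hh'] square_like_translateD by blast
    qed
  qed
qed

lemma disc_dvd_if_double_root:
  assumes "double_root_inf h \<or> double_root t h"
  shows "int p dvd disc h"
  using assms
proof
  assume inf: "double_root_inf h"
  obtain a b c d e where h: "h = Quartic a b c d e" by (cases h)
  have "form_cong h (Quartic a b c 0 0) (int p)"
    using inf by (simp add: double_root_inf_def form_cong_def h cong_0_iff)
  from disc_cong[OF this] show ?thesis by (simp add: disc_expand cong_0_iff)
next
  assume t: "double_root t h"
  obtain a b c d e where h: "translate t h = Quartic a b c d e" by (cases "translate t h")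
  have "form_cong (translate t h) (Quartic 0 0 c d e) (int p)"
    using t by (simp add: double_root_def form_cong_def h cong_0_iff)
  from disc_cong[OF this] show ?thesis by (simp add: disc_expand cong_0_iff disc_translate)
qed

lemma two_double_roots_square_like:
  assumes nz: "\<not> form_dvd (int p) h" and s: "double_root s h"
    and t: "double_root_inf h \<or> (double_root t h \<and> \<not> int p dvd t - s)"
  shows "square_like h"
proof (rule square_like_translateD[of s])
  obtain a b c d e where T: "translate s h = Quartic a b c d e" by (cases "translate s h")
  have ab: "int p dvd a" "int p dvd b" using s by (auto simp: double_root_def T)
  have nz': "\<not> form_dvd (int p) (Quartic a b c d e)"
    using nz form_dvd_translate_iff[of "int p" s h] by (simp add: T)
  from t show "square_like (translate s h)"
  proof
    assume "double_root_inf h"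
    then have de: "int p dvd d" "int p dvd e"
      using double_root_inf_translate[of s h] by (auto simp: double_root_inf_def T)
    then have "\<not> int p dvd c" using nz' ab by (simp add: form_dvd_def)
    moreover have "form_cong (translate s h) (scaled_square c 0 1 0) (int p)"
      using ab de by (simp add: form_cong_def T scaled_square_def cong_0_iff)
    ultimately show ?thesis unfolding square_like_def by blast
  next
    assume t: "double_root t h \<and> \<not> int p dvd t - s"
    define u where "u = t - s"
    have u: "\<not> int p dvd u" "\<not> int p dvd u ^ 2" using t dvd_power_p by (auto simp: u_def)
    have "double_root u (translate s h)" using t by (simp add: double_root_translate u_def)
    then have H: "int p dvd a + b * u + c * u ^ 2 + d * u ^ 3 + e * u ^ 4"
      "int p dvd b + 2 * c * u + 3 * d * u ^ 2 + 4 * e * u ^ 3"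
      by (auto simp: double_root_def T)
    define G where "G = c + d * u + e * u ^ 2"
    have eq1: "u ^ 2 * G = (a + b * u + c * u ^ 2 + d * u ^ 3 + e * u ^ 4) - a - b * u"
      by (simp add: G_def eval_nat_numeral algebra_simps)
    have "int p dvd u ^ 2 * G" unfolding eq1 
      by (rule dvd_diff[OF dvd_diff[OF H(1) ab(1)] dvd_mult2[OF ab(2)]])
    then have G: "int p dvd G" by (rule dvd_cancel[OF u(2)])
    have eq2: "u ^ 2 * (d + 2 * e * u) = (b + 2 * c * u + 3 * d * u ^ 2 + 4 * e * u ^ 3) - b - 2 * u * G"
      by (simp add: G_def eval_nat_numeral algebra_simps)
    have "int p dvd u ^ 2 * (d + 2 * e * u)" unfolding eq2
      by (rule dvd_diff[OF dvd_diff[OF H(2) ab(2)] dvd_mult[OF G]])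
    then have d: "int p dvd d + 2 * e * u" by (rule dvd_cancel[OF u(2)])
    have "c - e * u ^ 2 = G - u * (d + 2 * e * u)"
      by (simp add: G_def eval_nat_numeral algebra_simps)
    then have c: "int p dvd c - e * u ^ 2" using G d by simp
    have "\<not> int p dvd e"
    proof
      assume e: "int p dvd e"
      have "int p dvd d" using d e by (simp add: dvd_add_left_iff)
      moreover have "int p dvd c" using c e dvd_diff_left_iff[of "int p" "e * u ^ 2" c] by simp
      ultimately show False using nz' ab e by (simp add: form_dvd_def)
    qed
    moreover have "form_cong (translate s h) (scaled_square e 0 (- u) 1) (int p)"
      using ab d c by (simp add: form_cong_def T scaled_square_def cong_0_iff cong_iff_dvd_diff algebra_simps)
    ultimately show ?thesis unfolding square_like_def by blast
  qed
qed

end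

section \<open>Double roots and fibres of the squaring map\<close>

lemma sum_V_mod:
  "(\<Sum>h\<in>V_mod q. G h) = (\<Sum>c\<in>{0..<int q}. \<Sum>d\<in>{0..<int q}. \<Sum>e\<in>{0..<int q}.
     \<Sum>b\<in>{0..<int q}. \<Sum>a\<in>{0..<int q}. G (Quartic a b c d e))"
proof -
  define P where "P = {0..<int q}"
  have V: "V_mod q = (\<lambda>(c, d, e, b, a). Quartic a b c d e) ` (P \<times> P \<times> P \<times> P \<times> P)"
  proof (intro equalityI subsetI)
    fix h assume "h \<in> V_mod q"
    then show "h \<in> (\<lambda>(c, d, e, b, a). Quartic a b c d e) ` (P \<times> P \<times> P \<times> P \<times> P)"
      by (cases h) (auto simp: V_mod_def P_def image_iff)
  qed (auto simp: V_mod_def P_def)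
  have inj: "inj_on (\<lambda>(c, d, e, b, a). Quartic a b c d e) (P \<times> P \<times> P \<times> P \<times> P)"
    by (auto simp: inj_on_def)
  have "(\<Sum>h\<in>V_mod q. G h) = (\<Sum>(c, d, e, b, a)\<in>P \<times> P \<times> P \<times> P \<times> P. G (Quartic a b c d e))"
    unfolding V sum.reindex[OF inj] by (intro sum.cong refl) auto
  then show ?thesis by (simp add: sum.cartesian_product P_def)
qed

lemma form_cong_V_mod:
  assumes "q > 0"
  obtains h where "h \<in> V_mod q" "form_cong h g (int q)"
    "\<And>h'. h' \<in> V_mod q \<Longrightarrow> form_cong h' g (int q) \<Longrightarrow> h' = h"
proof -
  define h where "h = map_quartic_form (\<lambda>x. x mod int q) g"
  have "h \<in> V_mod q" using assms by (cases g) (simp add: h_def V_mod_def)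
  moreover have "form_cong h g (int q)" by (cases g) (simp add: h_def form_cong_def)
  moreover have "h' = h" if "h' \<in> V_mod q" "form_cong h' g (int q)" for h'
    using that by (cases g; cases h') (auto simp: h_def V_mod_def form_cong_def cong_def)
  ultimately show ?thesis using that by blast
qed

lemma sum_V_mod_delta:
  fixes E :: "int quartic_form \<Rightarrow> 'a::semiring_1"
  assumes "q > 0" "\<And>h h'. form_cong h h' (int q) \<Longrightarrow> E h = E h'"
  shows "(\<Sum>h\<in>V_mod q. of_bool (form_cong h g (int q)) * E h) = E g"
proof -
  obtain h0 where h0: "h0 \<in> V_mod q" "form_cong h0 g (int q)"
    "\<And>h'. h' \<in> V_mod q \<Longrightarrow> form_cong h' g (int q) \<Longrightarrow> h' = h0"
    using form_cong_V_mod[OF assms(1)] by blast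
  have "(\<Sum>h\<in>V_mod q. of_bool (form_cong h g (int q)) * E h) = (\<Sum>h\<in>V_mod q. if h = h0 then E g else 0)"
  proof (rule sum.cong[OF refl])
    fix h assume h: "h \<in> V_mod q"
    show "of_bool (form_cong h g (int q)) * E h = (if h = h0 then E g else 0)"
    proof (cases "h = h0")
      case True
      then show ?thesis using h0(2) assms(2)[OF h0(2)] by simp
    next
      case False
      then have "\<not> form_cong h g (int q)" using h0(3) h by blast
      then show ?thesis using False by simp
    qed
  qed
  also have "\<dots> = E g" using h0(1) finite_V_mod[of q] by simp
  finally show ?thesis .
qed

text \<open>
  The pairing with its denominators moved into the second argument.
\<close>

definition form_dot :: "int quartic_form \<Rightarrow> int quartic_form \<Rightarrow> int" where
  "form_dot h F = qc0 h * qc0 F + qc1 h * qc1 F + qc2 h * qc2 F + qc3 h * qc3 F + qc4 h * qc4 F"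

lemma form_dot_cong: "form_cong h h' m \<Longrightarrow> [form_dot h F = form_dot h' F] (mod m)"
  by (auto simp: form_dot_def form_cong_def intro!: cong_add cong_mult)

lemma form_dot_scaled_square: "form_dot (scaled_square k \<alpha> \<beta> \<gamma>) F = k * dual_conic F \<alpha> \<beta> \<gamma>"
  by (simp add: form_dot_def scaled_square_def dual_conic_def algebra_simps)

context prime_gt_3
begin

definition double_root_number :: "int quartic_form \<Rightarrow> int" where
  "double_root_number h = of_bool (double_root_inf h) + (\<Sum>t\<in>Fp. of_bool (double_root t h))"

text \<open>
  The double roots of \<open>k Q^2\<close> are the roots of \<open>Q\<close>.
\<close>

lemma double_root_number_square:
  assumes k: "\<not> int p dvd k" and Q: "\<not> (int p dvd \<alpha> \<and> int p dvd \<beta> \<and> int p dvd \<gamma>)"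
    and h: "form_cong h (scaled_square k \<alpha> \<beta> \<gamma>) (int p)"
  shows "double_root_number h = 1 + chi (\<beta> ^ 2 - 4 * \<alpha> * \<gamma>)"
proof -
  have dr: "double_root t h \<longleftrightarrow> int p dvd \<gamma> * t ^ 2 + \<beta> * t + \<alpha>" for t
  proof -
    have "double_root t h \<longleftrightarrow> double_root t (scaled_square k \<alpha> \<beta> \<gamma>)"
      by (rule double_root_cong[OF h cong_refl])
    also have "\<dots> \<longleftrightarrow> int p dvd k * (\<alpha> + \<beta> * t + \<gamma> * t ^ 2) ^ 2 \<and>
        int p dvd k * (2 * (\<alpha> + \<beta> * t + \<gamma> * t ^ 2) * (\<beta> + 2 * \<gamma> * t))"
      unfolding double_root_def translate_scaled_square by (simp add: scaled_square_def)
    also have "\<dots> \<longleftrightarrow> int p dvd \<alpha> + \<beta> * t + \<gamma> * t ^ 2"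
      by (auto simp only: dvd_mult_p dvd_power_p[OF zero_less_numeral] k)
    finally show ?thesis by (simp add: algebra_simps)
  qed
  have inf: "double_root_inf h \<longleftrightarrow> int p dvd \<gamma>"
    using double_root_inf_cong[OF h] k dvd_mult_p dvd_power_p[of 2]
    by (auto simp: double_root_inf_def scaled_square_def)
  show ?thesis
  proof (cases "int p dvd \<gamma>")
    case False
    then show ?thesis
      unfolding double_root_number_def dr inf quadratic_root_count[OF False]
      by (simp add: mult.commute mult.left_commute)
  next
    case g: True
    have "int p dvd \<gamma> * t ^ 2 + \<beta> * t + \<alpha> \<longleftrightarrow> int p dvd \<beta> * t + \<alpha>" for t
      using g dvd_add_right_iff[of "int p" "\<gamma> * t ^ 2" "\<beta> * t + \<alpha>"] by (simp add: add.assoc)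
    then have nu: "double_root_number h = 1 + (\<Sum>t\<in>Fp. of_bool (int p dvd \<beta> * t + \<alpha>))"
      using g by (simp add: double_root_number_def dr inf)
    have "chi (\<beta> ^ 2 - 4 * \<alpha> * \<gamma>) = chi (\<beta> ^ 2)"
      using g by (intro chi_cong) (simp add: cong_iff_dvd_diff)
    then have ch: "chi (\<beta> ^ 2 - 4 * \<alpha> * \<gamma>) = of_bool (\<not> int p dvd \<beta>)" by (simp add: chi_square)
    show ?thesis
    proof (cases "int p dvd \<beta>")
      case False
      then show ?thesis unfolding nu ch sum_linear_indicator[OF False] by simp
    next
      case b: True
      then have "\<not> int p dvd \<beta> * t + \<alpha>" for t using Q g by (simp add: dvd_add_right_iff)
      then show ?thesis using b by (simp add: nu ch)
    qed
  qed
qed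

text \<open>
  The parametrisations \<open>(k, Q)\<close> of a given nonzero form \<open>k Q^2\<close> are
  \<open>(k/l^2, l Q)\<close> with \<open>l\<close> nonzero. The coordinate \<open>x0\<close> is
  one that does not vanish, so that \<open>l\<close> can be recovered from it.
\<close>

lemma square_fibre_count_aux:
  assumes x0: "\<not> int p dvd x0"
  shows "(\<Sum>k\<in>Fp. \<Sum>x\<in>Fp. \<Sum>y\<in>Fp. \<Sum>z\<in>Fp. of_bool (\<not> int p dvd x \<and> int p dvd x0 * y - x * y0 \<and>
     int p dvd x0 * z - x * z0 \<and> int p dvd k * x ^ 2 - k0)) = int p - 1"
proof -
  have lin: "(\<Sum>y\<in>Fp. of_bool (int p dvd x0 * y - x * y0)) = (1 :: int)" for x y0
    using sum_linear_indicator[OF x0, of "- (x * y0)"] by simp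
  have "of_bool (\<not> int p dvd x \<and> int p dvd x0 * y - x * y0 \<and> int p dvd x0 * z - x * z0 \<and> int p dvd k * x ^ 2 - k0)
     = of_bool (\<not> int p dvd x) * of_bool (int p dvd k * x ^ 2 - k0) *
       of_bool (int p dvd x0 * y - x * y0) * (of_bool (int p dvd x0 * z - x * z0) :: int)" for x y z k
    by (simp only: of_bool_conj mult_ac)
  then have "(\<Sum>k\<in>Fp. \<Sum>x\<in>Fp. \<Sum>y\<in>Fp. \<Sum>z\<in>Fp. of_bool (\<not> int p dvd x \<and> int p dvd x0 * y - x * y0 \<and>
     int p dvd x0 * z - x * z0 \<and> int p dvd k * x ^ 2 - k0)) =
     (\<Sum>k\<in>Fp. \<Sum>x\<in>Fp. of_bool (\<not> int p dvd x) * (of_bool (int p dvd k * x ^ 2 - k0) :: int))"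
    by (simp only: sum_distrib_left[symmetric] lin mult_1_right)
  also have "\<dots> = (\<Sum>x\<in>Fp. of_bool (\<not> int p dvd x) * (\<Sum>k\<in>Fp. of_bool (int p dvd k * x ^ 2 - k0)))"
    by (subst sum.swap) (simp only: sum_distrib_left)
  also have "\<dots> = (\<Sum>x\<in>Fp. of_bool (\<not> int p dvd x))"
  proof (rule sum.cong[OF refl])
    fix x
    show "of_bool (\<not> int p dvd x) * (\<Sum>k\<in>Fp. of_bool (int p dvd k * x ^ 2 - k0)) = (of_bool (\<not> int p dvd x) :: int)"
    proof (cases "int p dvd x")
      case False
      then have "\<not> int p dvd x ^ 2" using dvd_power_p by simp
      then have "(\<Sum>k\<in>Fp. of_bool (int p dvd x ^ 2 * k + (- k0))) = (1 :: int)" by (rule sum_linear_indicator)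
      then show ?thesis by (simp add: mult.commute)
    qed simp
  qed
  finally show ?thesis by (simp only: sum_not_dvd_indicator)
qed

lemma square_fibre_backward:
  assumes x: "int p dvd l * x0 - x" and "int p dvd x0 * \<alpha> - x * \<alpha>0" "int p dvd x0 * \<beta> - x * \<beta>0"
    "int p dvd x0 * \<gamma> - x * \<gamma>0" and k: "int p dvd k * x ^ 2 - k0 * x0 ^ 2" and x0: "\<not> int p dvd x0"
  shows "form_cong (scaled_square k0 \<alpha>0 \<beta>0 \<gamma>0) (scaled_square k \<alpha> \<beta> \<gamma>) (int p)"
proof -
  have lin: "[l * v0 = v] (mod int p)" if "int p dvd x0 * v - x * v0" for v v0
  proof -
    have "x0 * (l * v0 - v) = (l * x0 - x) * v0 - (x0 * v - x * v0)" by (simp add: algebra_simps)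
    then have "int p dvd x0 * (l * v0 - v)" using x that by simp
    then have "int p dvd l * v0 - v" by (rule dvd_cancel[OF x0])
    then show ?thesis by (simp add: cong_iff_dvd_diff)
  qed
  have "x0 ^ 2 * (k * l ^ 2 - k0) = k * ((l * x0 - x) * (l * x0 + x)) + (k * x ^ 2 - k0 * x0 ^ 2)"
    by (simp add: algebra_simps power2_eq_square)
  then have "int p dvd x0 ^ 2 * (k * l ^ 2 - k0)" using x k by simp
  then have "int p dvd k * l ^ 2 - k0" using x0 dvd_mult_p dvd_power_p[of 2 x0] by auto
  then have kl: "[k0 = k * l ^ 2] (mod int p)" by (simp add: cong_iff_dvd_diff dvd_diff_commute)
  have "form_cong (scaled_square k0 \<alpha>0 \<beta>0 \<gamma>0) (scaled_square (k * l ^ 2) \<alpha>0 \<beta>0 \<gamma>0) (int p)"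
    using kl by (intro scaled_square_cong) auto
  also have "scaled_square (k * l ^ 2) \<alpha>0 \<beta>0 \<gamma>0 = scaled_square k (l * \<alpha>0) (l * \<beta>0) (l * \<gamma>0)"
    by (simp add: scaled_square_rescale)
  finally have 1: "form_cong (scaled_square k0 \<alpha>0 \<beta>0 \<gamma>0) (scaled_square k (l * \<alpha>0) (l * \<beta>0) (l * \<gamma>0)) (int p)" .
  have "form_cong (scaled_square k (l * \<alpha>0) (l * \<beta>0) (l * \<gamma>0)) (scaled_square k \<alpha> \<beta> \<gamma>) (int p)"
    using assms by (intro scaled_square_cong lin cong_refl)
  with 1 show ?thesis by (rule form_cong_trans)
qed

lemma square_fibre_count:
  assumes k0: "\<not> int p dvd k0" and Q0: "\<not> (int p dvd \<alpha>0 \<and> int p dvd \<beta>0 \<and> int p dvd \<gamma>0)"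
  shows "(\<Sum>k\<in>Fp. \<Sum>\<alpha>\<in>Fp. \<Sum>\<beta>\<in>Fp. \<Sum>\<gamma>\<in>Fp. of_bool (\<not> int p dvd k \<and>
    form_cong (scaled_square k0 \<alpha>0 \<beta>0 \<gamma>0) (scaled_square k \<alpha> \<beta> \<gamma>) (int p))) = int p - 1"
proof -
  define C where "C = (\<lambda>k \<alpha> \<beta> \<gamma>. \<not> int p dvd k \<and>
    form_cong (scaled_square k0 \<alpha>0 \<beta>0 \<gamma>0) (scaled_square k \<alpha> \<beta> \<gamma>) (int p))"
  have CD: "int p dvd k * \<alpha> ^ 2 - k0 * \<alpha>0 ^ 2" "int p dvd k * \<alpha> * \<beta> - k0 * \<alpha>0 * \<beta>0"
      "int p dvd k * (\<beta> ^ 2 + 2 * \<alpha> * \<gamma>) - k0 * (\<beta>0 ^ 2 + 2 * \<alpha>0 * \<gamma>0)"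
      "int p dvd k * \<beta> * \<gamma> - k0 * \<beta>0 * \<gamma>0" "int p dvd k * \<gamma> ^ 2 - k0 * \<gamma>0 ^ 2" "\<not> int p dvd k"
    if "C k \<alpha> \<beta> \<gamma>" for k \<alpha> \<beta> \<gamma>
  proof -
    have c: "form_cong (scaled_square k \<alpha> \<beta> \<gamma>) (scaled_square k0 \<alpha>0 \<beta>0 \<gamma>0) (int p)"
      using that form_cong_sym by (auto simp: C_def)
    have half: "int p dvd k * x * y - k0 * x' * y'" if "int p dvd k * (2 * x * y) - k0 * (2 * x' * y')"
      for x y x' y'
    proof (rule dvd_cancel[OF not_dvd_2])
      show "int p dvd 2 * (k * x * y - k0 * x' * y')" using that by (simp add: algebra_simps)
    qed
    show "int p dvd k * \<alpha> ^ 2 - k0 * \<alpha>0 ^ 2" "int p dvd k * \<gamma> ^ 2 - k0 * \<gamma>0 ^ 2"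
      "int p dvd k * (\<beta> ^ 2 + 2 * \<alpha> * \<gamma>) - k0 * (\<beta>0 ^ 2 + 2 * \<alpha>0 * \<gamma>0)"
      using c by (auto simp: form_cong_def scaled_square_def cong_iff_dvd_diff)
    show "int p dvd k * \<alpha> * \<beta> - k0 * \<alpha>0 * \<beta>0" "int p dvd k * \<beta> * \<gamma> - k0 * \<beta>0 * \<gamma>0"
      using c by (simp_all add: form_cong_def scaled_square_def cong_iff_dvd_diff half)
    show "\<not> int p dvd k" using that by (simp add: C_def)
  qed
  have CI: "C k \<alpha> \<beta> \<gamma>" if x0: "\<not> int p dvd x0" and "int p dvd x0 * \<alpha> - x * \<alpha>0" "int p dvd x0 * \<beta> - x * \<beta>0"
    "int p dvd x0 * \<gamma> - x * \<gamma>0" and k: "int p dvd k * x ^ 2 - k0 * x0 ^ 2" for k \<alpha> \<beta> \<gamma> x x0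
  proof -
    obtain l where "int p dvd x0 * l - x" using ex_inverse[OF x0] by blast
    then have "int p dvd l * x0 - x" by (simp add: mult.commute)
    from square_fibre_backward[OF this that(2-4) k x0] have
      "form_cong (scaled_square k0 \<alpha>0 \<beta>0 \<gamma>0) (scaled_square k \<alpha> \<beta> \<gamma>) (int p)" .
    moreover have "\<not> int p dvd k"
    proof
      assume "int p dvd k"
      then have "int p dvd k * x ^ 2" by simp
      from dvd_diff[OF this k] have "int p dvd k0 * x0 ^ 2" by simp
      then show False using k0 x0 dvd_mult_p dvd_power_p[of 2 x0] by auto
    qed
    ultimately show ?thesis by (simp add: C_def)
  qed
  have nd: "\<not> int p dvd x" if "int p dvd k * x ^ 2 - k0 * x0 ^ 2" "\<not> int p dvd x0" for k x x0
  proof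
    assume "int p dvd x"
    then have "int p dvd k * x ^ 2" by (simp add: power2_eq_square)
    from dvd_diff[OF this that(1)] have "int p dvd k0 * x0 ^ 2" by simp
    then show False using k0 that(2) dvd_mult_p dvd_power_p[of 2 x0] by auto
  qed
  have dz: "int p dvd x" if "int p dvd k * x ^ 2 - k0 * x0 ^ 2" "int p dvd x0" "\<not> int p dvd k" for k x x0
  proof -
    have "int p dvd k0 * x0 ^ 2" using that(2) by (simp add: power2_eq_square)
    from dvd_add[OF that(1) this] have "int p dvd k * x ^ 2" by simp
    then show ?thesis using that(3) dvd_mult_p dvd_power_p[of 2 x] by auto
  qed
  \<comment> \<open>proportionality of a coordinate \<open>v\<close> to the distinguished coordinate \<open>x\<close>, from their product\<close>
  have minor: "int p dvd x0 * v - x * v0" if "int p dvd k * x ^ 2 - k0 * x0 ^ 2" "int p dvd k * x * v - k0 * x0 * v0"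
    "\<not> int p dvd k" "\<not> int p dvd x" for k x x0 v v0
  proof -
    have "(k * x) * (x0 * v - x * v0) = x0 * (k * x * v - k0 * x0 * v0) - v0 * (k * x ^ 2 - k0 * x0 ^ 2)"
      by (simp add: algebra_simps power2_eq_square)
    then have "int p dvd (k * x) * (x0 * v - x * v0)" using that by simp
    then show ?thesis using that(3,4) by (simp only: dvd_mult_p) blast
  qed
  have "(\<Sum>k\<in>Fp. \<Sum>\<alpha>\<in>Fp. \<Sum>\<beta>\<in>Fp. \<Sum>\<gamma>\<in>Fp. of_bool (C k \<alpha> \<beta> \<gamma>)) = int p - 1"
  proof (cases "int p dvd \<gamma>0")
    case g0: False
    have "C k \<alpha> \<beta> \<gamma> \<longleftrightarrow> \<not> int p dvd \<gamma> \<and> int p dvd \<gamma>0 * \<alpha> - \<gamma> * \<alpha>0 \<and>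
        int p dvd \<gamma>0 * \<beta> - \<gamma> * \<beta>0 \<and> int p dvd k * \<gamma> ^ 2 - k0 * \<gamma>0 ^ 2" for k \<alpha> \<beta> \<gamma>
    proof
      assume C: "C k \<alpha> \<beta> \<gamma>"
      note D = CD[OF C]
      have g: "\<not> int p dvd \<gamma>" by (rule nd[OF D(5) g0])
      have b: "int p dvd \<gamma>0 * \<beta> - \<gamma> * \<beta>0"
        by (rule minor[OF D(5) _ D(6) g]) (use D(4) in \<open>simp add: mult_ac\<close>)
      have "(2 * k * \<gamma> * \<gamma>0) * (\<gamma>0 * \<alpha> - \<gamma> * \<alpha>0) =
          \<gamma>0 ^ 2 * (k * (\<beta> ^ 2 + 2 * \<alpha> * \<gamma>) - k0 * (\<beta>0 ^ 2 + 2 * \<alpha>0 * \<gamma>0))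
          - k * ((\<gamma>0 * \<beta> - \<gamma> * \<beta>0) * (\<gamma>0 * \<beta> + \<gamma> * \<beta>0))
          - (k * \<gamma> ^ 2 - k0 * \<gamma>0 ^ 2) * (\<beta>0 ^ 2 + 2 * \<gamma>0 * \<alpha>0)"
        by (simp add: algebra_simps power2_eq_square)
      then have "int p dvd (2 * k * \<gamma> * \<gamma>0) * (\<gamma>0 * \<alpha> - \<gamma> * \<alpha>0)" using D(3,5) b by simp
      then have "int p dvd \<gamma>0 * \<alpha> - \<gamma> * \<alpha>0" using D(6) g g0 not_dvd_2
        by (simp only: dvd_mult_p) blast
      with g b D(5) show "\<not> int p dvd \<gamma> \<and> int p dvd \<gamma>0 * \<alpha> - \<gamma> * \<alpha>0 \<and>
        int p dvd \<gamma>0 * \<beta> - \<gamma> * \<beta>0 \<and> int p dvd k * \<gamma> ^ 2 - k0 * \<gamma>0 ^ 2" by blast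
    next
      assume "\<not> int p dvd \<gamma> \<and> int p dvd \<gamma>0 * \<alpha> - \<gamma> * \<alpha>0 \<and>
        int p dvd \<gamma>0 * \<beta> - \<gamma> * \<beta>0 \<and> int p dvd k * \<gamma> ^ 2 - k0 * \<gamma>0 ^ 2"
      then have A: "int p dvd \<gamma>0 * \<alpha> - \<gamma> * \<alpha>0" "int p dvd \<gamma>0 * \<beta> - \<gamma> * \<beta>0"
          "int p dvd \<gamma>0 * \<gamma> - \<gamma> * \<gamma>0" "int p dvd k * \<gamma> ^ 2 - k0 * \<gamma>0 ^ 2"
          by simp_all
        show "C k \<alpha> \<beta> \<gamma>" by (rule CI[OF g0 A])
    qed
    then have "(\<Sum>k\<in>Fp. \<Sum>\<alpha>\<in>Fp. \<Sum>\<beta>\<in>Fp. \<Sum>\<gamma>\<in>Fp. of_bool (C k \<alpha> \<beta> \<gamma>)) =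
        (\<Sum>k\<in>Fp. \<Sum>\<alpha>\<in>Fp. \<Sum>\<beta>\<in>Fp. \<Sum>\<gamma>\<in>Fp. of_bool (\<not> int p dvd \<gamma> \<and> int p dvd \<gamma>0 * \<alpha> - \<gamma> * \<alpha>0 \<and>
        int p dvd \<gamma>0 * \<beta> - \<gamma> * \<beta>0 \<and> int p dvd k * \<gamma> ^ 2 - k0 * \<gamma>0 ^ 2) :: int)"
      by (simp only:)
    also have "\<dots> = (\<Sum>k\<in>Fp. \<Sum>\<alpha>\<in>Fp. \<Sum>\<gamma>\<in>Fp. \<Sum>\<beta>\<in>Fp. of_bool (\<not> int p dvd \<gamma> \<and> int p dvd \<gamma>0 * \<alpha> - \<gamma> * \<alpha>0 \<and>
        int p dvd \<gamma>0 * \<beta> - \<gamma> * \<beta>0 \<and> int p dvd k * \<gamma> ^ 2 - k0 * \<gamma>0 ^ 2))"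
      by (rule sum.cong[OF refl], rule sum.cong[OF refl], rule sum.swap)
    also have "\<dots> = (\<Sum>k\<in>Fp. \<Sum>\<gamma>\<in>Fp. \<Sum>\<alpha>\<in>Fp. \<Sum>\<beta>\<in>Fp. of_bool (\<not> int p dvd \<gamma> \<and> int p dvd \<gamma>0 * \<alpha> - \<gamma> * \<alpha>0 \<and>
        int p dvd \<gamma>0 * \<beta> - \<gamma> * \<beta>0 \<and> int p dvd k * \<gamma> ^ 2 - k0 * \<gamma>0 ^ 2))"
      by (rule sum.cong[OF refl], rule sum.swap)
    also have "\<dots> = int p - 1" by (rule square_fibre_count_aux[OF g0])
    finally show ?thesis .
  next
    case g0: True
    show ?thesis
    proof (cases "int p dvd \<beta>0")
      case b0: False
      have "C k \<alpha> \<beta> \<gamma> \<longleftrightarrow> \<not> int p dvd \<beta> \<and> int p dvd \<beta>0 * \<alpha> - \<beta> * \<alpha>0 \<and>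
          int p dvd \<beta>0 * \<gamma> - \<beta> * \<gamma>0 \<and> int p dvd k * \<beta> ^ 2 - k0 * \<beta>0 ^ 2" for k \<alpha> \<beta> \<gamma>
      proof
        assume C: "C k \<alpha> \<beta> \<gamma>"
        note D = CD[OF C]
        have g: "int p dvd \<gamma>" by (rule dz[OF D(5) g0 D(6)])
        have "k * \<beta> ^ 2 - k0 * \<beta>0 ^ 2 = (k * (\<beta> ^ 2 + 2 * \<alpha> * \<gamma>) - k0 * (\<beta>0 ^ 2 + 2 * \<alpha>0 * \<gamma>0))
            - 2 * k * \<alpha> * \<gamma> + 2 * k0 * \<alpha>0 * \<gamma>0"
          by (simp add: algebra_simps)
        also have "int p dvd \<dots>" by (intro dvd_add dvd_diff D(3) dvd_mult g g0)
        finally have bb: "int p dvd k * \<beta> ^ 2 - k0 * \<beta>0 ^ 2" .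
        have b: "\<not> int p dvd \<beta>" by (rule nd[OF bb b0])
        have "int p dvd \<beta>0 * \<alpha> - \<beta> * \<alpha>0"
          by (rule minor[OF bb _ D(6) b]) (use D(2) in \<open>simp add: mult_ac\<close>)
        moreover have "int p dvd \<beta>0 * \<gamma> - \<beta> * \<gamma>0" using g g0 by simp
        ultimately show "\<not> int p dvd \<beta> \<and> int p dvd \<beta>0 * \<alpha> - \<beta> * \<alpha>0 \<and>
          int p dvd \<beta>0 * \<gamma> - \<beta> * \<gamma>0 \<and> int p dvd k * \<beta> ^ 2 - k0 * \<beta>0 ^ 2" using b bb by blast
      next
        assume "\<not> int p dvd \<beta> \<and> int p dvd \<beta>0 * \<alpha> - \<beta> * \<alpha>0 \<and>
          int p dvd \<beta>0 * \<gamma> - \<beta> * \<gamma>0 \<and> int p dvd k * \<beta> ^ 2 - k0 * \<beta>0 ^ 2"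
        then have A: "int p dvd \<beta>0 * \<alpha> - \<beta> * \<alpha>0" "int p dvd \<beta>0 * \<beta> - \<beta> * \<beta>0"
          "int p dvd \<beta>0 * \<gamma> - \<beta> * \<gamma>0" "int p dvd k * \<beta> ^ 2 - k0 * \<beta>0 ^ 2"
          by simp_all
        show "C k \<alpha> \<beta> \<gamma>" by (rule CI[OF b0 A])
      qed
      then have "(\<Sum>k\<in>Fp. \<Sum>\<alpha>\<in>Fp. \<Sum>\<beta>\<in>Fp. \<Sum>\<gamma>\<in>Fp. of_bool (C k \<alpha> \<beta> \<gamma>)) =
          (\<Sum>k\<in>Fp. \<Sum>\<alpha>\<in>Fp. \<Sum>\<beta>\<in>Fp. \<Sum>\<gamma>\<in>Fp. of_bool (\<not> int p dvd \<beta> \<and> int p dvd \<beta>0 * \<alpha> - \<beta> * \<alpha>0 \<and>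
          int p dvd \<beta>0 * \<gamma> - \<beta> * \<gamma>0 \<and> int p dvd k * \<beta> ^ 2 - k0 * \<beta>0 ^ 2) :: int)"
        by (simp only:)
      also have "\<dots> = (\<Sum>k\<in>Fp. \<Sum>\<beta>\<in>Fp. \<Sum>\<alpha>\<in>Fp. \<Sum>\<gamma>\<in>Fp. of_bool (\<not> int p dvd \<beta> \<and> int p dvd \<beta>0 * \<alpha> - \<beta> * \<alpha>0 \<and>
          int p dvd \<beta>0 * \<gamma> - \<beta> * \<gamma>0 \<and> int p dvd k * \<beta> ^ 2 - k0 * \<beta>0 ^ 2))"
        by (rule sum.cong[OF refl], rule sum.swap)
      also have "\<dots> = int p - 1" by (rule square_fibre_count_aux[OF b0])
      finally show ?thesis .
    next
      case b0: True
      then have a0: "\<not> int p dvd \<alpha>0" using Q0 g0 by blast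
      have "C k \<alpha> \<beta> \<gamma> \<longleftrightarrow> \<not> int p dvd \<alpha> \<and> int p dvd \<alpha>0 * \<beta> - \<alpha> * \<beta>0 \<and>
          int p dvd \<alpha>0 * \<gamma> - \<alpha> * \<gamma>0 \<and> int p dvd k * \<alpha> ^ 2 - k0 * \<alpha>0 ^ 2" for k \<alpha> \<beta> \<gamma>
      proof
        assume C: "C k \<alpha> \<beta> \<gamma>"
        note D = CD[OF C]
        have g: "int p dvd \<gamma>" by (rule dz[OF D(5) g0 D(6)])
        have "k * \<beta> ^ 2 - k0 * \<beta>0 ^ 2 = (k * (\<beta> ^ 2 + 2 * \<alpha> * \<gamma>) - k0 * (\<beta>0 ^ 2 + 2 * \<alpha>0 * \<gamma>0))
            - 2 * k * \<alpha> * \<gamma> + 2 * k0 * \<alpha>0 * \<gamma>0"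
          by (simp add: algebra_simps)
        also have "int p dvd \<dots>" by (intro dvd_add dvd_diff D(3) dvd_mult g g0)
        finally have b: "int p dvd \<beta>" by (rule dz[OF _ b0 D(6)])
        have "\<not> int p dvd \<alpha>" by (rule nd[OF D(1) a0])
        then show "\<not> int p dvd \<alpha> \<and> int p dvd \<alpha>0 * \<beta> - \<alpha> * \<beta>0 \<and>
          int p dvd \<alpha>0 * \<gamma> - \<alpha> * \<gamma>0 \<and> int p dvd k * \<alpha> ^ 2 - k0 * \<alpha>0 ^ 2"
          using g g0 b b0 D(1) by simp
      next
        assume "\<not> int p dvd \<alpha> \<and> int p dvd \<alpha>0 * \<beta> - \<alpha> * \<beta>0 \<and>
          int p dvd \<alpha>0 * \<gamma> - \<alpha> * \<gamma>0 \<and> int p dvd k * \<alpha> ^ 2 - k0 * \<alpha>0 ^ 2"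
        then have A: "int p dvd \<alpha>0 * \<alpha> - \<alpha> * \<alpha>0" "int p dvd \<alpha>0 * \<beta> - \<alpha> * \<beta>0"
          "int p dvd \<alpha>0 * \<gamma> - \<alpha> * \<gamma>0" "int p dvd k * \<alpha> ^ 2 - k0 * \<alpha>0 ^ 2"
          by simp_all
        show "C k \<alpha> \<beta> \<gamma>" by (rule CI[OF a0 A])
      qed
      then show ?thesis
        using square_fibre_count_aux[OF a0, of \<beta>0 \<gamma>0 "k0 * \<alpha>0 ^ 2"] by (simp only:)
    qed
  qed
  then show ?thesis by (simp only: C_def)
qed

end

section \<open>The Fourier transform of the singular locus at a prime\<close>

context prime_gt_3
begin

definition weighted_square_fibre :: "int quartic_form \<Rightarrow> int" where
  "weighted_square_fibre h = (\<Sum>k\<in>Fp. \<Sum>\<alpha>\<in>Fp. \<Sum>\<beta>\<in>Fp. \<Sum>\<gamma>\<in>Fp.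
     of_bool (\<not> int p dvd k \<and> form_cong h (scaled_square k \<alpha> \<beta> \<gamma>) (int p)) * chi (\<beta> ^ 2 - 4 * \<alpha> * \<gamma>))"

lemma scaled_square_form_dvd:
  assumes "\<not> int p dvd k" "form_cong h (scaled_square k \<alpha> \<beta> \<gamma>) (int p)" "form_dvd (int p) h"
  shows "int p dvd \<alpha> \<and> int p dvd \<beta> \<and> int p dvd \<gamma>"
proof -
  have "form_dvd (int p) (scaled_square k \<alpha> \<beta> \<gamma>)" using assms(2,3) form_dvd_cong by blast
  then have d: "int p dvd k * \<alpha> ^ 2" "int p dvd k * \<gamma> ^ 2" "int p dvd k * (\<beta> ^ 2 + 2 * \<alpha> * \<gamma>)"
    by (auto simp: form_dvd_def scaled_square_def)
  then have a: "int p dvd \<alpha>" and g: "int p dvd \<gamma>"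
    using assms(1) by (simp_all only: dvd_mult_p dvd_power_p[OF zero_less_numeral]) auto
  have "int p dvd \<beta> ^ 2 + 2 * \<alpha> * \<gamma>" using d(3) assms(1) dvd_cancel by blast
  then have "int p dvd \<beta> ^ 2" using a dvd_add_left_iff[of "int p" "2 * \<alpha> * \<gamma>" "\<beta> ^ 2"] by simp
  then show ?thesis using a g by (simp only: dvd_power_p[OF zero_less_numeral])
qed

lemma scaled_square_dvd_disc:
  assumes "form_cong h (scaled_square k \<alpha> \<beta> \<gamma>) (int p)"
  shows "int p dvd disc h"
  using disc_cong[OF assms] by (simp add: disc_scaled_square cong_0_iff)

text \<open>
  A nonzero singular form that is not a multiple of a square has exactly one double root. For a
  form \<open>k Q^2\<close> the excess \<open>\<chi>(disc Q)\<close> in the number of double roots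
  is removed by the \<open>p - 1\<close> elements of the fibre, and the zero form, which has
  \<open>p + 1\<close> double roots, needs its own correction.
\<close>

lemma singular_indicator_decomposition:
  "(int p - 1) * of_bool (int p dvd disc h) = (int p - 1) * double_root_number h
     - int p * (int p - 1) * of_bool (form_dvd (int p) h) - weighted_square_fibre h"
proof (cases "form_dvd (int p) h")
  case True
  have tr: "double_root t h" for t
    using form_dvd_translate[OF True, of t] by (simp add: double_root_def form_dvd_def)
  have inf: "double_root_inf h" using True by (simp add: double_root_inf_def form_dvd_def)
  have "double_root_number h = 1 + int p" by (simp add: double_root_number_def tr inf)
  moreover have "int p dvd disc h" using disc_dvd_if_double_root inf by blast
  moreover have "weighted_square_fibre h = 0"
    unfolding weighted_square_fibre_def
  proof (intro sum.neutral ballI)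
    fix k \<alpha> \<beta> \<gamma>
    show "of_bool (\<not> int p dvd k \<and> form_cong h (scaled_square k \<alpha> \<beta> \<gamma>) (int p)) * chi (\<beta> ^ 2 - 4 * \<alpha> * \<gamma>) = 0"
    proof (cases "\<not> int p dvd k \<and> form_cong h (scaled_square k \<alpha> \<beta> \<gamma>) (int p)")
      case C: True
      then have "int p dvd \<alpha> \<and> int p dvd \<beta> \<and> int p dvd \<gamma>"
        using scaled_square_form_dvd True by blast
      then have "int p dvd \<beta> ^ 2 - 4 * \<alpha> * \<gamma>" by (simp add: power2_eq_square)
      then have "chi (\<beta> ^ 2 - 4 * \<alpha> * \<gamma>) = 0" by (simp only: chi_eq_0_iff)
      then show ?thesis by simp
    next
      case False
      then show ?thesis by (simp only: of_bool_eq mult_zero_left)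
    qed
  qed
  ultimately show ?thesis using True by (simp add: algebra_simps)
next
  case nz: False
  show ?thesis
  proof (cases "square_like h")
    case True
    then obtain k0 \<alpha>0 \<beta>0 \<gamma>0 where k0: "\<not> int p dvd k0"
      and h0: "form_cong h (scaled_square k0 \<alpha>0 \<beta>0 \<gamma>0) (int p)"
      unfolding square_like_def by blast
    have Q0: "\<not> (int p dvd \<alpha> \<and> int p dvd \<beta> \<and> int p dvd \<gamma>)"
      if "form_cong h (scaled_square k \<alpha> \<beta> \<gamma>) (int p)" for k \<alpha> \<beta> \<gamma>
    proof
      assume "int p dvd \<alpha> \<and> int p dvd \<beta> \<and> int p dvd \<gamma>"
      then have "form_dvd (int p) (scaled_square k \<alpha> \<beta> \<gamma>)"
        by (simp add: form_dvd_def scaled_square_def power2_eq_square)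
      then show False using nz that form_dvd_cong by blast
    qed
    have "of_bool (\<not> int p dvd k \<and> form_cong h (scaled_square k \<alpha> \<beta> \<gamma>) (int p)) * chi (\<beta> ^ 2 - 4 * \<alpha> * \<gamma>) =
        (double_root_number h - 1) * of_bool (\<not> int p dvd k \<and>
          form_cong (scaled_square k0 \<alpha>0 \<beta>0 \<gamma>0) (scaled_square k \<alpha> \<beta> \<gamma>) (int p))" for k \<alpha> \<beta> \<gamma>
    proof -
      have "form_cong h (scaled_square k \<alpha> \<beta> \<gamma>) (int p) \<longleftrightarrow>
          form_cong (scaled_square k0 \<alpha>0 \<beta>0 \<gamma>0) (scaled_square k \<alpha> \<beta> \<gamma>) (int p)"
        using h0 form_cong_trans form_cong_sym by blast
      moreover have "chi (\<beta> ^ 2 - 4 * \<alpha> * \<gamma>) = double_root_number h - 1"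
        if "\<not> int p dvd k \<and> form_cong h (scaled_square k \<alpha> \<beta> \<gamma>) (int p)"
        using double_root_number_square[of k \<alpha> \<beta> \<gamma> h] that Q0 by simp
      ultimately show ?thesis by (cases "\<not> int p dvd k \<and> form_cong h (scaled_square k \<alpha> \<beta> \<gamma>) (int p)") auto
    qed
    then have "weighted_square_fibre h = (double_root_number h - 1) * (int p - 1)"
      unfolding weighted_square_fibre_def
      by (simp only: sum_distrib_left[symmetric] square_fibre_count[OF k0 Q0[OF h0]])
    then show ?thesis using nz scaled_square_dvd_disc[OF h0] by (simp add: algebra_simps)
  next
    case nsq: False
    then have "of_bool (\<not> int p dvd k \<and> form_cong h (scaled_square k \<alpha> \<beta> \<gamma>) (int p)) = (0 :: int)" for k \<alpha> \<beta> \<gamma>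
      unfolding square_like_def by auto
    then have "weighted_square_fibre h = 0"
      unfolding weighted_square_fibre_def by (simp only: mult_zero_left sum.neutral_const)
    moreover have "double_root_number h = of_bool (int p dvd disc h)"
    proof (cases "int p dvd disc h")
      case False
      then have "\<not> double_root_inf h" "\<not> double_root t h" for t
        using disc_dvd_if_double_root by blast+
      then show ?thesis using False by (simp add: double_root_number_def)
    next
      case True
      show ?thesis
      proof (cases "double_root_inf h")
        case inf: True
        then have "\<not> double_root t h" for t using two_double_roots_square_like[OF nz] nsq by blast
        then show ?thesis using inf True by (simp add: double_root_number_def)
      next
        case inf: False
        then obtain s where s: "double_root s h"
          using singular_form_classification[OF True] nsq by blast
        have "double_root t h \<longleftrightarrow> [t = s] (mod int p)" for t
        proof
          assume "double_root t h"
          then show "[t = s] (mod int p)"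
            using two_double_roots_square_like[OF nz s] nsq by (auto simp: cong_iff_dvd_diff)
        next
          assume "[t = s] (mod int p)"
          then show "double_root t h" using double_root_cong[OF form_cong_refl] s by blast
        qed
        then have "(\<Sum>t\<in>Fp. of_bool (double_root t h) :: int) = (\<Sum>t\<in>Fp. if [t = s] (mod int p) then 1 else 0)"
          by (intro sum.cong) auto
        also have "\<dots> = 1" by (rule sum_residues_delta[OF p_pos]) simp
        finally show ?thesis using inf True by (simp add: double_root_number_def)
      qed
    qed
    ultimately show ?thesis using nz by simp
  qed
qed

text \<open>
  The number of points of the projective line such that \<open>F\<close> annihilates all forms
  with a double root there. The three conditions for a finite point \<open>t\<close> express that
  \<open>F\<close> is orthogonal to a basis of these forms.
\<close>

definition apolar_number :: "int quartic_form \<Rightarrow> int" where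
  "apolar_number F = of_bool (int p dvd qc0 F \<and> int p dvd qc1 F \<and> int p dvd qc2 F) +
     (\<Sum>t\<in>Fp. of_bool (int p dvd t ^ 2 * qc0 F - 2 * t * qc1 F + qc2 F \<and>
        int p dvd 2 * t ^ 3 * qc0 F - 3 * t ^ 2 * qc1 F + qc3 F \<and>
        int p dvd 3 * t ^ 4 * qc0 F - 4 * t ^ 3 * qc1 F + qc4 F))"

lemma sum_of_bool_add_char: "(\<Sum>x\<in>Fp. of_bool (int p dvd x) * add_char p (x * a)) = 1"
proof -
  have "(\<Sum>x\<in>Fp. of_bool (int p dvd x) * add_char p (x * a)) =
      (\<Sum>x\<in>Fp. if [x = 0] (mod int p) then add_char p (x * a) else 0)"
    by (intro sum.cong) (auto simp: cong_0_iff)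
  also have "\<dots> = add_char p (0 * a)"
    by (rule sum_residues_delta[OF p_pos]) (auto intro: add_char_cong[OF p_pos] cong_scalar_right)
  finally show ?thesis by simp
qed

lemma sum_double_root_inf:
  "(\<Sum>h\<in>V_mod p. of_bool (double_root_inf h) * add_char p (form_dot h F)) =
    of_nat p ^ 3 * of_bool (int p dvd qc0 F \<and> int p dvd qc1 F \<and> int p dvd qc2 F)"
proof -
  have split: "of_bool (double_root_inf (Quartic a b c d e)) * add_char p (form_dot (Quartic a b c d e) F) =
      add_char p (c * qc2 F) * (of_bool (int p dvd d) * add_char p (d * qc3 F)) *
      (of_bool (int p dvd e) * add_char p (e * qc4 F)) * add_char p (b * qc1 F) * add_char p (a * qc0 F)"
    for a b c d e
    by (simp only: double_root_inf_def form_dot_def quartic_form.sel add_char_add of_bool_conj mult_ac)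
  show ?thesis
    unfolding sum_V_mod split
    by (simp only: sum_distrib_left[symmetric] sum_distrib_right[symmetric] sum_of_bool_add_char sum_add_char[OF p_pos])
       (auto simp: power3_eq_cube)
qed

lemma sum_double_root:
  "(\<Sum>h\<in>V_mod p. of_bool (double_root t h) * add_char p (form_dot h F)) =
    of_nat p ^ 3 * of_bool (int p dvd t ^ 2 * qc0 F - 2 * t * qc1 F + qc2 F \<and>
        int p dvd 2 * t ^ 3 * qc0 F - 3 * t ^ 2 * qc1 F + qc3 F \<and>
        int p dvd 3 * t ^ 4 * qc0 F - 4 * t ^ 3 * qc1 F + qc4 F)"
proof -
  define L1 where "L1 = t ^ 2 * qc0 F - 2 * t * qc1 F + qc2 F"
  define L2 where "L2 = 2 * t ^ 3 * qc0 F - 3 * t ^ 2 * qc1 F + qc3 F"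
  define L3 where "L3 = 3 * t ^ 4 * qc0 F - 4 * t ^ 3 * qc1 F + qc4 F"
  define E where "E = (\<lambda>a b c d e. add_char p (form_dot (Quartic a b c d e) F))"
  have E_cong: "E a b c d e = E a' b' c d e" if "[a = a'] (mod int p)" "[b = b'] (mod int p)" for a a' b b' c d e
    unfolding E_def
    by (intro add_char_cong[OF p_pos] form_dot_cong) (use that in \<open>simp add: form_cong_def\<close>)
  have "(\<Sum>b\<in>Fp. \<Sum>a\<in>Fp. of_bool (double_root t (Quartic a b c d e)) * E a b c d e) =
      add_char p (c * L1) * add_char p (d * L2) * add_char p (e * L3)" for c d e
  proof -
    define B where "B = - (2 * c * t + 3 * d * t ^ 2 + 4 * e * t ^ 3)"
    define A where "A = c * t ^ 2 + 2 * d * t ^ 3 + 3 * e * t ^ 4"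
    have iff: "double_root t (Quartic a b c d e) \<longleftrightarrow> [b = B] (mod int p) \<and> [a = A] (mod int p)" for a b
    proof -
      have b: "b + 2 * c * t + 3 * d * t ^ 2 + 4 * e * t ^ 3 = b - B" by (simp add: B_def)
      have "a + b * t + c * t ^ 2 + d * t ^ 3 + e * t ^ 4 = (b - B) * t + (a - A)"
        by (simp add: A_def B_def eval_nat_numeral algebra_simps)
      then have "double_root t (Quartic a b c d e) \<longleftrightarrow> int p dvd (b - B) * t + (a - A) \<and> int p dvd b - B"
        by (simp only: double_root_def translate.simps quartic_form.sel b)
      also have "\<dots> \<longleftrightarrow> int p dvd b - B \<and> int p dvd a - A"
        by (auto simp: dvd_add_right_iff)
      finally show ?thesis by (simp only: cong_iff_dvd_diff)
    qed
    have "(\<Sum>b\<in>Fp. \<Sum>a\<in>Fp. of_bool (double_root t (Quartic a b c d e)) * E a b c d e) =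
        (\<Sum>b\<in>Fp. if [b = B] (mod int p) then \<Sum>a\<in>Fp. if [a = A] (mod int p) then E a b c d e else 0 else 0)"
    proof (rule sum.cong[OF refl])
      fix b
      have "of_bool (double_root t (Quartic a b c d e)) * E a b c d e =
          (if [b = B] (mod int p) then if [a = A] (mod int p) then E a b c d e else 0 else 0)" for a
        by (simp add: iff)
      then show "(\<Sum>a\<in>Fp. of_bool (double_root t (Quartic a b c d e)) * E a b c d e) =
          (if [b = B] (mod int p) then \<Sum>a\<in>Fp. if [a = A] (mod int p) then E a b c d e else 0 else 0)"
        by (cases "[b = B] (mod int p)") (simp_all only: if_True if_False sum.neutral_const)
    qed
    also have "\<dots> = (\<Sum>b\<in>Fp. if [b = B] (mod int p) then E A b c d e else 0)"
      by (subst sum_residues_delta[OF p_pos]) (auto intro: E_cong)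
    also have "\<dots> = E A B c d e"
      by (rule sum_residues_delta[OF p_pos]) (auto intro: E_cong)
    also have "form_dot (Quartic A B c d e) F = c * L1 + d * L2 + e * L3"
      by (simp add: form_dot_def A_def B_def L1_def L2_def L3_def algebra_simps)
    then have "E A B c d e = add_char p (c * L1) * add_char p (d * L2) * add_char p (e * L3)"
      by (simp only: E_def add_char_add)
    finally show ?thesis .
  qed
  then have "(\<Sum>h\<in>V_mod p. of_bool (double_root t h) * add_char p (form_dot h F)) =
      (\<Sum>c\<in>Fp. \<Sum>d\<in>Fp. \<Sum>e\<in>Fp. add_char p (c * L1) * add_char p (d * L2) * add_char p (e * L3))"
    unfolding sum_V_mod E_def by (simp only:)
  also have "\<dots> = of_nat p ^ 3 * of_bool (int p dvd L1 \<and> int p dvd L2 \<and> int p dvd L3)"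
    by (simp only: sum_distrib_left[symmetric] sum_distrib_right[symmetric] sum_add_char[OF p_pos])
       (auto simp: power3_eq_cube)
  finally show ?thesis unfolding L1_def L2_def L3_def .
qed

lemma sum_double_root_number:
  "(\<Sum>h\<in>V_mod p. of_int (double_root_number h) * add_char p (form_dot h F)) = of_nat p ^ 3 * of_int (apolar_number F)"
proof -
  have "of_int (double_root_number h) * add_char p (form_dot h F) =
      of_bool (double_root_inf h) * add_char p (form_dot h F) +
      (\<Sum>t\<in>Fp. of_bool (double_root t h) * add_char p (form_dot h F))" for h
    by (simp only: double_root_number_def of_int_add of_int_sum of_int_of_bool distrib_right sum_distrib_right)
  then have "(\<Sum>h\<in>V_mod p. of_int (double_root_number h) * add_char p (form_dot h F)) =
      (\<Sum>h\<in>V_mod p. of_bool (double_root_inf h) * add_char p (form_dot h F)) +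
      (\<Sum>t\<in>Fp. \<Sum>h\<in>V_mod p. of_bool (double_root t h) * add_char p (form_dot h F))"
    by (simp only: sum.distrib) (simp only: sum.swap[of _ Fp])
  then show ?thesis
    unfolding sum_double_root_inf sum_double_root apolar_number_def
    by (simp only: of_int_add of_int_sum of_int_of_bool distrib_left sum_distrib_left)
qed

text \<open>
  Summing over \<open>k\<close> first detects the conic \<open>[Q^2, F] = 0\<close>; the term
  \<open>k = 0\<close> to be removed is the full sum of \<open>\<chi>(disc Q)\<close>.
\<close>

lemma sum_weighted_square_fibre:
  "(\<Sum>h\<in>V_mod p. of_int (weighted_square_fibre h) * add_char p (form_dot h F)) =
    of_int (int p * conic_sum F - int p * (int p - 1))"
proof -
  define D where "D = (\<lambda>\<alpha> \<beta> \<gamma>. of_int (chi (\<beta> ^ 2 - 4 * \<alpha> * \<gamma>)) :: complex)"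
  define I where "I = (\<lambda>h k \<alpha> \<beta> \<gamma>. of_bool (form_cong h (scaled_square k \<alpha> \<beta> \<gamma>) (int p)) * add_char p (form_dot h F))"
  have delta: "(\<Sum>h\<in>V_mod p. I h k \<alpha> \<beta> \<gamma>) = add_char p (k * dual_conic F \<alpha> \<beta> \<gamma>)" for k \<alpha> \<beta> \<gamma>
    unfolding I_def
    by (subst sum_V_mod_delta[OF p_pos])
       (auto simp: form_dot_scaled_square intro: add_char_cong[OF p_pos] form_dot_cong)
  have kk: "(\<Sum>k\<in>Fp. of_bool (\<not> int p dvd k) * add_char p (k * A)) = of_int (int p * of_bool (int p dvd A) - 1)" for A
  proof -
    have "of_bool (\<not> int p dvd k) * add_char p (k * A) = add_char p (k * A) - of_bool (int p dvd k) * add_char p (k * A)" for k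
      by simp
    then show ?thesis
      by (simp only: sum_subtractf sum_of_bool_add_char sum_add_char[OF p_pos]) simp
  qed
  have "of_int (weighted_square_fibre h) * add_char p (form_dot h F) =
      (\<Sum>k\<in>Fp. \<Sum>\<alpha>\<in>Fp. \<Sum>\<beta>\<in>Fp. \<Sum>\<gamma>\<in>Fp. D \<alpha> \<beta> \<gamma> * of_bool (\<not> int p dvd k) * I h k \<alpha> \<beta> \<gamma>)" for h
    unfolding weighted_square_fibre_def D_def I_def
    by (simp only: of_int_sum of_int_mult of_int_of_bool of_bool_conj sum_distrib_right) (simp only: mult_ac)
  then have "(\<Sum>h\<in>V_mod p. of_int (weighted_square_fibre h) * add_char p (form_dot h F)) =
      (\<Sum>h\<in>V_mod p. \<Sum>k\<in>Fp. \<Sum>\<alpha>\<in>Fp. \<Sum>\<beta>\<in>Fp. \<Sum>\<gamma>\<in>Fp. D \<alpha> \<beta> \<gamma> * of_bool (\<not> int p dvd k) * I h k \<alpha> \<beta> \<gamma>)"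
    by (simp only:)
  also have "\<dots> = (\<Sum>k\<in>Fp. \<Sum>\<alpha>\<in>Fp. \<Sum>\<beta>\<in>Fp. \<Sum>\<gamma>\<in>Fp. D \<alpha> \<beta> \<gamma> * (of_bool (\<not> int p dvd k) * add_char p (k * dual_conic F \<alpha> \<beta> \<gamma>)))"
    by (simp only: sum.swap[of _ _ "V_mod p"] sum_distrib_left[symmetric] delta mult.assoc)
  also have "\<dots> = (\<Sum>\<alpha>\<in>Fp. \<Sum>\<beta>\<in>Fp. \<Sum>\<gamma>\<in>Fp. \<Sum>k\<in>Fp. D \<alpha> \<beta> \<gamma> * (of_bool (\<not> int p dvd k) * add_char p (k * dual_conic F \<alpha> \<beta> \<gamma>)))"
  proof -
    have swap4: "(\<Sum>k\<in>Fp. \<Sum>\<alpha>\<in>Fp. \<Sum>\<beta>\<in>Fp. \<Sum>\<gamma>\<in>Fp. H k \<alpha> \<beta> \<gamma>) = (\<Sum>\<alpha>\<in>Fp. \<Sum>\<beta>\<in>Fp. \<Sum>\<gamma>\<in>Fp. \<Sum>k\<in>Fp. H k \<alpha> \<beta> \<gamma>)"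
      for H :: "int \<Rightarrow> int \<Rightarrow> int \<Rightarrow> int \<Rightarrow> complex"
      by (subst sum.swap, rule sum.cong[OF refl], subst sum.swap, rule sum.cong[OF refl], rule sum.swap)
    show ?thesis by (rule swap4)
  qed
  also have "\<dots> = (\<Sum>\<alpha>\<in>Fp. \<Sum>\<beta>\<in>Fp. \<Sum>\<gamma>\<in>Fp. of_int (int p *
        (if int p dvd dual_conic F \<alpha> \<beta> \<gamma> then chi (\<beta> ^ 2 - 4 * \<alpha> * \<gamma>) else 0) - chi (\<beta> ^ 2 - 4 * \<alpha> * \<gamma>)))"
    by (intro sum.cong refl, simp only: sum_distrib_left[symmetric] kk) (simp add: D_def algebra_simps)
  also have "\<dots> = of_int (int p * conic_sum F - (\<Sum>\<alpha>\<in>Fp. \<Sum>\<beta>\<in>Fp. \<Sum>\<gamma>\<in>Fp. chi (\<beta> ^ 2 - 4 * \<alpha> * \<gamma>)))"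
    unfolding conic_sum_def by (simp only: of_int_sum[symmetric] sum_subtractf sum_distrib_left)
  finally show ?thesis by (simp only: sum_chi_discriminant)
qed

text \<open>
  The contribution of the zero form cancels against that of \<open>k = 0\<close>.
\<close>

lemma singular_fourier_sum:
  "(of_nat p - 1) * (\<Sum>h\<in>V_mod p. of_bool (int p dvd disc h) * add_char p (form_dot h F)) =
    of_int ((int p - 1) * int p ^ 3 * apolar_number F - int p * conic_sum F)"
proof -
  have zero: "(\<Sum>h\<in>V_mod p. of_bool (form_dvd (int p) h) * add_char p (form_dot h F)) = 1"
  proof -
    have "form_dvd (int p) h \<longleftrightarrow> form_cong h 0 (int p)" for h
      by (simp add: form_dvd_def form_cong_def zero_quartic_form_def cong_0_iff)
    then have "(\<Sum>h\<in>V_mod p. of_bool (form_dvd (int p) h) * add_char p (form_dot h F)) = add_char p (form_dot 0 F)"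
      using sum_V_mod_delta[OF p_pos, of "\<lambda>h. add_char p (form_dot h F)" 0]
        add_char_cong[OF p_pos form_dot_cong] by simp
    then show ?thesis by (simp add: form_dot_def zero_quartic_form_def)
  qed
  have "(of_nat p - 1) * (of_bool (int p dvd disc h) * add_char p (form_dot h F)) =
      (of_nat p - 1) * (of_int (double_root_number h) * add_char p (form_dot h F))
      - of_nat p * (of_nat p - 1) * (of_bool (form_dvd (int p) h) * add_char p (form_dot h F))
      - of_int (weighted_square_fibre h) * add_char p (form_dot h F)" for h
  proof -
    have "(of_int ((int p - 1) * of_bool (int p dvd disc h)) :: complex) =
      of_int ((int p - 1) * double_root_number h
     - int p * (int p - 1) * of_bool (form_dvd (int p) h) - weighted_square_fibre h)"
      by (simp only: singular_indicator_decomposition)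
    then have "(of_nat p - 1) * (of_bool (int p dvd disc h) :: complex) = (of_nat p - 1) * of_int (double_root_number h)
      - of_nat p * (of_nat p - 1) * of_bool (form_dvd (int p) h) - of_int (weighted_square_fibre h)"
      by simp
    then show ?thesis by (simp only: mult.assoc[symmetric] left_diff_distrib)
  qed
  then have "(of_nat p - 1) * (\<Sum>h\<in>V_mod p. of_bool (int p dvd disc h) * add_char p (form_dot h F)) =
      (of_nat p - 1) * (of_nat p ^ 3 * of_int (apolar_number F)) - of_nat p * (of_nat p - 1)
      - of_int (int p * conic_sum F - int p * (int p - 1))"
    by (simp only: sum_distrib_left sum_subtractf)
       (simp only: sum_distrib_left[symmetric] zero sum_double_root_number sum_weighted_square_fibre mult_1_right)
  then show ?thesis by (simp add: algebra_simps)
qed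

lemma apolar_number_nonneg: "apolar_number F \<ge> 0"
  by (simp add: apolar_number_def sum_nonneg)

lemma apolar_number_le: "apolar_number F \<le> int p + 1"
proof -
  have "(\<Sum>t\<in>Fp. of_bool (P t) :: int) \<le> (\<Sum>t\<in>Fp. 1)" for P :: "int \<Rightarrow> bool"
    by (intro sum_mono) auto
  then have sum_le: "(\<Sum>t\<in>Fp. of_bool (P t) :: int) \<le> int p" for P :: "int \<Rightarrow> bool"
    by simp
  have "of_bool P \<le> (1 :: int)" for P by simp
  from add_mono[OF this sum_le] show ?thesis
    unfolding apolar_number_def by (simp only: add.commute[of "int p" 1])
qed

text \<open>
  The first of the three conditions is a quadratic equation for \<open>t\<close>, unless the first
  two coefficients of \<open>F\<close> vanish; then the three conditions force \<open>F =
  0\<close>, and only the point at infinity can count.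
\<close>

lemma apolar_number_le_2:
  assumes nz: "\<not> form_dvd (int p) F"
  shows "apolar_number F \<le> 2"
proof -
  obtain a b c d e where F: "F = Quartic a b c d e" by (cases F)
  show ?thesis
  proof (cases "int p dvd a \<and> int p dvd b")
    case True
    have none: "of_bool (int p dvd t ^ 2 * a - 2 * t * b + c \<and> int p dvd 2 * t ^ 3 * a - 3 * t ^ 2 * b + d \<and>
        int p dvd 3 * t ^ 4 * a - 4 * t ^ 3 * b + e) = (0 :: int)" for t
      using True nz by (auto simp: F form_dvd_def dvd_add_right_iff dvd_diff)
    show ?thesis
      unfolding apolar_number_def F quartic_form.sel none by simp
  next
    case False
    have "(\<Sum>t\<in>Fp. of_bool (int p dvd t ^ 2 * a - 2 * t * b + c \<and> int p dvd 2 * t ^ 3 * a - 3 * t ^ 2 * b + d \<and>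
        int p dvd 3 * t ^ 4 * a - 4 * t ^ 3 * b + e)) \<le> (\<Sum>t\<in>Fp. of_bool (int p dvd a * t ^ 2 + (- 2 * b) * t + c) :: int)"
      by (intro sum_mono) (auto simp: algebra_simps)
    also have "\<dots> \<le> 2"
    proof (rule quadratic_root_count_le)
      show "\<not> (int p dvd a \<and> int p dvd - 2 * b \<and> int p dvd c)"
        using False dvd_mult_p[of 2 b] not_dvd_2 by auto
    qed
    finally have le: "(\<Sum>t\<in>Fp. of_bool (int p dvd t ^ 2 * a - 2 * t * b + c \<and> int p dvd 2 * t ^ 3 * a - 3 * t ^ 2 * b + d \<and>
        int p dvd 3 * t ^ 4 * a - 4 * t ^ 3 * b + e)) \<le> (2 :: int)" .
    have "of_bool (int p dvd a \<and> int p dvd b \<and> int p dvd c) = (0 :: int)" using False by auto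
    with le show ?thesis unfolding apolar_number_def F quartic_form.sel by (simp only: add_0)
  qed
qed

text \<open>
  A form \<open>F\<close> that annihilates all forms with a double root at one point is determined
  by two of its coefficients, and both of its invariants vanish.
\<close>

lemma apolar_number_eq_0:
  assumes "\<not> (int p dvd apolar_I F \<and> int p dvd apolar_J F)"
  shows "apolar_number F = 0"
proof -
  obtain a b c d e where F: "F = Quartic a b c d e" by (cases F)
  have inf: "\<not> (int p dvd a \<and> int p dvd b \<and> int p dvd c)"
    using assms by (auto simp: F apolar_I_def apolar_J_def power2_eq_square power3_eq_cube)
  have "\<not> (int p dvd t ^ 2 * a - 2 * t * b + c \<and> int p dvd 2 * t ^ 3 * a - 3 * t ^ 2 * b + d \<and>
        int p dvd 3 * t ^ 4 * a - 4 * t ^ 3 * b + e)" for t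
  proof
    assume A: "int p dvd t ^ 2 * a - 2 * t * b + c \<and> int p dvd 2 * t ^ 3 * a - 3 * t ^ 2 * b + d \<and>
        int p dvd 3 * t ^ 4 * a - 4 * t ^ 3 * b + e"
    define G where "G = Quartic a b (2 * t * b - t ^ 2 * a) (3 * t ^ 2 * b - 2 * t ^ 3 * a) (4 * t ^ 3 * b - 3 * t ^ 4 * a)"
    have "[c = 2 * t * b - t ^ 2 * a] (mod int p)" "[d = 3 * t ^ 2 * b - 2 * t ^ 3 * a] (mod int p)"
      "[e = 4 * t ^ 3 * b - 3 * t ^ 4 * a] (mod int p)"
      using A by (simp_all add: cong_iff_dvd_diff algebra_simps)
    then have "[apolar_I F = apolar_I G] (mod int p)" "[apolar_J F = apolar_J G] (mod int p)"
      unfolding apolar_I_def apolar_J_def F G_def quartic_form.sel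
      by (auto intro!: cong_add cong_diff cong_mult cong_pow)
    moreover have "apolar_I G = 0" "apolar_J G = 0"
      by (simp_all add: apolar_I_def apolar_J_def G_def eval_nat_numeral algebra_simps)
    ultimately show False using assms by (simp add: cong_0_iff)
  qed
  then have fin: "of_bool (int p dvd t ^ 2 * a - 2 * t * b + c \<and> int p dvd 2 * t ^ 3 * a - 3 * t ^ 2 * b + d \<and>
        int p dvd 3 * t ^ 4 * a - 4 * t ^ 3 * b + e) = (0 :: int)" for t
    by (simp only: of_bool_eq)
  show ?thesis
    unfolding apolar_number_def F quartic_form.sel fin using inf by simp
qed

end

section \<open>Local bounds and multiplicativity\<close>

text \<open>
  The leading coefficient of the sextic covariant of \<open>f\<close>.
\<close>

definition form_R :: "int quartic_form \<Rightarrow> int" where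
  "form_R f = qc1 f ^ 3 + 8 * qc0 f ^ 2 * qc3 f - 4 * qc0 f * qc1 f * qc2 f"

lemma inv_I_cong: "form_cong f g m \<Longrightarrow> [inv_I f = inv_I g] (mod m)"
  by (cases f; cases g)
     (auto simp: form_cong_def inv_I_def intro!: cong_add cong_diff cong_mult cong_pow)

lemma inv_J_cong: "form_cong f g m \<Longrightarrow> [inv_J f = inv_J g] (mod m)"
  by (cases f; cases g)
     (auto simp: form_cong_def inv_J_def intro!: cong_add cong_diff cong_mult cong_pow)

lemma form_R_cong: "form_cong f g m \<Longrightarrow> [form_R f = form_R g] (mod m)"
  by (cases f; cases g)
     (auto simp: form_cong_def form_R_def intro!: cong_add cong_diff cong_mult cong_pow)

text \<open>
  Away from the zeros of this product the resolvent cubic is nondegenerate and the evaluation of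
  the conic sum by the pencil is valid.
\<close>

definition generic_cov :: "int quartic_form \<Rightarrow> int" where
  "generic_cov f = qc0 f * inv_J f * form_R f"

definition local_weight :: "nat \<Rightarrow> int quartic_form \<Rightarrow> real" where
  "local_weight p f =
    (if form_dvd (int p) f then real p powr (-1)
     else if int p dvd inv_I f \<and> int p dvd inv_J f then real p powr (-2)
     else if int p dvd generic_cov f then real p powr (-3)
     else real p powr (-7/2))"

text \<open>
  The coefficients of \<open>f\<close> divided by the binomial coefficients \<open>1, 4, 6, 4,
  1\<close> modulo \<open>q\<close>.
\<close>

definition apolar_coeffs :: "nat \<Rightarrow> int quartic_form \<Rightarrow> int quartic_form" where
  "apolar_coeffs q f = Quartic (qc0 f) (modular_inverse (int q) 4 * qc1 f) (modular_inverse (int q) 6 * qc2 f)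
     (modular_inverse (int q) 4 * qc3 f) (qc4 f)"

lemma pairing_eq_form_dot: "pairing q h f = form_dot h (apolar_coeffs q f)"
  by (simp add: pairing_def form_dot_def apolar_coeffs_def)

lemma Phi_hat_coprime_alt:
  "Phi_hat_coprime q f = (\<Sum>h\<in>V_mod q. of_bool (int q dvd disc h) * add_char q (pairing q h f)) / of_nat q ^ 5"
  by (simp add: Phi_hat_coprime_def Phi_def add_char_def cong_0_iff)

context prime_gt_3
begin

lemma apolar_coeffs_dvd:
  defines "F \<equiv> apolar_coeffs p"
  shows "form_dvd (int p) (F f) \<longleftrightarrow> form_dvd (int p) f"
    and "int p dvd inv_I f \<longleftrightarrow> int p dvd apolar_I (F f)"
    and "int p dvd inv_J f \<longleftrightarrow> int p dvd apolar_J (F f)"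
    and "int p dvd form_R f \<longleftrightarrow> int p dvd apolar_R (F f)"
proof -
  obtain a b c d e where f: "f = Quartic a b c d e" by (cases f)
  define i where "i = modular_inverse (int p) 4"
  define j where "j = modular_inverse (int p) 6"
  have i: "[4 * i = 1] (mod int p)" unfolding i_def
    using coprime_p[OF not_dvd_4] by (intro cong_modular_inverse1)
  have j: "[6 * j = 1] (mod int p)" unfolding j_def
    using coprime_p[OF not_dvd_6] by (intro cong_modular_inverse1)
  have F: "F f = Quartic a (i * b) (j * c) (i * d) e"
    by (simp add: F_def apolar_coeffs_def f i_def j_def)
  define f' where "f' = Quartic a (4 * (i * b)) (6 * (j * c)) (4 * (i * d)) e"
  have fc: "[b = 4 * (i * b)] (mod int p)" "[c = 6 * (j * c)] (mod int p)" "[d = 4 * (i * d)] (mod int p)"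
    using cong_scalar_right[OF i] cong_scalar_right[OF j] by (simp_all add: cong_sym_eq mult.assoc)
  then have ff: "form_cong f f' (int p)" by (simp add: form_cong_def f f'_def)
  show "form_dvd (int p) (F f) \<longleftrightarrow> form_dvd (int p) f"
    using form_dvd_cong[OF ff] not_dvd_4 not_dvd_6
    by (simp only: form_dvd_def f'_def F quartic_form.sel dvd_mult_p simp_thms)
  have "[inv_I f = inv_I f'] (mod int p)" "[inv_J f = inv_J f'] (mod int p)" "[form_R f = form_R f'] (mod int p)"
    using ff by (rule inv_I_cong inv_J_cong form_R_cong)+
  moreover have "inv_I f' = 12 * apolar_I (F f)" "inv_J f' = 432 * apolar_J (F f)" "form_R f' = 32 * apolar_R (F f)"
    by (simp_all add: inv_I_def inv_J_def form_R_def f'_def F apolar_I_def apolar_J_def apolar_R_def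
        eval_nat_numeral algebra_simps)
  ultimately show "int p dvd inv_I f \<longleftrightarrow> int p dvd apolar_I (F f)"
    "int p dvd inv_J f \<longleftrightarrow> int p dvd apolar_J (F f)"
    "int p dvd form_R f \<longleftrightarrow> int p dvd apolar_R (F f)"
    using not_dvd_12 not_dvd_432 not_dvd_32 by (simp_all only: cong_dvd_iff dvd_mult_p simp_thms)
qed

lemma norm_Phi_hat_prime_eq_bound:
  fixes f :: "int quartic_form"
  defines "F \<equiv> apolar_coeffs p f"
  shows "cmod (Phi_hat_coprime p f) \<le>
    (real p ^ 3 * real_of_int (apolar_number F) + real p / (real p - 1) * \<bar>real_of_int (conic_sum F)\<bar>) / real p ^ 5"
proof -
  define S where "S = (\<Sum>h\<in>V_mod p. of_bool (int p dvd disc h) * add_char p (form_dot h F))"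
  have p1: "real p - 1 > 0" using p_gt_3 by simp
  have "(of_nat p - 1) * S = of_int ((int p - 1) * int p ^ 3 * apolar_number F - int p * conic_sum F)"
    unfolding S_def by (rule singular_fourier_sum)
  then have "cmod ((of_nat p - 1) * S) = cmod (of_int ((int p - 1) * int p ^ 3 * apolar_number F - int p * conic_sum F))"
    by simp
  moreover have "cmod ((of_nat p - 1) * S) = (real p - 1) * cmod S"
  proof -
    have "(of_nat p - 1 :: complex) = of_real (real p - 1)" by simp
    then show ?thesis using p1 by (simp only: norm_mult norm_of_real)
  qed
  moreover have "cmod (of_int ((int p - 1) * int p ^ 3 * apolar_number F - int p * conic_sum F)) =
      \<bar>real_of_int ((int p - 1) * int p ^ 3 * apolar_number F - int p * conic_sum F)\<bar>"
    by (rule norm_of_int)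
  ultimately have "(real p - 1) * cmod S = \<bar>(real p - 1) * (real p ^ 3 * real_of_int (apolar_number F)) - real p * real_of_int (conic_sum F)\<bar>"
    by (simp add: mult.assoc)
  also have "\<dots> \<le> \<bar>(real p - 1) * (real p ^ 3 * real_of_int (apolar_number F))\<bar> + \<bar>real p * real_of_int (conic_sum F)\<bar>"
    by (rule abs_triangle_ineq4)
  also have "\<dots> = (real p - 1) * (real p ^ 3 * real_of_int (apolar_number F) + real p / (real p - 1) * \<bar>real_of_int (conic_sum F)\<bar>)"
  proof -
    define N where "N = real p ^ 3 * real_of_int (apolar_number F)"
    define C where "C = real_of_int (conic_sum F)"
    have "N \<ge> 0" using apolar_number_nonneg[of F] by (simp add: N_def)
    then have "\<bar>(real p - 1) * N\<bar> = (real p - 1) * N" using p1 by simp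
    moreover have "\<bar>real p * C\<bar> = (real p - 1) * (real p / (real p - 1) * \<bar>C\<bar>)"
      using p1 by (simp add: abs_mult)
    ultimately show ?thesis unfolding N_def C_def by (simp only: distrib_left)
  qed
  finally have "cmod S \<le> real p ^ 3 * real_of_int (apolar_number F) + real p / (real p - 1) * \<bar>real_of_int (conic_sum F)\<bar>"
    using p1 by simp
  moreover have "cmod (Phi_hat_coprime p f) = cmod S / real p ^ 5"
    by (simp add: Phi_hat_coprime_alt pairing_eq_form_dot S_def F_def norm_divide norm_power)
  ultimately show ?thesis by (simp add: divide_right_mono)
qed

text \<open>
  The four cases come from \<open>apolar_number \<le> p + 1\<close>, from \<open>apolar_number
  \<le> 2\<close>, from the count of \<open>O(p^2)\<close> points on the conic, and from the
  square-root bound.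
\<close>

lemma norm_Phi_hat_prime_le: "cmod (Phi_hat_coprime p f) \<le> 15 * local_weight p f"
proof -
  define F where "F = apolar_coeffs p f"
  define n where "n = real_of_int (apolar_number F)"
  define c where "c = \<bar>real_of_int (conic_sum F)\<bar>"
  define x where "x = real p"
  have x5: "x \<ge> 5" using p_ge_5 by (simp add: x_def)
  note main = norm_Phi_hat_prime_eq_bound[of f, folded F_def, folded n_def c_def x_def]
  have frac: "x / (x - 1) \<le> 2" using x5 by (simp add: field_simps)
  have c0: "c \<ge> 0" "n \<ge> 0" using apolar_number_nonneg by (simp_all add: c_def n_def)
  have c3: "c \<le> x ^ 3"
    using conic_sum_trivial_bound[of F] unfolding c_def x_def
    by (metis of_int_abs of_int_le_iff of_int_of_nat_eq of_int_power)
  have main': "cmod (Phi_hat_coprime p f) \<le> (x ^ 3 * n + 2 * c) / x ^ 5"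
    using main mult_right_mono[OF frac c0(1)] x5
    by (meson add_left_mono divide_right_mono order_trans zero_le_power le_numeral_extra(1) zero_le_numeral)
  have powr: "x powr (-1) = x ^ 4 / x ^ 5" "x powr (-2) = x ^ 3 / x ^ 5" "x powr (-3) = x ^ 2 / x ^ 5"
    "x powr (-7/2) = x * sqrt x / x ^ 5"
  proof -
    have k: "x powr (real m - 5) = x ^ m / x ^ 5" for m
      using x5 by (simp add: powr_diff powr_realpow)
    show "x powr (-1) = x ^ 4 / x ^ 5" using k[of 4] by simp
    show "x powr (-2) = x ^ 3 / x ^ 5" using k[of 3] by simp
    show "x powr (-3) = x ^ 2 / x ^ 5" using k[of 2] by simp
    have "x powr (-7/2) = x powr (1 + 1/2 - real 5)" by simp
    also have "\<dots> = x * sqrt x / x ^ 5"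
      using x5 by (simp only: powr_diff powr_add powr_realpow powr_half_sqrt powr_one)
    finally show "x powr (-7/2) = x * sqrt x / x ^ 5" .
  qed
  have conclude: "cmod (Phi_hat_coprime p f) \<le> 15 * (y / x ^ 5)" if "x ^ 3 * n + 2 * c \<le> 15 * y" for y
    using main' divide_right_mono[OF that, of "x ^ 5"] x5 by simp
  show ?thesis
  proof (cases "form_dvd (int p) f")
    case True
    have "n \<le> x + 1" using apolar_number_le[of F] unfolding n_def x_def by linarith
    then have 1: "x ^ 3 * n \<le> x ^ 3 * (x + 1)" using x5 by (intro mult_left_mono) auto
    have 2: "x ^ 3 * 1 \<le> x ^ 3 * x" using x5 by (intro mult_left_mono) auto
    have 3: "x ^ 3 * x = x ^ 4" "x ^ 3 * (x + 1) = x ^ 4 + x ^ 3"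
      by (simp_all add: eval_nat_numeral algebra_simps)
    have "x ^ 3 * n \<le> x ^ 4 + x ^ 3" "x ^ 3 \<le> x ^ 4" using 1 2 by (simp_all only: 3 mult_1_right)
    moreover have "x ^ 4 \<ge> 0" using x5 by simp
    ultimately have "x ^ 3 * n + 2 * c \<le> 15 * x ^ 4" using c3 by linarith
    from conclude[OF this] show ?thesis using True powr by (simp add: local_weight_def x_def)
  next
    case nz: False
    then have nzF: "\<not> form_dvd (int p) F" using apolar_coeffs_dvd(1) by (simp add: F_def)
    show ?thesis
    proof (cases "int p dvd inv_I f \<and> int p dvd inv_J f")
      case True
      have "n \<le> 2" using apolar_number_le_2[OF nzF] by (simp add: n_def)
      then have "x ^ 3 * n \<le> x ^ 3 * 2" using x5 by (intro mult_left_mono) auto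
      moreover have "x ^ 3 \<ge> 0" using x5 by simp
      ultimately have "x ^ 3 * n + 2 * c \<le> 15 * x ^ 3" using c3 by linarith
      from conclude[OF this] show ?thesis using True nz powr by (simp add: local_weight_def x_def)
    next
      case IJ: False
      then have n0: "n = 0"
        using apolar_number_eq_0[of F] apolar_coeffs_dvd(2,3)[of f] by (simp add: n_def F_def)
      show ?thesis
      proof (cases "int p dvd generic_cov f")
        case True
        have "\<bar>conic_sum F\<bar> \<le> 2 * int p ^ 2"
          by (rule order_trans[OF abs_conic_sum_le dual_conic_point_count]) (use nzF in \<open>simp add: form_dvd_def\<close>)
        then have "real_of_int \<bar>conic_sum F\<bar> \<le> real_of_int (2 * int p ^ 2)" by (simp only: of_int_le_iff)
        then have "c \<le> 2 * x ^ 2" by (simp add: c_def x_def)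
        moreover have "x ^ 3 * n = 0" "x ^ 2 \<ge> 0" using n0 by simp_all
        ultimately have "x ^ 3 * n + 2 * c \<le> 15 * x ^ 2" by linarith
        from conclude[OF this] have le: "cmod (Phi_hat_coprime p f) \<le> 15 * (x ^ 2 / x ^ 5)" .
        have "local_weight p f = x powr (-3)"
          unfolding local_weight_def x_def using True nz IJ by auto
        with le show ?thesis by (simp only: powr)
      next
        case gen: False
        then have "\<not> int p dvd qc0 F" "\<not> int p dvd apolar_J F" "\<not> int p dvd apolar_R F"
          using apolar_coeffs_dvd(3,4)[of f] dvd_mult_p by (auto simp: generic_cov_def F_def apolar_coeffs_def)
        then have "c \<le> 15 * (x - 1) * sqrt x" using conic_sum_generic_bound by (simp add: c_def x_def)
        then have "x / (x - 1) * c \<le> x / (x - 1) * (15 * (x - 1) * sqrt x)"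
          using x5 by (intro mult_left_mono) auto
        also have "\<dots> = 15 * (x * sqrt x)" using x5 by (simp add: field_simps)
        finally have "x ^ 3 * n + x / (x - 1) * c \<le> 15 * (x * sqrt x)" using n0 by simp
        from order_trans[OF main divide_right_mono[OF this]]
        have "cmod (Phi_hat_coprime p f) \<le> 15 * (x * sqrt x / x ^ 5)" using x5 by simp
        moreover have "local_weight p f = x powr (-7/2)"
          unfolding local_weight_def x_def using gen nz IJ by auto
        ultimately show ?thesis by (simp only: powr)
      qed
    qed
  qed
qed

end

lemma card_V_mod: "card (V_mod q) = q ^ 5"
  using sum_V_mod[of "\<lambda>_. 1 :: nat" q] by (simp add: eval_nat_numeral)

definition form_smult :: "int \<Rightarrow> int quartic_form \<Rightarrow> int quartic_form" where
  "form_smult k f = Quartic (k * qc0 f) (k * qc1 f) (k * qc2 f) (k * qc3 f) (k * qc4 f)"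

lemma disc_form_smult: "disc (form_smult k f) = k ^ 6 * disc f"
  by (cases f) (simp add: form_smult_def disc_expand eval_nat_numeral algebra_simps)

text \<open>
  By the Chinese remainder theorem \<open>h = q2 h1 + q1 h2\<close>. Scaling a form by a unit does
  not affect the vanishing of its discriminant, so no twist of \<open>f\<close> appears.
\<close>

lemma Phi_hat_coprime_mult:
  assumes "q1 > 0" "q2 > 0" and cop: "coprime q1 q2" and c6: "coprime (q1 * q2) 6"
  shows "Phi_hat_coprime (q1 * q2) f = Phi_hat_coprime q1 f * Phi_hat_coprime q2 f"
proof -
  define q where "q = q1 * q2"
  define cr where "cr = (\<lambda>x1 x2. (int q2 * x1 + int q1 * x2) mod int q)"
  define \<phi> where "\<phi> = (\<lambda>(h1, h2). Quartic (cr (qc0 h1) (qc0 h2)) (cr (qc1 h1) (qc1 h2)) (cr (qc2 h1) (qc2 h2))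
     (cr (qc3 h1) (qc3 h2)) (cr (qc4 h1) (qc4 h2)))"
  have q0: "q > 0" using assms by (simp add: q_def)
  have cr: "[cr x1 x2 = int q2 * x1 + int q1 * x2] (mod int q)" for x1 x2
    by (simp add: cr_def cong_def)
  have dvdq: "int q1 dvd int q" "int q2 dvd int q" by (simp_all add: q_def)
  have cr1: "[cr x1 x2 = int q2 * x1] (mod int q1)" and cr2: "[cr x1 x2 = int q1 * x2] (mod int q2)" for x1 x2
  proof -
    have "[cr x1 x2 = int q2 * x1 + int q1 * x2] (mod int q1)" "[cr x1 x2 = int q2 * x1 + int q1 * x2] (mod int q2)"
      using cr dvdq cong_dvd_modulus by blast+
    moreover have "[int q2 * x1 + int q1 * x2 = int q2 * x1] (mod int q1)"
      "[int q2 * x1 + int q1 * x2 = int q1 * x2] (mod int q2)"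
      by (simp_all add: cong_iff_dvd_diff)
    ultimately show "[cr x1 x2 = int q2 * x1] (mod int q1)" "[cr x1 x2 = int q1 * x2] (mod int q2)"
      by (blast intro: cong_trans)+
  qed
  have icop: "coprime (int q2) (int q1)" "coprime (int q1) (int q2)" using cop by (simp_all add: coprime_commute)
  have cancel: "x1 = y1 \<and> x2 = y2" if "cr x1 x2 = cr y1 y2" "x1 \<in> {0..<int q1}" "y1 \<in> {0..<int q1}"
    "x2 \<in> {0..<int q2}" "y2 \<in> {0..<int q2}" for x1 x2 y1 y2
  proof -
    have "[int q2 * x1 = int q2 * y1] (mod int q1)" "[int q1 * x2 = int q1 * y2] (mod int q2)"
      using cr1[of x1 x2] cr1[of y1 y2] cr2[of x1 x2] cr2[of y1 y2] that(1)
      by (metis cong_sym cong_trans)+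
    then have "[x1 = y1] (mod int q1)" "[x2 = y2] (mod int q2)"
      using icop by (simp_all add: cong_mult_lcancel)
    with that show ?thesis by (simp add: cong_def)
  qed
  have range: "cr x1 x2 \<in> {0..<int q}" for x1 x2 using q0 by (simp add: cr_def)
  have inj: "inj_on \<phi> (V_mod q1 \<times> V_mod q2)"
  proof (rule inj_onI)
    fix u v assume u: "u \<in> V_mod q1 \<times> V_mod q2" and v: "v \<in> V_mod q1 \<times> V_mod q2" and eq: "\<phi> u = \<phi> v"
    obtain h1 h2 k1 k2 where uv: "u = (h1, h2)" "v = (k1, k2)" by (cases u; cases v)
    have mem: "h1 \<in> V_mod q1" "h2 \<in> V_mod q2" "k1 \<in> V_mod q1" "k2 \<in> V_mod q2" using u v uv by auto
    obtain a0 a1 a2 a3 a4 where h1: "h1 = Quartic a0 a1 a2 a3 a4" by (cases h1)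
    obtain b0 b1 b2 b3 b4 where h2: "h2 = Quartic b0 b1 b2 b3 b4" by (cases h2)
    obtain c0 c1 c2 c3 c4 where k1: "k1 = Quartic c0 c1 c2 c3 c4" by (cases k1)
    obtain d0 d1 d2 d3 d4 where k2: "k2 = Quartic d0 d1 d2 d3 d4" by (cases k2)
    have e: "cr a0 b0 = cr c0 d0" "cr a1 b1 = cr c1 d1" "cr a2 b2 = cr c2 d2" "cr a3 b3 = cr c3 d3"
      "cr a4 b4 = cr c4 d4" using eq by (simp_all add: \<phi>_def uv h1 h2 k1 k2)
    show "u = v"
      using cancel[OF e(1)] cancel[OF e(2)] cancel[OF e(3)] cancel[OF e(4)] cancel[OF e(5)] mem
      by (simp add: uv h1 h2 k1 k2 V_mod_def)
  qed
  have sub: "\<phi> ` (V_mod q1 \<times> V_mod q2) \<subseteq> V_mod q"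
    using range by (auto simp: \<phi>_def V_mod_def)
  have "card (\<phi> ` (V_mod q1 \<times> V_mod q2)) = card (V_mod q)"
    by (simp add: card_image[OF inj] card_cartesian_product card_V_mod q_def power_mult_distrib)
  then have img: "\<phi> ` (V_mod q1 \<times> V_mod q2) = V_mod q"
    using sub finite_V_mod card_subset_eq by blast
  have summand: "of_bool (int q dvd disc (\<phi> (h1, h2))) * add_char q (pairing q (\<phi> (h1, h2)) f) =
      (of_bool (int q1 dvd disc h1) * add_char q1 (pairing q1 h1 f)) *
      (of_bool (int q2 dvd disc h2) * add_char q2 (pairing q2 h2 f))" for h1 h2
  proof -
    have dd: "int m dvd disc (\<phi> (h1, h2)) \<longleftrightarrow> int m dvd disc h"
      if "form_cong (\<phi> (h1, h2)) (form_smult (int n) h) (int m)" "coprime (int n) (int m)" for m n h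
    proof -
      have "[disc (\<phi> (h1, h2)) = int n ^ 6 * disc h] (mod int m)"
        using disc_cong[OF that(1)] by (simp add: disc_form_smult)
      then have "int m dvd disc (\<phi> (h1, h2)) \<longleftrightarrow> int m dvd int n ^ 6 * disc h" by (rule cong_dvd_iff)
      also have "\<dots> \<longleftrightarrow> int m dvd disc h"
        using that(2) by (intro coprime_dvd_mult_right_iff) (simp add: coprime_commute)
      finally show ?thesis .
    qed
    have "int q dvd disc (\<phi> (h1, h2)) \<longleftrightarrow> int q1 dvd disc (\<phi> (h1, h2)) \<and> int q2 dvd disc (\<phi> (h1, h2))"
      using icop(2) dvdq by (auto simp: q_def intro: divides_mult dvd_mult_left dvd_mult_right)
    also have "\<dots> \<longleftrightarrow> int q1 dvd disc h1 \<and> int q2 dvd disc h2"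
      using dd[of q2 h1 q1] dd[of q1 h2 q2] icop cr1 cr2
      by (simp add: \<phi>_def form_cong_def form_smult_def)
    finally have D: "int q dvd disc (\<phi> (h1, h2)) \<longleftrightarrow> int q1 dvd disc h1 \<and> int q2 dvd disc h2" .
    define X where "X = form_dot h1 (apolar_coeffs q f)"
    define Y where "Y = form_dot h2 (apolar_coeffs q f)"
    have "form_cong (\<phi> (h1, h2)) (Quartic (int q2 * qc0 h1 + int q1 * qc0 h2) (int q2 * qc1 h1 + int q1 * qc1 h2)
        (int q2 * qc2 h1 + int q1 * qc2 h2) (int q2 * qc3 h1 + int q1 * qc3 h2) (int q2 * qc4 h1 + int q1 * qc4 h2)) (int q)"
      using cr by (simp add: \<phi>_def form_cong_def)
    from form_dot_cong[OF this, of "apolar_coeffs q f"]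
    have "[pairing q (\<phi> (h1, h2)) f = int q2 * X + int q1 * Y] (mod int q)"
      by (simp add: pairing_eq_form_dot X_def Y_def form_dot_def algebra_simps)
    then have "add_char q (pairing q (\<phi> (h1, h2)) f) = add_char q (int q2 * X + int q1 * Y)"
      by (rule add_char_cong[OF q0])
    also have "\<dots> = add_char q1 X * add_char q2 Y"
      unfolding add_char_add
      using assms(1,2) by (simp add: add_char_def q_def field_simps)
    finally have A: "add_char q (pairing q (\<phi> (h1, h2)) f) = add_char q1 X * add_char q2 Y" .
    have XY: "add_char q1 X = add_char q1 (pairing q1 h1 f)" "add_char q2 Y = add_char q2 (pairing q2 h2 f)"
    proof -
      have inv: "[modular_inverse (int q) n = modular_inverse (int m) n] (mod int m)"
        if "int m dvd int q" "coprime n (int q)" for m n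
      proof -
        have cm: "coprime n (int m)" using that coprime_divisors[of n n "int m" "int q"] by simp
        have "[n * modular_inverse (int q) n = 1] (mod int m)"
          using cong_modular_inverse1[OF that(2)] that(1) cong_dvd_modulus by blast
        moreover have "[n * modular_inverse (int m) n = 1] (mod int m)"
          using cong_modular_inverse1[OF cm] .
        ultimately have "[n * modular_inverse (int q) n = n * modular_inverse (int m) n] (mod int m)"
          by (meson cong_sym cong_trans)
        then show ?thesis using cm by (simp add: cong_mult_lcancel)
      qed
      have "coprime 6 (int q)"
        using c6 unfolding q_def by (metis coprime_commute coprime_int_iff of_nat_numeral)
      then have "coprime (2 * 3) (int q)" by simp
      then have c: "coprime 6 (int q)" "coprime 4 (int q)"
        using coprime_mult_left_iff[of 2 3 "int q"] coprime_mult_left_iff[of 2 2 "int q"] by simp_all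
      have eq: "[form_dot h (apolar_coeffs q f) = pairing m h f] (mod int m)" if "int m dvd int q" for m h
        unfolding pairing_eq_form_dot form_dot_def apolar_coeffs_def quartic_form.sel
        by (intro cong_add cong_mult cong_refl inv that c)
      show "add_char q1 X = add_char q1 (pairing q1 h1 f)"
        unfolding X_def using eq[OF dvdq(1)] by (rule add_char_cong[OF assms(1)])
      show "add_char q2 Y = add_char q2 (pairing q2 h2 f)"
        unfolding Y_def using eq[OF dvdq(2)] by (rule add_char_cong[OF assms(2)])
    qed
    show ?thesis by (simp only: D A XY of_bool_conj mult_ac)
  qed
  have "(\<Sum>h\<in>V_mod q. of_bool (int q dvd disc h) * add_char q (pairing q h f)) =
      (\<Sum>u\<in>V_mod q1 \<times> V_mod q2. of_bool (int q dvd disc (\<phi> u)) * add_char q (pairing q (\<phi> u) f))"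
    unfolding img[symmetric] sum.reindex[OF inj] by simp
  also have "\<dots> = (\<Sum>(h1, h2)\<in>V_mod q1 \<times> V_mod q2. (of_bool (int q1 dvd disc h1) * add_char q1 (pairing q1 h1 f)) *
      (of_bool (int q2 dvd disc h2) * add_char q2 (pairing q2 h2 f)))"
    by (intro sum.cong refl) (auto simp only: summand split_paired_all prod.case)
  also have "\<dots> = (\<Sum>h1\<in>V_mod q1. of_bool (int q1 dvd disc h1) * add_char q1 (pairing q1 h1 f)) *
      (\<Sum>h2\<in>V_mod q2. of_bool (int q2 dvd disc h2) * add_char q2 (pairing q2 h2 f))"
    by (simp only: sum_product sum.cartesian_product)
  finally show ?thesis
    by (simp add: Phi_hat_coprime_alt q_def power_mult_distrib)
qed

lemma Phi_hat_coprime_1: "Phi_hat_coprime 1 f = 1"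
proof -
  have "V_mod 1 = {Quartic 0 0 0 0 0}"
  proof (intro equalityI subsetI)
    fix h assume "h \<in> V_mod 1"
    then show "h \<in> {Quartic 0 0 0 0 0}" by (cases h) (simp add: V_mod_def)
  qed (simp add: V_mod_def)
  then show ?thesis by (simp add: Phi_hat_coprime_alt pairing_def)
qed

lemma norm_Phi_hat_prod_primes_le:
  assumes "finite S" "\<And>p. p \<in> S \<Longrightarrow> prime p \<and> p > 3"
  shows "cmod (Phi_hat_coprime (\<Prod>S) f) \<le> (\<Prod>p\<in>S. 15 * local_weight p f)"
  using assms
proof (induction S rule: finite_induct)
  case empty
  show ?case by (simp only: prod.empty Phi_hat_coprime_1 norm_one order_refl)
next
  case (insert p S)
  have p: "prime p" "p > 3" using insert.prems by auto
  interpret prime_gt_3 p by unfold_locales (use p in auto)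
  have copS: "coprime x (\<Prod>S)" if "\<And>y. y \<in> S \<Longrightarrow> coprime x y" for x :: nat
    using that by (intro prod_coprime_right) auto
  have 1: "coprime p (\<Prod>S)"
    using insert p by (intro copS primes_coprime) auto
  have six: "coprime 6 y" if "prime y" "y > 3" for y :: nat
  proof -
    have "coprime 2 y" "coprime 3 y" using that by (intro primes_coprime; force)+
    then show ?thesis using coprime_mult_left_iff[of 2 3 y] by simp
  qed
  have 2: "coprime 6 (\<Prod>S)" using insert.prems by (intro copS six) auto
  have 3: "coprime (p * \<Prod>S) 6" using 2 six[OF p] by (simp add: coprime_commute)
  have pos: "\<Prod>S > 0" using insert.prems by (intro prod_pos) (auto simp: prime_gt_0_nat)
  have "cmod (Phi_hat_coprime (\<Prod>(insert p S)) f) = cmod (Phi_hat_coprime p f) * cmod (Phi_hat_coprime (\<Prod>S) f)"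
    using insert.hyps Phi_hat_coprime_mult[OF p_pos pos 1 3] by (simp add: norm_mult)
  also have "\<dots> \<le> (15 * local_weight p f) * (\<Prod>p\<in>S. 15 * local_weight p f)"
    using insert.IH insert.prems by (intro mult_mono norm_Phi_hat_prime_le) (auto simp: local_weight_def)
  finally show ?case using insert.hyps by simp
qed

lemma squarefree_eq_prod_prime_factors:
  fixes q :: nat
  assumes "squarefree q"
  shows "\<Prod>(prime_factors q) = q"
proof -
  have q0: "q \<noteq> 0"
  proof
    assume "q = 0"
    with assms show False by simp
  qed
  have "(\<Prod>p\<in>prime_factors q. p) = (\<Prod>p\<in>prime_factors q. p ^ multiplicity p q)"
  proof (rule prod.cong[OF refl])
    fix p assume p: "p \<in> prime_factors q"
    then have "multiplicity p q = 1"
      using assms squarefree_factorial_semiring'[OF q0] by blast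
    then show "p = p ^ multiplicity p q" by simp
  qed
  also have "\<dots> = q" using prod_prime_factors[OF q0] by simp
  finally show ?thesis by simp
qed

lemma norm_Phi_hat_coprime_le:
  assumes "squarefree q" "coprime q 6"
  shows "cmod (Phi_hat_coprime q f) \<le> 15 ^ card (prime_factors q) * (\<Prod>p\<in>prime_factors q. local_weight p f)"
proof -
  have pr3: "prime p \<and> p > 3" if p: "p \<in> prime_factors q" for p
  proof -
    have pr: "prime p" "p dvd q" using p by auto
    have "\<not> p dvd 6"
      using pr assms(2) by (metis coprime_common_divisor not_prime_unit)
    then have "p \<noteq> 2" "p \<noteq> 3" by auto
    then show ?thesis using pr prime_ge_2_nat[of p] by linarith
  qed
  have "cmod (Phi_hat_coprime (\<Prod>(prime_factors q)) f) \<le> (\<Prod>p\<in>prime_factors q. 15 * local_weight p f)"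
    by (rule norm_Phi_hat_prod_primes_le[OF finite_set_mset pr3])
  then show ?thesis by (simp add: squarefree_eq_prod_prime_factors[OF assms(1)] prod.distrib)
qed

section \<open>Counting forms with vanishing covariants\<close>

definition int_box :: "real \<Rightarrow> int quartic_form set" where
  "int_box r = {f. map_quartic_form real_of_int f \<in> quartic_box r}"

definition int_ball :: "real \<Rightarrow> int set" where
  "int_ball r = {x. \<bar>real_of_int x\<bar> \<le> r}"

lemma int_box_iff:
  "Quartic a b c d e \<in> int_box r \<longleftrightarrow> a \<in> int_ball r \<and> b \<in> int_ball r \<and> c \<in> int_ball r \<and> d \<in> int_ball r \<and> e \<in> int_ball r"
  by (auto simp: int_box_def int_ball_def quartic_box_def)

lemma finite_int_box: "finite (int_box r)"
  unfolding int_box_def by (rule finite_integral_quartic_box)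

lemma int_ball_eq: "int_ball r = {- \<lfloor>r\<rfloor>..\<lfloor>r\<rfloor>}"
  by (auto simp: int_ball_def abs_le_iff le_floor_iff) (simp_all add: le_floor_iff minus_le_iff)

lemma finite_int_ball: "finite (int_ball r)"
  by (simp add: int_ball_eq)

lemma card_int_ball: "r \<ge> 1 \<Longrightarrow> real (card (int_ball r)) \<le> 3 * r"
proof -
  assume r: "r \<ge> 1"
  then have "\<lfloor>r\<rfloor> \<ge> 1" by simp
  then have "real (card (int_ball r)) = 2 * real_of_int \<lfloor>r\<rfloor> + 1" by (simp add: int_ball_eq)
  moreover have "real_of_int \<lfloor>r\<rfloor> \<le> r" by simp
  ultimately show ?thesis using r by linarith
qed

lemma card_le_of_four_coordinates:
  fixes A :: "'a set" and r :: real
  assumes "r \<ge> 1" "inj_on g A" "g ` A \<subseteq> int_ball r \<times> int_ball r \<times> int_ball r \<times> int_ball r"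
  shows "real (card A) \<le> 81 * r ^ 4"
proof -
  define B where "B = int_ball r"
  have "card A = card (g ` A)" using assms(2) by (simp add: card_image)
  also have "\<dots> \<le> card (B \<times> B \<times> B \<times> B)"
    using assms(3) finite_int_ball by (intro card_mono) (auto simp: B_def)
  finally have "real (card A) \<le> real (card B) ^ 4"
    by (simp add: card_cartesian_product eval_nat_numeral flip: of_nat_mult)
  also have "\<dots> \<le> (3 * r) ^ 4"
    using card_int_ball[OF assms(1)] by (intro power_mono) (auto simp: B_def)
  finally show ?thesis by (simp add: power_mult_distrib)
qed

lemma card_le_of_two_coordinates:
  fixes A :: "'a set" and r :: real
  assumes "r \<ge> 1" "inj_on g A" "g ` A \<subseteq> int_ball r \<times> int_ball r"
  shows "real (card A) \<le> 9 * r ^ 2"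
proof -
  define B where "B = int_ball r"
  have "card A = card (g ` A)" using assms(2) by (simp add: card_image)
  also have "\<dots> \<le> card (B \<times> B)"
    using assms(3) finite_int_ball by (intro card_mono) (auto simp: B_def)
  finally have "real (card A) \<le> real (card B) ^ 2"
    by (simp add: card_cartesian_product power2_eq_square flip: of_nat_mult)
  also have "\<dots> \<le> (3 * r) ^ 2"
    using card_int_ball[OF assms(1)] by (intro power_mono) (auto simp: B_def)
  finally show ?thesis by (simp add: power_mult_distrib)
qed

text \<open>
  The leading coefficient of the Hessian of \<open>f\<close>, up to a constant.
\<close>

definition form_P :: "int quartic_form \<Rightarrow> int" where
  "form_P f = 3 * qc1 f ^ 2 - 8 * qc0 f * qc2 f"

text \<open>
  By the syzygy among the covariants this is a combination of \<open>I\<close> and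
  \<open>J\<close>, yet it does not involve the last coefficient of \<open>f\<close>.
\<close>

definition form_Delta :: "int quartic_form \<Rightarrow> int" where
  "form_Delta f = form_P f ^ 3 - 27 * form_R f ^ 2"

lemma form_Delta_eq: "form_Delta f = 48 * qc0 f ^ 2 * form_P f * inv_I f + 64 * qc0 f ^ 3 * inv_J f"
  by (cases f) (simp add: form_Delta_def form_P_def form_R_def inv_I_def inv_J_def eval_nat_numeral algebra_simps)

text \<open>
  Each factor of \<open>generic_cov\<close> is linear in one coefficient, which it therefore
  determines by the other four. For \<open>J\<close> this fails where \<open>8 a0 a2 = 3
  a1^2\<close>, and there \<open>a2\<close> is determined instead.
\<close>

lemma generic_cov_zero_count:
  assumes r: "r \<ge> 1"
  shows "real (card {f \<in> int_box r. generic_cov f = 0}) \<le> 324 * r ^ 4"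
proof -
  define A1 where "A1 = {f \<in> int_box r. qc0 f = 0}"
  define A2 where "A2 = {f \<in> int_box r. qc0 f \<noteq> 0 \<and> form_R f = 0}"
  define A3 where "A3 = {f \<in> int_box r. qc0 f \<noteq> 0 \<and> inv_J f = 0 \<and> 8 * qc0 f * qc2 f \<noteq> 3 * qc1 f ^ 2}"
  define A4 where "A4 = {f \<in> int_box r. qc0 f \<noteq> 0 \<and> 8 * qc0 f * qc2 f = 3 * qc1 f ^ 2}"
  have fin: "finite A1" "finite A2" "finite A3" "finite A4"
    by (simp_all add: A1_def A2_def A3_def A4_def finite_int_box)
  have "{f \<in> int_box r. generic_cov f = 0} \<subseteq> A1 \<union> (A2 \<union> (A3 \<union> A4))"
    by (auto simp: generic_cov_def A1_def A2_def A3_def A4_def)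
  then have "card {f \<in> int_box r. generic_cov f = 0} \<le> card (A1 \<union> (A2 \<union> (A3 \<union> A4)))"
    using fin by (intro card_mono) auto
  also have "\<dots> \<le> card A1 + (card A2 + (card A3 + card A4))"
    using card_Un_le[of A1 "A2 \<union> (A3 \<union> A4)"] card_Un_le[of A2 "A3 \<union> A4"] card_Un_le[of A3 A4] by linarith
  finally have le: "real (card {f \<in> int_box r. generic_cov f = 0}) \<le>
      real (card A1) + (real (card A2) + (real (card A3) + real (card A4)))"
    by (simp only: of_nat_add[symmetric] of_nat_le_iff)
  have c1: "real (card A1) \<le> 81 * r ^ 4"
  proof (rule card_le_of_four_coordinates[OF r, of "\<lambda>f. (qc1 f, qc2 f, qc3 f, qc4 f)"])
    show "inj_on (\<lambda>f. (qc1 f, qc2 f, qc3 f, qc4 f)) A1"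
    proof (rule inj_onI)
      fix f g assume "f \<in> A1" "g \<in> A1" "(qc1 f, qc2 f, qc3 f, qc4 f) = (qc1 g, qc2 g, qc3 g, qc4 g)"
      then show "f = g" by (simp add: A1_def quartic_form.expand)
    qed
    show "(\<lambda>f. (qc1 f, qc2 f, qc3 f, qc4 f)) ` A1 \<subseteq> int_ball r \<times> int_ball r \<times> int_ball r \<times> int_ball r"
    proof (rule image_subsetI)
      fix f assume "f \<in> A1"
      then show "(qc1 f, qc2 f, qc3 f, qc4 f) \<in> int_ball r \<times> int_ball r \<times> int_ball r \<times> int_ball r"
        by (cases f) (simp add: A1_def int_box_iff)
    qed
  qed
  have c2: "real (card A2) \<le> 81 * r ^ 4"
  proof (rule card_le_of_four_coordinates[OF r, of "\<lambda>f. (qc0 f, qc1 f, qc2 f, qc4 f)"])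
    show "inj_on (\<lambda>f. (qc0 f, qc1 f, qc2 f, qc4 f)) A2"
    proof (rule inj_onI)
      fix f g assume f: "f \<in> A2" and g: "g \<in> A2" and "(qc0 f, qc1 f, qc2 f, qc4 f) = (qc0 g, qc1 g, qc2 g, qc4 g)"
      then have eq: "qc0 f = qc0 g" "qc1 f = qc1 g" "qc2 f = qc2 g" "qc4 f = qc4 g" by auto
      have "form_R f = form_R g" using f g by (simp add: A2_def)
      then have "8 * qc0 f ^ 2 * qc3 f = 8 * qc0 f ^ 2 * qc3 g"
        by (simp add: form_R_def eq)
      then have "qc3 f = qc3 g" using f by (simp add: A2_def)
      with eq show "f = g" by (simp add: quartic_form.expand)
    qed
    show "(\<lambda>f. (qc0 f, qc1 f, qc2 f, qc4 f)) ` A2 \<subseteq> int_ball r \<times> int_ball r \<times> int_ball r \<times> int_ball r"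
    proof (rule image_subsetI)
      fix f assume "f \<in> A2"
      then show "(qc0 f, qc1 f, qc2 f, qc4 f) \<in> int_ball r \<times> int_ball r \<times> int_ball r \<times> int_ball r"
        by (cases f) (simp add: A2_def int_box_iff)
    qed
  qed
  have c3: "real (card A3) \<le> 81 * r ^ 4"
  proof (rule card_le_of_four_coordinates[OF r, of "\<lambda>f. (qc0 f, qc1 f, qc2 f, qc3 f)"])
    show "inj_on (\<lambda>f. (qc0 f, qc1 f, qc2 f, qc3 f)) A3"
    proof (rule inj_onI)
      fix f g assume f: "f \<in> A3" and g: "g \<in> A3" and "(qc0 f, qc1 f, qc2 f, qc3 f) = (qc0 g, qc1 g, qc2 g, qc3 g)"
      then have eq: "qc0 g = qc0 f" "qc1 g = qc1 f" "qc2 g = qc2 f" "qc3 g = qc3 f" by auto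
      have "9 * ((8 * qc0 f * qc2 f - 3 * qc1 f ^ 2) * (qc4 f - qc4 g)) = inv_J f - inv_J g"
        by (simp add: inv_J_def eq algebra_simps)
      then have "(8 * qc0 f * qc2 f - 3 * qc1 f ^ 2) * (qc4 f - qc4 g) = 0"
        using f g by (simp add: A3_def)
      then have "qc4 f = qc4 g" using f by (auto simp: A3_def)
      with eq show "f = g" by (simp add: quartic_form.expand)
    qed
    show "(\<lambda>f. (qc0 f, qc1 f, qc2 f, qc3 f)) ` A3 \<subseteq> int_ball r \<times> int_ball r \<times> int_ball r \<times> int_ball r"
    proof (rule image_subsetI)
      fix f assume "f \<in> A3"
      then show "(qc0 f, qc1 f, qc2 f, qc3 f) \<in> int_ball r \<times> int_ball r \<times> int_ball r \<times> int_ball r"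
        by (cases f) (simp add: A3_def int_box_iff)
    qed
  qed
  have c4: "real (card A4) \<le> 81 * r ^ 4"
  proof (rule card_le_of_four_coordinates[OF r, of "\<lambda>f. (qc0 f, qc1 f, qc3 f, qc4 f)"])
    show "inj_on (\<lambda>f. (qc0 f, qc1 f, qc3 f, qc4 f)) A4"
    proof (rule inj_onI)
      fix f g assume f: "f \<in> A4" and g: "g \<in> A4" and "(qc0 f, qc1 f, qc3 f, qc4 f) = (qc0 g, qc1 g, qc3 g, qc4 g)"
      then have eq: "qc0 f = qc0 g" "qc1 f = qc1 g" "qc3 f = qc3 g" "qc4 f = qc4 g" by auto
      have "8 * qc0 g * qc2 f = 8 * qc0 g * qc2 g"
        using f g by (simp add: A4_def eq)
      then have "qc2 f = qc2 g" using g by (simp add: A4_def)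
      with eq show "f = g" by (simp add: quartic_form.expand)
    qed
    show "(\<lambda>f. (qc0 f, qc1 f, qc3 f, qc4 f)) ` A4 \<subseteq> int_ball r \<times> int_ball r \<times> int_ball r \<times> int_ball r"
    proof (rule image_subsetI)
      fix f assume "f \<in> A4"
      then show "(qc0 f, qc1 f, qc3 f, qc4 f) \<in> int_ball r \<times> int_ball r \<times> int_ball r \<times> int_ball r"
        by (cases f) (simp add: A4_def int_box_iff)
    qed
  qed
  show ?thesis using le c1 c2 c3 c4 by linarith
qed

text \<open>
  The first three coefficients determine \<open>form_P\<close>, hence \<open>form_R\<close> up to
  sign, hence the fourth coefficient.
\<close>

lemma form_Delta_zero_count:
  assumes r: "r \<ge> 1"
  shows "real (card {f \<in> int_box r. qc0 f = 0 \<or> form_Delta f = 0}) \<le> 243 * r ^ 4"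
proof -
  define A1 where "A1 = {f \<in> int_box r. qc0 f = 0}"
  define A2 where "A2 = {f \<in> int_box r. qc0 f \<noteq> 0 \<and> form_Delta f = 0 \<and> form_R f \<ge> 0}"
  define A3 where "A3 = {f \<in> int_box r. qc0 f \<noteq> 0 \<and> form_Delta f = 0 \<and> form_R f < 0}"
  have fin: "finite A1" "finite A2" "finite A3"
    by (simp_all add: A1_def A2_def A3_def finite_int_box)
  have "{f \<in> int_box r. qc0 f = 0 \<or> form_Delta f = 0} \<subseteq> A1 \<union> (A2 \<union> A3)"
    by (auto simp: A1_def A2_def A3_def)
  then have "card {f \<in> int_box r. qc0 f = 0 \<or> form_Delta f = 0} \<le> card (A1 \<union> (A2 \<union> A3))"
    using fin by (intro card_mono) auto
  also have "\<dots> \<le> card A1 + (card A2 + card A3)"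
    using card_Un_le[of A1 "A2 \<union> A3"] card_Un_le[of A2 A3] by linarith
  finally have le: "real (card {f \<in> int_box r. qc0 f = 0 \<or> form_Delta f = 0}) \<le>
      real (card A1) + (real (card A2) + real (card A3))"
    by (simp only: of_nat_add[symmetric] of_nat_le_iff)
  have c1: "real (card A1) \<le> 81 * r ^ 4"
  proof (rule card_le_of_four_coordinates[OF r, of "\<lambda>f. (qc1 f, qc2 f, qc3 f, qc4 f)"])
    show "inj_on (\<lambda>f. (qc1 f, qc2 f, qc3 f, qc4 f)) A1"
    proof (rule inj_onI)
      fix f g assume "f \<in> A1" "g \<in> A1" "(qc1 f, qc2 f, qc3 f, qc4 f) = (qc1 g, qc2 g, qc3 g, qc4 g)"
      then show "f = g" by (simp add: A1_def quartic_form.expand)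
    qed
    show "(\<lambda>f. (qc1 f, qc2 f, qc3 f, qc4 f)) ` A1 \<subseteq> int_ball r \<times> int_ball r \<times> int_ball r \<times> int_ball r"
    proof (rule image_subsetI)
      fix f assume "f \<in> A1"
      then show "(qc1 f, qc2 f, qc3 f, qc4 f) \<in> int_ball r \<times> int_ball r \<times> int_ball r \<times> int_ball r"
        by (cases f) (simp add: A1_def int_box_iff)
    qed
  qed
  have same: "f = g" if eq: "qc0 f = qc0 g" "qc1 f = qc1 g" "qc2 f = qc2 g" "qc4 f = qc4 g"
    and R: "form_R f = form_R g" and a: "qc0 f \<noteq> 0" for f g :: "int quartic_form"
  proof -
    have "8 * qc0 f ^ 2 * qc3 f = 8 * qc0 f ^ 2 * qc3 g"
      using R by (simp add: form_R_def eq)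
    then have "qc3 f = qc3 g" using a by simp
    with eq show "f = g" by (simp add: quartic_form.expand)
  qed
  have R2: "form_R f ^ 2 = form_R g ^ 2" if "form_P f = form_P g" "form_Delta f = 0" "form_Delta g = 0" for f g
    using that by (simp add: form_Delta_def)
  have img: "(\<lambda>f. (qc0 f, qc1 f, qc2 f, qc4 f)) ` A \<subseteq> int_ball r \<times> int_ball r \<times> int_ball r \<times> int_ball r"
    if "A \<subseteq> int_box r" for A
  proof (rule image_subsetI)
    fix f assume "f \<in> A"
    with that show "(qc0 f, qc1 f, qc2 f, qc4 f) \<in> int_ball r \<times> int_ball r \<times> int_ball r \<times> int_ball r"
      by (cases f) (auto simp: int_box_iff)
  qed
  have c2: "real (card A2) \<le> 81 * r ^ 4"
  proof (rule card_le_of_four_coordinates[OF r _ img])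
    show "inj_on (\<lambda>f. (qc0 f, qc1 f, qc2 f, qc4 f)) A2"
    proof (rule inj_onI)
      fix f g assume f: "f \<in> A2" and g: "g \<in> A2" and "(qc0 f, qc1 f, qc2 f, qc4 f) = (qc0 g, qc1 g, qc2 g, qc4 g)"
      then have eq: "qc0 f = qc0 g" "qc1 f = qc1 g" "qc2 f = qc2 g" "qc4 f = qc4 g" by auto
      have "form_R f ^ 2 = form_R g ^ 2" using f g eq by (intro R2) (auto simp: A2_def form_P_def)
      then have "form_R f = form_R g" using f g power2_eq_imp_eq by (auto simp: A2_def)
      then show "f = g" using eq f by (intro same) (auto simp: A2_def)
    qed
  qed (auto simp: A2_def)
  have c3: "real (card A3) \<le> 81 * r ^ 4"
  proof (rule card_le_of_four_coordinates[OF r _ img])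
    show "inj_on (\<lambda>f. (qc0 f, qc1 f, qc2 f, qc4 f)) A3"
    proof (rule inj_onI)
      fix f g assume f: "f \<in> A3" and g: "g \<in> A3" and "(qc0 f, qc1 f, qc2 f, qc4 f) = (qc0 g, qc1 g, qc2 g, qc4 g)"
      then have eq: "qc0 f = qc0 g" "qc1 f = qc1 g" "qc2 f = qc2 g" "qc4 f = qc4 g" by auto
      have "form_R f ^ 2 = form_R g ^ 2" using f g eq by (intro R2) (auto simp: A3_def form_P_def)
      then have "(- form_R f) ^ 2 = (- form_R g) ^ 2" by simp
      then have "- form_R f = - form_R g"
        using f g by (intro power2_eq_imp_eq[of "- form_R f"]) (auto simp: A3_def)
      then show "f = g" using eq f by (intro same) (auto simp: A3_def)
    qed
  qed (auto simp: A3_def)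
  show ?thesis using le c1 c2 c3 by linarith
qed

lemma cube_eq_square_int:
  fixes P R :: int
  assumes "P ^ 3 = R ^ 2"
  obtains w where "P = w ^ 2" "R = w ^ 3"
proof (cases "P = 0")
  case True
  then have "P = 0 ^ 2" "R = 0 ^ 3" using assms by auto
  then show ?thesis using that by blast
next
  case False
  have "P ^ 2 dvd R ^ 2" unfolding assms[symmetric] by (simp add: le_imp_power_dvd)
  then have "P dvd R" by simp
  then obtain w where w: "R = P * w" by blast
  have "P ^ 2 * P = P ^ 2 * w ^ 2"
    using assms by (simp add: w power_mult_distrib eval_nat_numeral)
  then have "P = w ^ 2" using False by simp
  moreover from this have "R = w ^ 3" by (simp add: w eval_nat_numeral)
  ultimately show ?thesis using that by blast
qed

lemma card_int_divisors_le:
  fixes n :: int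
  assumes "n \<noteq> 0"
  shows "finite {u. u dvd n}" "card {u. u dvd n} \<le> 2 * card {d::nat. int d dvd n}"
proof -
  have sub: "{u. u dvd n} \<subseteq> int ` {d::nat. int d dvd n} \<union> (\<lambda>d. - int d) ` {d::nat. int d dvd n}"
  proof
    fix u assume "u \<in> {u. u dvd n}"
    then have "int (nat \<bar>u\<bar>) dvd n" by simp
    moreover have "u = int (nat \<bar>u\<bar>) \<or> u = - int (nat \<bar>u\<bar>)" by auto
    ultimately show "u \<in> int ` {d::nat. int d dvd n} \<union> (\<lambda>d. - int d) ` {d::nat. int d dvd n}" by blast
  qed
  have "{d::nat. int d dvd n} \<subseteq> {..nat \<bar>n\<bar>}"
  proof
    fix d :: nat assume "d \<in> {d::nat. int d dvd n}"
    then have "int d \<le> \<bar>n\<bar>" using assms dvd_imp_le_int[of n "int d"] by simp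
    then show "d \<in> {..nat \<bar>n\<bar>}" by simp
  qed
  then have fin: "finite {d::nat. int d dvd n}" by (rule finite_subset) simp
  then show "finite {u. u dvd n}" using sub finite_subset by blast
  have "card {u. u dvd n} \<le> card (int ` {d::nat. int d dvd n} \<union> (\<lambda>d. - int d) ` {d::nat. int d dvd n})"
    using sub fin by (intro card_mono) auto
  also have "\<dots> \<le> card (int ` {d::nat. int d dvd n}) + card ((\<lambda>d. - int d) ` {d::nat. int d dvd n})"
    by (rule card_Un_le)
  also have "\<dots> \<le> card {d::nat. int d dvd n} + card {d::nat. int d dvd n}"
    by (intro add_mono card_image_le fin)
  finally show "card {u. u dvd n} \<le> 2 * card {d::nat. int d dvd n}" by simp
qed

text \<open>
  If \<open>I = J = 0\<close> then \<open>form_P = 3 w^2\<close> and \<open>form_R = w^3\<close>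
  for an integer \<open>w\<close>, and the definition of \<open>form_P\<close> becomes \<open>3
  (a1 - w) (a1 + w) = 8 a0 a2\<close>. Given nonzero \<open>a0\<close> and \<open>a2\<close>, the
  factor \<open>a1 - w\<close> is one of few divisors; it determines \<open>a1\<close> and
  \<open>w\<close>, and then \<open>form_R\<close> and \<open>I\<close> determine the remaining
  coefficients.
\<close>

lemma triple_root_count:
  fixes T N r :: real
  assumes r: "r \<ge> 1" and T1: "T \<ge> 1" and N: "8 * r ^ 2 \<le> N"
    and T: "\<And>n::int. n \<noteq> 0 \<Longrightarrow> \<bar>real_of_int n\<bar> \<le> N \<Longrightarrow> real (card {d::nat. int d dvd n}) \<le> T"
  shows "real (card {f \<in> int_box r. inv_I f = 0 \<and> inv_J f = 0}) \<le> 54 * T * r ^ 2"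
proof -
  define A where "A = {f \<in> int_box r. inv_I f = 0 \<and> inv_J f = 0}"
  define A1 where "A1 = {f \<in> A. qc0 f = 0 \<and> qc1 f = 0}"
  define A2 where "A2 = {f \<in> A. qc0 f = 0 \<and> qc1 f \<noteq> 0}"
  define w where "w = (\<lambda>f. SOME w. form_P f = 3 * w ^ 2 \<and> form_R f = w ^ 3)"
  define A3 where "A3 = {f \<in> A. qc0 f \<noteq> 0 \<and> qc2 f = 0 \<and> w f = qc1 f}"
  define A4 where "A4 = {f \<in> A. qc0 f \<noteq> 0 \<and> qc2 f = 0 \<and> w f = - qc1 f}"
  define A5 where "A5 = {f \<in> A. qc0 f \<noteq> 0 \<and> qc2 f \<noteq> 0}"
  have finA: "finite A" by (simp add: A_def finite_int_box)
  then have fin: "finite A1" "finite A2" "finite A3" "finite A4" "finite A5"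
    by (simp_all add: A1_def A2_def A3_def A4_def A5_def)
  have w: "form_P f = 3 * w f ^ 2 \<and> form_R f = w f ^ 3" if "f \<in> A" for f
  proof -
    have "form_P f ^ 3 = 27 * form_R f ^ 2"
      using form_Delta_eq[of f] that by (simp add: A_def form_Delta_def)
    then have eq: "form_P f ^ 3 = 3 * (9 * form_R f ^ 2)" by simp
    then have "3 dvd form_P f ^ 3" by simp
    then have "3 dvd form_P f" using prime_dvd_power[of "3::int"] by simp
    then obtain P where P: "form_P f = 3 * P" by blast
    have "P ^ 3 = form_R f ^ 2" using eq by (simp add: P power_mult_distrib)
    then obtain v where "P = v ^ 2" "form_R f = v ^ 3" using cube_eq_square_int by blast
    then have "form_P f = 3 * v ^ 2 \<and> form_R f = v ^ 3" by (simp add: P)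
    then show ?thesis unfolding w_def by (rule someI)
  qed
  have bw: "3 * ((qc1 f - w f) * (qc1 f + w f)) = 8 * qc0 f * qc2 f" if "f \<in> A" for f
    using w[OF that] by (simp add: form_P_def algebra_simps power2_eq_square)
  have "A \<subseteq> A1 \<union> (A2 \<union> (A3 \<union> (A4 \<union> A5)))"
  proof
    fix f assume f: "f \<in> A"
    show "f \<in> A1 \<union> (A2 \<union> (A3 \<union> (A4 \<union> A5)))"
    proof (cases "qc0 f \<noteq> 0 \<and> qc2 f = 0")
      case True
      then have "(qc1 f - w f) * (qc1 f + w f) = 0" using bw[OF f] by simp
      then have "w f = qc1 f \<or> w f = - qc1 f" by auto
      then show ?thesis using f True by (auto simp: A3_def A4_def)
    qed (use f in \<open>auto simp: A1_def A2_def A5_def\<close>)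
  qed
  then have "card A \<le> card (A1 \<union> (A2 \<union> (A3 \<union> (A4 \<union> A5))))"
    using fin by (intro card_mono) auto
  also have "\<dots> \<le> card A1 + (card A2 + (card A3 + (card A4 + card A5)))"
    using card_Un_le[of A1 "A2 \<union> (A3 \<union> (A4 \<union> A5))"] card_Un_le[of A2 "A3 \<union> (A4 \<union> A5)"]
      card_Un_le[of A3 "A4 \<union> A5"] card_Un_le[of A4 A5] by linarith
  finally have le: "real (card A) \<le> real (card A1) + (real (card A2) + (real (card A3) + (real (card A4) + real (card A5))))"
    by (simp only: of_nat_add[symmetric] of_nat_le_iff)
  have box: "qc0 f \<in> int_ball r \<and> qc1 f \<in> int_ball r \<and> qc2 f \<in> int_ball r \<and> qc3 f \<in> int_ball r \<and> qc4 f \<in> int_ball r"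
    if "f \<in> A" for f
    using that by (cases f) (simp add: A_def int_box_iff)
  have determined: "f = g" if fg: "f \<in> A" "g \<in> A" and a: "qc0 f \<noteq> 0"
    and eq: "qc0 f = qc0 g" "qc1 f = qc1 g" "qc2 f = qc2 g" "w f = w g" for f g
  proof -
    have "form_R f = form_R g" using w[OF fg(1)] w[OF fg(2)] eq(4) by simp
    then have "8 * qc0 f ^ 2 * qc3 f = 8 * qc0 f ^ 2 * qc3 g"
      by (simp add: form_R_def eq)
    then have 3: "qc3 f = qc3 g" using a by simp
    have "inv_I f = inv_I g" using fg by (simp add: A_def)
    then have "12 * qc0 f * qc4 f = 12 * qc0 f * qc4 g"
      by (simp add: inv_I_def eq 3)
    then have "qc4 f = qc4 g" using a by simp
    with eq 3 show ?thesis by (simp add: quartic_form.expand)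
  qed
  have c1: "real (card A1) \<le> 9 * r ^ 2"
  proof (rule card_le_of_two_coordinates[OF r, of "\<lambda>f. (qc3 f, qc4 f)"])
    show "inj_on (\<lambda>f. (qc3 f, qc4 f)) A1"
    proof (rule inj_onI)
      fix f g assume fg: "f \<in> A1" "g \<in> A1" and "(qc3 f, qc4 f) = (qc3 g, qc4 g)"
      moreover have "qc2 f = 0" "qc2 g = 0" using fg by (auto simp: A1_def A_def inv_I_def)
      ultimately show "f = g" by (simp add: A1_def quartic_form.expand)
    qed
    show "(\<lambda>f. (qc3 f, qc4 f)) ` A1 \<subseteq> int_ball r \<times> int_ball r" using box by (auto simp: A1_def)
  qed
  have c2: "real (card A2) \<le> 9 * r ^ 2"
  proof (rule card_le_of_two_coordinates[OF r, of "\<lambda>f. (qc1 f, qc2 f)"])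
    show "inj_on (\<lambda>f. (qc1 f, qc2 f)) A2"
    proof (rule inj_onI)
      fix f g assume fg: "f \<in> A2" "g \<in> A2" and "(qc1 f, qc2 f) = (qc1 g, qc2 g)"
      then have eq: "qc1 f = qc1 g" "qc2 f = qc2 g" "qc0 f = 0" "qc0 g = 0" by (auto simp: A2_def)
      have b: "qc1 g \<noteq> 0" using fg by (simp add: A2_def)
      have "3 * qc1 g * qc3 f = 3 * qc1 g * qc3 g"
        using fg by (simp add: A2_def A_def inv_I_def eq)
      then have 3: "qc3 f = qc3 g" using b by simp
      have "inv_J f = inv_J g" using fg by (simp add: A2_def A_def)
      then have "27 * (qc1 g ^ 2 * qc4 f) = 27 * (qc1 g ^ 2 * qc4 g)"
        by (simp add: inv_J_def eq 3)
      then have "qc4 f = qc4 g" using b by simp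
      with eq 3 show "f = g" by (simp add: quartic_form.expand)
    qed
    show "(\<lambda>f. (qc1 f, qc2 f)) ` A2 \<subseteq> int_ball r \<times> int_ball r" using box by (auto simp: A2_def)
  qed
  have c3: "real (card A3) \<le> 9 * r ^ 2"
  proof (rule card_le_of_two_coordinates[OF r, of "\<lambda>f. (qc0 f, qc1 f)"])
    show "inj_on (\<lambda>f. (qc0 f, qc1 f)) A3"
      by (rule inj_onI, rule determined) (auto simp: A3_def)
    show "(\<lambda>f. (qc0 f, qc1 f)) ` A3 \<subseteq> int_ball r \<times> int_ball r" using box by (auto simp: A3_def)
  qed
  have c4: "real (card A4) \<le> 9 * r ^ 2"
  proof (rule card_le_of_two_coordinates[OF r, of "\<lambda>f. (qc0 f, qc1 f)"])
    show "inj_on (\<lambda>f. (qc0 f, qc1 f)) A4"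
      by (rule inj_onI, rule determined) (auto simp: A4_def)
    show "(\<lambda>f. (qc0 f, qc1 f)) ` A4 \<subseteq> int_ball r \<times> int_ball r" using box by (auto simp: A4_def)
  qed
  have c5: "real (card A5) \<le> 18 * T * r ^ 2"
  proof -
    define B where "B = int_ball r - {0}"
    define S where "S = (SIGMA z:B \<times> B. {u. u dvd 8 * fst z * snd z})"
    define g where "g = (\<lambda>f. ((qc0 f, qc2 f), qc1 f - w f))"
    have finB: "finite B" by (simp add: B_def finite_int_ball)
    have nz: "8 * fst z * snd z \<noteq> 0" if "z \<in> B \<times> B" for z using that by (auto simp: B_def)
    have finS: "finite S" unfolding S_def
      using finB nz card_int_divisors_le(1) by (intro finite_SigmaI) auto
    have "g ` A5 \<subseteq> S"
    proof (rule image_subsetI)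
      fix f assume f: "f \<in> A5"
      then have "qc1 f - w f dvd 8 * qc0 f * qc2 f"
        unfolding bw[symmetric, of f] using A5_def by (auto simp: bw[symmetric])
      then show "g f \<in> S" using f box by (auto simp: g_def S_def B_def A5_def)
    qed
    moreover have "inj_on g A5"
    proof (rule inj_onI)
      fix f h assume fh: "f \<in> A5" "h \<in> A5" and "g f = g h"
      then have eq: "qc0 f = qc0 h" "qc2 f = qc2 h" "qc1 f - w f = qc1 h - w h" by (auto simp: g_def)
      have A: "f \<in> A" "h \<in> A" using fh by (auto simp: A5_def)
      have prod: "3 * ((qc1 f - w f) * (qc1 f + w f)) = 3 * ((qc1 f - w f) * (qc1 h + w h))"
        using bw[OF A(1)] bw[OF A(2)] eq by simp
      have "qc1 f - w f \<noteq> 0" using bw[OF A(1)] fh(1) by (auto simp: A5_def)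
      with prod have "qc1 f + w f = qc1 h + w h" by simp
      with eq(3) have "qc1 f = qc1 h" "w f = w h" by linarith+
      then show "f = h" using eq fh A by (intro determined) (auto simp: A5_def)
    qed
    ultimately have "card A5 \<le> card S" using finS by (intro card_inj_on_le)
    also have "card S = (\<Sum>z\<in>B \<times> B. card {u. u dvd 8 * fst z * snd z})"
      unfolding S_def using finB nz card_int_divisors_le(1) by (intro card_SigmaI) auto
    finally have "real (card A5) \<le> (\<Sum>z\<in>B \<times> B. real (card {u. u dvd 8 * fst z * snd z}))"
      by (simp only: of_nat_sum[symmetric] of_nat_le_iff)
    also have "\<dots> \<le> (\<Sum>z\<in>B \<times> B. 2 * T)"
    proof (rule sum_mono)
      fix z assume z: "z \<in> B \<times> B"
      have "\<bar>real_of_int (8 * fst z * snd z)\<bar> = 8 * (\<bar>real_of_int (fst z)\<bar> * \<bar>real_of_int (snd z)\<bar>)"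
        by (simp add: abs_mult)
      also have "\<dots> \<le> 8 * (r * r)"
        using z r by (intro mult_left_mono mult_mono) (auto simp: B_def int_ball_def)
      also have "\<dots> \<le> N" using N by (simp add: power2_eq_square)
      finally have "real (card {d::nat. int d dvd 8 * fst z * snd z}) \<le> T" by (rule T[OF nz[OF z]])
      then show "real (card {u. u dvd 8 * fst z * snd z}) \<le> 2 * T"
        using card_int_divisors_le(2)[OF nz[OF z]] by linarith
    qed
    also have "\<dots> = real (card B) ^ 2 * (2 * T)"
      by (simp add: card_cartesian_product power2_eq_square)
    also have "\<dots> \<le> (3 * r) ^ 2 * (2 * T)"
    proof (intro mult_right_mono power_mono)
      have "card B \<le> card (int_ball r)" unfolding B_def by (intro card_mono finite_int_ball) auto
      then show "real (card B) \<le> 3 * r" using card_int_ball[OF r] by linarith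
    qed (use T1 in auto)
    finally show ?thesis by (simp add: power_mult_distrib mult_ac)
  qed
  have "r ^ 2 \<le> T * r ^ 2" using T1 by (simp add: mult_le_cancel_right1)
  then show ?thesis using le c1 c2 c3 c4 c5 unfolding A_def by simp
qed

section \<open>Moduli at which a form has a triple root\<close>

text \<open>
  For \<open>p > 3\<close>, the form has a triple root modulo \<open>p\<close> exactly if
  \<open>p\<close> divides \<open>I\<close> and \<open>J\<close>.
\<close>

definition triple_root_moduli :: "int quartic_form \<Rightarrow> nat set" where
  "triple_root_moduli f = {q. squarefree q \<and> coprime q 6 \<and> int q dvd inv_I f \<and> int q dvd inv_J f \<and>
     (\<forall>p. prime p \<longrightarrow> p dvd q \<longrightarrow> \<not> form_dvd (int p) f)}"

text \<open>
  The condition \<open>I \<equiv> 0\<close> modulo \<open>q\<close> determines the last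
  coefficient only modulo \<open>q / gcd(a0, q)\<close>; the bound on the gcd keeps this modulus
  at least \<open>sqrt q\<close>.
\<close>

definition transversal_moduli :: "int quartic_form \<Rightarrow> nat set" where
  "transversal_moduli f = {q. q > 0 \<and> coprime q 6 \<and> int q dvd inv_I f \<and> int q dvd inv_J f \<and>
     gcd (qc0 f) (int q) ^ 2 \<le> int q}"

text \<open>
  A form whose invariants vanish modulo \<open>p\<close> has a triple root there, and so at most
  one other root.
\<close>

lemma (in prime_gt_3) triple_root_values:
  assumes I: "int p dvd inv_I f" and J: "int p dvd inv_J f"
    and roots: "int p dvd qc0 (translate k1 f)" "int p dvd qc0 (translate k2 f)" "int p dvd qc0 (translate k3 f)"
    and distinct: "\<not> int p dvd k2 - k1" "\<not> int p dvd k3 - k1" "\<not> int p dvd k3 - k2"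
  shows "form_dvd (int p) f"
proof -
  obtain a b c d e where T: "translate k1 f = Quartic a b c d e" by (cases "translate k1 f")
  have a: "int p dvd a" using roots(1) by (simp add: T)
  have "int p dvd inv_I (translate k1 f)" "int p dvd inv_J (translate k1 f)"
    using I J by (simp_all only: inv_I_translate inv_J_translate)
  then have IJ: "int p dvd 12 * a * e - 3 * b * d + c ^ 2"
    "int p dvd 72 * a * c * e + 9 * b * c * d - 27 * (a * d ^ 2 + b ^ 2 * e) - 2 * c ^ 3"
    by (simp_all add: T inv_I_def inv_J_def)
  have "3 * b * d - c ^ 2 = a * (12 * e) - (12 * a * e - 3 * b * d + c ^ 2)" by simp
  also have "int p dvd \<dots>" by (rule dvd_diff[OF dvd_mult2[OF a] IJ(1)])
  finally have c2: "int p dvd 3 * b * d - c ^ 2" .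
  have "c ^ 3 - 27 * b ^ 2 * e = (72 * a * c * e + 9 * b * c * d - 27 * (a * d ^ 2 + b ^ 2 * e) - 2 * c ^ 3)
      - a * (72 * c * e - 27 * d ^ 2) - (3 * b * d - c ^ 2) * (3 * c)"
    by (simp add: algebra_simps power2_eq_square power3_eq_cube)
  also have "int p dvd \<dots>" by (rule dvd_diff[OF dvd_diff[OF IJ(2) dvd_mult2[OF a]] dvd_mult2[OF c2]])
  finally have c3: "int p dvd c ^ 3 - 27 * b ^ 2 * e" .
  have cubic: "int p dvd b + c * u + d * u ^ 2 + e * u ^ 3" if "int p dvd qc0 (translate (k1 + u) f)" "\<not> int p dvd u" for u
  proof -
    have val: "qc0 (translate (k1 + u) f) = a + b * u + c * u ^ 2 + d * u ^ 3 + e * u ^ 4"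
      unfolding translate_translate[symmetric] T by simp
    have eq: "u * (b + c * u + d * u ^ 2 + e * u ^ 3) = (a + b * u + c * u ^ 2 + d * u ^ 3 + e * u ^ 4) - a"
      by (simp add: algebra_simps eval_nat_numeral)
    have "int p dvd u * (b + c * u + d * u ^ 2 + e * u ^ 3)"
      unfolding eq by (rule dvd_diff[OF that(1)[unfolded val] a])
    then show ?thesis by (rule dvd_cancel[OF that(2)])
  qed
  have lin: "int p dvd 3 * b + c * u" if "int p dvd b + c * u + d * u ^ 2 + e * u ^ 3" for u
  proof -
    have "(3 * b + c * u) ^ 3 = (b + c * u + d * u ^ 2 + e * u ^ 3) * (27 * b ^ 2)
        - (3 * b * d - c ^ 2) * (9 * b * u ^ 2) + (c ^ 3 - 27 * b ^ 2 * e) * u ^ 3"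
      by (simp add: algebra_simps power2_eq_square power3_eq_cube)
    also have "int p dvd \<dots>" by (rule dvd_add[OF dvd_diff[OF dvd_mult2[OF that] dvd_mult2[OF c2]] dvd_mult2[OF c3]])
    finally show ?thesis by (simp only: dvd_power_p[OF zero_less_numeral])
  qed
  define u where "u = k2 - k1"
  define v where "v = k3 - k1"
  have nd: "\<not> int p dvd u" "\<not> int p dvd v" "\<not> int p dvd v - u" using distinct by (simp_all add: u_def v_def)
  have cu: "int p dvd b + c * u + d * u ^ 2 + e * u ^ 3" and cv: "int p dvd b + c * v + d * v ^ 2 + e * v ^ 3"
    using cubic[of u] cubic[of v] roots nd by (simp_all add: u_def v_def)
  have "(v - u) * c = (3 * b + c * v) - (3 * b + c * u)" by (simp add: algebra_simps)
  also have "int p dvd \<dots>" by (rule dvd_diff[OF lin[OF cv] lin[OF cu]])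
  finally have c: "int p dvd c" by (rule dvd_cancel[OF nd(3)])
  have "3 * b = (3 * b + c * u) - c * u" by simp
  also have "int p dvd \<dots>" by (rule dvd_diff[OF lin[OF cu] dvd_mult2[OF c]])
  finally have b: "int p dvd b" by (rule dvd_cancel[OF not_dvd_3])
  have de: "int p dvd d + e * u" if "int p dvd b + c * u + d * u ^ 2 + e * u ^ 3" "\<not> int p dvd u" for u
  proof -
    have "u ^ 2 * (d + e * u) = (b + c * u + d * u ^ 2 + e * u ^ 3) - b - c * u"
      by (simp add: algebra_simps eval_nat_numeral)
    also have "int p dvd \<dots>" by (rule dvd_diff[OF dvd_diff[OF that(1) b] dvd_mult2[OF c]])
    finally have "int p dvd u ^ 2 * (d + e * u)" .
    moreover have "\<not> int p dvd u ^ 2" using that(2) dvd_power_p[of 2 u] by simp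
    ultimately show ?thesis using dvd_cancel by blast
  qed
  have "(v - u) * e = (d + e * v) - (d + e * u)" by (simp add: algebra_simps)
  also have "int p dvd \<dots>" by (rule dvd_diff[OF de[OF cv nd(2)] de[OF cu nd(1)]])
  finally have e: "int p dvd e" by (rule dvd_cancel[OF nd(3)])
  have "d = (d + e * u) - e * u" by simp
  also have "int p dvd \<dots>" by (rule dvd_diff[OF de[OF cu nd(1)] dvd_mult2[OF e]])
  finally have "int p dvd d" .
  then have "form_dvd (int p) (translate k1 f)" using a b c e by (simp add: T form_dvd_def)
  then show ?thesis by (simp only: form_dvd_translate_iff)
qed

lemma prime_factor_gt_3:
  assumes "coprime q (6::nat)" "p \<in> prime_factors q"
  shows "prime p \<and> p > 3"
proof -
  have pr: "prime p" "p dvd q" using assms(2) by auto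
  have "\<not> p dvd 6"
    using pr assms(1) by (metis coprime_common_divisor not_prime_unit)
  then have "p \<noteq> 2" "p \<noteq> 3" by auto
  then show ?thesis using pr prime_ge_2_nat[of p] by linarith
qed

lemma gcd_squarefree_eq_prod:
  fixes q :: nat and n :: int
  assumes q: "squarefree q"
  shows "gcd n (int q) = int (\<Prod>p\<in>prime_factors q. if int p dvd n then p else 1)"
proof -
  define d where "d = nat (gcd n (int q))"
  have d: "int d = gcd n (int q)" by (simp add: d_def)
  have q0: "q \<noteq> 0"
  proof
    assume "q = 0"
    with q show False by simp
  qed
  have "int d dvd int q" unfolding d by simp
  then have dq: "d dvd q" by (simp only: int_dvd_int_iff)
  have d0: "d \<noteq> 0" using dq q0 by auto
  have "squarefree d" using dq q squarefree_mono by blast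
  then have "d = \<Prod>(prime_factors d)" by (rule squarefree_eq_prod_prime_factors[symmetric])
  also have "prime_factors d = {p \<in> prime_factors q. int p dvd n}"
  proof (intro equalityI subsetI)
    fix p assume "p \<in> prime_factors d"
    then have "prime p" "p dvd d" by auto
    moreover have "int p dvd int d" using \<open>p dvd d\<close> by (simp only: int_dvd_int_iff)
    then have "int p dvd n" unfolding d by simp
    moreover have "p dvd q" by (rule dvd_trans[OF \<open>p dvd d\<close> dq])
    ultimately show "p \<in> {p \<in> prime_factors q. int p dvd n}"
      using q0 by (simp add: prime_factors_dvd)
  next
    fix p assume "p \<in> {p \<in> prime_factors q. int p dvd n}"
    then have p: "prime p" "p dvd q" "int p dvd n" by auto
    then have "int p dvd int d" unfolding d by simp
    then show "p \<in> prime_factors d" using p d0 by (simp add: prime_factors_dvd)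
  qed
  also have "\<Prod>{p \<in> prime_factors q. int p dvd n} = (\<Prod>p\<in>prime_factors q. if int p dvd n then p else 1)"
    by (rule prod.inter_filter) simp
  finally show ?thesis using d by simp
qed

text \<open>
  Modulo each prime divisor of \<open>q\<close> at most two of the four values \<open>f(1,0), ...,
  f(1,3)\<close> vanish. So the product of the four gcds is at most \<open>q^2\<close>, and one of
  them is at most \<open>sqrt q\<close>.
\<close>

lemma exists_transversal_translate:
  assumes q: "q \<in> triple_root_moduli f"
  shows "\<exists>k\<in>{0..3}. q \<in> transversal_moduli (translate k f)"
proof -
  have sq: "squarefree q" and cop: "coprime q 6" and I: "int q dvd inv_I f" and J: "int q dvd inv_J f"
    and nd: "\<And>p. prime p \<Longrightarrow> p dvd q \<Longrightarrow> \<not> form_dvd (int p) f"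
    using q by (auto simp: triple_root_moduli_def)
  have q0: "q > 0"
  proof (rule ccontr)
    assume "\<not> q > 0"
    with sq show False by simp
  qed
  define H where "H = (\<lambda>k. qc0 (translate k f))"
  define g where "g = (\<lambda>k. \<Prod>p\<in>prime_factors q. if int p dvd H k then p else 1)"
  have gcd: "gcd (H k) (int q) = int (g k)" for k
    unfolding g_def by (rule gcd_squarefree_eq_prod[OF sq])
  have "g 0 * g 1 * g 2 * g 3 = (\<Prod>p\<in>prime_factors q. (if int p dvd H 0 then p else 1) * (if int p dvd H 1 then p else 1)
      * (if int p dvd H 2 then p else 1) * (if int p dvd H 3 then p else 1))"
    by (simp only: g_def prod.distrib)
  also have "\<dots> \<le> (\<Prod>p\<in>prime_factors q. p ^ 2)"
  proof (rule prod_mono)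
    fix p assume p: "p \<in> prime_factors q"
    have p3: "prime p" "p > 3" using prime_factor_gt_3[OF cop p] by auto
    then interpret prime_gt_3 p by unfold_locales
    have pq: "int p dvd int q" using p by auto
    have small: "\<not> int p dvd j - i" if "i \<in> {0..3}" "j \<in> {0..3}" "i \<noteq> j" for i j :: int
      using that p3 zdvd_imp_le[of "int p" "\<bar>j - i\<bar>"] by auto
    have three: "\<not> (int p dvd H k1 \<and> int p dvd H k2 \<and> int p dvd H k3)"
      if "k1 \<in> {0..3}" "k2 \<in> {0..3}" "k3 \<in> {0..3}" "k1 \<noteq> k2" "k1 \<noteq> k3" "k2 \<noteq> k3" for k1 k2 k3
    proof
      assume A: "int p dvd H k1 \<and> int p dvd H k2 \<and> int p dvd H k3"
      have "form_dvd (int p) f"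
      proof (rule triple_root_values)
        show "int p dvd inv_I f" by (rule dvd_trans[OF pq I])
        show "int p dvd inv_J f" by (rule dvd_trans[OF pq J])
        show "int p dvd qc0 (translate k1 f)" "int p dvd qc0 (translate k2 f)" "int p dvd qc0 (translate k3 f)"
          using A unfolding H_def by simp_all
        show "\<not> int p dvd k2 - k1" "\<not> int p dvd k3 - k1" "\<not> int p dvd k3 - k2"
          using that by (simp_all add: small)
      qed
      moreover have "p dvd q" using p by auto
      ultimately show False using nd[OF p3(1)] by simp
    qed
    have "(if int p dvd H 0 then p else 1) * (if int p dvd H 1 then p else 1)
      * (if int p dvd H 2 then p else 1) * (if int p dvd H 3 then p else 1) \<le> p ^ 2"
      using three[of 0 1 2] three[of 0 1 3] three[of 0 2 3] three[of 1 2 3] p3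
      by (simp add: power2_eq_square split: if_split)
    then show "0 \<le> (if int p dvd H 0 then p else 1) * (if int p dvd H 1 then p else 1)
      * (if int p dvd H 2 then p else 1) * (if int p dvd H 3 then p else 1) \<and>
      (if int p dvd H 0 then p else 1) * (if int p dvd H 1 then p else 1)
      * (if int p dvd H 2 then p else 1) * (if int p dvd H 3 then p else 1) \<le> p ^ 2" by simp
  qed
  also have "\<dots> = (\<Prod>(prime_factors q)) ^ 2" by (rule prod_power_distrib[symmetric])
  also have "\<dots> = q ^ 2" by (simp only: squarefree_eq_prod_prime_factors[OF sq])
  finally have prod: "g 0 * g 1 * g 2 * g 3 \<le> q ^ 2" .
  have "\<exists>k\<in>{0..3}. g k ^ 2 \<le> q"
  proof (rule ccontr)
    assume "\<not> ?thesis"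
    then have gt: "q < g 0 ^ 2" "q < g 1 ^ 2" "q < g 2 ^ 2" "q < g 3 ^ 2"
      by (auto simp: not_le)
    have 1: "q * q < g 0 ^ 2 * g 1 ^ 2" by (rule mult_strict_mono'[OF gt(1,2)]) simp_all
    have 2: "q * q < g 2 ^ 2 * g 3 ^ 2" by (rule mult_strict_mono'[OF gt(3,4)]) simp_all
    have "(q * q) * (q * q) < (g 0 ^ 2 * g 1 ^ 2) * (g 2 ^ 2 * g 3 ^ 2)"
      by (rule mult_strict_mono'[OF 1 2]) simp_all
    also have "\<dots> = (g 0 * g 1 * g 2 * g 3) ^ 2" by (simp add: power_mult_distrib mult.assoc)
    also have "\<dots> \<le> (q ^ 2) ^ 2" using prod by (intro power_mono) auto
    finally show False by (simp add: eval_nat_numeral)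
  qed
  then obtain k where k: "k \<in> {0..3}" "g k ^ 2 \<le> q" by blast
  then have "int (g k ^ 2) \<le> int q" by (simp only: of_nat_le_iff)
  then have "gcd (H k) (int q) ^ 2 \<le> int q" unfolding gcd by simp
  then have "q \<in> transversal_moduli (translate k f)"
    using q0 cop I J by (simp add: transversal_moduli_def H_def inv_I_translate inv_J_translate)
  with k show ?thesis by blast
qed

lemma card_residue_class_le:
  assumes A: "A \<subseteq> int_ball r" and m: "m > (0::int)" and r: "r \<ge> 0"
    and pair: "\<And>x y. x \<in> A \<Longrightarrow> y \<in> A \<Longrightarrow> m dvd x - y"
  shows "real (card A) \<le> 2 * r / real_of_int m + 2"
proof -
  have inj: "inj_on (\<lambda>x. x div m) A"
  proof (rule inj_onI)
    fix x y assume xy: "x \<in> A" "y \<in> A" "x div m = y div m"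
    moreover have "x mod m = y mod m" using pair[OF xy(1,2)] by (simp add: mod_eq_dvd_iff)
    ultimately show "x = y" by (metis div_mult_mod_eq)
  qed
  define lo where "lo = (- \<lfloor>r\<rfloor>) div m"
  define hi where "hi = \<lfloor>r\<rfloor> div m"
  have "(\<lambda>x. x div m) ` A \<subseteq> {lo..hi}"
    using A m by (auto simp: int_ball_eq lo_def hi_def intro!: zdiv_mono1)
  then have "card A \<le> card {lo..hi}"
    using inj by (intro card_inj_on_le) auto
  also have "\<dots> = nat (hi - lo + 1)" by simp
  finally have "real (card A) \<le> real (nat (hi - lo + 1))" by simp
  also have "\<dots> \<le> 2 * r / real_of_int m + 2"
  proof -
    have f: "real_of_int \<lfloor>r\<rfloor> \<le> r" by simp
    have hi: "real_of_int hi \<le> r / real_of_int m"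
    proof -
      have "real_of_int hi \<le> real_of_int \<lfloor>r\<rfloor> / real_of_int m" unfolding hi_def by (rule real_of_int_div4)
      also have "\<dots> \<le> r / real_of_int m" using f m by (intro divide_right_mono) auto
      finally show ?thesis .
    qed
    have lo: "- (r / real_of_int m) - 1 \<le> real_of_int lo"
    proof -
      have "real_of_int (- \<lfloor>r\<rfloor>) / real_of_int m - real_of_int lo \<le> 1" unfolding lo_def by (rule real_of_int_div3)
      moreover have "- (r / real_of_int m) \<le> real_of_int (- \<lfloor>r\<rfloor>) / real_of_int m"
        using divide_right_mono[OF f, of "real_of_int m"] m by simp
      ultimately show ?thesis by linarith
    qed
    have "2 * r / real_of_int m + 2 \<ge> 0" using r m by simp
    moreover have "real_of_int (hi - lo + 1) \<le> 2 * r / real_of_int m + 2" using hi lo by (simp add: add_divide_distrib)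
    ultimately show ?thesis by (cases "hi - lo + 1 \<ge> 0") auto
  qed
  finally show ?thesis .
qed

text \<open>
  The congruence \<open>I \<equiv> 0\<close> modulo \<open>q\<close> is \<open>12 a0 a4 \<equiv> 3
  a1 a3 - a2^2\<close>.
\<close>

lemma last_coefficient_count:
  fixes a X :: int and q :: nat
  assumes q: "q > 0" "coprime q 6" and g: "gcd a (int q) ^ 2 \<le> int q" and r: "r \<ge> 0"
  shows "real (card {e \<in> int_ball r. int q dvd 12 * a * e - X}) \<le> 2 * r / sqrt (real q) + 2"
proof -
  define h where "h = gcd a (int q)"
  define m where "m = int q div h"
  have h0: "h > 0" using q by (simp add: h_def)
  have hm: "int q = h * m" by (simp add: h_def m_def)
  have "h * m > 0" using q by (simp flip: hm)
  then have m0: "m > 0" using h0 zero_less_mult_pos by blast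
  have pair: "m dvd x - y" if "int q dvd 12 * a * x - X" "int q dvd 12 * a * y - X" for x y
  proof -
    have eq: "(12 * a * x - X) - (12 * a * y - X) = 12 * (a * (x - y))" by (simp add: algebra_simps)
    have d: "int q dvd 12 * (a * (x - y))" using dvd_diff[OF that] by (simp only: eq)
    have "coprime (int q) (int 6)" using q(2) by (simp only: coprime_int_iff)
    then have "coprime (int q) (2 * 3)" by simp
    then have "coprime (int q) 2" "coprime (int q) 3" by (simp_all only: coprime_mult_right_iff)
    then have "coprime (int q) (2 * (2 * 3))" by (simp only: coprime_mult_right_iff simp_thms)
    then have "coprime (int q) 12" by simp
    then have "int q dvd a * (x - y)" using d coprime_dvd_mult_right_iff by blast
    moreover have "h * (a div h) = a" by (simp add: h_def)
    ultimately have "h * m dvd (h * (a div h)) * (x - y)" by (simp only: hm)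
    then have "m dvd (a div h) * (x - y)" using h0 by (simp only: mult.assoc dvd_mult_cancel_left) simp
    moreover have "coprime m (a div h)"
      using q div_gcd_coprime[of a "int q"] by (simp add: m_def h_def coprime_commute)
    ultimately show ?thesis using coprime_dvd_mult_right_iff by blast
  qed
  have "real (card {e \<in> int_ball r. int q dvd 12 * a * e - X}) \<le> 2 * r / real_of_int m + 2"
    by (rule card_residue_class_le[OF _ m0 r]) (auto intro: pair)
  also have "\<dots> \<le> 2 * r / sqrt (real q) + 2"
  proof -
    have "real_of_int (h ^ 2) \<le> real_of_int (int q)" using g unfolding h_def by (simp only: of_int_le_iff)
    then have "real_of_int h ^ 2 \<le> real q" by simp
    then have "real_of_int h \<le> sqrt (real q)" by (rule real_le_rsqrt)
    then have "sqrt (real q) * real_of_int h \<le> sqrt (real q) * sqrt (real q)" by (intro mult_left_mono) auto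
    also have "\<dots> = real_of_int (int q)" by simp
    also have "\<dots> = real_of_int h * real_of_int m" by (simp only: hm of_int_mult)
    finally have "sqrt (real q) * real_of_int h \<le> real_of_int m * real_of_int h" by (simp only: mult.commute)
    then have "sqrt (real q) \<le> real_of_int m" using h0 by simp
    moreover have "sqrt (real q) > 0" using q by simp
    ultimately have "2 * r / real_of_int m \<le> 2 * r / sqrt (real q)"
      using r m0 by (intro divide_left_mono) auto
    then show ?thesis by simp
  qed
  finally show ?thesis .
qed

lemma int_box_coeff_bounds:
  assumes "f \<in> int_box r"
  shows "\<bar>real_of_int (qc0 f)\<bar> \<le> r" "\<bar>real_of_int (qc1 f)\<bar> \<le> r" "\<bar>real_of_int (qc2 f)\<bar> \<le> r"
    "\<bar>real_of_int (qc3 f)\<bar> \<le> r" "\<bar>real_of_int (qc4 f)\<bar> \<le> r"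
  using assms by (cases f; simp add: int_box_iff int_ball_def)+

lemma inv_J_bound:
  assumes "f \<in> int_box r"
  shows "\<bar>real_of_int (inv_J f)\<bar> \<le> 137 * r ^ 3"
proof -
  note b = int_box_coeff_bounds[OF assms]
  have r0: "r \<ge> 0" using b(1) by linarith
  have m3: "x * y * z \<le> r ^ 3 \<and> - (r ^ 3) \<le> x * y * z" if "\<bar>x\<bar> \<le> r" "\<bar>y\<bar> \<le> r" "\<bar>z\<bar> \<le> r" for x y z :: real
  proof -
    have "\<bar>x * y * z\<bar> \<le> r ^ 3"
      unfolding abs_mult power3_eq_cube using that r0 by (intro mult_mono) auto
    then show ?thesis by linarith
  qed
  define a0 a1 a2 a3 a4 where "a0 = real_of_int (qc0 f)" "a1 = real_of_int (qc1 f)" "a2 = real_of_int (qc2 f)"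
    "a3 = real_of_int (qc3 f)" "a4 = real_of_int (qc4 f)"
  note defs = this
  have "real_of_int (inv_J f) = 72 * (a0 * a2 * a4) + 9 * (a1 * a2 * a3) - 27 * (a0 * a3 * a3) - 27 * (a1 * a1 * a4) - 2 * (a2 * a2 * a2)"
    by (simp add: inv_J_def defs power2_eq_square power3_eq_cube algebra_simps)
  moreover note m3[OF b(1) b(3) b(5), folded defs] m3[OF b(2) b(3) b(4), folded defs]
    m3[OF b(1) b(4) b(4), folded defs] m3[OF b(2) b(2) b(5), folded defs] m3[OF b(3) b(3) b(3), folded defs]
  ultimately have "real_of_int (inv_J f) \<le> 137 * r ^ 3" "- (137 * r ^ 3) \<le> real_of_int (inv_J f)"
    by linarith+
  then show ?thesis by (simp add: abs_le_iff)
qed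

lemma form_R_bound:
  assumes "f \<in> int_box r"
  shows "\<bar>real_of_int (form_R f)\<bar> \<le> 13 * r ^ 3"
proof -
  note b = int_box_coeff_bounds[OF assms]
  have r0: "r \<ge> 0" using b(1) by linarith
  have m3: "x * y * z \<le> r ^ 3 \<and> - (r ^ 3) \<le> x * y * z" if "\<bar>x\<bar> \<le> r" "\<bar>y\<bar> \<le> r" "\<bar>z\<bar> \<le> r" for x y z :: real
  proof -
    have "\<bar>x * y * z\<bar> \<le> r ^ 3"
      unfolding abs_mult power3_eq_cube using that r0 by (intro mult_mono) auto
    then show ?thesis by linarith
  qed
  define a0 a1 a2 a3 where "a0 = real_of_int (qc0 f)" "a1 = real_of_int (qc1 f)" "a2 = real_of_int (qc2 f)"
    "a3 = real_of_int (qc3 f)"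
  note defs = this
  have "real_of_int (form_R f) = a1 * a1 * a1 + 8 * (a0 * a0 * a3) - 4 * (a0 * a1 * a2)"
    by (simp add: form_R_def defs power2_eq_square power3_eq_cube algebra_simps)
  moreover note m3[OF b(2) b(2) b(2), folded defs] m3[OF b(1) b(1) b(4), folded defs]
    m3[OF b(1) b(2) b(3), folded defs]
  ultimately have "real_of_int (form_R f) \<le> 13 * r ^ 3" "- (13 * r ^ 3) \<le> real_of_int (form_R f)"
    by linarith+
  then show ?thesis by (simp add: abs_le_iff)
qed

lemma form_Delta_bound:
  assumes "f \<in> int_box r"
  shows "\<bar>real_of_int (form_Delta f)\<bar> \<le> 6000 * r ^ 6"
proof -
  note b = int_box_coeff_bounds[OF assms]
  have r0: "r \<ge> 0" using b(1) by linarith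
  have m2: "\<bar>x * y\<bar> \<le> r ^ 2" if "\<bar>x\<bar> \<le> r" "\<bar>y\<bar> \<le> r" for x y :: real
    unfolding abs_mult power2_eq_square using that r0 by (intro mult_mono) auto
  define a0 a1 a2 where "a0 = real_of_int (qc0 f)" "a1 = real_of_int (qc1 f)" "a2 = real_of_int (qc2 f)"
  note defs = this
  have "real_of_int (form_P f) = 3 * (a1 * a1) - 8 * (a0 * a2)"
    by (simp add: form_P_def defs power2_eq_square)
  then have P: "\<bar>real_of_int (form_P f)\<bar> \<le> 11 * r ^ 2"
    using m2[of a1 a1] m2[of a0 a2] b unfolding defs[symmetric] by linarith
  have P3: "\<bar>real_of_int (form_P f)\<bar> ^ 3 \<le> (11 * r ^ 2) ^ 3" using P by (intro power_mono) auto
  have R2: "\<bar>real_of_int (form_R f)\<bar> ^ 2 \<le> (13 * r ^ 3) ^ 2" using form_R_bound[OF assms] by (intro power_mono) auto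
  have "\<bar>real_of_int (form_Delta f)\<bar> \<le> \<bar>real_of_int (form_P f)\<bar> ^ 3 + 27 * \<bar>real_of_int (form_R f)\<bar> ^ 2"
    using abs_triangle_ineq4[of "real_of_int (form_P f) ^ 3" "27 * real_of_int (form_R f) ^ 2"]
    by (simp add: form_Delta_def abs_mult power_abs)
  also have "\<dots> \<le> (11 * r ^ 2) ^ 3 + 27 * (13 * r ^ 3) ^ 2" using P3 R2 by linarith
  also have "\<dots> = 5894 * r ^ 6" by (simp add: power_mult_distrib flip: power_mult)
  also have "\<dots> \<le> 6000 * r ^ 6" using r0 by (intro mult_right_mono) auto
  finally show ?thesis .
qed

lemma form_Delta_last_irrelevant: "form_Delta (Quartic a b c d e) = form_Delta (Quartic a b c d 0)"
  by (simp add: form_Delta_def form_P_def form_R_def)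

text \<open>
  For fixed \<open>a0, ..., a3\<close> with \<open>form_Delta\<close> nonzero, \<open>q\<close> is
  one of few divisors of \<open>form_Delta\<close>, and \<open>a4\<close> takes at most \<open>2 r
  / sqrt q + 2\<close> values: the weight \<open>sqrt q\<close> gives \<open>O(r + sqrt
  M)\<close>. The forms with \<open>a0 = 0\<close> or \<open>form_Delta = 0\<close> are
  \<open>O(r^4)\<close> in number, and for them \<open>q\<close> is one of few divisors of
  \<open>J\<close>.
\<close>

lemma sum_sqrt_transversal_moduli:
  fixes T N r M :: real
  assumes r: "r \<ge> 1" and M: "M \<ge> 1" and T1: "T \<ge> 1" and N: "6000 * r ^ 6 \<le> N"
    and T: "\<And>n::int. n \<noteq> 0 \<Longrightarrow> \<bar>real_of_int n\<bar> \<le> N \<Longrightarrow> real (card {d::nat. int d dvd n}) \<le> T"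
  shows "(\<Sum>f | f \<in> int_box r \<and> inv_J f \<noteq> 0. \<Sum>q | q \<in> transversal_moduli f \<and> real q \<le> M. sqrt (real q))
    \<le> 405 * T * (r ^ 5 + r ^ 4 * sqrt M)"
proof -
  define G where "G = (\<lambda>f. \<Sum>q | q \<in> transversal_moduli f \<and> real q \<le> M. sqrt (real q))"
  define bad where "bad = {f \<in> int_box r. inv_J f \<noteq> 0 \<and> (qc0 f = 0 \<or> form_Delta f = 0)}"
  define good where "good = {f \<in> int_box r. qc0 f \<noteq> 0 \<and> form_Delta f \<noteq> 0}"
  have fin: "finite bad" "finite good" by (simp_all add: bad_def good_def finite_int_box)
  have finM: "finite {q::nat. P q \<and> real q \<le> M}" for P
    by (rule finite_subset[of _ "{..nat \<lfloor>M\<rfloor>}"]) (auto simp: le_nat_floor)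
  have G0: "G f \<ge> 0" for f unfolding G_def by (intro sum_nonneg) auto
  have "{f. f \<in> int_box r \<and> inv_J f \<noteq> 0} \<subseteq> bad \<union> good" by (auto simp: bad_def good_def)
  then have "(\<Sum>f | f \<in> int_box r \<and> inv_J f \<noteq> 0. G f) \<le> (\<Sum>f\<in>bad \<union> good. G f)"
    using fin G0 by (intro sum_mono2) auto
  also have "\<dots> = (\<Sum>f\<in>bad. G f) + (\<Sum>f\<in>good. G f)"
    using fin by (intro sum.union_disjoint) (auto simp: bad_def good_def)
  finally have split: "(\<Sum>f | f \<in> int_box r \<and> inv_J f \<noteq> 0. G f) \<le> (\<Sum>f\<in>bad. G f) + (\<Sum>f\<in>good. G f)" .
  have divisors: "card D \<le> card {d::nat. int d dvd n}" "finite D" if "D \<subseteq> {d. int d dvd n}" "n \<noteq> 0" for D and n :: int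
  proof -
    have "{d::nat. int d dvd n} \<subseteq> {..nat \<bar>n\<bar>}"
    proof
      fix d :: nat assume "d \<in> {d::nat. int d dvd n}"
      then have "int d \<le> \<bar>n\<bar>" using that(2) dvd_imp_le_int[of n "int d"] by simp
      then show "d \<in> {..nat \<bar>n\<bar>}" by simp
    qed
    then have f: "finite {d::nat. int d dvd n}" by (rule finite_subset) simp
    show "finite D" using that(1) f by (rule finite_subset)
    show "card D \<le> card {d::nat. int d dvd n}" using f that(1) by (rule card_mono)
  qed
  have r36: "137 * r ^ 3 \<le> N"
  proof -
    have "r ^ 3 \<le> r ^ 6" using r by (intro power_increasing) auto
    moreover have "r ^ 6 \<ge> 1" using r by simp
    ultimately show ?thesis using N by linarith
  qed
  have "(\<Sum>f\<in>bad. G f) \<le> (\<Sum>f\<in>bad. T * sqrt M)"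
  proof (rule sum_mono)
    fix f assume f: "f \<in> bad"
    then have J: "inv_J f \<noteq> 0" and box: "f \<in> int_box r" by (auto simp: bad_def)
    have tau: "real (card {d::nat. int d dvd inv_J f}) \<le> T"
      using inv_J_bound[OF box] r36 by (intro T J) linarith
    define D where "D = {q. q \<in> transversal_moduli f \<and> real q \<le> M}"
    have "D \<subseteq> {d. int d dvd inv_J f}" by (auto simp: D_def transversal_moduli_def)
    from divisors(1)[OF this J] have cD: "real (card D) \<le> T" using tau by linarith
    have "G f \<le> (\<Sum>q\<in>D. sqrt M)" unfolding G_def D_def[symmetric] by (intro sum_mono) (auto simp: D_def)
    also have "\<dots> = real (card D) * sqrt M" by simp
    also have "\<dots> \<le> T * sqrt M" using cD M by (intro mult_right_mono) auto
    finally show "G f \<le> T * sqrt M" .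
  qed
  also have "\<dots> = real (card bad) * (T * sqrt M)" by simp
  also have "\<dots> \<le> (243 * r ^ 4) * (T * sqrt M)"
  proof (rule mult_right_mono)
    have "card bad \<le> card {f \<in> int_box r. qc0 f = 0 \<or> form_Delta f = 0}"
      by (intro card_mono) (auto simp: bad_def finite_int_box)
    then show "real (card bad) \<le> 243 * r ^ 4" using form_Delta_zero_count[OF r] by linarith
  qed (use T1 M in auto)
  finally have bad_le: "(\<Sum>f\<in>bad. G f) \<le> (243 * r ^ 4) * (T * sqrt M)" .
  define B where "B = int_ball r"
  have finB: "finite B" by (simp add: B_def finite_int_ball)
  define Z where "Z = {z \<in> B \<times> B \<times> B \<times> B. case z of (a, b, c, d) \<Rightarrow> a \<noteq> 0 \<and> form_Delta (Quartic a b c d 0) \<noteq> 0}"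
  have finZ: "finite Z" unfolding Z_def using finB by (intro finite_Collect_conjI) auto
  define mk :: "(int \<times> int \<times> int \<times> int) \<times> int \<Rightarrow> int quartic_form" where
    "mk = (\<lambda>(z, e). case z of (a, b, c, d) \<Rightarrow> Quartic a b c d e)"
  have "good \<subseteq> mk ` (Z \<times> B)"
  proof
    fix f assume f: "f \<in> good"
    obtain a b c d e where fq: "f = Quartic a b c d e" by (cases f)
    have "((a, b, c, d), e) \<in> Z \<times> B"
      using f by (simp add: good_def fq int_box_iff Z_def B_def form_Delta_last_irrelevant[of a b c d e])
    then show "f \<in> mk ` (Z \<times> B)" by (rule rev_image_eqI) (simp add: mk_def fq)
  qed
  then have "(\<Sum>f\<in>good. G f) \<le> (\<Sum>f\<in>mk ` (Z \<times> B). G f)"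
    using finZ finB G0 by (intro sum_mono2) auto
  also have "\<dots> = (\<Sum>x\<in>Z \<times> B. G (mk x))"
    by (subst sum.reindex) (auto simp: mk_def inj_on_def)
  also have "\<dots> = (\<Sum>z\<in>Z. \<Sum>e\<in>B. G (mk (z, e)))" by (simp add: sum.cartesian_product)
  also have "\<dots> \<le> (\<Sum>z\<in>Z. T * (2 * r + 2 * sqrt M))"
  proof (rule sum_mono)
    fix z assume z: "z \<in> Z"
    obtain a b c d where zq: "z = (a, b, c, d)" by (cases z)
    define \<Delta> where "\<Delta> = form_Delta (Quartic a b c d 0)"
    have \<Delta>0: "\<Delta> \<noteq> 0" using z by (simp add: Z_def zq \<Delta>_def)
    define D where "D = {q. q > 0 \<and> coprime q 6 \<and> int q dvd \<Delta> \<and> gcd a (int q) ^ 2 \<le> int q \<and> real q \<le> M}"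
    have Dsub: "D \<subseteq> {d. int d dvd \<Delta>}" by (auto simp: D_def)
    have finD: "finite D" using divisors(2)[OF Dsub \<Delta>0] .
    have "Quartic a b c d 0 \<in> int_box r"
      using z r by (auto simp: Z_def zq B_def int_box_iff int_ball_def)
    then have "\<bar>real_of_int \<Delta>\<bar> \<le> N" using form_Delta_bound N unfolding \<Delta>_def by fastforce
    then have cD: "real (card D) \<le> T" using T[OF \<Delta>0] divisors(1)[OF Dsub \<Delta>0] by linarith
    define X where "X = 3 * b * d - c ^ 2"
    have "G (mk (z, e)) \<le> (\<Sum>q\<in>D. sqrt (real q) * of_bool (int q dvd 12 * a * e - X))" for e
    proof -
      define f where "f = Quartic a b c d e"
      have sub: "{q. q \<in> transversal_moduli f \<and> real q \<le> M} \<subseteq> {q \<in> D. int q dvd 12 * a * e - X}"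
      proof
        fix q assume q: "q \<in> {q. q \<in> transversal_moduli f \<and> real q \<le> M}"
        then have IJ: "int q dvd inv_I f" "int q dvd inv_J f" by (auto simp: transversal_moduli_def)
        then have "int q dvd form_Delta f" unfolding form_Delta_eq by simp
        then have "int q dvd \<Delta>" by (simp add: f_def \<Delta>_def form_Delta_last_irrelevant[of a b c d e])
        moreover have "inv_I f = 12 * a * e - X" by (simp add: f_def inv_I_def X_def)
        ultimately show "q \<in> {q \<in> D. int q dvd 12 * a * e - X}"
          using q IJ by (simp add: D_def transversal_moduli_def f_def)
      qed
      have "G f \<le> (\<Sum>q | q \<in> D \<and> int q dvd 12 * a * e - X. sqrt (real q))"
        unfolding G_def using sub finD by (intro sum_mono2) auto
      also have "\<dots> = (\<Sum>q\<in>D. if int q dvd 12 * a * e - X then sqrt (real q) else 0)"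
        by (rule sum.inter_filter[OF finD])
      also have "\<dots> = (\<Sum>q\<in>D. sqrt (real q) * of_bool (int q dvd 12 * a * e - X))"
        by (intro sum.cong) auto
      finally show ?thesis by (simp add: mk_def zq f_def)
    qed
    then have "(\<Sum>e\<in>B. G (mk (z, e))) \<le> (\<Sum>e\<in>B. \<Sum>q\<in>D. sqrt (real q) * of_bool (int q dvd 12 * a * e - X))"
      by (intro sum_mono)
    also have "\<dots> = (\<Sum>q\<in>D. sqrt (real q) * (\<Sum>e\<in>B. of_bool (int q dvd 12 * a * e - X)))"
      by (subst sum.swap) (simp add: sum_distrib_left)
    also have "\<dots> \<le> (\<Sum>q\<in>D. 2 * r + 2 * sqrt M)"
    proof (rule sum_mono)
      fix q assume q: "q \<in> D"
      have q0: "sqrt (real q) > 0" using q by (simp add: D_def)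
      have "(\<Sum>e\<in>B. of_bool (int q dvd 12 * a * e - X)) = real (card {e \<in> B. int q dvd 12 * a * e - X})"
        using finB by (simp add: Int_def)
      also have "\<dots> \<le> 2 * r / sqrt (real q) + 2"
        unfolding B_def using q r by (intro last_coefficient_count) (auto simp: D_def)
      finally have "sqrt (real q) * (\<Sum>e\<in>B. of_bool (int q dvd 12 * a * e - X)) \<le> sqrt (real q) * (2 * r / sqrt (real q) + 2)"
        using q0 by (intro mult_left_mono) auto
      also have "\<dots> = 2 * r + 2 * sqrt (real q)" using q0 by (simp add: field_simps)
      also have "\<dots> \<le> 2 * r + 2 * sqrt M" using q by (simp add: D_def)
      finally show "sqrt (real q) * (\<Sum>e\<in>B. of_bool (int q dvd 12 * a * e - X)) \<le> 2 * r + 2 * sqrt M" .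
    qed
    also have "\<dots> = real (card D) * (2 * r + 2 * sqrt M)" by simp
    also have "\<dots> \<le> T * (2 * r + 2 * sqrt M)" using cD r M by (intro mult_right_mono) auto
    finally show "(\<Sum>e\<in>B. G (mk (z, e))) \<le> T * (2 * r + 2 * sqrt M)" .
  qed
  also have "\<dots> = real (card Z) * (T * (2 * r + 2 * sqrt M))" by simp
  also have "\<dots> \<le> (81 * r ^ 4) * (T * (2 * r + 2 * sqrt M))"
  proof (rule mult_right_mono)
    show "real (card Z) \<le> 81 * r ^ 4"
      by (rule card_le_of_four_coordinates[OF r, of "\<lambda>x. x"]) (auto simp: Z_def B_def)
  qed (use T1 M r in auto)
  finally have good_le: "(\<Sum>f\<in>good. G f) \<le> (81 * r ^ 4) * (T * (2 * r + 2 * sqrt M))" .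
  have "(243 * r ^ 4) * (T * sqrt M) + (81 * r ^ 4) * (T * (2 * r + 2 * sqrt M)) =
      405 * (T * (r ^ 4 * sqrt M)) + 162 * (T * r ^ 5)"
    by (simp add: algebra_simps eval_nat_numeral)
  also have "\<dots> \<le> 405 * (T * (r ^ 4 * sqrt M)) + 405 * (T * r ^ 5)"
    using T1 r by (intro add_left_mono mult_right_mono) auto
  also have "\<dots> = 405 * T * (r ^ 5 + r ^ 4 * sqrt M)" by (simp add: algebra_simps)
  finally show ?thesis using split bad_le good_le unfolding G_def by linarith
qed

lemma translate_int_box:
  assumes f: "f \<in> int_box r" and k: "k \<in> {0..3}"
  shows "translate k f \<in> int_box (142 * r)"
proof -
  obtain a b c d e where fq: "f = Quartic a b c d e" by (cases f)
  have bd: "\<bar>real_of_int a\<bar> \<le> r" "\<bar>real_of_int b\<bar> \<le> r" "\<bar>real_of_int c\<bar> \<le> r" "\<bar>real_of_int d\<bar> \<le> r" "\<bar>real_of_int e\<bar> \<le> r"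
    using f by (auto simp: fq int_box_iff int_ball_def)
  (* The constant is the worst case b + 2 c k + 3 d k^2 + 4 e k^3 at k = 3: 1 + 6 + 27 + 108 =
     142. *)
  have "k = 0 \<or> k = 1 \<or> k = 2 \<or> k = 3" using k by auto
  then show ?thesis
    using bd by (elim disjE; simp add: fq int_box_iff int_ball_def abs_le_iff; linarith)
qed

lemma sum_sqrt_triple_root_moduli:
  fixes T N r M :: real
  assumes r: "r \<ge> 1" and M: "M \<ge> 1" and T1: "T \<ge> 1" and N: "6000 * (142 * r) ^ 6 \<le> N"
    and T: "\<And>n::int. n \<noteq> 0 \<Longrightarrow> \<bar>real_of_int n\<bar> \<le> N \<Longrightarrow> real (card {d::nat. int d dvd n}) \<le> T"
  shows "(\<Sum>f | f \<in> int_box r \<and> inv_J f \<noteq> 0. \<Sum>q | q \<in> triple_root_moduli f \<and> real q \<le> M. sqrt (real q))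
    \<le> 1620 * 142 ^ 5 * T * (r ^ 5 + r ^ 4 * sqrt M)"
proof -
  define A where "A = {f. f \<in> int_box r \<and> inv_J f \<noteq> 0}"
  define G where "G = (\<lambda>f. \<Sum>q | q \<in> transversal_moduli f \<and> real q \<le> M. sqrt (real q))"
  have finM: "finite {q::nat. P q \<and> real q \<le> M}" for P
    by (rule finite_subset[of _ "{..nat \<lfloor>M\<rfloor>}"]) (auto simp: le_nat_floor)
  have G0: "G f \<ge> 0" for f unfolding G_def by (intro sum_nonneg) auto
  have finA: "finite A" by (simp add: A_def finite_int_box)
  have "(\<Sum>q | q \<in> triple_root_moduli f \<and> real q \<le> M. sqrt (real q)) \<le> (\<Sum>k\<in>{0..3}. G (translate k f))" for f
  proof -
    define L where "L = {q. q \<in> triple_root_moduli f \<and> real q \<le> M}"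
    define S where "S = (\<lambda>k. {q. q \<in> transversal_moduli (translate k f) \<and> real q \<le> M})"
    have finLS: "finite L" "finite (S k)" for k by (simp_all add: L_def S_def finM)
    have "(\<Sum>q\<in>L. sqrt (real q)) \<le> (\<Sum>q\<in>L. \<Sum>k\<in>{0..3::int}. if q \<in> S k then sqrt (real q) else 0)"
    proof (rule sum_mono)
      fix q assume q: "q \<in> L"
      then have "q \<in> triple_root_moduli f" by (simp add: L_def)
      from exists_transversal_translate[OF this]
      obtain k where k: "k \<in> {0..3}" "q \<in> transversal_moduli (translate k f)" by blast
      then have "q \<in> S k" using q by (simp add: S_def L_def)
      then have "sqrt (real q) = (\<Sum>k\<in>{k}. if q \<in> S k then sqrt (real q) else 0)" by simp
      also have "\<dots> \<le> (\<Sum>k\<in>{0..3::int}. if q \<in> S k then sqrt (real q) else 0)"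
        using k(1) by (intro sum_mono2) auto
      finally show "sqrt (real q) \<le> (\<Sum>k\<in>{0..3::int}. if q \<in> S k then sqrt (real q) else 0)" .
    qed
    also have "\<dots> = (\<Sum>k\<in>{0..3::int}. \<Sum>q\<in>L. if q \<in> S k then sqrt (real q) else 0)" by (rule sum.swap)
    also have "\<dots> \<le> (\<Sum>k\<in>{0..3::int}. \<Sum>q\<in>S k. sqrt (real q))"
    proof (rule sum_mono)
      fix k :: int
      have "(\<Sum>q\<in>L. if q \<in> S k then sqrt (real q) else 0) = (\<Sum>q\<in>{q \<in> L. q \<in> S k}. sqrt (real q))"
        by (rule sum.inter_filter[symmetric, OF finLS(1)])
      also have "\<dots> \<le> (\<Sum>q\<in>S k. sqrt (real q))" using finLS by (intro sum_mono2) auto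
      finally show "(\<Sum>q\<in>L. if q \<in> S k then sqrt (real q) else 0) \<le> (\<Sum>q\<in>S k. sqrt (real q))" .
    qed
    finally have "(\<Sum>q\<in>L. sqrt (real q)) \<le> (\<Sum>k\<in>{0..3::int}. \<Sum>q\<in>S k. sqrt (real q))" .
    then show ?thesis unfolding G_def L_def S_def .
  qed
  then have "(\<Sum>f\<in>A. \<Sum>q | q \<in> triple_root_moduli f \<and> real q \<le> M. sqrt (real q)) \<le> (\<Sum>f\<in>A. \<Sum>k\<in>{0..3}. G (translate k f))"
    by (intro sum_mono)
  also have "\<dots> = (\<Sum>k\<in>{0..3}. \<Sum>f\<in>A. G (translate k f))" by (rule sum.swap)
  also have "\<dots> \<le> (\<Sum>k\<in>{0..3::int}. 405 * T * ((142 * r) ^ 5 + (142 * r) ^ 4 * sqrt M))"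
  proof (rule sum_mono)
    fix k :: int assume k: "k \<in> {0..3}"
    have inj: "inj_on (translate k) A"
      by (rule inj_on_inverseI[of _ "translate (- k)"]) (simp add: translate_translate translate_0)
    have "(\<Sum>f\<in>A. G (translate k f)) = (\<Sum>f\<in>translate k ` A. G f)" by (simp add: sum.reindex[OF inj])
    also have "\<dots> \<le> (\<Sum>f | f \<in> int_box (142 * r) \<and> inv_J f \<noteq> 0. G f)"
      using translate_int_box[OF _ k] G0 finite_int_box
      by (intro sum_mono2) (auto simp: A_def inv_J_translate)
    also have "\<dots> \<le> 405 * T * ((142 * r) ^ 5 + (142 * r) ^ 4 * sqrt M)"
      unfolding G_def using r M T1 N T by (intro sum_sqrt_transversal_moduli) auto
    finally show "(\<Sum>f\<in>A. G (translate k f)) \<le> 405 * T * ((142 * r) ^ 5 + (142 * r) ^ 4 * sqrt M)" .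
  qed
  also have "\<dots> = 1620 * T * (142 ^ 5 * r ^ 5 + 142 ^ 4 * (r ^ 4 * sqrt M))" by (simp add: power_mult_distrib)
  also have "\<dots> \<le> 1620 * T * (142 ^ 5 * r ^ 5 + 142 ^ 5 * (r ^ 4 * sqrt M))"
    using r M T1 by (intro mult_left_mono add_left_mono mult_right_mono) auto
  also have "\<dots> = 1620 * 142 ^ 5 * T * (r ^ 5 + r ^ 4 * sqrt M)" by (simp add: algebra_simps)
  finally show ?thesis unfolding A_def .
qed

section \<open>Weights of squarefree moduli\<close>

definition prime_part :: "nat \<Rightarrow> (nat \<Rightarrow> bool) \<Rightarrow> nat" where
  "prime_part q S = \<Prod>{p \<in> prime_factors q. S p}"

lemma prime_part_pos: "prime_part q S > 0"
  unfolding prime_part_def by (intro prod_pos) (auto dest!: in_prime_factors_imp_prime simp: prime_gt_0_nat)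

lemma prime_part_dvd:
  assumes "squarefree q"
  shows "prime_part q S dvd q"
proof -
  have "prime_part q S dvd \<Prod>(prime_factors q)"
    unfolding prime_part_def by (intro prod_dvd_prod_subset) auto
  then show ?thesis by (simp only: squarefree_eq_prod_prime_factors[OF assms])
qed

lemma prime_part_dvd_int:
  fixes n :: int
  assumes q: "squarefree q" and S: "\<And>p. p \<in> prime_factors q \<Longrightarrow> S p \<Longrightarrow> int p dvd n"
  shows "int (prime_part q S) dvd n"
proof -
  have "prime_part q S dvd \<Prod>{p \<in> prime_factors q. int p dvd n}"
    unfolding prime_part_def using S by (intro prod_dvd_prod_subset) auto
  also have "\<Prod>{p \<in> prime_factors q. int p dvd n} = (\<Prod>p\<in>prime_factors q. if int p dvd n then p else 1)"
    by (rule prod.inter_filter) simp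
  finally have "int (prime_part q S) dvd gcd n (int q)"
    unfolding gcd_squarefree_eq_prod[OF q] by (simp only: int_dvd_int_iff)
  then show ?thesis by simp
qed

lemma prime_part_mult:
  assumes "\<And>p. \<not> (S p \<and> U p)"
  shows "prime_part q S * prime_part q U = prime_part q (\<lambda>p. S p \<or> U p)"
proof -
  have "{p \<in> prime_factors q. S p \<or> U p} = {p \<in> prime_factors q. S p} \<union> {p \<in> prime_factors q. U p}" by auto
  moreover have "{p \<in> prime_factors q. S p} \<inter> {p \<in> prime_factors q. U p} = {}" using assms by auto
  ultimately show ?thesis by (simp add: prime_part_def prod.union_disjoint)
qed

lemma prime_part_all:
  assumes "squarefree q" "\<And>p. p \<in> prime_factors q \<Longrightarrow> S p"
  shows "prime_part q S = q"
proof -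
  have "{p \<in> prime_factors q. S p} = prime_factors q" using assms(2) by auto
  then show ?thesis by (simp add: prime_part_def squarefree_eq_prod_prime_factors[OF assms(1)])
qed

lemma prime_part_powr:
  "(\<Prod>p\<in>prime_factors q. if S p then real p powr x else 1) = real (prime_part q S) powr x"
proof -
  have "(\<Prod>p\<in>prime_factors q. if S p then real p powr x else 1) = (\<Prod>p\<in>{p \<in> prime_factors q. S p}. real p powr x)"
    by (rule prod.inter_filter[symmetric]) simp
  also have "\<dots> = (\<Prod>p\<in>{p \<in> prime_factors q. S p}. real p) powr x"
    by (rule prod_powr_distrib[symmetric])
  finally show ?thesis by (simp add: prime_part_def)
qed

lemma prime_part_factor:
  assumes "squarefree q" "p \<in> prime_factors (prime_part q S)"
  shows "p \<in> prime_factors q" "S p"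
proof -
  have "prime_factors (prime_part q S) = {p \<in> prime_factors q. S p}"
  proof -
    have fin: "finite {p \<in> prime_factors q. S p}" by simp
    have "prime_factors (\<Prod>{p \<in> prime_factors q. S p}) = \<Union> (prime_factors ` {p \<in> prime_factors q. S p})"
    proof (subst prime_factors_prod)
      show "0 \<notin> (\<lambda>x. x) ` {p \<in> prime_factors q. S p}" by (auto dest: in_prime_factors_imp_prime)
    qed simp_all
    also have "\<dots> = (\<Union>p\<in>{p \<in> prime_factors q. S p}. {p})"
    proof (rule SUP_cong[OF refl])
      fix p assume "p \<in> {p \<in> prime_factors q. S p}"
      then have "prime p" by auto
      then show "prime_factors p = {p}" by (rule prime_prime_factors)
    qed
    finally show ?thesis by (simp add: prime_part_def)
  qed
  with assms(2) show "p \<in> prime_factors q" "S p" by auto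
qed

definition content_prime :: "int quartic_form \<Rightarrow> nat \<Rightarrow> bool" where
  "content_prime f p \<longleftrightarrow> form_dvd (int p) f"

definition triple_prime :: "int quartic_form \<Rightarrow> nat \<Rightarrow> bool" where
  "triple_prime f p \<longleftrightarrow> \<not> form_dvd (int p) f \<and> int p dvd inv_I f \<and> int p dvd inv_J f"

definition special_prime :: "int quartic_form \<Rightarrow> nat \<Rightarrow> bool" where
  "special_prime f p \<longleftrightarrow> \<not> form_dvd (int p) f \<and> \<not> (int p dvd inv_I f \<and> int p dvd inv_J f) \<and> int p dvd generic_cov f"

definition modulus_weight :: "int quartic_form \<Rightarrow> nat \<Rightarrow> real" where
  "modulus_weight f q = (\<Prod>p\<in>prime_factors q. local_weight p f)"

text \<open>
  Relative to the generic exponent \<open>-7/2\<close>, the exponents at the three exceptional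
  kinds of primes are larger by \<open>5/2\<close>, \<open>3/2\<close> and \<open>1/2\<close>.
\<close>

lemma modulus_weight_eq:
  assumes q: "squarefree q"
  shows "modulus_weight f q = real q powr (-7/2) * real (prime_part q (content_prime f)) powr (5/2) *
    real (prime_part q (triple_prime f)) powr (3/2) * real (prime_part q (special_prime f)) powr (1/2)"
proof -
  have "local_weight p f = real p powr (-7/2) * (if content_prime f p then real p powr (5/2) else 1) *
      (if triple_prime f p then real p powr (3/2) else 1) * (if special_prime f p then real p powr (1/2) else 1)"
    if p: "p \<in> prime_factors q" for p
  proof -
    have "real p > 0" using p by (auto dest!: in_prime_factors_imp_prime simp: prime_gt_0_nat)
    then have a: "real p powr (-7/2) * real p powr (5/2) = real p powr (-1)"
      "real p powr (-7/2) * real p powr (3/2) = real p powr (-2)"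
      "real p powr (-7/2) * real p powr (1/2) = real p powr (-3)"
      by (simp_all add: powr_add[symmetric])
    show ?thesis
      unfolding local_weight_def content_prime_def triple_prime_def special_prime_def
      by (simp only: a if_True if_False simp_thms mult_1_right split: if_split) (auto simp: a)
  qed
  then have "modulus_weight f q = (\<Prod>p\<in>prime_factors q. real p powr (-7/2) * (if content_prime f p then real p powr (5/2) else 1) *
      (if triple_prime f p then real p powr (3/2) else 1) * (if special_prime f p then real p powr (1/2) else 1))"
    unfolding modulus_weight_def by (intro prod.cong refl)
  also have "\<dots> = (\<Prod>p\<in>prime_factors q. real p powr (-7/2)) * real (prime_part q (content_prime f)) powr (5/2) *
    real (prime_part q (triple_prime f)) powr (3/2) * real (prime_part q (special_prime f)) powr (1/2)"
    by (simp only: prod.distrib prime_part_powr)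
  also have "(\<Prod>p\<in>prime_factors q. real p powr (-7/2)) = real q powr (-7/2)"
    using prime_part_powr[where q = q and S = "\<lambda>_. True" and x = "-7/2"] prime_part_all[OF q, of "\<lambda>_. True"] by simp
  finally show ?thesis .
qed

lemma prime_parts_dvd:
  assumes q: "squarefree q"
  shows "prime_part q (content_prime f) * prime_part q (triple_prime f) dvd q"
    "prime_part q (content_prime f) * prime_part q (triple_prime f) * prime_part q (special_prime f) dvd q"
proof -
  have 1: "prime_part q (content_prime f) * prime_part q (triple_prime f) =
      prime_part q (\<lambda>p. content_prime f p \<or> triple_prime f p)"
    by (rule prime_part_mult) (simp add: content_prime_def triple_prime_def)
  then show "prime_part q (content_prime f) * prime_part q (triple_prime f) dvd q"
    by (simp add: prime_part_dvd[OF q])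
  have "prime_part q (content_prime f) * prime_part q (triple_prime f) * prime_part q (special_prime f) =
      prime_part q (\<lambda>p. (content_prime f p \<or> triple_prime f p) \<or> special_prime f p)"
    unfolding 1 by (rule prime_part_mult) (auto simp: content_prime_def triple_prime_def special_prime_def)
  then show "prime_part q (content_prime f) * prime_part q (triple_prime f) * prime_part q (special_prime f) dvd q"
    by (simp add: prime_part_dvd[OF q])
qed

lemma modulus_weight_triple_root:
  assumes q: "squarefree q" and IJ: "inv_I f = 0" "inv_J f = 0"
  shows "modulus_weight f q = real q powr (-2) * real (prime_part q (content_prime f))"
proof -
  define c where "c = prime_part q (content_prime f)"
  define t where "t = prime_part q (triple_prime f)"
  have s: "prime_part q (special_prime f) = 1"
  proof -
    have "{p \<in> prime_factors q. special_prime f p} = {}" using IJ by (auto simp: special_prime_def)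
    then show ?thesis unfolding prime_part_def by (simp only: prod.empty)
  qed
  have "c * t = prime_part q (\<lambda>p. content_prime f p \<or> triple_prime f p)"
    unfolding c_def t_def by (rule prime_part_mult) (simp add: content_prime_def triple_prime_def)
  also have "\<dots> = q" by (rule prime_part_all[OF q]) (simp add: content_prime_def triple_prime_def IJ)
  finally have ct: "real q = real c * real t" by (metis of_nat_mult)
  have pos: "real c > 0" "real t > 0" using prime_part_pos by (simp_all add: c_def t_def)
  have "modulus_weight f q = (real c * real t) powr (-7/2) * real c powr (5/2) * real t powr (3/2)"
    unfolding modulus_weight_eq[OF q] s c_def[symmetric] t_def[symmetric] ct by simp
  also have "\<dots> = (real c powr (-7/2) * real c powr (5/2)) * (real t powr (-7/2) * real t powr (3/2))"
    by (simp add: powr_mult)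
  also have "\<dots> = real c powr (-1) * real t powr (-2)"
    using pos by (simp add: powr_add[symmetric])
  also have "\<dots> = (real c powr (-2) * real c powr 1) * real t powr (-2)"
    using pos by (simp only: powr_add[symmetric]) simp
  also have "\<dots> = (real c * real t) powr (-2) * real c"
    using pos by (simp add: powr_mult)
  finally show ?thesis by (simp add: ct c_def)
qed

lemma modulus_weight_special:
  assumes q: "squarefree q" and X: "generic_cov f = 0"
  shows "modulus_weight f q = real q powr (-3) * real (prime_part q (content_prime f)) ^ 2 * real (prime_part q (triple_prime f))"
proof -
  define c where "c = prime_part q (content_prime f)"
  define t where "t = prime_part q (triple_prime f)"
  define s where "s = prime_part q (special_prime f)"
  have "c * t * s = prime_part q (\<lambda>p. content_prime f p \<or> triple_prime f p) * s"
    unfolding c_def t_def by (subst prime_part_mult) (simp_all add: content_prime_def triple_prime_def)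
  also have "\<dots> = prime_part q (\<lambda>p. (content_prime f p \<or> triple_prime f p) \<or> special_prime f p)"
    unfolding s_def by (rule prime_part_mult) (auto simp: content_prime_def triple_prime_def special_prime_def)
  also have "\<dots> = q"
    by (rule prime_part_all[OF q]) (auto simp: content_prime_def triple_prime_def special_prime_def X)
  finally have cts: "real q = real c * real t * real s" by (metis of_nat_mult)
  have pos: "real c > 0" "real t > 0" "real s > 0" using prime_part_pos by (simp_all add: c_def t_def s_def)
  have "modulus_weight f q = (real c * real t * real s) powr (-7/2) * real c powr (5/2) * real t powr (3/2) * real s powr (1/2)"
    unfolding modulus_weight_eq[OF q] s_def[symmetric] c_def[symmetric] t_def[symmetric] cts by simp
  also have "\<dots> = (real c powr (-7/2) * real c powr (5/2)) * (real t powr (-7/2) * real t powr (3/2)) *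
      (real s powr (-7/2) * real s powr (1/2))"
    by (simp add: powr_mult)
  also have "\<dots> = real c powr (-1) * real t powr (-2) * real s powr (-3)"
    using pos by (simp add: powr_add[symmetric])
  also have "\<dots> = (real c powr (-3) * real c powr (real 2)) * (real t powr (-3) * real t powr 1) * real s powr (-3)"
    using pos by (simp only: powr_add[symmetric]) simp
  also have "\<dots> = (real c * real t * real s) powr (-3) * real c ^ 2 * real t"
    using pos by (simp add: powr_mult powr_realpow)
  finally show ?thesis by (simp add: cts c_def t_def)
qed

lemma card_multiples_le:
  fixes w :: nat and x :: real
  assumes "w > 0" "x \<ge> 0"
  shows "real (card {q::nat. w dvd q \<and> q > 0 \<and> real q \<le> x}) \<le> x / real w"
proof -
  have "{q::nat. w dvd q \<and> q > 0 \<and> real q \<le> x} \<subseteq> (\<lambda>k. w * k) ` {1..nat \<lfloor>x / real w\<rfloor>}"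
  proof
    fix q assume q: "q \<in> {q::nat. w dvd q \<and> q > 0 \<and> real q \<le> x}"
    then obtain k where k: "q = w * k" by (auto elim: dvdE)
    have "real w * real k \<le> x" using q k by auto
    then have "real k \<le> x / real w" using assms by (simp add: field_simps)
    then have "k \<le> nat \<lfloor>x / real w\<rfloor>" by (simp add: le_nat_floor)
    moreover have "k \<ge> 1" using q k by (cases k) auto
    ultimately show "q \<in> (\<lambda>k. w * k) ` {1..nat \<lfloor>x / real w\<rfloor>}" using k by auto
  qed
  then have "card {q::nat. w dvd q \<and> q > 0 \<and> real q \<le> x} \<le> card {1..nat \<lfloor>x / real w\<rfloor>}"
    by (rule surj_card_le[rotated]) simp
  then have "real (card {q::nat. w dvd q \<and> q > 0 \<and> real q \<le> x}) \<le> real (nat \<lfloor>x / real w\<rfloor>)" by simp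
  also have "\<dots> \<le> x / real w" using assms by simp
  finally show ?thesis .
qed

text \<open>
  The moduli with a given key \<open>y\<close> are among the multiples of \<open>wt y\<close> up
  to \<open>x\<close>.
\<close>

lemma sum_by_divisor_key_le:
  fixes D :: "nat set" and K :: "nat \<Rightarrow> 'y" and wt :: "'y \<Rightarrow> nat" and \<phi> :: "'y \<Rightarrow> real"
  assumes D: "\<And>q. q \<in> D \<Longrightarrow> q > 0 \<and> real q \<le> x" and x: "x \<ge> 0"
    and Y: "finite Y" "\<And>q. q \<in> D \<Longrightarrow> K q \<in> Y"
    and wt: "\<And>q. q \<in> D \<Longrightarrow> wt (K q) dvd q" "\<And>y. y \<in> Y \<Longrightarrow> wt y > 0"
    and \<phi>: "\<And>y. y \<in> Y \<Longrightarrow> \<phi> y \<ge> 0"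
  shows "(\<Sum>q\<in>D. \<phi> (K q)) \<le> (\<Sum>y\<in>Y. \<phi> y * (x / real (wt y)))"
proof -
  have finD: "finite D" using D by (intro finite_subset[of D "{..nat \<lfloor>x\<rfloor>}"]) (auto simp: le_nat_floor)
  have "(\<Sum>q\<in>D. \<phi> (K q)) = (\<Sum>y\<in>Y. \<Sum>q | q \<in> D \<and> K q = y. \<phi> (K q))"
    by (rule sum.group[symmetric]) (use finD Y in auto)
  also have "\<dots> \<le> (\<Sum>y\<in>Y. \<phi> y * (x / real (wt y)))"
  proof (rule sum_mono)
    fix y assume y: "y \<in> Y"
    have "(\<Sum>q | q \<in> D \<and> K q = y. \<phi> (K q)) = real (card {q. q \<in> D \<and> K q = y}) * \<phi> y" by simp
    also have "\<dots> \<le> (x / real (wt y)) * \<phi> y"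
    proof (rule mult_right_mono)
      have "{q. q \<in> D \<and> K q = y} \<subseteq> {q. wt y dvd q \<and> q > 0 \<and> real q \<le> x}" using D wt(1) by auto
      moreover have "finite {q. wt y dvd q \<and> q > 0 \<and> real q \<le> x}"
        by (rule finite_subset[of _ "{..nat \<lfloor>x\<rfloor>}"]) (auto simp: le_nat_floor)
      ultimately have "card {q. q \<in> D \<and> K q = y} \<le> card {q. wt y dvd q \<and> q > 0 \<and> real q \<le> x}"
        by (intro card_mono)
      then show "real (card {q. q \<in> D \<and> K q = y}) \<le> x / real (wt y)"
        using card_multiples_le[OF wt(2)[OF y] x] by linarith
    qed (rule \<phi>[OF y])
    finally show "(\<Sum>q | q \<in> D \<and> K q = y. \<phi> (K q)) \<le> \<phi> y * (x / real (wt y))" by (simp add: mult.commute)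
  qed
  finally show ?thesis .
qed

section \<open>Averages over moduli and over forms of given content\<close>

text \<open>
  The range of \<open>q / gcd(q, 6)\<close> for \<open>q\<close> in \<open>[Q, 2Q]\<close>.
\<close>

definition coprime_moduli :: "real \<Rightarrow> nat set" where
  "coprime_moduli Q = {q. squarefree q \<and> coprime q 6 \<and> Q / 6 \<le> real q \<and> real q \<le> 2 * Q}"

definition content_divisors :: "int quartic_form \<Rightarrow> nat set" where
  "content_divisors f = {d. form_dvd (int d) f}"

text \<open>
  The possible values of the divisors of a modulus that are made of the primes dividing
  \<open>f\<close>, and of the primes modulo which \<open>f\<close> is nonzero with a triple root.
\<close>

definition content_pairs :: "real \<Rightarrow> int quartic_form \<Rightarrow> (nat \<times> nat) set" where
  "content_pairs Q f = {(d, m). d \<in> content_divisors f \<and> m \<in> triple_root_moduli f \<and> real d * real m \<le> 2 * Q}"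

lemma squarefree_pos: "squarefree (q::nat) \<Longrightarrow> q > 0"
  by (rule ccontr) simp

lemma finite_natural_divisors:
  fixes n :: int
  assumes "n \<noteq> 0"
  shows "finite {d::nat. int d dvd n}"
proof (rule finite_subset)
  show "{d::nat. int d dvd n} \<subseteq> {..nat \<bar>n\<bar>}"
  proof
    fix d :: nat assume "d \<in> {d::nat. int d dvd n}"
    then have "int d \<le> \<bar>n\<bar>" using assms dvd_imp_le_int[of n "int d"] by simp
    then show "d \<in> {..nat \<bar>n\<bar>}" by simp
  qed
qed simp

lemma nonzero_form_coefficient:
  assumes "f \<noteq> (0 :: int quartic_form)" "f \<in> int_box r"
  obtains x where "x \<noteq> 0" "\<bar>real_of_int x\<bar> \<le> r" "\<And>m. form_dvd m f \<Longrightarrow> m dvd x"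
proof -
  have "qc0 f \<noteq> 0 \<or> qc1 f \<noteq> 0 \<or> qc2 f \<noteq> 0 \<or> qc3 f \<noteq> 0 \<or> qc4 f \<noteq> 0"
    using assms(1) by (cases f) (simp add: zero_quartic_form_def)
  then show ?thesis
    using that[of "qc0 f"] that[of "qc1 f"] that[of "qc2 f"] that[of "qc3 f"] that[of "qc4 f"]
      int_box_coeff_bounds[OF assms(2)] unfolding form_dvd_def by blast
qed

lemma content_divisor_le:
  assumes "f \<noteq> 0" "f \<in> int_box r" "d \<in> content_divisors f"
  shows "d > 0" "real d \<le> r"
proof -
  obtain x where x: "x \<noteq> 0" "\<bar>real_of_int x\<bar> \<le> r" "\<And>m. form_dvd m f \<Longrightarrow> m dvd x"
    using nonzero_form_coefficient[OF assms(1,2)] by blast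
  have dx: "int d dvd x" using assms(3) x(3) by (simp add: content_divisors_def)
  then show "d > 0" using x(1) by (cases "d = 0") auto
  have "int d \<le> \<bar>x\<bar>" using dx x(1) dvd_imp_le_int[of x "int d"] by simp
  then have "real_of_int (int d) \<le> real_of_int \<bar>x\<bar>" by (simp only: of_int_le_iff)
  then show "real d \<le> r" using x(2) by simp
qed

lemma form_dvd_obtain:
  assumes "form_dvd m f"
  obtains g where "f = form_smult m g"
proof -
  obtain a b c d e where f: "f = Quartic a b c d e" by (cases f)
  have "m dvd a" "m dvd b" "m dvd c" "m dvd d" "m dvd e" using assms by (simp_all add: form_dvd_def f)
  then obtain a' b' c' d' e' where "a = m * a'" "b = m * b'" "c = m * c'" "d = m * d'" "e = m * e'"
    by (elim dvdE)
  then have "f = form_smult m (Quartic a' b' c' d' e')" by (simp add: f form_smult_def)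
  then show ?thesis by (rule that)
qed

lemma covariants_form_smult:
  "inv_I (form_smult k g) = k ^ 2 * inv_I g" "inv_J (form_smult k g) = k ^ 3 * inv_J g"
  "generic_cov (form_smult k g) = k ^ 7 * generic_cov g"
proof -
  show I: "inv_I (form_smult k g) = k ^ 2 * inv_I g" and J: "inv_J (form_smult k g) = k ^ 3 * inv_J g"
    by (simp_all add: form_smult_def inv_I_def inv_J_def eval_nat_numeral algebra_simps)
  have R: "form_R (form_smult k g) = k ^ 3 * form_R g"
    by (simp add: form_smult_def form_R_def eval_nat_numeral algebra_simps)
  have "generic_cov (form_smult k g) = (k * qc0 g) * (k ^ 3 * inv_J g) * (k ^ 3 * form_R g)"
    unfolding generic_cov_def J R by (simp add: form_smult_def)
  also have "\<dots> = (k * k ^ 3 * k ^ 3) * generic_cov g" by (simp only: generic_cov_def mult_ac)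
  also have "k * k ^ 3 * k ^ 3 = k ^ 7" by (simp add: eval_nat_numeral)
  finally show "generic_cov (form_smult k g) = k ^ 7 * generic_cov g" .
qed

lemma form_smult_int_box:
  assumes "d > (0::nat)"
  shows "form_smult (int d) g \<in> int_box r \<longleftrightarrow> g \<in> int_box (r / real d)"
proof -
  have "int d * x \<in> int_ball r \<longleftrightarrow> x \<in> int_ball (r / real d)" for x
    using assms by (simp add: int_ball_def abs_mult pos_le_divide_eq mult.commute)
  then show ?thesis by (cases g) (simp add: form_smult_def int_box_iff)
qed

lemma inj_form_smult: "k \<noteq> 0 \<Longrightarrow> inj (form_smult k)"
  by (rule injI) (simp add: form_smult_def quartic_form.expand)

lemma sum_inverse_squares_le: "(\<Sum>d=1..n. 1 / real d ^ 2) \<le> 2"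
proof (cases "n = 0")
  case False
  then have "n \<ge> 1" by simp
  then have "(\<Sum>d=1..n. 1 / real d ^ 2) \<le> 2 - 1 / real n"
  proof (induction n rule: nat_induct_at_least)
    case (Suc n)
    have n0: "real n > 0" using Suc.hyps by simp
    have "1 / real (Suc n) ^ 2 \<le> 1 / (real n * real (Suc n))"
      unfolding power2_eq_square using n0 by (intro divide_left_mono mult_right_mono) auto
    also have "\<dots> = 1 / real n - 1 / real (Suc n)" using n0 by (simp add: field_simps)
    finally show ?case using Suc.IH by simp
  qed simp
  moreover have "1 / real n \<ge> 0" by simp
  ultimately show ?thesis by linarith
qed simp

lemma powr_neg_le:
  assumes "Q > 0" "Q / 6 \<le> real q" "x \<ge> 0"
  shows "real q powr (- x) \<le> (Q / 6) powr (- x)"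
  using assms by (intro powr_mono2') auto

lemma prime_part_content_dvd:
  assumes "squarefree q"
  shows "prime_part q (content_prime f) \<in> content_divisors f"
  unfolding content_divisors_def mem_Collect_eq form_dvd_def
  by (intro conjI prime_part_dvd_int[OF assms]) (auto simp: content_prime_def form_dvd_def)

lemma prime_part_triple_moduli:
  assumes q: "squarefree q" "coprime q 6"
  shows "prime_part q (triple_prime f) \<in> triple_root_moduli f"
proof -
  define t where "t = prime_part q (triple_prime f)"
  have tq: "t dvd q" unfolding t_def by (rule prime_part_dvd[OF q(1)])
  have "squarefree t" using tq q(1) squarefree_mono by blast
  moreover have "coprime t 6" using tq q(2) coprime_divisors[of t q 6 6] by simp
  moreover have "int t dvd inv_I f" "int t dvd inv_J f"
    unfolding t_def by (rule prime_part_dvd_int[OF q(1)]; simp add: triple_prime_def)+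
  moreover have "\<not> form_dvd (int p) f" if p: "prime p" "p dvd t" for p
  proof -
    have "p \<in> prime_factors t" using p prime_part_pos[of q "triple_prime f"] by (simp add: prime_factors_dvd t_def)
    then have "triple_prime f p" unfolding t_def by (rule prime_part_factor(2)[OF q(1)])
    then show ?thesis by (simp add: triple_prime_def)
  qed
  ultimately show ?thesis unfolding triple_root_moduli_def t_def by blast
qed

text \<open>
  A uniform bound for the number of divisors of all integers that occur. It separates the counting
  from the choice of \<open>\<epsilon>\<close>.
\<close>

locale divisor_bounded =
  fixes T N :: real
  assumes T_ge_1: "T \<ge> 1"
    and divisors_le: "\<And>n::int. n \<noteq> 0 \<Longrightarrow> \<bar>real_of_int n\<bar> \<le> N \<Longrightarrow> real (card {d::nat. int d dvd n}) \<le> T"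
begin

lemma content_divisors_card:
  assumes "f \<noteq> 0" "f \<in> int_box r" "r \<le> N"
  shows "finite (content_divisors f)" "real (card (content_divisors f)) \<le> T"
proof -
  obtain x where x: "x \<noteq> 0" "\<bar>real_of_int x\<bar> \<le> r" "\<And>m. form_dvd m f \<Longrightarrow> m dvd x"
    using nonzero_form_coefficient[OF assms(1,2)] by blast
  have sub: "content_divisors f \<subseteq> {d::nat. int d dvd x}" using x(3) by (auto simp: content_divisors_def)
  have fin: "finite {d::nat. int d dvd x}" by (rule finite_natural_divisors[OF x(1)])
  show "finite (content_divisors f)" using sub fin by (rule finite_subset)
  have "card (content_divisors f) \<le> card {d::nat. int d dvd x}" using fin sub by (rule card_mono)
  moreover have "real (card {d::nat. int d dvd x}) \<le> T" using x(2) assms(3) by (intro divisors_le x(1)) linarith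
  ultimately show "real (card (content_divisors f)) \<le> T" by linarith
qed

text \<open>
  Since \<open>I = J = 0\<close>, every prime not dividing the form gives it a triple root, so
  \<open>q\<close> has weight \<open>c / q^2\<close> with \<open>c\<close> its part dividing the
  content. There are \<open>O(Q/c)\<close> such \<open>q\<close> for each of the few
  \<open>c\<close>.
\<close>

lemma moduli_sum_triple_root:
  assumes f: "f \<noteq> 0" "f \<in> int_box r" "r \<le> N" and Q: "Q > 0" and IJ: "inv_I f = 0" "inv_J f = 0"
  shows "(\<Sum>q\<in>coprime_moduli Q. modulus_weight f q) \<le> 72 * T / Q"
proof -
  define Y where "Y = content_divisors f"
  have Y: "finite Y" "real (card Y) \<le> T" "\<And>y. y \<in> Y \<Longrightarrow> y > 0"
    using content_divisors_card[OF f] content_divisor_le[OF f(1,2)] by (simp_all add: Y_def)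
  define K where "K = (\<lambda>q. prime_part q (content_prime f))"
  define \<phi> where "\<phi> = (\<lambda>y. (Q / 6) powr (-2) * real y)"
  have "(\<Sum>q\<in>coprime_moduli Q. modulus_weight f q) \<le> (\<Sum>q\<in>coprime_moduli Q. \<phi> (K q))"
  proof (rule sum_mono)
    fix q assume q: "q \<in> coprime_moduli Q"
    then have "modulus_weight f q = real q powr (-2) * real (K q)"
      using modulus_weight_triple_root[OF _ IJ] by (simp add: coprime_moduli_def K_def)
    also have "\<dots> \<le> \<phi> (K q)" unfolding \<phi>_def
      using q Q by (intro mult_right_mono powr_neg_le) (auto simp: coprime_moduli_def)
    finally show "modulus_weight f q \<le> \<phi> (K q)" .
  qed
  also have "\<dots> \<le> (\<Sum>y\<in>Y. \<phi> y * (2 * Q / real y))"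
    by (rule sum_by_divisor_key_le[where wt = "\<lambda>y. y"])
       (use Q Y in \<open>auto simp: coprime_moduli_def K_def Y_def \<phi>_def squarefree_pos
          intro: prime_part_content_dvd prime_part_dvd\<close>)
  also have "\<dots> = (\<Sum>y\<in>Y. (Q / 6) powr (-2) * (2 * Q))"
    by (intro sum.cong refl) (use Y(3) in \<open>force simp: \<phi>_def\<close>)
  also have "\<dots> = real (card Y) * ((Q / 6) powr (-2) * (2 * Q))" by simp
  also have "(Q / 6) powr (-2) * (2 * Q) = 72 / Q"
    using Q by (simp add: powr_minus powr_realpow[of "Q / 6" 2, simplified] field_simps power2_eq_square)
  also have "real (card Y) * (72 / Q) \<le> T * (72 / Q)" using Y(2) Q by (intro mult_right_mono) auto
  finally show ?thesis by (simp add: mult.commute)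
qed

text \<open>
  Now \<open>q\<close> has weight \<open>c^2 t / q^3\<close>, where \<open>t\<close> divides the
  nonzero integer \<open>n\<close>, and there are \<open>O(Q / (c t))\<close> such
  \<open>q\<close> for each pair \<open>(c, t)\<close>.
\<close>

lemma moduli_sum_special:
  assumes f: "f \<noteq> 0" "f \<in> int_box r" "r \<le> N" and Q: "Q > 0" and X: "generic_cov f = 0"
    and n: "n \<noteq> 0" "\<bar>real_of_int n\<bar> \<le> N" "\<And>m. m dvd inv_I f \<Longrightarrow> m dvd inv_J f \<Longrightarrow> m dvd n"
  shows "(\<Sum>q\<in>coprime_moduli Q. modulus_weight f q) \<le> 432 * T / Q ^ 2 * (\<Sum>d\<in>content_divisors f. real d)"
proof -
  define C where "C = content_divisors f"
  define D where "D = {m::nat. int m dvd n}"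
  have C: "finite C" "\<And>y. y \<in> C \<Longrightarrow> y > 0"
    using content_divisors_card[OF f] content_divisor_le[OF f(1,2)] by (simp_all add: C_def)
  have D: "finite D" "real (card D) \<le> T" "\<And>y. y \<in> D \<Longrightarrow> y > 0"
    using finite_natural_divisors[OF n(1)] divisors_le[OF n(1,2)] n(1) by (auto simp: D_def intro!: gr0I)
  define K where "K = (\<lambda>q. (prime_part q (content_prime f), prime_part q (triple_prime f)))"
  define \<phi> :: "nat \<times> nat \<Rightarrow> real" where "\<phi> = (\<lambda>(c, t). (Q / 6) powr (-3) * real c ^ 2 * real t)"
  have "(\<Sum>q\<in>coprime_moduli Q. modulus_weight f q) \<le> (\<Sum>q\<in>coprime_moduli Q. \<phi> (K q))"
  proof (rule sum_mono)
    fix q assume q: "q \<in> coprime_moduli Q"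
    then have "modulus_weight f q = real q powr (-3) * real (prime_part q (content_prime f)) ^ 2 * real (prime_part q (triple_prime f))"
      using modulus_weight_special[OF _ X] by (simp add: coprime_moduli_def)
    also have "\<dots> \<le> \<phi> (K q)" unfolding \<phi>_def K_def prod.case
      using q Q by (intro mult_right_mono powr_neg_le) (auto simp: coprime_moduli_def)
    finally show "modulus_weight f q \<le> \<phi> (K q)" .
  qed
  also have "\<dots> \<le> (\<Sum>y\<in>C \<times> D. \<phi> y * (2 * Q / real ((\<lambda>(c, t). c * t) y)))"
  proof (rule sum_by_divisor_key_le)
    fix q assume "q \<in> coprime_moduli Q"
    then have q: "squarefree q" "coprime q 6" "real q \<le> 2 * Q" by (auto simp: coprime_moduli_def)
    show "q > 0 \<and> real q \<le> 2 * Q" using q squarefree_pos by auto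
    have "prime_part q (triple_prime f) \<in> D"
      using prime_part_triple_moduli[OF q(1,2), of f] n(3) by (simp add: D_def triple_root_moduli_def)
    then show "K q \<in> C \<times> D" using prime_part_content_dvd[OF q(1)] by (simp add: K_def C_def)
    show "(\<lambda>(c, t). c * t) (K q) dvd q" using prime_parts_dvd(1)[OF q(1)] by (simp add: K_def)
  next
    fix y assume "y \<in> C \<times> D"
    then show "(\<lambda>(c, t). c * t) y > 0" using C D by auto
    show "\<phi> y \<ge> 0" by (simp add: \<phi>_def split: prod.split)
  qed (use Q C D in auto)
  also have "\<dots> = (\<Sum>y\<in>C \<times> D. ((Q / 6) powr (-3) * (2 * Q)) * real (fst y))"
  proof (rule sum.cong[OF refl])
    fix y assume y: "y \<in> C \<times> D"
    obtain c t where ct: "y = (c, t)" by (cases y)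
    have "real c > 0" "real t > 0" using y C D by (auto simp: ct)
    then show "\<phi> y * (2 * Q / real ((\<lambda>(c, t). c * t) y)) = ((Q / 6) powr (-3) * (2 * Q)) * real (fst y)"
      by (simp add: \<phi>_def ct power2_eq_square)
  qed
  also have "\<dots> = (\<Sum>c\<in>C. \<Sum>t\<in>D. ((Q / 6) powr (-3) * (2 * Q)) * real c)"
    unfolding sum.cartesian_product by (intro sum.cong refl) auto
  also have "\<dots> = (\<Sum>c\<in>C. real (card D) * (((Q / 6) powr (-3) * (2 * Q)) * real c))"
    by (simp only: sum_constant)
  also have "\<dots> = real (card D) * (((Q / 6) powr (-3) * (2 * Q)) * (\<Sum>c\<in>C. real c))"
    by (simp only: sum_distrib_left)
  also have "(Q / 6) powr (-3) * (2 * Q) = 432 / Q ^ 2"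
    using Q by (simp add: powr_minus powr_realpow[of "Q / 6" 3, simplified] field_simps power2_eq_square power3_eq_cube)
  also have "real (card D) * (432 / Q ^ 2 * (\<Sum>c\<in>C. real c)) \<le> T * (432 / Q ^ 2 * (\<Sum>c\<in>C. real c))"
    using D(2) Q by (intro mult_right_mono mult_nonneg_nonneg sum_nonneg) auto
  also have "\<dots> = 432 * T / Q ^ 2 * (\<Sum>c\<in>C. real c)" by simp
  finally show ?thesis unfolding C_def .
qed

text \<open>
  Now \<open>q\<close> has weight \<open>q^(-7/2) c^(5/2) t^(3/2) s^(1/2)\<close>, where
  \<open>s\<close> divides \<open>generic_cov f\<close>, and there are \<open>O(Q / (c t
  s))\<close> such \<open>q\<close>. The remaining factor \<open>s^(-1/2)\<close> is estimated by
  1.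
\<close>

lemma moduli_sum_generic:
  assumes f: "f \<noteq> 0" "f \<in> int_box r" "r \<le> N" and Q: "Q > 0"
    and X: "generic_cov f \<noteq> 0" "\<bar>real_of_int (generic_cov f)\<bar> \<le> N"
  shows "(\<Sum>q\<in>coprime_moduli Q. modulus_weight f q) \<le> 2592 * T * Q powr (-5/2) *
     (\<Sum>(d, m)\<in>content_pairs Q f. real d * sqrt (real d) * sqrt (real m))"
proof -
  define Y where "Y = content_pairs Q f"
  define D where "D = {m::nat. int m dvd generic_cov f}"
  have J: "inv_J f \<noteq> 0" using X by (auto simp: generic_cov_def)
  have "Y \<subseteq> content_divisors f \<times> {m::nat. int m dvd inv_J f}"
    by (auto simp: Y_def content_pairs_def triple_root_moduli_def)
  then have finY: "finite Y"
    using content_divisors_card(1)[OF f] finite_natural_divisors[OF J] finite_subset by blast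
  have Ypos: "real c > 0 \<and> real t > 0" if "(c, t) \<in> Y" for c t
    using that content_divisor_le(1)[OF f(1,2)] squarefree_pos by (auto simp: Y_def content_pairs_def triple_root_moduli_def)
  have D: "finite D" "real (card D) \<le> T" "\<And>y. y \<in> D \<Longrightarrow> y > 0"
    using finite_natural_divisors[OF X(1)] divisors_le[OF X] X(1) by (auto simp: D_def intro!: gr0I)
  define K where "K = (\<lambda>q. ((prime_part q (content_prime f), prime_part q (triple_prime f)), prime_part q (special_prime f)))"
  define wt :: "(nat \<times> nat) \<times> nat \<Rightarrow> nat" where "wt = (\<lambda>((c, t), s). c * t * s)"
  define \<phi> :: "(nat \<times> nat) \<times> nat \<Rightarrow> real" where
    "\<phi> = (\<lambda>((c, t), s). (Q / 6) powr (-7/2) * real c powr (5/2) * real t powr (3/2) * real s powr (1/2))"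
  define \<kappa> where "\<kappa> = (Q / 6) powr (-7/2) * (2 * Q)"
  have "(\<Sum>q\<in>coprime_moduli Q. modulus_weight f q) \<le> (\<Sum>q\<in>coprime_moduli Q. \<phi> (K q))"
  proof (rule sum_mono)
    fix q assume q: "q \<in> coprime_moduli Q"
    then have sq: "squarefree q" by (simp add: coprime_moduli_def)
    have "real q powr (- (7/2)) \<le> (Q / 6) powr (- (7/2))"
      using q Q by (intro powr_neg_le) (auto simp: coprime_moduli_def)
    then have "real q powr (-7/2) \<le> (Q / 6) powr (-7/2)" by simp
    then show "modulus_weight f q \<le> \<phi> (K q)"
      unfolding \<phi>_def K_def prod.case modulus_weight_eq[OF sq] by (intro mult_right_mono) auto
  qed
  also have "\<dots> \<le> (\<Sum>y\<in>Y \<times> D. \<phi> y * (2 * Q / real (wt y)))"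
  proof (rule sum_by_divisor_key_le)
    fix q assume "q \<in> coprime_moduli Q"
    then have q: "squarefree q" "coprime q 6" "real q \<le> 2 * Q" by (auto simp: coprime_moduli_def)
    then have q0: "q > 0" using squarefree_pos by blast
    show "q > 0 \<and> real q \<le> 2 * Q" using q q0 by auto
    have "prime_part q (content_prime f) * prime_part q (triple_prime f) \<le> q"
      using prime_parts_dvd(1)[OF q(1)] q0 by (intro dvd_imp_le)
    then have "real (prime_part q (content_prime f) * prime_part q (triple_prime f)) \<le> real q"
      by (simp only: of_nat_le_iff)
    then have "real (prime_part q (content_prime f)) * real (prime_part q (triple_prime f)) \<le> 2 * Q"
      using q(3) by simp
    then have "(prime_part q (content_prime f), prime_part q (triple_prime f)) \<in> Y"
      using prime_part_content_dvd[OF q(1)] prime_part_triple_moduli[OF q(1,2)]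
      by (simp add: Y_def content_pairs_def)
    moreover have "prime_part q (special_prime f) \<in> D"
      unfolding D_def mem_Collect_eq by (rule prime_part_dvd_int[OF q(1)]) (simp add: special_prime_def)
    ultimately show "K q \<in> Y \<times> D" by (simp add: K_def)
    show "wt (K q) dvd q" using prime_parts_dvd(2)[OF q(1)] by (simp add: K_def wt_def)
  next
    fix y assume y: "y \<in> Y \<times> D"
    obtain c t s where cts: "y = ((c, t), s)" by (metis surj_pair)
    show "wt y > 0" using y Ypos[of c t] D(3)[of s] by (simp add: cts wt_def)
    show "\<phi> y \<ge> 0" by (simp add: \<phi>_def cts)
  qed (use Q finY D in auto)
  also have "\<dots> \<le> (\<Sum>y\<in>Y \<times> D. \<kappa> * (real (fst (fst y)) * sqrt (real (fst (fst y))) * sqrt (real (snd (fst y)))))"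
  proof (rule sum_mono)
    fix y assume y: "y \<in> Y \<times> D"
    obtain c t s where cts: "y = ((c, t), s)" by (metis surj_pair)
    have pos: "real c > 0" "real t > 0" "real s \<ge> 1"
      using y Ypos[of c t] D(3)[of s] by (auto simp: cts)
    have 1: "real c powr (5/2) / real c = real c * sqrt (real c)"
    proof -
      have "real c powr (5/2) = real c powr (1 + 1 + 1/2)" by simp
      also have "\<dots> = real c * real c * sqrt (real c)" using pos by (simp only: powr_add powr_one powr_half_sqrt)
      finally show ?thesis using pos by simp
    qed
    have 2: "real t powr (3/2) / real t = sqrt (real t)"
    proof -
      have "real t powr (3/2) = real t powr (1 + 1/2)" by simp
      also have "\<dots> = real t * sqrt (real t)" using pos by (simp only: powr_add powr_one powr_half_sqrt)
      finally show ?thesis using pos by simp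
    qed
    have 3: "real s powr (1/2) / real s \<le> 1"
    proof -
      have "real s powr (1/2) \<le> real s powr 1" using pos by (intro powr_mono) auto
      then show ?thesis using pos by simp
    qed
    have "\<phi> y * (2 * Q / real (wt y)) = \<kappa> * (real c powr (5/2) / real c) * (real t powr (3/2) / real t) * (real s powr (1/2) / real s)"
      by (simp add: \<phi>_def \<kappa>_def cts wt_def)
    also have "\<dots> \<le> \<kappa> * (real c powr (5/2) / real c) * (real t powr (3/2) / real t) * 1"
      using 3 Q by (intro mult_left_mono) (auto simp: \<kappa>_def)
    finally show "\<phi> y * (2 * Q / real (wt y)) \<le> \<kappa> * (real (fst (fst y)) * sqrt (real (fst (fst y))) * sqrt (real (snd (fst y))))"
      by (simp only: 1 2 cts fst_conv snd_conv mult_1_right mult.assoc)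
  qed
  also have "\<dots> = (\<Sum>y\<in>Y. \<Sum>s\<in>D. \<kappa> * (real (fst y) * sqrt (real (fst y)) * sqrt (real (snd y))))"
    unfolding sum.cartesian_product by (intro sum.cong refl) auto
  also have "\<dots> = (\<Sum>y\<in>Y. real (card D) * (\<kappa> * (real (fst y) * sqrt (real (fst y)) * sqrt (real (snd y)))))"
    by (simp only: sum_constant)
  also have "\<dots> = real (card D) * (\<kappa> * (\<Sum>y\<in>Y. real (fst y) * sqrt (real (fst y)) * sqrt (real (snd y))))"
    by (simp only: sum_distrib_left)
  also have "\<dots> \<le> T * ((2592 * Q powr (-5/2)) * (\<Sum>y\<in>Y. real (fst y) * sqrt (real (fst y)) * sqrt (real (snd y))))"
  proof (intro mult_mono mult_right_mono sum_nonneg)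
    have "(Q / 6) powr (-7/2) = Q powr (-7/2) * 6 powr (7/2)"
      using Q by (simp add: powr_divide powr_minus field_simps)
    moreover have "Q powr (-7/2) * Q = Q powr (-5/2)"
      using powr_add[of Q "-7/2" 1] Q by simp
    ultimately have "\<kappa> = 2 * 6 powr (7/2) * Q powr (-5/2)" by (simp add: \<kappa>_def mult_ac)
    moreover have "(6::real) powr (7/2) \<le> 6 powr (real 4)" by (intro powr_mono) auto
    then have "(6::real) powr (7/2) \<le> 1296" by (simp only: powr_realpow) simp
    then have "2 * 6 powr (7/2) * Q powr (-5/2) \<le> 2 * 1296 * Q powr (-5/2)"
      by (intro mult_right_mono mult_left_mono) auto
    ultimately show "\<kappa> \<le> 2592 * Q powr (-5/2)" by simp
  qed (use T_ge_1 D(2) Q in \<open>auto simp: \<kappa>_def intro!: mult_nonneg_nonneg sum_nonneg\<close>)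
  finally show ?thesis by (simp add: Y_def split_beta mult_ac)
qed

end

text \<open>
  The forms divisible by \<open>d\<close> correspond to the forms in the box of radius
  \<open>r/d\<close>, so that \<open>d\<close> contributes \<open>O(d (r/d)^4)\<close>.
\<close>

lemma sum_content_special:
  assumes r: "r \<ge> 1"
  shows "(\<Sum>f | f \<in> int_box r \<and> f \<noteq> 0 \<and> generic_cov f = 0. \<Sum>d\<in>content_divisors f. real d) \<le> 648 * r ^ 4"
proof -
  define F where "F = {f. f \<in> int_box r \<and> f \<noteq> 0 \<and> generic_cov f = 0}"
  define n where "n = nat \<lfloor>r\<rfloor>"
  have finF: "finite F" by (simp add: F_def finite_int_box)
  have cd: "(\<Sum>d\<in>content_divisors f. real d) = (\<Sum>d=1..n. if d \<in> content_divisors f then real d else 0)"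
    if f: "f \<in> F" for f
  proof -
    have "content_divisors f \<subseteq> {1..n}"
    proof
      fix d assume "d \<in> content_divisors f"
      then have "d > 0" "real d \<le> r" using content_divisor_le f by (auto simp: F_def)
      then show "d \<in> {1..n}" by (simp add: n_def le_nat_floor)
    qed
    then have "content_divisors f = {d \<in> {1..n}. d \<in> content_divisors f}" by auto
    then have "(\<Sum>d\<in>content_divisors f. real d) = (\<Sum>d\<in>{d \<in> {1..n}. d \<in> content_divisors f}. real d)" by simp
    also have "\<dots> = (\<Sum>d=1..n. if d \<in> content_divisors f then real d else 0)" by (rule sum.inter_filter) simp
    finally show ?thesis .
  qed
  have "(\<Sum>f\<in>F. \<Sum>d\<in>content_divisors f. real d) = (\<Sum>f\<in>F. \<Sum>d=1..n. if d \<in> content_divisors f then real d else 0)"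
    by (intro sum.cong refl cd)
  also have "\<dots> = (\<Sum>d=1..n. \<Sum>f\<in>F. if d \<in> content_divisors f then real d else 0)" by (rule sum.swap)
  also have "\<dots> \<le> (\<Sum>d=1..n. 324 * r ^ 4 * (1 / real d ^ 2))"
  proof (rule sum_mono)
    fix d assume d: "d \<in> {1..n}"
    then have d0: "d > 0" by simp
    have "real d \<le> real n" using d by simp
    also have "\<dots> \<le> r" using r by (simp add: n_def)
    finally have dr: "real d \<le> r" .
    define A where "A = {g \<in> int_box (r / real d). generic_cov g = 0}"
    have finA: "finite A" by (simp add: A_def finite_int_box)
    have "{f \<in> F. d \<in> content_divisors f} \<subseteq> form_smult (int d) ` A"
    proof
      fix f assume f: "f \<in> {f \<in> F. d \<in> content_divisors f}"
      then obtain g where g: "f = form_smult (int d) g" using form_dvd_obtain by (auto simp: content_divisors_def)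
      then have "g \<in> A" using f d0 by (simp add: A_def F_def form_smult_int_box covariants_form_smult)
      then show "f \<in> form_smult (int d) ` A" using g by blast
    qed
    then have "card {f \<in> F. d \<in> content_divisors f} \<le> card A" by (rule surj_card_le[OF finA])
    moreover have "real (card A) \<le> 324 * (r / real d) ^ 4"
      unfolding A_def using d0 dr by (intro generic_cov_zero_count) simp
    ultimately have c: "real (card {f \<in> F. d \<in> content_divisors f}) \<le> 324 * (r / real d) ^ 4" by linarith
    have "(\<Sum>f\<in>F. if d \<in> content_divisors f then real d else 0) = (\<Sum>f\<in>{f \<in> F. d \<in> content_divisors f}. real d)"
      by (rule sum.inter_filter[symmetric, OF finF])
    also have "\<dots> = real (card {f \<in> F. d \<in> content_divisors f}) * real d" by simp
    also have "\<dots> \<le> 324 * (r / real d) ^ 4 * real d" using c by (intro mult_right_mono) auto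
    also have "\<dots> = 324 * r ^ 4 * (1 / real d ^ 3)" using d0 by (simp add: power_divide eval_nat_numeral)
    also have "\<dots> \<le> 324 * r ^ 4 * (1 / real d ^ 2)"
      using d0 r by (intro mult_left_mono divide_left_mono power_increasing) auto
    finally show "(\<Sum>f\<in>F. if d \<in> content_divisors f then real d else 0) \<le> 324 * r ^ 4 * (1 / real d ^ 2)" .
  qed
  also have "\<dots> = 324 * r ^ 4 * (\<Sum>d=1..n. 1 / real d ^ 2)" by (simp only: sum_distrib_left)
  also have "\<dots> \<le> 324 * r ^ 4 * 2" using r by (intro mult_left_mono sum_inverse_squares_le) auto
  finally show ?thesis by (simp add: F_def)
qed

lemma triple_root_moduli_form_smult:
  assumes "m \<in> triple_root_moduli (form_smult (int d) g)"
  shows "m \<in> triple_root_moduli g"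
proof -
  have m0: "squarefree m \<and> coprime m 6 \<and> int m dvd int d ^ 2 * inv_I g \<and> int m dvd int d ^ 3 * inv_J g \<and>
    (\<forall>p. prime p \<longrightarrow> p dvd m \<longrightarrow> \<not> form_dvd (int p) (form_smult (int d) g))"
    using assms unfolding triple_root_moduli_def mem_Collect_eq covariants_form_smult .
  note I = m0[THEN conjunct2, THEN conjunct2, THEN conjunct1]
  note J = m0[THEN conjunct2, THEN conjunct2, THEN conjunct2, THEN conjunct1]
  have prim: "\<not> form_dvd (int p) (form_smult (int d) g)" if "prime p" "p dvd m" for p
    using m0[THEN conjunct2, THEN conjunct2, THEN conjunct2, THEN conjunct2] that by blast
  have "coprime m d"
  proof (rule ccontr)
    assume "\<not> coprime m d"
    then have "gcd m d \<noteq> 1" by (simp only: coprime_iff_gcd_eq_1 not_False_eq_True)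
    then obtain p where p: "prime p" "p dvd gcd m d" by (rule prime_factor_nat[THEN exE]) blast
    from p(2) have pm: "p dvd m" and pd: "p dvd d" by (rule dvd_trans, simp)+
    from pd have "int p dvd int d" by (simp only: int_dvd_int_iff)
    then have "form_dvd (int p) (form_smult (int d) g)"
      by (simp only: form_dvd_def form_smult_def quartic_form.sel dvd_mult2 simp_thms)
    with prim[OF p(1) pm] show False by (rule notE)
  qed
  then have ic: "coprime (int m) (int d ^ k)" for k by (simp add: coprime_int_iff)
  have "int m dvd inv_I g" using I by (rule iffD1[OF coprime_dvd_mult_right_iff[OF ic]])
  moreover have "int m dvd inv_J g" using J by (rule iffD1[OF coprime_dvd_mult_right_iff[OF ic]])
  moreover have "\<forall>p. prime p \<longrightarrow> p dvd m \<longrightarrow> \<not> form_dvd (int p) g"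
  proof (intro allI impI notI)
    fix p assume p: "prime p" "p dvd m" "form_dvd (int p) g"
    from p(3) have "form_dvd (int p) (form_smult (int d) g)"
      by (simp only: form_dvd_def form_smult_def quartic_form.sel dvd_mult simp_thms)
    with prim[OF p(1,2)] show False by (rule notE)
  qed
  ultimately show ?thesis
    unfolding triple_root_moduli_def mem_Collect_eq
    using m0[THEN conjunct1] m0[THEN conjunct2, THEN conjunct1] by (intro conjI)
qed

text \<open>
  Passing to the box of radius \<open>r/d\<close> saves enough powers of \<open>d\<close> to
  outweigh the factor \<open>d^(3/2)\<close> and to make the sum over \<open>d\<close> converge.
\<close>

lemma rescaled_box_bound:
  fixes x r Q P :: real
  assumes x: "x \<ge> 1" and r: "r \<ge> 0" and Q: "Q \<ge> 0" and P: "P \<ge> 0"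
  shows "x * sqrt x * (P * ((r / x) ^ 5 + (r / x) ^ 4 * sqrt (2 * Q / x))) \<le>
    P * (r ^ 5 + r ^ 4 * sqrt (2 * Q)) * (1 / x ^ 2)"
proof -
  define s where "s = sqrt x"
  define w where "w = sqrt (2 * Q)"
  have s: "s > 0" "s \<le> x" 
  proof -
    show "s > 0" using x by (simp add: s_def)
    have "x \<le> x ^ 2" by (rule self_le_power[OF x]) simp
    then show "s \<le> x" unfolding s_def using x by (intro real_le_lsqrt) simp_all
  qed
  have w: "w \<ge> 0" using Q by (simp add: w_def)
  have e0: "sqrt (2 * Q / x) = w / s" by (simp add: w_def s_def real_sqrt_divide)
  have x4: "x ^ 4 = x * x ^ 3" and x5: "x ^ 5 = x * x * x ^ 3" by (simp_all add: eval_nat_numeral)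
  have inv: "1 / x ^ 3 \<le> 1 / x ^ 2" using x by (intro divide_left_mono power_increasing) auto
  have "(r / x) ^ 5 = r ^ 5 / (x * x * x ^ 3)" by (simp only: power_divide x5)
  moreover have "x * s * (r ^ 5 / (x * x * z)) = r ^ 5 * (s / (x * z))" for z using x by simp
  ultimately have "x * s * (r / x) ^ 5 = r ^ 5 * (s / (x * x ^ 3))" by (simp only:)
  also have "s / (x * x ^ 3) \<le> x / (x * x ^ 3)" using s x by (intro divide_right_mono) auto
  also have "x / (x * x ^ 3) = 1 / x ^ 3" using x by simp
  also note inv
  finally have 1: "x * s * (r / x) ^ 5 \<le> r ^ 5 * (1 / x ^ 2)" using r by (simp add: mult_left_mono)
  have "x * s * ((r / x) ^ 4 * (w / s)) = r ^ 4 * w * (1 / x ^ 3)"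
  proof -
    have "(r / x) ^ 4 = r ^ 4 / (x * x ^ 3)" by (simp only: power_divide x4)
    moreover have "x * s * (r ^ 4 / (x * z) * (w / s)) = r ^ 4 * w * (1 / z)" for z using x s(1) by simp
    ultimately show ?thesis by (simp only:)
  qed
  also have "\<dots> \<le> r ^ 4 * w * (1 / x ^ 2)" using inv r w by (intro mult_left_mono) auto
  finally have 2: "x * s * ((r / x) ^ 4 * (w / s)) \<le> r ^ 4 * w * (1 / x ^ 2)" .
  have "x * s * (P * ((r / x) ^ 5 + (r / x) ^ 4 * (w / s))) =
      P * (x * s * (r / x) ^ 5 + x * s * ((r / x) ^ 4 * (w / s)))"
  proof -
    have "x * s * (P * (a + b)) = P * (x * s * a + x * s * b)" for a b by (simp add: algebra_simps)
    then show ?thesis .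
  qed
  also have "\<dots> \<le> P * (r ^ 5 * (1 / x ^ 2) + r ^ 4 * w * (1 / x ^ 2))"
    by (rule mult_left_mono[OF add_mono[OF 1 2] P])
  also have "\<dots> = P * (r ^ 5 + r ^ 4 * w) * (1 / x ^ 2)" 
  proof -
    have "P * (a * y + b * y) = P * (a + b) * y" for a b y by (simp add: algebra_simps)
    then show ?thesis .
  qed
  finally show ?thesis unfolding e0 s_def[symmetric] w_def[symmetric] .
qed

text \<open>
  Dividing a form by \<open>d\<close> does not change its triple roots modulo primes that do not
  divide \<open>d\<close>.
\<close>

lemma (in divisor_bounded) sum_fixed_content:
  assumes d: "d > 0" "real d \<le> r" and Q: "r < Q" and N: "6000 * (142 * r) ^ 6 \<le> N"
  shows "(\<Sum>f | f \<in> int_box r \<and> generic_cov f \<noteq> 0. \<Sum>m | (d, m) \<in> content_pairs Q f. sqrt (real m))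
    \<le> 1620 * 142 ^ 5 * T * ((r / real d) ^ 5 + (r / real d) ^ 4 * sqrt (2 * Q / real d))"
proof -
  define F where "F = {f. f \<in> int_box r \<and> generic_cov f \<noteq> 0}"
  define H :: "int quartic_form \<Rightarrow> real" where "H = (\<lambda>f. \<Sum>m | (d, m) \<in> content_pairs Q f. sqrt (real m))"
  define A where "A = {g. g \<in> int_box (r / real d) \<and> inv_J g \<noteq> 0}"
  define F1 where "F1 = {f \<in> F. d \<in> content_divisors f}"
  have fin: "finite F" "finite A" by (simp_all add: F_def A_def finite_int_box)
  have H0: "H f \<ge> 0" for f unfolding H_def by (intro sum_nonneg) auto
  have F1: "F1 \<subseteq> form_smult (int d) ` A"
  proof
    fix f assume f: "f \<in> F1"
    then have "form_dvd (int d) f" by (simp add: F1_def content_divisors_def)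
    then obtain g where g: "f = form_smult (int d) g" by (rule form_dvd_obtain)
    have "inv_J f \<noteq> 0" "f \<in> int_box r" using f by (auto simp: F1_def F_def generic_cov_def)
    then have "g \<in> A" using d by (simp add: A_def g form_smult_int_box covariants_form_smult)
    then show "f \<in> form_smult (int d) ` A" using g by blast
  qed
  have zero: "H f = 0" if "f \<in> F - F1" for f
  proof -
    have "{m. (d, m) \<in> content_pairs Q f} = {}" using that by (auto simp: content_pairs_def F1_def)
    then show ?thesis unfolding H_def by (simp only: sum.empty)
  qed
  have "(\<Sum>f\<in>F. H f) = (\<Sum>f\<in>F1. H f)"
    by (rule sum.mono_neutral_right[OF fin(1)]) (use zero in \<open>auto simp: F1_def\<close>)
  also have "\<dots> \<le> (\<Sum>f\<in>form_smult (int d) ` A. H f)"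
    by (rule sum_mono2[OF _ F1]) (use fin H0 in auto)
  also have "\<dots> = (\<Sum>g\<in>A. H (form_smult (int d) g))"
  proof -
    have "int d \<noteq> 0" using d(1) by (simp only: of_nat_eq_0_iff)
    then have inj: "inj_on (form_smult (int d)) A" by (rule inj_on_subset[OF inj_form_smult subset_UNIV])
    show ?thesis by (rule sum.reindex[OF inj, of H, unfolded comp_def])
  qed
  also have "\<dots> \<le> (\<Sum>g\<in>A. \<Sum>m | m \<in> triple_root_moduli g \<and> real m \<le> 2 * Q / real d. sqrt (real m))"
  proof (rule sum_mono)
    fix g
    have "{m. (d, m) \<in> content_pairs Q (form_smult (int d) g)} \<subseteq> {m. m \<in> triple_root_moduli g \<and> real m \<le> 2 * Q / real d}"
    proof
      fix m assume "m \<in> {m. (d, m) \<in> content_pairs Q (form_smult (int d) g)}"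
      then have m: "m \<in> triple_root_moduli (form_smult (int d) g)" "real d * real m \<le> 2 * Q"
        by (simp_all add: content_pairs_def)
      have "real m \<le> 2 * Q / real d" using m(2) d(1) by (simp add: pos_le_divide_eq mult.commute)
      then show "m \<in> {m. m \<in> triple_root_moduli g \<and> real m \<le> 2 * Q / real d}"
        using triple_root_moduli_form_smult[OF m(1)] by simp
    qed
    moreover have "finite {m. m \<in> triple_root_moduli g \<and> real m \<le> 2 * Q / real d}"
      by (rule finite_subset[of _ "{..nat \<lfloor>2 * Q / real d\<rfloor>}"]) (auto simp: le_nat_floor)
    ultimately show "H (form_smult (int d) g) \<le> (\<Sum>m | m \<in> triple_root_moduli g \<and> real m \<le> 2 * Q / real d. sqrt (real m))"
      unfolding H_def by (intro sum_mono2) simp_all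
  qed
  also have "\<dots> \<le> 1620 * 142 ^ 5 * T * ((r / real d) ^ 5 + (r / real d) ^ 4 * sqrt (2 * Q / real d))"
    unfolding A_def
  proof (rule sum_sqrt_triple_root_moduli[OF _ _ T_ge_1])
    show "r / real d \<ge> 1" using d by simp
    show "2 * Q / real d \<ge> 1" using d Q by (simp add: pos_le_divide_eq)
    have "r / real d \<le> r / 1" using d by (intro divide_left_mono) auto
    then have "(142 * (r / real d)) ^ 6 \<le> (142 * r) ^ 6" using d by (intro power_mono) auto
    then show "6000 * (142 * (r / real d)) ^ 6 \<le> N" using N by linarith
    show "real (card {d::nat. int d dvd n}) \<le> T" if "n \<noteq> 0" "\<bar>real_of_int n\<bar> \<le> N" for n
      using that by (rule divisors_le)
  qed
  finally show ?thesis unfolding F_def H_def .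
qed

lemma (in divisor_bounded) sum_content_pairs:
  assumes r: "r \<ge> 1" and Q: "r < Q" and N: "6000 * (142 * r) ^ 6 \<le> N"
  shows "(\<Sum>f | f \<in> int_box r \<and> generic_cov f \<noteq> 0. \<Sum>(d, m)\<in>content_pairs Q f. real d * sqrt (real d) * sqrt (real m))
    \<le> 6480 * 142 ^ 5 * T * (r ^ 5 + r ^ 4 * sqrt Q)"
proof -
  define F where "F = {f. f \<in> int_box r \<and> generic_cov f \<noteq> 0}"
  define n where "n = nat \<lfloor>r\<rfloor>"
  define S where "S = (\<lambda>d f. {m. (d, m) \<in> content_pairs Q f})"
  have F0: "f \<noteq> 0" "inv_J f \<noteq> 0" "f \<in> int_box r" if "f \<in> F" for f
    using that by (auto simp: F_def generic_cov_def zero_quartic_form_def)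
  have finS: "finite (S d f)" if "f \<in> F" for d f
    by (rule finite_subset[OF _ finite_natural_divisors[OF F0(2)[OF that]]])
       (auto simp: S_def content_pairs_def triple_root_moduli_def)
  have expand: "(\<Sum>(d, m)\<in>content_pairs Q f. real d * sqrt (real d) * sqrt (real m)) =
      (\<Sum>d=1..n. real d * sqrt (real d) * (\<Sum>m\<in>S d f. sqrt (real m)))" if f: "f \<in> F" for f
  proof -
    have eq: "content_pairs Q f = (SIGMA d:{1..n}. S d f)"
    proof (intro equalityI subsetI)
      fix z assume z: "z \<in> content_pairs Q f"
      obtain d m where dm: "z = (d, m)" by (cases z)
      have "d \<in> content_divisors f" using z by (simp add: content_pairs_def dm)
      then have "d > 0" "real d \<le> r" using content_divisor_le[OF F0(1)[OF f] F0(3)[OF f]] by simp_all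
      then have "d \<in> {1..n}" by (simp add: n_def le_nat_floor)
      then show "z \<in> (SIGMA d:{1..n}. S d f)" using z by (simp add: S_def dm)
    next
      fix z assume "z \<in> (SIGMA d:{1..n}. S d f)"
      then show "z \<in> content_pairs Q f" by (cases z) (simp add: S_def)
    qed
    have "(\<Sum>(d, m)\<in>content_pairs Q f. real d * sqrt (real d) * sqrt (real m)) =
        (\<Sum>d=1..n. \<Sum>m\<in>S d f. real d * sqrt (real d) * sqrt (real m))"
      unfolding eq by (rule sum.Sigma[symmetric]) (simp_all add: finS[OF f])
    then show ?thesis by (simp only: sum_distrib_left)
  qed
  define P where "P = 1620 * 142 ^ 5 * T"
  have P0: "P \<ge> 0" using T_ge_1 by (simp add: P_def)
  have "(\<Sum>f\<in>F. \<Sum>(d, m)\<in>content_pairs Q f. real d * sqrt (real d) * sqrt (real m)) =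
      (\<Sum>f\<in>F. \<Sum>d=1..n. real d * sqrt (real d) * (\<Sum>m\<in>S d f. sqrt (real m)))"
    by (rule sum.cong[OF refl expand])
  also have "\<dots> = (\<Sum>d=1..n. real d * sqrt (real d) * (\<Sum>f\<in>F. \<Sum>m\<in>S d f. sqrt (real m)))"
    by (subst sum.swap) (simp only: sum_distrib_left)
  also have "\<dots> \<le> (\<Sum>d=1..n. P * (r ^ 5 + r ^ 4 * sqrt (2 * Q)) * (1 / real d ^ 2))"
  proof (rule sum_mono)
    fix d assume d: "d \<in> {1..n}"
    then have d0: "d > 0" by simp
    have "real d \<le> real n" using d by simp
    also have "\<dots> \<le> r" using r by (simp add: n_def)
    finally have dr: "real d \<le> r" .
    have "real d * sqrt (real d) * (\<Sum>f\<in>F. \<Sum>m\<in>S d f. sqrt (real m)) \<le>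
        real d * sqrt (real d) * (P * ((r / real d) ^ 5 + (r / real d) ^ 4 * sqrt (2 * Q / real d)))"
      unfolding F_def S_def P_def
      by (rule mult_left_mono[OF sum_fixed_content[OF d0 dr Q N]]) simp
    also have "\<dots> \<le> P * (r ^ 5 + r ^ 4 * sqrt (2 * Q)) * (1 / real d ^ 2)"
      by (rule rescaled_box_bound) (use d0 r Q P0 in auto)
    finally show "real d * sqrt (real d) * (\<Sum>f\<in>F. \<Sum>m\<in>S d f. sqrt (real m)) \<le>
        P * (r ^ 5 + r ^ 4 * sqrt (2 * Q)) * (1 / real d ^ 2)" .
  qed
  also have "\<dots> = P * (r ^ 5 + r ^ 4 * sqrt (2 * Q)) * (\<Sum>d=1..n. 1 / real d ^ 2)" by (simp only: sum_distrib_left)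
  also have "\<dots> \<le> P * (r ^ 5 + r ^ 4 * sqrt (2 * Q)) * 2"
  proof (rule mult_left_mono[OF sum_inverse_squares_le])
    show "0 \<le> P * (r ^ 5 + r ^ 4 * sqrt (2 * Q))"
      using r Q P0 by (intro mult_nonneg_nonneg add_nonneg_nonneg) auto
  qed
  also have "\<dots> \<le> (P * (2 * r ^ 5 + r ^ 4 * (2 * sqrt Q))) * 2"
  proof (rule mult_right_mono[OF mult_left_mono[OF _ P0]])
    have "sqrt (2 * Q) \<le> sqrt (4 * Q)" using r Q by simp
    also have "\<dots> = 2 * sqrt Q" by (simp add: real_sqrt_mult)
    finally have "r ^ 4 * sqrt (2 * Q) \<le> r ^ 4 * (2 * sqrt Q)" using r by (intro mult_left_mono) auto
    moreover have "r ^ 5 \<ge> 0" using r by simp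
    ultimately show "r ^ 5 + r ^ 4 * sqrt (2 * Q) \<le> 2 * r ^ 5 + r ^ 4 * (2 * sqrt Q)" by linarith
  qed simp
  also have "\<dots> = 4 * P * (r ^ 5 + r ^ 4 * sqrt Q)" by (simp add: algebra_simps)
  finally show ?thesis unfolding F_def P_def by simp
qed

section \<open>The sum over moduli and forms\<close>

text \<open>
  The factor \<open>15\<close> per prime is harmless: \<open>15^\<omega> \<le>
  (2^\<omega>)^4\<close>, and \<open>2^\<omega>\<close> is at most the number of divisors.
\<close>

lemma norm_Phi_hat_le:
  assumes T: "\<And>n. n \<noteq> (0::int) \<Longrightarrow> \<bar>real_of_int n\<bar> \<le> N \<Longrightarrow> real (card {d::nat. int d dvd n}) \<le> T"
    and q: "q \<in> coprime_moduli Q" "2 * Q \<le> N"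
  shows "cmod (Phi_hat_coprime q f) \<le> T ^ 4 * modulus_weight f q"
proof -
  have q': "squarefree q" "coprime q 6" "real q \<le> 2 * Q" using q(1) by (simp_all add: coprime_moduli_def)
  have q0: "q > 0" using squarefree_pos[OF q'(1)] .
  have w0: "modulus_weight f q \<ge> 0"
    unfolding modulus_weight_def local_weight_def by (intro prod_nonneg) simp
  have "real (card {d. d dvd q}) \<le> T"
    using T[of "int q", unfolded int_dvd_int_iff] q0 q'(3) q(2) by simp
  moreover have "(2::real) ^ card (prime_factors q) \<le> real (card {d. d dvd q})"
    using two_power_card_prime_factors_le[OF q0] by (metis of_nat_le_iff of_nat_numeral of_nat_power)
  ultimately have two: "(2::real) ^ card (prime_factors q) \<le> T" by linarith
  have "(15::real) ^ card (prime_factors q) \<le> (2 ^ 4) ^ card (prime_factors q)"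
    by (intro power_mono) simp_all
  also have "\<dots> = (2 ^ card (prime_factors q)) ^ 4"
    by (simp only: power_mult[symmetric] mult.commute)
  also have "\<dots> \<le> T ^ 4" using two by (intro power_mono) simp_all
  finally have "15 ^ card (prime_factors q) * modulus_weight f q \<le> T ^ 4 * modulus_weight f q"
    using w0 by (rule mult_right_mono)
  moreover have "cmod (Phi_hat_coprime q f) \<le> 15 ^ card (prime_factors q) * modulus_weight f q"
    unfolding modulus_weight_def by (rule norm_Phi_hat_coprime_le[OF q'(1,2)])
  ultimately show ?thesis by linarith
qed

text \<open>
  A number is determined by \<open>q / gcd(q, 6)\<close> and \<open>gcd(q, 6)\<close>, and the
  latter takes at most six values.
\<close>

lemma sum_over_coprime_parts_le:
  fixes F :: "nat \<Rightarrow> real"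
  assumes F: "\<And>q. F q \<ge> 0"
  shows "(\<Sum>q | squarefree q \<and> Q \<le> real q \<and> real q \<le> 2 * Q. F (q div gcd q 6)) \<le>
    6 * (\<Sum>q\<in>coprime_moduli Q. F q)"
proof -
  define A where "A = {q::nat. squarefree q \<and> Q \<le> real q \<and> real q \<le> 2 * Q}"
  define h where "h = (\<lambda>q::nat. (q div gcd q 6, gcd q 6))"
  have fin: "finite (coprime_moduli Q)"
    by (rule finite_subset[of _ "{..nat \<lfloor>2 * Q\<rfloor>}"]) (auto simp: coprime_moduli_def le_nat_floor)
  have inj: "inj_on h A"
  proof (rule inj_onI)
    fix x y assume h: "h x = h y"
    have "fst (h z) * snd (h z) = z" for z by (simp add: h_def)
    from this[of x, unfolded h] this[of y] show "x = y" by (rule trans[OF sym])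
  qed
  have sub: "h ` A \<subseteq> coprime_moduli Q \<times> {1..6}"
  proof
    fix z assume "z \<in> h ` A"
    then obtain q where q: "q \<in> A" "z = h q" by blast
    have sq: "squarefree q" "Q \<le> real q" "real q \<le> 2 * Q" using q(1) by (simp_all add: A_def)
    define g where "g = gcd q 6"
    have g: "g > 0" "g \<le> 6" "g dvd q"
      unfolding g_def by (auto intro: dvd_imp_le)
    have eq: "q div g * g = q" using g(3) by simp
    have "squarefree (q div g)" using eq sq(1) by (metis dvd_triv_left squarefree_mono)
    moreover have "coprime (q div g) 6" unfolding g_def by (rule coprime_div_gcd_6[OF sq(1)])
    moreover have "Q / 6 \<le> real (q div g)"
    proof -
      have "real q = real (q div g) * real g" using eq by (metis of_nat_mult)
      also have "\<dots> \<le> real (q div g) * 6" using g(2) by (intro mult_left_mono) simp_all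
      finally show ?thesis using sq(2) by linarith
    qed
    moreover have "real (q div g) \<le> 2 * Q"
    proof -
      have "q div g \<le> q" by simp
      then have "real (q div g) \<le> real q" by (simp only: of_nat_le_iff)
      then show ?thesis using sq(3) by linarith
    qed
    ultimately have "q div g \<in> coprime_moduli Q" by (simp add: coprime_moduli_def)
    moreover have "g \<in> {1..6}" using g(1,2) by simp
    ultimately show "z \<in> coprime_moduli Q \<times> {1..6}" unfolding q(2) h_def g_def by (rule SigmaI)
  qed
  have "(\<Sum>q\<in>A. F (q div gcd q 6)) = (\<Sum>z\<in>h ` A. F (fst z))"
    by (subst sum.reindex[OF inj]) (simp add: h_def)
  also have "\<dots> \<le> (\<Sum>z\<in>coprime_moduli Q \<times> {1..6::nat}. F (fst z))"
    by (rule sum_mono2[OF _ sub]) (use fin F in auto)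
  also have "\<dots> = (\<Sum>q\<in>coprime_moduli Q. \<Sum>g\<in>{1..6::nat}. F q)"
    unfolding sum.cartesian_product by (rule sum.cong[OF refl]) auto
  also have "\<dots> = (\<Sum>q\<in>coprime_moduli Q. 6 * F q)" by simp
  also have "\<dots> = 6 * (\<Sum>q\<in>coprime_moduli Q. F q)" by (simp only: sum_distrib_left)
  finally show ?thesis unfolding A_def .
qed

lemma inv_I_bound:
  assumes "f \<in> int_box r"
  shows "\<bar>real_of_int (inv_I f)\<bar> \<le> 16 * r ^ 2"
proof -
  note b = int_box_coeff_bounds[OF assms]
  have r0: "r \<ge> 0" using b(1) by linarith
  have m: "x * y \<le> r ^ 2 \<and> - (r ^ 2) \<le> x * y" if "\<bar>x\<bar> \<le> r" "\<bar>y\<bar> \<le> r" for x y :: real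
  proof -
    have "\<bar>x * y\<bar> \<le> r ^ 2"
      unfolding abs_mult power2_eq_square using that r0 by (intro mult_mono) auto
    then show ?thesis by linarith
  qed
  have eq: "real_of_int (inv_I f) = 12 * (real_of_int (qc0 f) * real_of_int (qc4 f))
      - 3 * (real_of_int (qc1 f) * real_of_int (qc3 f)) + real_of_int (qc2 f) * real_of_int (qc2 f)"
    by (cases f) (simp add: inv_I_def power2_eq_square)
  show ?thesis unfolding eq abs_le_iff
    using m[OF b(1,5)] m[OF b(2,4)] m[OF b(3,3)] by (intro conjI) linarith+
qed

lemma generic_cov_bound:
  assumes "f \<in> int_box r"
  shows "\<bar>real_of_int (generic_cov f)\<bar> \<le> 1781 * r ^ 7"
proof -
  have r0: "r \<ge> 0" using int_box_coeff_bounds(1)[OF assms] by linarith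
  have "\<bar>real_of_int (generic_cov f)\<bar> = \<bar>real_of_int (qc0 f)\<bar> * \<bar>real_of_int (inv_J f)\<bar> * \<bar>real_of_int (form_R f)\<bar>"
    by (simp add: generic_cov_def abs_mult)
  also have "\<dots> \<le> r * (137 * r ^ 3) * (13 * r ^ 3)"
    using int_box_coeff_bounds(1)[OF assms] inv_J_bound[OF assms] form_R_bound[OF assms] r0
    by (intro mult_mono) auto
  also have "\<dots> = 1781 * r ^ 7" by (simp add: eval_nat_numeral)
  finally show ?thesis .
qed

lemma sum_union_le:
  fixes f :: "'a \<Rightarrow> real"
  assumes "finite A" "finite B" "\<And>x. f x \<ge> 0"
  shows "sum f (A \<union> B) \<le> sum f A + sum f B"
  using sum.union_inter[OF assms(1,2), of f] sum_nonneg[of "A \<inter> B" f, OF assms(3)] by linarith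

text \<open>
  The three terms come from the forms with \<open>I = J = 0\<close>, from the other forms with
  \<open>generic_cov f = 0\<close>, and from those with \<open>generic_cov f\<close> nonzero; the
  last class also contributes to the middle term. The constant \<open>10^17\<close> exceeds the
  numerical constants in the size bounds of the integers whose divisors are counted.
\<close>

lemma (in divisor_bounded) sum_modulus_weights_le:
  assumes r: "r \<ge> 1" "r < Q" and N: "10 ^ 17 * Q ^ 7 \<le> N"
  shows "(\<Sum>f | f \<noteq> 0 \<and> f \<in> int_box r. \<Sum>q\<in>coprime_moduli Q. modulus_weight f q) \<le>
    10 ^ 19 * T ^ 2 * (r ^ 2 / Q + r ^ 4 / Q ^ 2 + r ^ 5 / Q powr (5 / 2))"
proof -
  define S where "S = (\<lambda>f. \<Sum>q\<in>coprime_moduli Q. modulus_weight f q)"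
  define A where "A = {f. f \<noteq> 0 \<and> f \<in> int_box r}"
  define A1 where "A1 = {f \<in> int_box r. f \<noteq> 0 \<and> inv_I f = 0 \<and> inv_J f = 0}"
  define A2 where "A2 = {f \<in> int_box r. f \<noteq> 0 \<and> generic_cov f = 0}"
  define A3 where "A3 = {f. f \<in> int_box r \<and> generic_cov f \<noteq> 0}"
  have Q: "Q > 0" "Q \<ge> 1" using r by auto
  have T0: "T \<ge> 1" by (rule T_ge_1)
  have S0: "S f \<ge> 0" for f
    unfolding S_def modulus_weight_def local_weight_def by (intro sum_nonneg prod_nonneg) simp
  have pw: "c * r ^ k \<le> N" if "0 \<le> c" "c \<le> 10 ^ 17" "k \<le> 7" for c k
  proof -
    have "r ^ k \<le> Q ^ k" using r by (intro power_mono) auto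
    also have "\<dots> \<le> Q ^ 7" using Q that(3) by (intro power_increasing) auto
    finally have "c * r ^ k \<le> 10 ^ 17 * Q ^ 7" using that Q r by (intro mult_mono) auto
    then show ?thesis using N by linarith
  qed
  have sizes: "8 * r ^ 2 \<le> N" "r \<le> N" "6000 * (142 * r) ^ 6 \<le> N" "1781 * r ^ 7 \<le> N" "137 * r ^ 3 \<le> N" "16 * r ^ 2 \<le> N"
  proof -
    show "8 * r ^ 2 \<le> N" by (rule pw) simp_all
    show "r \<le> N" using pw[of 1 1] by simp
    have "6000 * (142 * r) ^ 6 = (6000 * 142 ^ 6) * r ^ 6" by (simp only: power_mult_distrib mult.assoc)
    then show "6000 * (142 * r) ^ 6 \<le> N" using pw[of "6000 * 142 ^ 6" 6] by simp
    show "1781 * r ^ 7 \<le> N" by (rule pw) simp_all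
    show "137 * r ^ 3 \<le> N" by (rule pw) simp_all
    show "16 * r ^ 2 \<le> N" by (rule pw) simp_all
  qed
  have S1: "(\<Sum>f\<in>A1. S f) \<le> 10 ^ 19 * T ^ 2 * (r ^ 2 / Q)"
  proof -
    have "(\<Sum>f\<in>A1. S f) \<le> (\<Sum>f\<in>A1. 72 * T / Q)"
      unfolding S_def
      by (rule sum_mono, rule moduli_sum_triple_root[of _ r]) (use Q(1) sizes(2) in \<open>auto simp: A1_def\<close>)
    also have "\<dots> = real (card A1) * (72 * T / Q)" by (simp only: sum_constant)
    also have "\<dots> \<le> (54 * T * r ^ 2) * (72 * T / Q)"
    proof (rule mult_right_mono)
      have "card A1 \<le> card {f \<in> int_box r. inv_I f = 0 \<and> inv_J f = 0}"
        by (rule card_mono) (auto simp: A1_def finite_int_box)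
      then have "real (card A1) \<le> real (card {f \<in> int_box r. inv_I f = 0 \<and> inv_J f = 0})"
        by (simp only: of_nat_le_iff)
      also have "\<dots> \<le> 54 * T * r ^ 2"
        by (rule triple_root_count[OF r(1) T0 sizes(1) divisors_le])
      finally show "real (card A1) \<le> 54 * T * r ^ 2" .
      show "0 \<le> 72 * T / Q" using T0 Q by simp
    qed
    also have "\<dots> = 3888 * (T ^ 2 * (r ^ 2 / Q))" by (simp add: power2_eq_square mult_ac)
    also have "\<dots> \<le> 10 ^ 19 * (T ^ 2 * (r ^ 2 / Q))" using T0 Q by (intro mult_right_mono) simp_all
    finally show ?thesis by (simp only: mult.assoc)
  qed
  have S2: "(\<Sum>f\<in>A2 - A1. S f) \<le> 10 ^ 18 * T ^ 2 * (r ^ 4 / Q ^ 2)"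
  proof -
    have "(\<Sum>f\<in>A2 - A1. S f) \<le> (\<Sum>f\<in>A2 - A1. 432 * T / Q ^ 2 * (\<Sum>d\<in>content_divisors f. real d))"
    proof (rule sum_mono)
      fix f assume "f \<in> A2 - A1"
      then have f: "f \<noteq> 0" "f \<in> int_box r" "generic_cov f = 0" "inv_I f \<noteq> 0 \<or> inv_J f \<noteq> 0"
        by (auto simp: A1_def A2_def)
      have "\<exists>n. n \<noteq> 0 \<and> \<bar>real_of_int n\<bar> \<le> N \<and> (\<forall>m. m dvd inv_I f \<longrightarrow> m dvd inv_J f \<longrightarrow> m dvd n)"
      proof (cases "inv_I f = 0")
        case True
        then have "inv_J f \<noteq> 0" using f(4) by simp
        then show ?thesis using inv_J_bound[OF f(2)] sizes(5) by (intro exI[of _ "inv_J f"]) auto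
      next
        case False
        then show ?thesis using inv_I_bound[OF f(2)] sizes(6) by (intro exI[of _ "inv_I f"]) auto
      qed
      then obtain n where n: "n \<noteq> 0" "\<bar>real_of_int n\<bar> \<le> N" "\<And>m. m dvd inv_I f \<Longrightarrow> m dvd inv_J f \<Longrightarrow> m dvd n"
        by blast
      show "S f \<le> 432 * T / Q ^ 2 * (\<Sum>d\<in>content_divisors f. real d)"
        unfolding S_def by (rule moduli_sum_special[OF f(1,2) sizes(2) Q(1) f(3) n])
    qed
    also have "\<dots> \<le> (\<Sum>f\<in>A2. 432 * T / Q ^ 2 * (\<Sum>d\<in>content_divisors f. real d))"
    proof (rule sum_mono2)
      show "finite A2" by (simp add: A2_def finite_int_box)
      show "0 \<le> 432 * T / Q ^ 2 * (\<Sum>d\<in>content_divisors f. real d)" for f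
        using T0 Q by (intro mult_nonneg_nonneg sum_nonneg) simp_all
    qed blast
    also have "\<dots> = 432 * T / Q ^ 2 * (\<Sum>f\<in>A2. \<Sum>d\<in>content_divisors f. real d)"
      by (simp only: sum_distrib_left)
    also have "\<dots> \<le> 432 * T / Q ^ 2 * (648 * r ^ 4)"
      unfolding A2_def by (rule mult_left_mono[OF sum_content_special[OF r(1)]]) (use T0 Q in simp)
    also have "\<dots> = 279936 * T * (r ^ 4 / Q ^ 2)" by simp
    also have "\<dots> \<le> (10 ^ 18 * T ^ 2) * (r ^ 4 / Q ^ 2)"
    proof (rule mult_right_mono)
      have "T * 1 \<le> T * T" using T0 by (intro mult_left_mono) simp_all
      then have "T \<le> T ^ 2" by (simp only: power2_eq_square mult_1_right)
      then show "279936 * T \<le> 10 ^ 18 * T ^ 2" using T0 by (intro mult_mono) simp_all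
    qed (use Q in simp)
    finally show ?thesis .
  qed
  have S3: "(\<Sum>f\<in>A3. S f) \<le> 10 ^ 19 * T ^ 2 * (r ^ 5 / Q powr (5 / 2)) + 10 ^ 18 * T ^ 2 * (r ^ 4 / Q ^ 2)"
  proof -
    have "(\<Sum>f\<in>A3. S f) \<le> (\<Sum>f\<in>A3. 2592 * T * Q powr (-5/2) * (\<Sum>(d, m)\<in>content_pairs Q f. real d * sqrt (real d) * sqrt (real m)))"
    proof (rule sum_mono)
      fix f assume "f \<in> A3"
      then have f: "f \<in> int_box r" "generic_cov f \<noteq> 0" by (simp_all add: A3_def)
      then have f0: "f \<noteq> 0" by (auto simp: generic_cov_def zero_quartic_form_def)
      have "\<bar>real_of_int (generic_cov f)\<bar> \<le> N" using generic_cov_bound[OF f(1)] sizes(4) by linarith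
      then show "S f \<le> 2592 * T * Q powr (-5/2) * (\<Sum>(d, m)\<in>content_pairs Q f. real d * sqrt (real d) * sqrt (real m))"
        unfolding S_def by (rule moduli_sum_generic[OF f0 f(1) sizes(2) Q(1) f(2)])
    qed
    also have "\<dots> = 2592 * T * Q powr (-5/2) * (\<Sum>f\<in>A3. \<Sum>(d, m)\<in>content_pairs Q f. real d * sqrt (real d) * sqrt (real m))"
      by (simp only: sum_distrib_left)
    also have "\<dots> \<le> 2592 * T * Q powr (-5/2) * (6480 * 142 ^ 5 * T * (r ^ 5 + r ^ 4 * sqrt Q))"
      unfolding A3_def by (rule mult_left_mono[OF sum_content_pairs[OF r sizes(3)]]) (use T0 in simp)
    also have "\<dots> = (2592 * 6480 * 142 ^ 5) * T ^ 2 * (r ^ 5 * Q powr (-5/2)) +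
        (2592 * 6480 * 142 ^ 5) * T ^ 2 * (r ^ 4 * (Q powr (-5/2) * sqrt Q))"
    proof -
      have "a * T * w * (b * T * (x + y * z)) = (a * b) * T ^ 2 * (x * w) + (a * b) * T ^ 2 * (y * (w * z))"
        for a b w x y z :: real by (simp add: power2_eq_square algebra_simps)
      from this[of 2592 "Q powr (-5/2)" "6480 * 142 ^ 5" "r ^ 5" "r ^ 4" "sqrt Q"]
      show ?thesis by (simp only: mult.assoc)
    qed
    also have "r ^ 5 * Q powr (-5/2) = r ^ 5 / Q powr (5/2)"
      by (simp add: powr_minus_divide)
    also have "Q powr (-5/2) * sqrt Q = Q powr (-2)"
      using Q by (simp add: powr_half_sqrt[symmetric] powr_add[symmetric])
    also have "r ^ 4 * Q powr (-2) = r ^ 4 / Q ^ 2"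
      using Q by (simp add: powr_minus_divide)
    also have "(2592 * 6480 * 142 ^ 5) * T ^ 2 * (r ^ 5 / Q powr (5/2)) \<le> 10 ^ 19 * T ^ 2 * (r ^ 5 / Q powr (5/2))"
      using r by (intro mult_right_mono) simp_all
    also have "(2592 * 6480 * 142 ^ 5) * T ^ 2 * (r ^ 4 / Q ^ 2) \<le> 10 ^ 18 * T ^ 2 * (r ^ 4 / Q ^ 2)"
      by (intro mult_right_mono) simp_all
    finally show ?thesis by simp
  qed
  have finI: "finite (int_box r)" by (rule finite_int_box)
  have "A = A1 \<union> ((A2 - A1) \<union> A3)"
    by (auto simp: A_def A1_def A2_def A3_def generic_cov_def zero_quartic_form_def)
  then have "(\<Sum>f\<in>A. S f) = (\<Sum>f\<in>A1 \<union> ((A2 - A1) \<union> A3). S f)" by (simp only:)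
  also have "\<dots> \<le> (\<Sum>f\<in>A1. S f) + (\<Sum>f\<in>(A2 - A1) \<union> A3. S f)"
    by (rule sum_union_le) (use finI S0 in \<open>auto simp: A1_def A2_def A3_def\<close>)
  also have "(\<Sum>f\<in>(A2 - A1) \<union> A3. S f) \<le> (\<Sum>f\<in>A2 - A1. S f) + (\<Sum>f\<in>A3. S f)"
    by (rule sum_union_le) (use finI S0 in \<open>auto simp: A1_def A2_def A3_def\<close>)
  finally have tot: "(\<Sum>f\<in>A. S f) \<le> (\<Sum>f\<in>A1. S f) + ((\<Sum>f\<in>A2 - A1. S f) + (\<Sum>f\<in>A3. S f))" by simp
  have pos: "T ^ 2 * (r ^ 4 / Q ^ 2) \<ge> 0" by simp
  have "(\<Sum>f\<in>A. S f) \<le> 10 ^ 19 * (T ^ 2 * (r ^ 2 / Q)) + (10 ^ 19 * (T ^ 2 * (r ^ 4 / Q ^ 2)) + 10 ^ 19 * (T ^ 2 * (r ^ 5 / Q powr (5 / 2))))"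
  proof -
    have "s \<le> 10 ^ 19 * x + (10 ^ 19 * y + 10 ^ 19 * z)"
      if "s \<le> a + (b + c)" "a \<le> 10 ^ 19 * x" "b \<le> 10 ^ 18 * y" "c \<le> 10 ^ 19 * z + 10 ^ 18 * y" "y \<ge> 0"
      for s a b c x y z :: real
    proof -
      have e: "10 ^ 19 = (10000000000000000000 :: real)" "10 ^ 18 = (1000000000000000000 :: real)" by simp_all
      show ?thesis using that unfolding e by linarith
    qed
    from this[OF tot S1[unfolded mult.assoc] S2[unfolded mult.assoc] S3[unfolded mult.assoc] pos] show ?thesis .
  qed
  also have "\<dots> = 10 ^ 19 * T ^ 2 * (r ^ 2 / Q + r ^ 4 / Q ^ 2 + r ^ 5 / Q powr (5 / 2))"
    by (simp only: distrib_left mult.assoc add.assoc)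
  finally show ?thesis unfolding A_def S_def .
qed

theorem theorem4p2:
  fixes \<epsilon> :: real
  assumes "\<epsilon> > 0"
  shows "\<exists>C>0. \<forall>Q r :: real. 0 < r \<longrightarrow> r < Q \<longrightarrow>
    (\<Sum>q | squarefree (q::nat) \<and> Q \<le> real q \<and> real q \<le> 2 * Q.
       \<Sum>f | f \<noteq> (0 :: int quartic_form) \<and> map_quartic_form real_of_int f \<in> quartic_box r.
         cmod (Phi_hat q f))
    \<le> C * ((r ^ 2 / Q + r ^ 4 / Q ^ 2 + r ^ 5 / Q powr (5 / 2)) * Q powr \<epsilon>)"
proof -
  (* The divisor bound enters to the sixth power, for integers up to a constant times Q^7. *)
  define \<delta> where "\<delta> = \<epsilon> / 42"
  have \<delta>: "\<delta> > 0" using assms by (simp add: \<delta>_def)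
  obtain C where C: "C \<ge> 1" "\<And>n::nat. n > 0 \<Longrightarrow> real (card {d. d dvd n}) \<le> C * real n powr \<delta>"
    using divisor_bound[OF \<delta>] by blast
  define L :: real where "L = C * (10 ^ 17) powr \<delta>"
  have L: "L > 0" using C(1) by (simp add: L_def)
  show ?thesis
  proof (intro exI conjI allI impI)
    show "6 * 10 ^ 19 * L ^ 6 > 0" using L by simp
    fix Q r :: real assume r: "0 < r" "r < Q"
    define X where "X = r ^ 2 / Q + r ^ 4 / Q ^ 2 + r ^ 5 / Q powr (5 / 2)"
    define A where "A = {q::nat. squarefree q \<and> Q \<le> real q \<and> real q \<le> 2 * Q}"
    define B where "B = {f :: int quartic_form. f \<noteq> 0 \<and> f \<in> int_box r}"
    have X: "X \<ge> 0" using r by (simp add: X_def)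
    have "(\<Sum>q\<in>A. \<Sum>f\<in>B. cmod (Phi_hat q f)) \<le> 6 * 10 ^ 19 * L ^ 6 * (X * Q powr \<epsilon>)"
    proof (cases "r \<ge> 1")
      (* A nonzero integral form has a coefficient of absolute value at least 1. *)
      case False
      have "B = {}"
      proof (rule equals0I)
        fix f assume "f \<in> B"
        then have "f \<noteq> 0" "f \<in> int_box r" by (simp_all add: B_def)
        then obtain x where x: "x \<noteq> 0" "\<bar>real_of_int x\<bar> \<le> r" by (rule nonzero_form_coefficient)
        from x(1) have "1 \<le> \<bar>real_of_int x\<bar>" by linarith
        with x(2) False show False by linarith
      qed
      then show ?thesis using L X by simp
    next
      case True
      define N where "N = 10 ^ 17 * Q ^ 7"
      define T where "T = C * N powr \<delta>"
      have Q: "Q > 0" "Q \<ge> 1" using r True by auto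
      have T6: "T ^ 6 = L ^ 6 * Q powr \<epsilon>"
      proof -
        have "N powr \<delta> = (10 ^ 17) powr \<delta> * (Q ^ 7) powr \<delta>" using Q by (simp add: N_def powr_mult)
        also have "(Q ^ 7) powr \<delta> = Q powr (7 * \<delta>)"
        proof -
          have "Q ^ 7 = Q powr 7" using Q by simp
          then show ?thesis by (simp only: powr_powr)
        qed
        finally have "T = L * Q powr (7 * \<delta>)" by (simp add: T_def L_def)
        then have "T ^ 6 = L ^ 6 * (Q powr (7 * \<delta>)) ^ 6" by (simp only: power_mult_distrib)
        also have "(Q powr (7 * \<delta>)) ^ 6 = Q powr \<epsilon>"
        proof -
          have "(Q powr (7 * \<delta>)) ^ 6 = (Q powr (7 * \<delta>)) powr 6" using Q by simp
          also have "\<dots> = Q powr \<epsilon>" by (simp add: powr_powr \<delta>_def)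
          finally show ?thesis .
        qed
        finally show ?thesis .
      qed
      have N1: "N \<ge> 1"
      proof -
        have "(1::real) * 1 \<le> 10 ^ 17 * Q ^ 7" using Q by (intro mult_mono one_le_power) simp_all
        then show ?thesis by (simp add: N_def)
      qed
      have divs: "real (card {d::nat. int d dvd n}) \<le> T" if n: "n \<noteq> 0" "\<bar>real_of_int n\<bar> \<le> N" for n
      proof -
        have "real (card {d::nat. int d dvd n}) = real (card {d. d dvd nat \<bar>n\<bar>})"
        proof -
          have "int d dvd n \<longleftrightarrow> d dvd nat \<bar>n\<bar>" for d 
            using int_dvd_int_iff[of d "nat \<bar>n\<bar>"] by simp
          then show ?thesis by (simp only:)
        qed
        also have "\<dots> \<le> C * real (nat \<bar>n\<bar>) powr \<delta>" using n by (intro C(2)) simp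
        also have "\<dots> \<le> C * N powr \<delta>"
          using n \<delta> C(1) by (intro mult_left_mono powr_mono2) simp_all
        finally show ?thesis unfolding T_def .
      qed
      interpret divisor_bounded T N
      proof
        have "1 * 1 \<le> C * N powr \<delta>" using C(1) N1 \<delta> by (intro mult_mono ge_one_powr_ge_zero) simp_all
        then show "T \<ge> 1" by (simp add: T_def)
      qed (rule divs)
      have QN: "2 * Q \<le> N"
      proof -
        have "Q ^ 1 \<le> Q ^ 7" using Q by (intro power_increasing) simp_all
        then have "2 * Q \<le> 10 ^ 17 * Q ^ 7" using Q by (intro mult_mono) simp_all
        then show ?thesis by (simp only: N_def)
      qed
      have "(\<Sum>q\<in>A. \<Sum>f\<in>B. cmod (Phi_hat q f)) = (\<Sum>f\<in>B. \<Sum>q\<in>A. cmod (Phi_hat_coprime (q div gcd q 6) f))"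
        unfolding Phi_hat_def by (rule sum.swap)
      also have "\<dots> \<le> (\<Sum>f\<in>B. 6 * (\<Sum>q\<in>coprime_moduli Q. cmod (Phi_hat_coprime q f)))"
        unfolding A_def by (intro sum_mono sum_over_coprime_parts_le norm_ge_zero)
      also have "\<dots> \<le> (\<Sum>f\<in>B. 6 * (\<Sum>q\<in>coprime_moduli Q. T ^ 4 * modulus_weight f q))"
        by (intro sum_mono mult_left_mono norm_Phi_hat_le[OF divs _ QN]) simp_all
      also have "\<dots> = 6 * T ^ 4 * (\<Sum>f\<in>B. \<Sum>q\<in>coprime_moduli Q. modulus_weight f q)"
        by (simp only: sum_distrib_left mult.assoc)
      also have "\<dots> \<le> 6 * T ^ 4 * (10 ^ 19 * T ^ 2 * X)"
        unfolding B_def X_def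
        by (rule mult_left_mono[OF sum_modulus_weights_le[OF True r(2)]]) (simp_all add: N_def)
      also have "\<dots> = 6 * 10 ^ 19 * T ^ 6 * X"
        by (simp add: eval_nat_numeral)
      also have "\<dots> = 6 * 10 ^ 19 * L ^ 6 * (X * Q powr \<epsilon>)" unfolding T6 by (simp only: mult_ac)
      finally show ?thesis .
    qed
    then show "(\<Sum>q | squarefree (q::nat) \<and> Q \<le> real q \<and> real q \<le> 2 * Q.
       \<Sum>f | f \<noteq> (0 :: int quartic_form) \<and> map_quartic_form real_of_int f \<in> quartic_box r. cmod (Phi_hat q f))
      \<le> 6 * 10 ^ 19 * L ^ 6 * ((r ^ 2 / Q + r ^ 4 / Q ^ 2 + r ^ 5 / Q powr (5 / 2)) * Q powr \<epsilon>)"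
      unfolding A_def B_def X_def int_box_def mem_Collect_eq .
  qed
qed

end
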